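(* Let $q\ge 1$ and let $(X_n)_{n\ge1}$ be i.i.d. random variables with values in $S$, defined on a probability space $(\Omega,\mathcal F,\mathbb P)$, with $X^{(n)}=X_n\cdots X_1$. Assume the contraction condition $\mathbb P\bigl(\bigcup_{n\ge1}[X^{(n)}\in S^\circ]\bigr)>0$. Assume moreover that there exist a real number $\alpha$ with $0<\alpha\le 2$, a slowly varying function $L$ (which is unbounded in case $\alpha=2$), and constants $c_+\ge0$, $c_-\ge0$ with $c_++c_->0$, such that (i) $\displaystyle\lim_{u\to+\infty}\frac{u^\alpha}{L(u)}\mathbb P[N_1>e^u]=c_+$ and $\displaystyle\lim_{u\to+\infty}\frac{u^\alpha}{L(u)}\mathbb P[N_1\le e^{-u}]=c_-$; (ii) $\displaystyle\limsup_{u\to+\infty}\frac{u^\alpha}{L(u)}\mathbb P[V_1\le e^{-u}]<+\infty$. Then there exist a sequence $(a_n)_{n\ge1}$ of positive reals with $\lim_n a_n=+\infty$ and a sequence $(b_n)_{n\ge1}$ of reals such that, for any sequences $(x_n)_{n\ge1}$ and $(y_n)_{n\ge1}$ of elements of $\overline B$, the random sequences $$\Bigl(\tfrac1{a_n}\bigl(1_{[T\le n]}\ln\langle y_n,X^{(n)}x_n\rangle-b_n\bigr)\Bigr)_{n\ge1}\quad\text{and}\quad\Bigl(\tfrac1{a_n}\bigl(\ln\Lambda_n-b_n\bigr)\Bigr)_{n\ge1}$$ converge in distribution to a stable law of index $\alpha$ (the same limit law for all such choices).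
   Context: $S$ is the multiplicative semigroup of real $q\times q$ matrices with nonnegative entries such that every row and every column contains a strictly positive entry; $S^\circ\subset S$ is the set of matrices with all entries strictly positive. $(e_i)_{i=1}^q$ is the canonical basis of $\mathbb R^q$, $\langle\cdot,\cdot\rangle$ the canonical scalar product, $\|x\|=\sum_{i=1}^q|\langle x,e_i\rangle|$. $\overline C=\{x\in\mathbb R^q:\langle x,e_i\rangle\ge0\ \forall i\}$ and $\overline B=\{x\in\overline C:\|x\|=1\}$. $T(\omega)=\inf\{n\ge1: X^{(n)}(\omega)\in S^\circ\}$; the quantity $1_{[T\le n]}\ln\langle y,X^{(n)}x\rangle$ is taken to be $0$ on $[T>n]$. $\Lambda_n$ is the spectral radius of $X^{(n)}$ (which is $>0$). $N_1=\sum_{i,j=1}^q\langle e_i,X_1e_j\rangle$ and $V_1=\min_{i=1,\dots,q}\sum_{j=1}^q\langle e_i,X_1e_j\rangle$. *)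

theory Defs
  imports "HOL-Probability.Probability"
begin

definition matS :: "(real^'q^'q) set" where
  "matS = {A. (\<forall>i j. 0 \<le> A$i$j) \<and> (\<forall>i. \<exists>j. 0 < A$i$j) \<and> (\<forall>j. \<exists>i. 0 < A$i$j)}"

definition matS_pos :: "(real^'q^'q) set" where
  "matS_pos = {A. \<forall>i j. 0 < A$i$j}"

definition Bbar :: "(real^'q) set" where
  "Bbar = {x. (\<forall>i. 0 \<le> x$i) \<and> (\<Sum>i\<in>UNIV. \<bar>x$i\<bar>) = 1}"

fun Xprod :: "(nat \<Rightarrow> 'a \<Rightarrow> real^'q^'q) \<Rightarrow> nat \<Rightarrow> 'a \<Rightarrow> real^'q^'q" where
  "Xprod X 0 \<omega> = mat 1"
| "Xprod X (Suc n) \<omega> = X (Suc n) \<omega> ** Xprod X n \<omega>"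

definition hitT :: "(nat \<Rightarrow> 'a \<Rightarrow> real^'q^'q) \<Rightarrow> 'a \<Rightarrow> enat" where
  "hitT X \<omega> = (if \<exists>n\<ge>1. Xprod X n \<omega> \<in> matS_pos
               then enat (LEAST n. n \<ge> 1 \<and> Xprod X n \<omega> \<in> matS_pos) else \<infinity>)"

definition spectral_radius :: "real^'q^'q \<Rightarrow> real" where
  "spectral_radius A =
     Max {cmod z | z. \<exists>v :: complex^'q. v \<noteq> 0 \<and>
                        (\<chi> i j. complex_of_real (A$i$j)) *v v = z *s v}"

definition entry_sum :: "real^'q^'q \<Rightarrow> real" where
  "entry_sum A = (\<Sum>i\<in>UNIV. \<Sum>j\<in>UNIV. A$i$j)"

definition min_row_sum :: "real^'q^'q \<Rightarrow> real" where
  "min_row_sum A = Min {(\<Sum>j\<in>UNIV. A$i$j) | i. True}"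

definition slowly_varying :: "(real \<Rightarrow> real) \<Rightarrow> bool" where
  "slowly_varying L \<longleftrightarrow> L \<in> borel_measurable borel \<and> (\<forall>\<^sub>F u in at_top. 0 < L u) \<and>
     (\<forall>c>0. ((\<lambda>u. L (c * u) / L u) \<longlongrightarrow> 1) at_top)"

text \<open>Non-degenerate stable law of index alpha in (0,2], via its characteristic function
  (scale sigma > 0, skewness beta in [-1,1], location gamma).\<close>
definition stable_law :: "real \<Rightarrow> real measure \<Rightarrow> bool" where
  "stable_law \<alpha> \<mu> \<longleftrightarrow> real_distribution \<mu> \<and>
     (\<exists>\<sigma> \<beta> \<gamma>. 0 < \<sigma> \<and> -1 \<le> \<beta> \<and> \<beta> \<le> 1 \<and>
       (\<forall>t. char \<mu> t =
          (if \<alpha> \<noteq> 1 then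
             exp (- complex_of_real ((\<sigma> * \<bar>t\<bar>) powr \<alpha>)
                    * (1 - \<i> * complex_of_real (\<beta> * sgn t * tan (pi * \<alpha> / 2)))
                  + \<i> * complex_of_real (\<gamma> * t))
           else
             exp (- complex_of_real (\<sigma> * \<bar>t\<bar>)
                    * (1 + \<i> * complex_of_real (\<beta> * (2 / pi) * sgn t * ln \<bar>t\<bar>))
                  + \<i> * complex_of_real (\<gamma> * t)))))"

definition conv_distr :: "'a measure \<Rightarrow> (nat \<Rightarrow> 'a \<Rightarrow> real) \<Rightarrow> real measure \<Rightarrow> bool" where
  "conv_distr M Y \<mu> \<longleftrightarrow> weak_conv_m (\<lambda>n. distr M borel (Y (Suc n))) \<mu>"

end

theory Submission
  imports Defs "HOL-Probability.Probability"
begin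

text \<open>Let \<open>N\<close> be the sum of the entries. Telescoping over the windows \<open>X\<^sub>n \<cdots> X\<^sub>k\<^sub>+\<^sub>1\<close> gives, up to a constant,
  \<open>ln N(X\<^sub>n \<cdots> X\<^sub>1) = \<Sum>k\<le>n. ln N(X\<^sub>k) - \<Sum>k\<le>n. D\<^sub>k\<close>, where the defect \<open>D\<^sub>k \<ge> 0\<close> depends on \<open>X\<^sub>k\<close> and on the matrices after it
  and is at most \<open>ln (N/V)\<close> of \<open>X\<^sub>k\<close>. By the contraction property \<open>D\<^sub>k\<close> depends on remote matrices exponentially little,
  so, after truncation at \<open>2 a\<^sub>n\<close>, the covariances of the defects are summable up to \<open>o(a\<^sub>n\<^sup>2)\<close> and, by Chebyshev, their sum
  is deterministic up to \<open>o(a\<^sub>n)\<close>. It only changes the centering of the i.i.d. sum, whose stable limit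
  follows from regular variation and an explicit computation of the limiting characteristic exponent.
  Finally \<open>\<langle>y, A x\<rangle>\<close> and the spectral radius of a positive matrix \<open>A\<close> both lie between the smallest entry and \<open>N(A)\<close>; for
  \<open>A = X\<^sub>n \<cdots> X\<^sub>1\<close> the ratio of these bounds is controlled by finitely many factors at both ends of the product, hence is tight.\<close>

section \<open>Weak convergence and characteristic functions\<close>

text \<open>Hypothesis (ii) only bounds the tail of \<open>ln (N/V)\<close> by a multiple of that of
  \<open>ln N\<close>, so at scale \<open>a n\<close> the defects could a priori fluctuate as much
  as the i.i.d. terms. A second bound on the same defect resolves this: the log ratio of the entry
  sum to the least column sum of the window after \<open>k\<close>, which is tight uniformly in the
  window and independent of \<open>X k\<close>. A large defect thus needs an extreme
  \<open>X k\<close> together with an independent event of small probability, so its truncated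
  second moment gains an arbitrarily small factor. The leftover constant is absorbed since
  \<open>(a n)^2 / n\<close> tends to infinity; for \<alpha> = 2 this is where the unboundedness of
  \<open>L\<close> enters. The factor 2 in the truncation arises because
  \<open>ln (N/V) > 2 * u\<close> forces \<open>ln N > u\<close> or
  \<open>V \<le> exp (- u)\<close>. The norming makes \<open>n * min (x^2) 1\<close> a weight that
  turns the law of \<open>ln N / a n\<close> into a probability measure. Weak convergence of these
  measures gives the exponent for every \<alpha>; for \<alpha> = 2 their limit is the point mass at
  0.\<close>

lemma power_tendsto_exp:
  fixes w :: "nat \<Rightarrow> complex"
  assumes le: "\<And>n. norm (w n) \<le> 1" and lim: "(\<lambda>n. of_nat n * (w n - 1)) \<longlonglongrightarrow> z"
  shows "(\<lambda>n. w n ^ n) \<longlonglongrightarrow> exp z"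
proof -
  define u where "u n = w n - 1" for n
  have nu: "(\<lambda>n. of_nat n * u n) \<longlonglongrightarrow> z" using lim by (simp add: u_def)
  have u0: "u \<longlonglongrightarrow> 0"
  proof -
    have "(\<lambda>n. (of_nat n * u n) * inverse (of_nat n)) \<longlonglongrightarrow> z * 0"
      by (intro tendsto_mult nu lim_inverse_n)
    moreover have "\<forall>\<^sub>F n in sequentially. (of_nat n * u n) * inverse (of_nat n) = u n"
      using eventually_gt_at_top[of 0] by eventually_elim (simp add: field_simps)
    ultimately show ?thesis by (simp add: filterlim_cong)
  qed
  have bound: "norm (w n ^ n - exp (of_nat n * u n)) \<le> 2 * (norm (of_nat n * u n) * norm (u n))"
    if "norm (u n) \<le> 1/2" for n
  proof -
    \<comment> \<open>With \<open>w n\<close> in the unit disc, \<open>exp (u n)\<close> is in it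
      too, so the n-th powers differ by at most n times the distance. The Taylor error of order
      \<open>norm (u n) ^ 2\<close> thus costs only \<open>norm (n * u n) * norm (u n)\<close>, a
      bounded factor times one tending to 0.\<close>
    have "Re (u n) \<le> 0"
      using le[of n] complex_Re_le_cmod[of "w n"] by (simp add: u_def)
    hence e1: "norm (exp (u n)) \<le> 1" by simp
    have "norm (exp (u n) - 1 - u n) \<le> 2 * (norm (u n))\<^sup>2"
    proof -
      have "norm (exp (u n) - (1 + u n)) \<le> exp (norm (u n)) * (norm (u n))\<^sup>2"
        using Taylor_exp_field[of "u n" 1] by (simp add: power2_eq_square)
      also have "exp (norm (u n)) \<le> 2"
      proof -
        have "exp (norm (u n)) \<le> exp (1/2)" using that by simp
        also have "\<dots> \<le> 1 + 1/2 + (1/2)^2" by (rule exp_bound) auto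
        finally show ?thesis by (simp add: power2_eq_square)
      qed
      finally show ?thesis by (simp add: mult_right_mono algebra_simps)
    qed
    hence "norm (w n - exp (u n)) \<le> 2 * (norm (u n))\<^sup>2"
      by (simp add: u_def norm_minus_commute)
    moreover have "norm (w n ^ n - exp (u n) ^ n) \<le> of_nat n * norm (w n - exp (u n))"
      by (rule norm_power_diff[OF le e1])
    ultimately have "norm (w n ^ n - exp (u n) ^ n) \<le> of_nat n * (2 * (norm (u n))\<^sup>2)"
      by (meson mult_left_mono of_nat_0_le_iff order_trans)
    thus ?thesis by (simp add: exp_of_nat_mult norm_mult power2_eq_square mult.assoc)
  qed
  have "(\<lambda>n. 2 * (norm (of_nat n * u n) * norm (u n))) \<longlonglongrightarrow> 2 * (norm z * norm (0::complex))"
    by (intro tendsto_mult tendsto_norm tendsto_const nu u0)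
  moreover have "\<forall>\<^sub>F n in sequentially. norm (u n) \<le> 1/2"
    using tendsto_norm_zero[OF u0] by (auto dest!: order_tendstoD(2)[of _ _ _ "1/2"] elim!: eventually_mono)
  ultimately have "(\<lambda>n. w n ^ n - exp (of_nat n * u n)) \<longlonglongrightarrow> 0"
    by (intro Lim_null_comparison[OF eventually_mono[OF _ bound]]) auto
  moreover have "(\<lambda>n. exp (of_nat n * u n)) \<longlonglongrightarrow> exp z" by (intro tendsto_exp nu)
  ultimately show ?thesis using tendsto_add by fastforce
qed

text \<open>Averaging \<open>1 - Re (char (M n) (u / K))\<close> over a standard normal
  \<open>u\<close> gives, by Fubini, the integral of \<open>1 - exp (- (x/K)^2 / 2)\<close>, which
  dominates a fixed multiple of the mass of \<open>\<bar>x\<bar> \<ge> K\<close>. In the limit the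
  average is formed with \<phi>, and continuity of \<phi> at 0 makes it small for large K.\<close>

lemma tight_of_char_tendsto:
  fixes M :: "nat \<Rightarrow> real measure" and \<phi> :: "real \<Rightarrow> complex"
  assumes rd: "\<And>n. real_distribution (M n)"
    and lim: "\<And>t. (\<lambda>n. char (M n) t) \<longlonglongrightarrow> \<phi> t" and cont: "isCont \<phi> 0"
  shows "tight M"
proof -
  interpret Mn: real_distribution "M n" for n by fact
  let ?N = "std_normal_distribution"
  interpret N: real_distribution ?N by (rule real_dist_normal_dist)
  have [measurable]: "\<phi> \<in> borel_measurable borel"
    by (rule borel_measurable_LIMSEQ_metric[OF _ lim]) auto
  have phi1: "norm (\<phi> t) \<le> 1" for t
    by (rule LIMSEQ_le_const2[OF tendsto_norm[OF lim]]) (use Mn.cmod_char_le_1 in auto)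
  have phi0: "\<phi> 0 = 1"
    using LIMSEQ_unique[OF lim[of 0]] by (simp add: Mn.char_zero)
  define I where "I n K = (\<integral>u. 1 - Re (char (M n) (u / K)) \<partial>?N)" for n and K :: real
  define J where "J K = (\<integral>u. 1 - Re (\<phi> (u / K)) \<partial>?N)" for K :: real
  have IJ: "(\<lambda>n. I n K) \<longlonglongrightarrow> J K" for K
    unfolding I_def J_def
  proof (rule integral_dominated_convergence[where w="\<lambda>_. 2"])
    show "AE u in ?N. (\<lambda>n. 1 - Re (char (M n) (u / K))) \<longlonglongrightarrow> 1 - Re (\<phi> (u / K))"
      by (intro always_eventually allI tendsto_intros lim)
    show "AE u in ?N. norm (1 - Re (char (M n) (u / K))) \<le> 2" for n
    proof (intro always_eventually allI)
      fix u show "norm (1 - Re (char (M n) (u / K))) \<le> 2"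
        using abs_Re_le_cmod[of "char (M n) (u/K)"] Mn.cmod_char_le_1[of n "u/K"] by auto
    qed
  qed auto
  have J0: "(\<lambda>k. J (real (Suc k))) \<longlonglongrightarrow> (\<integral>u. 1 - Re (\<phi> 0) \<partial>?N)"
    unfolding J_def
  proof (rule integral_dominated_convergence[where w="\<lambda>_. 2"])
    show "AE u in ?N. (\<lambda>k. 1 - Re (\<phi> (u / real (Suc k)))) \<longlonglongrightarrow> 1 - Re (\<phi> 0)"
    proof (intro always_eventually allI tendsto_intros)
      fix u :: real
      have "(\<lambda>k. u * inverse (real (Suc k))) \<longlonglongrightarrow> u * 0"
        by (intro tendsto_intros LIMSEQ_inverse_real_of_nat)
      thus "(\<lambda>k. \<phi> (u / real (Suc k))) \<longlonglongrightarrow> \<phi> 0"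
        by (intro isCont_tendsto_compose[OF cont]) (simp add: divide_inverse)
    qed
    show "AE u in ?N. norm (1 - Re (\<phi> (u / real (Suc k)))) \<le> 2" for k
    proof (intro always_eventually allI)
      fix u show "norm (1 - Re (\<phi> (u / real (Suc k)))) \<le> 2"
        using abs_Re_le_cmod[of "\<phi> (u/real (Suc k))"] phi1[of "u/real (Suc k)"] by auto
    qed
  qed auto
  have I_eq: "I n K = (\<integral>x. 1 - exp (- (x/K)\<^sup>2 / 2) \<partial>(M n))" for n K
  proof -
    interpret P: pair_prob_space ?N "M n" by unfold_locales
    have "I n K = (\<integral>u. (\<integral>x. 1 - cos (u / K * x) \<partial>(M n)) \<partial>?N)"
    proof -
      have "1 - Re (char (M n) t) = (\<integral>x. 1 - cos (t * x) \<partial>(M n))" for t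
      proof -
        have i: "integrable (M n) (\<lambda>x. iexp (t * x))"
          by (rule Mn.integrable_const_bound[where B=1]) auto
        have "Re (char (M n) t) = (\<integral>x. Re (iexp (t * x)) \<partial>(M n))"
          unfolding char_def by (rule integral_Re[OF i, symmetric])
        also have "\<dots> = (\<integral>x. cos (t * x) \<partial>(M n))" by (simp add: Re_exp)
        finally show ?thesis
          by (subst Bochner_Integration.integral_diff)
             (auto intro!: Mn.integrable_const_bound[where B=1] simp: Mn.prob_space[simplified])
      qed
      thus ?thesis unfolding I_def by simp
    qed
    also have "\<dots> = (\<integral>x. (\<integral>u. 1 - cos (u / K * x) \<partial>?N) \<partial>(M n))"
      by (rule P.Fubini_integral[symmetric], rule P.P.integrable_const_bound[where B=2])
         (auto intro!: always_eventually order_trans[OF abs_triangle_ineq4] simp: add_mono[of _ 1 _ 1, simplified])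
    also have "\<dots> = (\<integral>x. 1 - exp (- (x/K)\<^sup>2 / 2) \<partial>(M n))"
    proof (rule Bochner_Integration.integral_cong[OF refl])
      fix x
      have i: "integrable ?N (\<lambda>u. iexp (x / K * u))"
        by (rule N.integrable_const_bound[where B=1]) auto
      have "exp (- (x/K)\<^sup>2 / 2) = Re (char ?N (x / K))"
        by (simp add: char_std_normal_distribution)
      also have "\<dots> = (\<integral>u. Re (iexp (x / K * u)) \<partial>?N)"
        unfolding char_def by (rule integral_Re[OF i, symmetric])
      also have "\<dots> = (\<integral>u. cos (u / K * x) \<partial>?N)" by (simp add: Re_exp mult.commute)
      finally show "(\<integral>u. 1 - cos (u / K * x) \<partial>?N) = 1 - exp (- (x/K)\<^sup>2 / 2)"
        by (subst Bochner_Integration.integral_diff)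
           (auto intro!: N.integrable_const_bound[where B=1] simp: N.prob_space[simplified])
    qed
    finally show ?thesis .
  qed
  have I_ge: "(1 - exp (-1/2)) * measure (M n) {x. K \<le> \<bar>x\<bar>} \<le> I n K" if "K > 0" for n K
  proof -
    have "(1 - exp (-1/2)) * measure (M n) {x. K \<le> \<bar>x\<bar>} = (\<integral>x. (1 - exp (-1/2)) * indicator {x. K \<le> \<bar>x\<bar>} x \<partial>(M n))"
      by simp
    also have "\<dots> \<le> I n K"
      unfolding I_eq
    proof (rule integral_mono)
      show "integrable (M n) (\<lambda>x. 1 - exp (- (x/K)\<^sup>2 / 2))"
        by (rule Mn.integrable_const_bound[where B=1]) auto
      fix x
      show "(1 - exp (-1/2)) * indicator {x. K \<le> \<bar>x\<bar>} x \<le> 1 - exp (- (x/K)\<^sup>2 / 2)"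
      proof (cases "K \<le> \<bar>x\<bar>")
        case True
        hence "1 \<le> \<bar>x / K\<bar>" using that by (simp add: field_simps)
        hence "1 \<le> (x/K)\<^sup>2" by (metis abs_le_square_iff abs_one one_power2)
        thus ?thesis using True by simp
      qed auto
    qed (auto intro!: integrable_mult_right Mn.integrable_const_bound[where B=1] simp: indicator_def)
    finally show ?thesis .
  qed
  have e0: "0 < 1 - exp (-1/2::real)" by simp
  have "\<exists>a b. a < b \<and> (\<forall>n. 1 - \<epsilon> < measure (M n) {a<..b})" if "\<epsilon> > 0" for \<epsilon>
  proof -
    have pos: "0 < (1 - exp (-1/2)) * \<epsilon>" using e0 that by simp
    have "\<forall>\<^sub>F k in sequentially. J (real (Suc k)) < (1 - exp (-1/2)) * \<epsilon>"
      using J0 by (intro order_tendstoD(2)[OF _ pos]) (simp add: phi0)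
    then obtain k where k: "J (real (Suc k)) < (1 - exp (-1/2)) * \<epsilon>"
      by (auto simp: eventually_sequentially)
    obtain n0 where n0: "\<And>n. n \<ge> n0 \<Longrightarrow> I n (real (Suc k)) < (1 - exp (-1/2)) * \<epsilon>"
      using order_tendstoD(2)[OF IJ k] by (auto simp: eventually_sequentially)
    have *: "measure (M n) {x. real (Suc k) \<le> \<bar>x\<bar>} < \<epsilon>" if "n \<ge> n0" for n
    proof -
      have "(1 - exp (-1/2)) * measure (M n) {x. real (Suc k) \<le> \<bar>x\<bar>} < (1 - exp (-1/2)) * \<epsilon>"
        by (rule le_less_trans[OF I_ge n0[OF that]]) simp
      thus ?thesis using e0 by (simp add: mult_less_cancel_left)
    qed
    \<comment> \<open>The estimate so far holds for \<open>n \<ge> n0\<close>. The finitely many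
      earlier laws are tight one by one, so a larger interval serves all n.\<close>
    have "(\<lambda>k. measure (M n) {- real k<..real k}) \<longlonglongrightarrow> measure (M n) (\<Union>k::nat. {- real k<..real k})" for n
      by (rule Mn.finite_Lim_measure_incseq, auto simp add: incseq_def)
    moreover have "(\<Union>k::nat. {- real k<..real k}) = UNIV"
      by (auto, metis leI le_less_trans less_imp_le minus_less_iff reals_Archimedean2)
    ultimately have "(\<lambda>k. measure (M n) {- real k<..real k}) \<longlonglongrightarrow> 1" for n
      using Mn.prob_space by simp
    hence "\<forall>\<^sub>F k in sequentially. 1 - \<epsilon> < measure (M n) {- real k<..real k}" for n
      using that order_tendstoD(1)[of _ 1 _ "1 - \<epsilon>"] by force
    hence "\<forall>\<^sub>F k in sequentially. \<forall>n\<in>{..<n0}. 1 - \<epsilon> < measure (M n) {- real k<..real k}"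
      by (intro eventually_ball_finite) auto
    then obtain k' :: nat where k': "\<And>n. n < n0 \<Longrightarrow> 1 - \<epsilon> < measure (M n) {- real k'<..real k'}"
      by (auto simp: eventually_sequentially)
    define m where "m = max (Suc k) k'"
    have "1 - \<epsilon> < measure (M n) {- real m<..real m}" for n
    proof (cases "n < n0")
      case True
      show ?thesis by (rule less_le_trans[OF k'[OF True] Mn.finite_measure_mono]) (auto simp: m_def)
    next
      case False
      have "1 - \<epsilon> < 1 - measure (M n) {x. real (Suc k) \<le> \<bar>x\<bar>}" using *[of n] False by simp
      also have "\<dots> = measure (M n) (UNIV - {x. real (Suc k) \<le> \<bar>x\<bar>})"
        using Mn.prob_compl[of "{x. real (Suc k) \<le> \<bar>x\<bar>}" n] by simp
      also have "\<dots> \<le> measure (M n) {- real m<..real m}"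
        by (rule Mn.finite_measure_mono) (auto simp: m_def)
      finally show ?thesis .
    qed
    moreover have "- real m < real m" by (simp add: m_def)
    ultimately show ?thesis by blast
  qed
  thus ?thesis unfolding tight_def using rd by auto
qed

text \<open>Produces the limit law instead of presupposing it: tightness yields a weakly convergent
  subsequence, whose limit must have characteristic function \<phi>.\<close>

lemma levy_existence:
  fixes M :: "nat \<Rightarrow> real measure" and \<phi> :: "real \<Rightarrow> complex"
  assumes rd: "\<And>n. real_distribution (M n)"
    and lim: "\<And>t. (\<lambda>n. char (M n) t) \<longlonglongrightarrow> \<phi> t" and cont: "isCont \<phi> 0"
  shows "\<exists>\<mu>. real_distribution \<mu> \<and> char \<mu> = \<phi>"
proof -
  obtain r \<mu> where r: "strict_mono (r :: nat \<Rightarrow> nat)" "real_distribution \<mu>" "weak_conv_m (M \<circ> id \<circ> r) \<mu>"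
    using tight_imp_convergent_subsubsequence[OF tight_of_char_tendsto[OF assms], of id]
    by (auto simp: strict_mono_id)
  have "(\<lambda>n. char ((M \<circ> id \<circ> r) n) t) \<longlonglongrightarrow> char \<mu> t" for t
    by (rule levy_continuity1) (use r rd in \<open>auto simp: o_def\<close>)
  moreover have "(\<lambda>n. char ((M \<circ> id \<circ> r) n) t) \<longlonglongrightarrow> \<phi> t" for t
    using LIMSEQ_subseq_LIMSEQ[OF lim r(1)] by (simp add: o_def)
  ultimately have "char \<mu> = \<phi>" using LIMSEQ_unique by blast
  thus ?thesis using r by blast
qed

text \<open>Slutsky's lemma: off the exceptional event the exponentials
  \<open>iexp (t * A n)\<close> and \<open>iexp (t * B n)\<close> differ by at most
  \<open>\<bar>t\<bar> * \<epsilon>\<close>, on it by at most 2. It serves twice, to remove the sum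
  of the defects and to pass from the entry sum to the other functionals.\<close>

lemma (in prob_space) weak_conv_m_prob_diff:
  fixes A B :: "nat \<Rightarrow> 'a \<Rightarrow> real"
  assumes A: "weak_conv_m (\<lambda>n. distr M borel (A n)) \<mu>" and mu: "real_distribution \<mu>"
    and [measurable]: "\<And>n. A n \<in> borel_measurable M" "\<And>n. B n \<in> borel_measurable M"
    and diff: "\<And>\<epsilon>. \<epsilon> > 0 \<Longrightarrow> (\<lambda>n. prob {\<omega> \<in> space M. \<bar>A n \<omega> - B n \<omega>\<bar> > \<epsilon>}) \<longlonglongrightarrow> 0"
  shows "weak_conv_m (\<lambda>n. distr M borel (B n)) \<mu>"
proof (rule levy_continuity)
  show rdB: "real_distribution (distr M borel (B n))" for n by (rule real_distribution_distr) simp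
  show "real_distribution \<mu>" by fact
  have rdA: "real_distribution (distr M borel (A n))" for n by (rule real_distribution_distr) simp
  fix t
  have cA: "(\<lambda>n. char (distr M borel (A n)) t) \<longlonglongrightarrow> char \<mu> t"
    by (rule levy_continuity1[OF rdA mu A])
  have "(\<lambda>n. char (distr M borel (B n)) t - char (distr M borel (A n)) t) \<longlonglongrightarrow> 0"
  proof (rule tendstoI)
    fix e :: real assume "e > 0"
    \<comment> \<open>The summand 1 covers t = 0. The total error stays below
      \<open>e / 4 + 2 * (e / 4)\<close>.\<close>
    define \<epsilon> where "\<epsilon> = e / (4 * (1 + \<bar>t\<bar>))"
    have eps: "\<epsilon> > 0" and te: "\<bar>t\<bar> * \<epsilon> \<le> e / 4"
      using \<open>e > 0\<close> by (auto simp: \<epsilon>_def field_simps)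
    have "\<forall>\<^sub>F n in sequentially. prob {\<omega> \<in> space M. \<bar>A n \<omega> - B n \<omega>\<bar> > \<epsilon>} < e / 4"
      using diff[OF eps] \<open>e > 0\<close> by (intro order_tendstoD(2)) auto
    thus "\<forall>\<^sub>F n in sequentially. dist (char (distr M borel (B n)) t - char (distr M borel (A n)) t) 0 < e"
    proof eventually_elim
      fix n assume n: "prob {\<omega> \<in> space M. \<bar>A n \<omega> - B n \<omega>\<bar> > \<epsilon>} < e / 4"
      let ?S = "{\<omega> \<in> space M. \<bar>A n \<omega> - B n \<omega>\<bar> > \<epsilon>}"
      have iA: "integrable M (\<lambda>\<omega>. iexp (t * A n \<omega>))" and iB: "integrable M (\<lambda>\<omega>. iexp (t * B n \<omega>))"
        by (auto intro!: integrable_const_bound[where B=1])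
      have "char (distr M borel (B n)) t - char (distr M borel (A n)) t
          = (\<integral>\<omega>. iexp (t * B n \<omega>) - iexp (t * A n \<omega>) \<partial>M)"
        unfolding char_def using iA iB by (subst (1 2) integral_distr) auto
      also have "norm \<dots> \<le> (\<integral>\<omega>. \<bar>t\<bar> * \<epsilon> + 2 * indicator ?S \<omega> \<partial>M)"
      proof (rule order_trans[OF integral_norm_bound integral_mono])
        fix \<omega> assume w: "\<omega> \<in> space M"
        show "cmod (iexp (t * B n \<omega>) - iexp (t * A n \<omega>)) \<le> \<bar>t\<bar> * \<epsilon> + 2 * indicator ?S \<omega>"
        proof (cases "\<omega> \<in> ?S")
          case True
          have "cmod (iexp (t * B n \<omega>) - iexp (t * A n \<omega>)) \<le> 2"
            by (rule order_trans[OF norm_triangle_ineq4]) auto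
          thus ?thesis using True eps by (simp add: add_increasing)
        next
          case False
          have "iexp (t * B n \<omega>) - iexp (t * A n \<omega>) = iexp (t * A n \<omega>) * (iexp (t * B n \<omega> - t * A n \<omega>) - 1)"
            by (simp add: right_diff_distrib exp_diff)
          hence "cmod (iexp (t * B n \<omega>) - iexp (t * A n \<omega>)) = cmod (iexp (t * B n \<omega> - t * A n \<omega>) - 1)"
            by (simp add: norm_mult)
          also have "\<dots> \<le> \<bar>t * B n \<omega> - t * A n \<omega>\<bar>"
            using iexp_approx1[of "t * B n \<omega> - t * A n \<omega>" 0] by simp
          also have "\<dots> = \<bar>t\<bar> * \<bar>A n \<omega> - B n \<omega>\<bar>" by (simp add: abs_mult[symmetric] right_diff_distrib abs_minus_commute)
          also have "\<dots> \<le> \<bar>t\<bar> * \<epsilon>" using False w by (intro mult_left_mono) auto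
          finally show ?thesis using False by simp
        qed
      qed (use iA iB in \<open>auto intro!: integrable_const_bound[where B="\<bar>t\<bar> * \<epsilon> + 2"] simp: indicator_def eps less_imp_le\<close>)
      also have "\<dots> = \<bar>t\<bar> * \<epsilon> + 2 * prob ?S"
        by (subst Bochner_Integration.integral_add)
           (auto simp: prob_space intro!: integrable_mult_right integrable_const_bound[where B=1])
      also have "\<dots> < e" using n te \<open>e > 0\<close> by simp
      finally show "dist (char (distr M borel (B n)) t - char (distr M borel (A n)) t) 0 < e" by simp
    qed
  qed
  from tendsto_add[OF this cA] show "(\<lambda>n. char (distr M borel (B n)) t) \<longlonglongrightarrow> char \<mu> t" by simp
qed

text \<open>All measures have mass 1, so the tails on both sides fix the mass near 0; this suits
  measures understood only away from the origin. For \<open>x > 0\<close> right tails give the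
  distribution function. For \<open>x \<le> 0\<close> the left tails are open half-lines, hence the
  squeeze between neighbouring points; above \<open>x = 0\<close> the point \<open>d / 2\<close>
  takes over, where right tails apply.\<close>

lemma weak_conv_m_of_tails:
  fixes G :: "nat \<Rightarrow> real measure" and G' :: "real measure"
  assumes rd: "\<And>n. real_distribution (G n)" and rd': "real_distribution G'"
    and R: "\<And>x. x > 0 \<Longrightarrow> (\<lambda>n. measure (G n) {x<..}) \<longlonglongrightarrow> measure G' {x<..}"
    and L: "\<And>x. x > 0 \<Longrightarrow> (\<lambda>n. measure (G n) {..<-x}) \<longlonglongrightarrow> measure G' {..<-x}"
  shows "weak_conv_m G G'"
  unfolding weak_conv_m_def weak_conv_def
proof safe
  interpret Gn: real_distribution "G n" for n by fact
  interpret G': real_distribution G' by fact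
  have cdfc: "measure (G n) {x<..} = 1 - cdf (G n) x" for n x
    using Gn.prob_compl[of "{..x}" n] by (simp add: cdf_def Compl_eq_Diff_UNIV[symmetric])
  have cdfc': "measure G' {x<..} = 1 - cdf G' x" for x
    using G'.prob_compl[of "{..x}"] by (simp add: cdf_def Compl_eq_Diff_UNIV[symmetric])
  have pos: "(\<lambda>n. cdf (G n) x) \<longlonglongrightarrow> cdf G' x" if "x > 0" for x
    using R[OF that] tendsto_diff[OF tendsto_const[of 1] R[OF that]] by (simp add: cdfc cdfc')
  fix x assume c: "isCont (cdf G') x"
  show "(\<lambda>n. cdf (G n) x) \<longlonglongrightarrow> cdf G' x"
  proof (cases "x > 0")
    case False
    show ?thesis
    proof (rule LIMSEQ_I)
      fix e :: real assume "e > 0"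
      obtain d where d: "d > 0" "\<And>y. \<bar>y - x\<bar> < d \<Longrightarrow> \<bar>cdf G' y - cdf G' x\<bar> < e / 2"
        using c \<open>e > 0\<close> unfolding continuous_at_eps_delta dist_real_def by (meson half_gt_zero)
      define l where "l = x - d/2"
      have l: "l < 0" "l < x" "\<bar>l - x\<bar> < d" "\<bar>l - d/4 - x\<bar> < d" using False d by (auto simp: l_def)
      have lowlim: "(\<lambda>n. measure (G n) {..<l}) \<longlonglongrightarrow> measure G' {..<l}" using L[of "-l"] l by simp
      have low': "cdf G' (l - d/4) \<le> measure G' {..<l}" unfolding cdf_def
        using d by (intro G'.finite_measure_mono) auto
      have low: "cdf G' x - e/2 < measure G' {..<l}" using d(2)[OF l(4)] low' by linarith
      have ev1: "\<forall>\<^sub>F n in sequentially. cdf G' x - e/2 < measure (G n) {..<l}"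
        by (rule order_tendstoD(1)[OF lowlim low])
      have ev2: "\<forall>\<^sub>F n in sequentially. cdf (G n) x < cdf G' x + e/2"
      proof (cases "x = 0")
        case True
        have "cdf G' (d/2) < cdf G' x + e/2" using d(2)[of "d/2"] d(1) True abs_ge_self[of "cdf G' (d/2) - cdf G' x"] by auto
        from order_tendstoD(2)[OF pos this] d(1)
        have "\<forall>\<^sub>F n in sequentially. cdf (G n) (d/2) < cdf G' x + e/2" by simp
        thus ?thesis by eventually_elim (rule le_less_trans[OF Gn.cdf_nondecreasing], use d True in auto)
      next
        case False
        define z where "z = min (x/2) (x + d/2)"
        have z: "z < 0" "x < z" "\<bar>z - x\<bar> < d" using False \<open>\<not> x > 0\<close> d by (auto simp: z_def min_def)
        have "measure G' {..<z} \<le> cdf G' z" unfolding cdf_def by (intro G'.finite_measure_mono) auto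
        hence "measure G' {..<z} < cdf G' x + e/2" using d(2)[OF z(3)] by linarith
        moreover have "(\<lambda>n. measure (G n) {..<z}) \<longlonglongrightarrow> measure G' {..<z}" using L[of "-z"] z by simp
        ultimately have "\<forall>\<^sub>F n in sequentially. measure (G n) {..<z} < cdf G' x + e/2"
          by (intro order_tendstoD(2))
        thus ?thesis
          by eventually_elim (rule le_less_trans, auto simp: cdf_def intro!: Gn.finite_measure_mono z(2) le_less_trans[OF _ z(2)])
      qed
      have "\<forall>\<^sub>F n in sequentially. norm (cdf (G n) x - cdf G' x) < e"
        using ev1 ev2
      proof eventually_elim
        case (elim n)
        have "measure (G n) {..<l} \<le> cdf (G n) x" unfolding cdf_def
          using l by (intro Gn.finite_measure_mono) auto
        thus ?case using elim \<open>e > 0\<close> by auto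
      qed
      thus "\<exists>no. \<forall>n\<ge>no. norm (cdf (G n) x - cdf G' x) < e"
        by (simp add: eventually_sequentially)
    qed
  qed (use pos in auto)
qed

section \<open>Regularly varying tails\<close>

text \<open>Halving x repeatedly until it lies between \<open>x0 / 2\<close> and \<open>x0\<close>
  damps the initial bound by \<open>r ^ k\<close>, while the perturbations add up to at most
  \<epsilon>. This drives the Karamata limit for \<alpha> < 2.\<close>

lemma tendsto_zero_halving_recursion:
  fixes e :: "real \<Rightarrow> real"
  assumes r: "0 \<le> r" "r < 1" and nn: "\<And>x. 0 < x \<Longrightarrow> 0 \<le> e x"
    and rec: "\<And>\<epsilon>. 0 < \<epsilon> \<Longrightarrow> \<forall>\<^sub>F x in at_top. e x \<le> r * e (x / 2) + \<epsilon> * (1 - r)"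
    and bdd: "\<And>a b. 0 < a \<Longrightarrow> \<exists>B. \<forall>x\<in>{a..b}. e x \<le> B"
  shows "(e \<longlongrightarrow> 0) at_top"
proof (rule tendstoI)
  fix \<epsilon>' :: real assume "0 < \<epsilon>'"
  define \<epsilon> where "\<epsilon> = \<epsilon>' / 3"
  have eps: "0 < \<epsilon>" using \<open>0 < \<epsilon>'\<close> by (simp add: \<epsilon>_def)
  obtain x1 where x1: "\<And>x. x1 \<le> x \<Longrightarrow> e x \<le> r * e (x / 2) + \<epsilon> * (1 - r)"
    using rec[OF eps] by (auto simp: eventually_at_top_linorder)
  define x0 where "x0 = max x1 1"
  have x0: "0 < x0" "x1 \<le> x0" by (auto simp: x0_def)
  obtain B0 where B0: "\<forall>x\<in>{x0/2..x0}. e x \<le> B0" using bdd[of "x0/2" x0] x0 by auto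
  define B where "B = max B0 0"
  have B: "0 \<le> B" "\<And>x. x0 / 2 \<le> x \<Longrightarrow> x \<le> x0 \<Longrightarrow> e x \<le> B" using B0 by (auto simp: B_def le_max_iff_disj)
  have it: "e x \<le> r ^ k * B + \<epsilon>" if "x0 / 2 * 2 ^ k \<le> x" "x \<le> x0 * 2 ^ k" for k x
    using that
  proof (induction k arbitrary: x)
    case 0
    thus ?case using B(2)[of x] eps by simp
  next
    case (Suc k)
    have x2: "x0 / 2 * 2 ^ k \<le> x / 2" "x / 2 \<le> x0 * 2 ^ k" using Suc.prems by auto
    have "(1::real) \<le> 2 ^ k" by simp
    hence "x0 * 1 \<le> x0 * 2 ^ k" using x0 by (intro mult_left_mono) auto
    moreover have "x0 * 2 ^ k \<le> x" using Suc.prems(1) by simp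
    ultimately have "x1 \<le> x" using x0 by linarith
    hence "e x \<le> r * e (x / 2) + \<epsilon> * (1 - r)" by (rule x1)
    also have "\<dots> \<le> r * (r ^ k * B + \<epsilon>) + \<epsilon> * (1 - r)" using Suc.IH[OF x2] r by (intro add_right_mono mult_left_mono) auto
    finally show ?case by (simp add: algebra_simps)
  qed
  have "(\<lambda>k. r ^ k * B) \<longlonglongrightarrow> 0 * B" using r by (intro tendsto_intros LIMSEQ_realpow_zero)
  hence "\<forall>\<^sub>F k in sequentially. r ^ k * B < \<epsilon>" using eps by (intro order_tendstoD(2)) auto
  then obtain K where K: "\<And>k. K \<le> k \<Longrightarrow> r ^ k * B < \<epsilon>" by (auto simp: eventually_sequentially)
  show "\<forall>\<^sub>F x in at_top. dist (e x) 0 < \<epsilon>'"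
  proof (rule eventually_at_top_linorderI[of "x0 * 2 ^ K"])
    fix x assume x: "x0 * 2 ^ K \<le> x"
    have xpos: "0 < x" using x x0 by (smt (verit) mult_pos_pos zero_less_power)
    have "\<exists>k. x \<le> x0 * 2 ^ k"
    proof -
      obtain k where "x / x0 < 2 ^ k" using real_arch_pow[of 2 "x / x0"] by auto
      thus ?thesis using x0 by (auto simp: field_simps intro!: exI[of _ k])
    qed
    define k where "k = (LEAST k. x \<le> x0 * 2 ^ k)"
    have k: "x \<le> x0 * 2 ^ k" unfolding k_def by (rule LeastI_ex) fact
    have "K \<le> k"
    proof (rule ccontr)
      assume "\<not> K \<le> k"
      hence "(2::real) ^ k < 2 ^ K" by simp
      hence "x0 * 2 ^ k < x0 * 2 ^ K" using x0 by simp
      thus False using k x by linarith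
    qed
    moreover have "x0 / 2 * 2 ^ k \<le> x"
    proof (cases k)
      case 0
      thus ?thesis using x x0 \<open>K \<le> k\<close> by simp
    next
      case (Suc k')
      hence "\<not> x \<le> x0 * 2 ^ k'" using not_less_Least[of k' "\<lambda>k. x \<le> x0 * 2 ^ k"] unfolding k_def by auto
      thus ?thesis using Suc by simp
    qed
    ultimately have "e x < \<epsilon> + \<epsilon>" using it[OF _ k] K[of k] by fastforce
    thus "dist (e x) 0 < \<epsilon>'" using nn[OF xpos] eps by (simp add: \<epsilon>_def)
  qed
qed

section \<open>Karamata's theorem for truncated second moments\<close>

locale regular_tail =
  fixes H :: "real \<Rightarrow> real" and \<alpha> :: real
  assumes H_mono: "\<And>u v. 0 < u \<Longrightarrow> u \<le> v \<Longrightarrow> H v \<le> H u"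
    and H_nonneg: "\<And>u. 0 < u \<Longrightarrow> 0 \<le> H u" and H_le: "\<And>u. 0 < u \<Longrightarrow> H u \<le> 1"
    and H_rv: "\<And>c. 0 < c \<Longrightarrow> ((\<lambda>u. H (c * u) / H u) \<longlongrightarrow> c powr - \<alpha>) at_top"
    and H_lim: "(H \<longlongrightarrow> 0) at_top"
    and alpha: "0 < \<alpha>" "\<alpha> \<le> 2"
    and unb: "\<alpha> = 2 \<Longrightarrow> \<forall>C. \<exists>u>0. C < u\<^sup>2 * H u"
    and H_meas [measurable]: "H \<in> borel_measurable borel"
begin

text \<open>A zero of \<open>H\<close> would persist by monotonicity, and the ratios
  \<open>H u / H u\<close> would eventually be 0 / 0 = 0, against their limit 1.\<close>

lemma H_pos: assumes "0 < u" shows "0 < H u"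
proof (rule ccontr)
  assume "\<not> 0 < H u"
  hence "H u = 0" using H_nonneg[OF assms] by linarith
  hence "H (1 * v) / H v = 0" if "u \<le> v" for v using H_mono[OF assms that] H_nonneg[of v] assms that by auto
  hence "\<forall>\<^sub>F v in at_top. H (1 * v) / H v = 0" by (intro eventually_at_top_linorderI[of u])
  hence "((\<lambda>u. H (1 * u) / H u) \<longlongrightarrow> 0) at_top" by (rule tendsto_eventually)
  from tendsto_unique[OF _ this H_rv[of 1]] show False by simp
qed

text \<open>If \<open>T u\<close> is the probability of \<open>Z > u\<close>, this is the
  expectation of \<open>(min (max Z 0) x)^2\<close> by the layer cake formula.\<close>

definition trunc_moment :: "(real \<Rightarrow> real) \<Rightarrow> real \<Rightarrow> real" where
  "trunc_moment T x = (LINT u:{0<..x}|lborel. 2 * u * T u)"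

abbreviation "U \<equiv> trunc_moment H"

text \<open>Covers \<open>H\<close> itself with fraction 1 and the two one-sided tails of a law with
  fractions adding up to 1, so that one limit computation serves all three.\<close>

definition dominated_tail :: "(real \<Rightarrow> real) \<Rightarrow> real \<Rightarrow> bool" where
  "dominated_tail T p \<longleftrightarrow> T \<in> borel_measurable borel \<and> (\<forall>u>0. 0 \<le> T u \<and> T u \<le> H u) \<and> ((\<lambda>u. T u / H u) \<longlongrightarrow> p) at_top"

lemma dominated_tail_H: "dominated_tail H 1"
proof -
  have "\<forall>\<^sub>F u in at_top. H u / H u = 1" using eventually_gt_at_top[of 0] by eventually_elim (use H_pos in force)
  thus ?thesis unfolding dominated_tail_def using H_nonneg by (auto intro: tendsto_eventually)
qed

context
  fixes T :: "real \<Rightarrow> real" and p :: real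
  assumes T: "dominated_tail T p"
begin

lemma T_meas: "T \<in> borel_measurable borel"
  using T by (simp add: dominated_tail_def)

lemma T_bounds: "0 < u \<Longrightarrow> 0 \<le> T u" "0 < u \<Longrightarrow> T u \<le> H u"
  using T by (auto simp: dominated_tail_def)

lemma trunc_moment_integrable: "set_integrable lborel {0<..x} (\<lambda>u. 2 * u * T u)"
  unfolding set_integrable_def
proof (rule Bochner_Integration.integrable_bound)
  note [measurable] = T_meas
  show "(\<lambda>u. indicator {0<..x} u *\<^sub>R (2 * u * T u)) \<in> borel_measurable lborel" by measurable
  show "integrable lborel (\<lambda>u. indicator {0<..x} u *\<^sub>R (2 * \<bar>x\<bar>))"
    by (cases "0 \<le> x") (auto intro!: integrable_real_indicator[THEN integrable_scaleR_left])
  show "AE u in lborel. norm (indicator {0<..x} u *\<^sub>R (2 * u * T u)) \<le> norm (indicator {0<..x} u *\<^sub>R (2 * \<bar>x\<bar>))"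
  proof (rule AE_I2)
    fix u
    show "norm (indicator {0<..x} u *\<^sub>R (2 * u * T u)) \<le> norm (indicator {0<..x} u *\<^sub>R (2 * \<bar>x\<bar>))"
    proof (cases "u \<in> {0<..x}")
      case True
      hence "2 * u * T u \<le> 2 * \<bar>x\<bar> * 1" using T_bounds[of u] H_le[of u] by (intro mult_mono) auto
      thus ?thesis using True T_bounds(1)[of u] by simp
    qed simp
  qed
qed

lemma trunc_moment_diff:
  assumes "0 \<le> x" "x \<le> y"
  shows "trunc_moment T y - trunc_moment T x = (LINT u:{x<..y}|lborel. 2 * u * T u)"
    and "set_integrable lborel {x<..y} (\<lambda>u. 2 * u * T u)"
proof -
  show i: "set_integrable lborel {x<..y} (\<lambda>u. 2 * u * T u)"
    by (rule set_integrable_subset[OF trunc_moment_integrable[of y]]) (use assms in auto)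
  have "{0<..y} = {0<..x} \<union> {x<..y}" using assms by auto
  hence "trunc_moment T y = (LINT u:{0<..x} \<union> {x<..y}|lborel. 2 * u * T u)" by (simp add: trunc_moment_def)
  also have "\<dots> = trunc_moment T x + (LINT u:{x<..y}|lborel. 2 * u * T u)"
    unfolding trunc_moment_def by (rule set_integral_Un[OF _ trunc_moment_integrable i]) auto
  finally show "trunc_moment T y - trunc_moment T x = (LINT u:{x<..y}|lborel. 2 * u * T u)" by simp
qed

lemma trunc_moment_diff_scaled:
  assumes "0 \<le> d" "d \<le> 1" "0 < x"
  shows "trunc_moment T x - trunc_moment T (d * x) = x\<^sup>2 * (LINT y:{d<..1}|lborel. 2 * y * T (y * x))"
proof -
  have dx: "0 \<le> d * x" "d * x \<le> x" using assms by (auto simp: mult_left_le_one_le)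
  have "trunc_moment T x - trunc_moment T (d * x) = (LINT u|lborel. indicator {d * x<..x} u *\<^sub>R (2 * u * T u))"
    using trunc_moment_diff(1)[OF dx] by (simp add: set_lebesgue_integral_def)
  also have "\<dots> = \<bar>x\<bar> *\<^sub>R (LINT y|lborel. indicator {d * x<..x} (0 + x * y) *\<^sub>R (2 * (0 + x * y) * T (0 + x * y)))"
    by (rule lborel_integral_real_affine) (use assms in simp)
  also have "(\<lambda>y. indicator {d * x<..x} (0 + x * y) *\<^sub>R (2 * (0 + x * y) * T (0 + x * y)))
     = (\<lambda>y. x * (indicator {d<..1} y *\<^sub>R (2 * y * T (y * x))))"
  proof
    fix y
    have "indicator {d * x<..x} (0 + x * y) = (indicator {d<..1} y :: real)"
      using assms by (auto simp: indicator_def mult.commute[of x] mult_le_cancel_right1)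
    thus "indicator {d * x<..x} (0 + x * y) *\<^sub>R (2 * (0 + x * y) * T (0 + x * y)) = x * (indicator {d<..1} y *\<^sub>R (2 * y * T (y * x)))"
      by (simp add: mult_ac)
  qed
  also have "\<bar>x\<bar> *\<^sub>R (LINT y|lborel. x * (indicator {d<..1} y *\<^sub>R (2 * y * T (y * x)))) = x\<^sup>2 * (LINT y:{d<..1}|lborel. 2 * y * T (y * x))"
    using assms by (simp only: integral_mult_right_zero set_lebesgue_integral_def) (simp add: power2_eq_square)
  finally show ?thesis .
qed

lemma T_rv:
  assumes c: "0 < c" shows "((\<lambda>u. T (c * u) / H u) \<longlongrightarrow> p * c powr - \<alpha>) at_top"
proof -
  have "filterlim (\<lambda>u. c * u) at_top at_top" using c by (simp add: filterlim_tendsto_pos_mult_at_top[OF tendsto_const _ filterlim_ident])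
  moreover have "((\<lambda>u. T u / H u) \<longlongrightarrow> p) at_top" using T by (simp add: dominated_tail_def)
  ultimately have "((\<lambda>u. T (c * u) / H (c * u)) \<longlongrightarrow> p) at_top" by (rule filterlim_compose[rotated])
  from tendsto_mult[OF this H_rv[OF c]]
  have "((\<lambda>u. T (c * u) / H (c * u) * (H (c * u) / H u)) \<longlongrightarrow> p * c powr - \<alpha>) at_top" .
  moreover have "\<forall>\<^sub>F u in at_top. T (c * u) / H (c * u) * (H (c * u) / H u) = T (c * u) / H u"
    using eventually_gt_at_top[of 0]
  proof eventually_elim
    fix u :: real assume "0 < u"
    hence "H (c * u) \<noteq> 0" using H_pos[of "c * u"] c by simp
    thus "T (c * u) / H (c * u) * (H (c * u) / H u) = T (c * u) / H u" by simp
  qed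
  ultimately show ?thesis by (rule Lim_transform_eventually)
qed

text \<open>After the substitution \<open>u = x * y\<close> the integrand, divided by
  \<open>H x\<close>, converges pointwise by regular variation. The cutoff \<open>d\<close> supplies
  the domination: by monotonicity \<open>T (y * x) / H x\<close> is at most
  \<open>H (d * x) / H x\<close>, which is eventually bounded.\<close>

lemma trunc_moment_diff_limit:
  assumes d: "0 < d" "d \<le> 1"
  shows "((\<lambda>x. (trunc_moment T x - trunc_moment T (d * x)) / (x\<^sup>2 * H x)) \<longlongrightarrow> p * (LINT y:{d<..1}|lborel. 2 * y powr (1 - \<alpha>))) at_top"
proof -
  let ?f = "\<lambda>y. indicator {d<..1} y *\<^sub>R (p * (2 * y powr (1 - \<alpha>)))"
  let ?s = "\<lambda>x y. indicator {d<..1} y *\<^sub>R (2 * y * (T (y * x) / H x))"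
  let ?w = "\<lambda>y. indicator {d<..1} y *\<^sub>R (2 * (d powr - \<alpha> + 1))"
  have lim: "((\<lambda>x. LINT y|lborel. ?s x y) \<longlongrightarrow> (LINT y|lborel. ?f y)) at_top"
  proof (rule integral_dominated_convergence_at_top[where w="?w"])
    note [measurable] = T_meas
    show "?f \<in> borel_measurable lborel" "?s t \<in> borel_measurable lborel" for t by measurable
    show "AE y in lborel. ((\<lambda>x. ?s x y) \<longlongrightarrow> ?f y) at_top"
    proof (rule AE_I2)
      fix y :: real
      show "((\<lambda>x. ?s x y) \<longlongrightarrow> ?f y) at_top"
      proof (cases "y \<in> {d<..1}")
        case True
        hence y: "0 < y" using d by simp
        have "((\<lambda>x. 2 * y * (T (y * x) / H x)) \<longlongrightarrow> 2 * y * (p * y powr - \<alpha>)) at_top" by (intro tendsto_intros T_rv y)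
        moreover have "2 * y * (p * y powr - \<alpha>) = p * (2 * y powr (1 - \<alpha>))" using y by (simp add: powr_diff powr_minus field_simps)
        ultimately show ?thesis using True by simp
      qed simp
    qed
    have "\<forall>\<^sub>F x in at_top. H (d * x) / H x < d powr - \<alpha> + 1" using H_rv[OF d(1)] by (rule order_tendstoD(2)) simp
    thus "\<forall>\<^sub>F x in at_top. AE y in lborel. norm (?s x y) \<le> ?w y"
      using eventually_gt_at_top[of 0]
    proof eventually_elim
      fix x :: real assume x: "H (d * x) / H x < d powr - \<alpha> + 1" "0 < x"
      show "AE y in lborel. norm (?s x y) \<le> ?w y"
      proof (rule AE_I2)
        fix y :: real
        show "norm (?s x y) \<le> ?w y"
        proof (cases "y \<in> {d<..1}")
          case True
          hence y: "0 < y" "y \<le> 1" "d < y" using d by auto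
          have "T (y * x) \<le> H (y * x)" using y x by (intro T_bounds) simp
          also have "\<dots> \<le> H (d * x)" using y d x by (intro H_mono) auto
          finally have "T (y * x) / H x \<le> H (d * x) / H x" using x H_nonneg by (intro divide_right_mono) auto
          hence "T (y * x) / H x \<le> d powr - \<alpha> + 1" using x by linarith
          moreover have "0 \<le> T (y * x) / H x" using y x H_nonneg T_bounds(1) by simp
          ultimately have "(2 * y) * (T (y * x) / H x) \<le> 2 * (d powr - \<alpha> + 1)" using y by (intro mult_mono) auto
          moreover have "0 \<le> (2 * y) * (T (y * x) / H x)" using y \<open>0 \<le> T (y * x) / H x\<close> by (intro mult_nonneg_nonneg) auto
          moreover have "indicator {d<..1} y = (1 :: real)" using True by simp
          ultimately show ?thesis by (simp only: scaleR_one real_norm_def abs_of_nonneg)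
        qed simp
      qed
    qed
    show "integrable lborel ?w"
      using d by (intro integrable_real_indicator[THEN integrable_scaleR_left]) auto
  qed
  have ev: "\<forall>\<^sub>F x in at_top. (LINT y|lborel. ?s x y) = (trunc_moment T x - trunc_moment T (d * x)) / (x\<^sup>2 * H x)"
    using eventually_gt_at_top[of 0]
  proof eventually_elim
    fix x :: real assume x: "0 < x"
    have "?s x = (\<lambda>y. (indicator {d<..1} y *\<^sub>R (2 * y * T (y * x))) / H x)" by (rule ext) simp
    hence "(LINT y|lborel. ?s x y) = (LINT y:{d<..1}|lborel. 2 * y * T (y * x)) / H x"
      unfolding set_lebesgue_integral_def by (simp only: integral_divide_zero)
    also have "\<dots> = (trunc_moment T x - trunc_moment T (d * x)) / (x\<^sup>2 * H x)"
      using trunc_moment_diff_scaled[of d x] d x by simp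
    finally show "(LINT y|lborel. ?s x y) = (trunc_moment T x - trunc_moment T (d * x)) / (x\<^sup>2 * H x)" .
  qed
  have "(LINT y|lborel. ?f y) = p * (LINT y:{d<..1}|lborel. 2 * y powr (1 - \<alpha>))"
  proof -
    have "?f = (\<lambda>y. p * (indicator {d<..1} y *\<^sub>R (2 * y powr (1 - \<alpha>))))" by (rule ext) simp
    thus ?thesis unfolding set_lebesgue_integral_def by (simp only: integral_mult_right_zero)
  qed
  thus ?thesis using Lim_transform_eventually[OF lim ev] by (simp only:)
qed

end

lemma set_integral_Ioc_Icc:
  fixes f :: "real \<Rightarrow> real"
  assumes [measurable]: "f \<in> borel_measurable borel"
  shows "(LINT y:{d<..b}|lborel. f y) = (LINT y:{d..b}|lborel. f y)"
  unfolding set_lebesgue_integral_def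
proof (rule integral_cong_AE)
  have "AE y in lborel. y \<noteq> d" by (rule AE_lborel_singleton)
  thus "AE y in lborel. indicator {d<..b} y *\<^sub>R f y = indicator {d..b} y *\<^sub>R f y"
    by eventually_elim (auto simp: indicator_def)
qed measurable

lemma integral_powr_Ioc:
  assumes d: "0 < d" "d \<le> 1" and a: "\<alpha> < 2"
  shows "(LINT y:{d<..1}|lborel. 2 * y powr (1 - \<alpha>)) = 2 * (1 - d powr (2 - \<alpha>)) / (2 - \<alpha>)"
proof -
  have "(LINT y:{d<..1}|lborel. 2 * y powr (1 - \<alpha>)) = (LINT y:{d..1}|lborel. 2 * y powr (1 - \<alpha>))"
    by (rule set_integral_Ioc_Icc) measurable
  also have "\<dots> = 2 / (2 - \<alpha>) * 1 powr (2 - \<alpha>) - 2 / (2 - \<alpha>) * d powr (2 - \<alpha>)"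
    unfolding set_lebesgue_integral_def real_scaleR_def mult.commute[of "indicator _ _"]
  proof (rule integral_FTC_Icc_real)
    fix x assume x: "d \<le> x" "x \<le> 1"
    hence x0: "0 < x" using d by simp
    show "((\<lambda>y. 2 / (2 - \<alpha>) * y powr (2 - \<alpha>)) has_real_derivative 2 * x powr (1 - \<alpha>)) (at x)"
    proof -
      have "((\<lambda>y. 2 / (2 - \<alpha>) * y powr (2 - \<alpha>)) has_real_derivative 2 / (2 - \<alpha>) * ((2 - \<alpha>) * x powr (2 - \<alpha> - 1))) (at x)"
        by (intro DERIV_cmult has_real_derivative_powr x0)
      moreover have "2 / (2 - \<alpha>) * ((2 - \<alpha>) * x powr (2 - \<alpha> - 1)) = 2 * x powr (1 - \<alpha>)" using a by simp
      ultimately show ?thesis by (simp only:)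
    qed
    show "isCont (\<lambda>x. 2 * x powr (1 - \<alpha>)) x" using x0 by (intro continuous_intros) auto
  qed (use d in auto)
  finally show ?thesis by (simp only: powr_one_eq_one right_diff_distrib diff_divide_distrib times_divide_eq_left mult_1_right)
qed

lemma integral_inverse_Ioc:
  assumes d: "0 < d" "d \<le> 1" and a: "\<alpha> = 2"
  shows "(LINT y:{d<..1}|lborel. 2 * y powr (1 - \<alpha>)) = - 2 * ln d"
proof -
  have "(LINT y:{d<..1}|lborel. 2 * y powr (1 - \<alpha>)) = (LINT y:{d..1}|lborel. 2 * y powr (1 - \<alpha>))"
    by (rule set_integral_Ioc_Icc) measurable
  also have "\<dots> = 2 * ln 1 - 2 * ln d"
    unfolding set_lebesgue_integral_def real_scaleR_def mult.commute[of "indicator _ _"]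
  proof (rule integral_FTC_Icc_real)
    fix x assume x: "d \<le> x" "x \<le> 1"
    hence x0: "0 < x" using d by simp
    show "((\<lambda>y. 2 * ln y) has_real_derivative 2 * x powr (1 - \<alpha>)) (at x)"
      using x0 a by (auto intro!: derivative_eq_intros simp: powr_minus divide_inverse)
    show "isCont (\<lambda>x. 2 * x powr (1 - \<alpha>)) x" using x0 by (intro continuous_intros) auto
  qed (use d in auto)
  finally show ?thesis by simp
qed

lemma U_mono: "0 \<le> x \<Longrightarrow> x \<le> y \<Longrightarrow> U x \<le> U y"
proof -
  assume x: "0 \<le> x" "x \<le> y"
  have "0 \<le> (LINT u:{x<..y}|lborel. 2 * u * H u)" unfolding set_lebesgue_integral_def
    by (rule Bochner_Integration.integral_nonneg) (use x H_nonneg in \<open>auto simp: indicator_def\<close>)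
  thus ?thesis using trunc_moment_diff(1)[OF dominated_tail_H x] by simp
qed

lemma U_bounds:
  assumes x: "0 < x" shows "x\<^sup>2 * H x \<le> U x" "U x \<le> x\<^sup>2" "0 < U x"
proof -
  have quad: "set_integrable lborel {0<..x} (\<lambda>u. 2 * u * c)" "(LINT u:{0<..x}|lborel. 2 * u * c) = x\<^sup>2 * c" for c
  proof -
    show "set_integrable lborel {0<..x} (\<lambda>u. 2 * u * c)"
      by (rule set_integrable_subset[of _ "{0..x}"]) (auto intro!: borel_integrable_atLeastAtMost' continuous_intros)
    have "(LINT u:{0<..x}|lborel. 2 * u * c) = (LINT u:{0..x}|lborel. 2 * u * c)" by (rule set_integral_Ioc_Icc) measurable
    also have "\<dots> = x\<^sup>2 * c - 0\<^sup>2 * c"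
      unfolding set_lebesgue_integral_def real_scaleR_def mult.commute[of "indicator _ _"]
      by (rule integral_FTC_Icc_real) (use x in \<open>auto intro!: derivative_eq_intros continuous_intros\<close>)
    finally show "(LINT u:{0<..x}|lborel. 2 * u * c) = x\<^sup>2 * c" by simp
  qed
  note i = trunc_moment_integrable[OF dominated_tail_H, of x]
  have "(LINT u:{0<..x}|lborel. 2 * u * H x) \<le> U x" unfolding trunc_moment_def
    by (rule set_integral_mono[OF quad(1) i]) (auto intro!: mult_left_mono H_mono)
  thus 1: "x\<^sup>2 * H x \<le> U x" by (simp only: quad)
  have "U x \<le> (LINT u:{0<..x}|lborel. 2 * u * 1)" unfolding trunc_moment_def
    by (rule set_integral_mono[OF i quad(1)]) (use H_le in \<open>auto intro!: mult_left_mono\<close>)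
  thus "U x \<le> x\<^sup>2" by (simp only: quad)
  have "0 < x\<^sup>2 * H x" using x H_pos[OF x] by simp
  thus "0 < U x" using 1 by linarith
qed

text \<open>Below \<open>A\<close> the bound \<open>H \<le> 1\<close> is used, above it
  monotonicity. With \<open>A\<close> fixed and \<open>H A\<close> small this makes
  \<open>U x\<close> negligible against \<open>x^2\<close>.\<close>

lemma U_le_split:
  assumes "0 < A" "A \<le> x" shows "U x \<le> A\<^sup>2 + x\<^sup>2 * H A"
proof -
  have x: "0 < x" using assms by simp
  have i: "set_integrable lborel {A<..x} (\<lambda>u. 2 * u * H A)"
    by (rule set_integrable_subset[of _ "{A..x}"]) (auto intro!: borel_integrable_atLeastAtMost' continuous_intros)
  have "U x - U A = (LINT u:{A<..x}|lborel. 2 * u * H u)" using trunc_moment_diff(1)[OF dominated_tail_H] assms by auto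
  also have "\<dots> \<le> (LINT u:{A<..x}|lborel. 2 * u * H A)"
    by (rule set_integral_mono[OF trunc_moment_diff(2)[OF dominated_tail_H] i]) (use assms in \<open>auto intro!: mult_left_mono H_mono\<close>)
  also have "\<dots> = (LINT u:{A..x}|lborel. 2 * u * H A)" by (rule set_integral_Ioc_Icc) measurable
  also have "\<dots> = x\<^sup>2 * H A - A\<^sup>2 * H A"
      unfolding set_lebesgue_integral_def real_scaleR_def mult.commute[of "indicator _ _"]
      by (rule integral_FTC_Icc_real) (use assms in \<open>auto intro!: derivative_eq_intros continuous_intros\<close>)
  finally have "U x \<le> U A + x\<^sup>2 * H A - A\<^sup>2 * H A" by simp
  moreover have "U A \<le> A\<^sup>2" "0 \<le> A\<^sup>2 * H A" using U_bounds[OF assms(1)] H_nonneg[OF assms(1)] by auto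
  ultimately show ?thesis by linarith
qed

text \<open>For \<alpha> = 2 the increment of \<open>U\<close> from \<open>d * x\<close> to
  \<open>x\<close> alone is about \<open>- 2 * ln d\<close> times \<open>x^2 * H x\<close>, and
  \<open>d\<close> is arbitrary. For \<alpha> < 2 the quotient
  \<open>s x = U x / (x^2 * H x)\<close> satisfies \<open>s x = \<rho> x * s (x / 2) + I x\<close>
  with \<open>\<rho>\<close> tending to \<open>r < 1\<close> and \<open>I\<close> to
  \<open>S * (1 - r)\<close>; the fixed point \<open>S\<close> attracts.\<close>

lemma U_ratio_limit: "((\<lambda>x. x\<^sup>2 * H x / U x) \<longlongrightarrow> (2 - \<alpha>) / 2) at_top"
proof (cases "\<alpha> = 2")
  case True
  show ?thesis
  proof (rule tendstoI)
    fix \<epsilon> :: real assume e: "0 < \<epsilon>"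
    \<comment> \<open>Chosen so that \<open>- 2 * ln d\<close> equals
      \<open>2 * (1 / \<epsilon> + 1)\<close>, which exceeds \<open>1 / \<epsilon>\<close>.\<close>
    define d where "d = exp (- (1 / \<epsilon> + 1))"
    have "0 < 1 / \<epsilon> + 1" using e by (simp add: add_pos_pos)
    hence d: "0 < d" "d \<le> 1" by (auto simp: d_def)
    have "- 2 * ln d = 2 * (1 / \<epsilon> + 1)" by (simp add: d_def)
    hence "((\<lambda>x. (U x - U (d * x)) / (x\<^sup>2 * H x)) \<longlongrightarrow> 2 * (1 / \<epsilon> + 1)) at_top"
      using trunc_moment_diff_limit[OF dominated_tail_H d] integral_inverse_Ioc[OF d True] by (simp only: mult_1)
    hence "\<forall>\<^sub>F x in at_top. 1 / \<epsilon> < (U x - U (d * x)) / (x\<^sup>2 * H x)"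
      by (rule order_tendstoD(1)) (use e in \<open>simp add: add_pos_pos field_simps\<close>)
    thus "\<forall>\<^sub>F x in at_top. dist (x\<^sup>2 * H x / U x) ((2 - \<alpha>) / 2) < \<epsilon>" using eventually_gt_at_top[of 0]
    proof eventually_elim
      fix x :: real assume x: "1 / \<epsilon> < (U x - U (d * x)) / (x\<^sup>2 * H x)" "0 < x"
      have p: "0 < x\<^sup>2 * H x" using x(2) H_pos by simp
      have "0 < U (d * x)" by (rule U_bounds) (use d x in simp)
      hence "(U x - U (d * x)) / (x\<^sup>2 * H x) \<le> U x / (x\<^sup>2 * H x)" using p by (intro divide_right_mono) auto
      hence "1 / \<epsilon> < U x / (x\<^sup>2 * H x)" using x(1) by linarith
      hence "x\<^sup>2 * H x / U x < \<epsilon>" using p e U_bounds(3)[OF x(2)] by (simp add: field_simps)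
      moreover have "0 \<le> x\<^sup>2 * H x / U x" using p U_bounds(3)[OF x(2)] by simp
      ultimately show "dist (x\<^sup>2 * H x / U x) ((2 - \<alpha>) / 2) < \<epsilon>" using True by simp
    qed
  qed
next
  case False
  hence a2: "\<alpha> < 2" using alpha by simp
  define s where "s x = U x / (x\<^sup>2 * H x)" for x
  define r where "r = (1/2) powr (2 - \<alpha>)"
  define S where "S = 2 / (2 - \<alpha>)"
  have r: "0 < r" "r < 1" using a2 powr_less_mono2[of "2 - \<alpha>" "1/2" 1] by (auto simp: r_def)
  have S0: "0 < S" using a2 by (simp add: S_def)
  define I where "I x = (U x - U (1/2 * x)) / (x\<^sup>2 * H x)" for x
  define \<rho> where "\<rho> x = H (1/2 * x) / H x / 4" for x
  have I_lim: "(I \<longlongrightarrow> S * (1 - r)) at_top"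
    unfolding I_def using trunc_moment_diff_limit[OF dominated_tail_H, of "1/2"] integral_powr_Ioc[of "1/2"] a2
    by (simp add: S_def r_def)
  have "((\<lambda>x. H (1/2 * x) / H x / 4) \<longlongrightarrow> (1/2) powr - \<alpha> / 4) at_top" by (intro tendsto_intros H_rv) auto
  moreover have "(1/2) powr - \<alpha> / 4 = r"
  proof -
    have "r = (1/2) powr 2 * (1/2) powr - \<alpha>" unfolding r_def powr_add[symmetric] by simp
    thus ?thesis by (simp add: power2_eq_square)
  qed
  ultimately have rho_lim: "(\<rho> \<longlongrightarrow> r) at_top" unfolding \<rho>_def by (simp only:)
  have s_rec: "s x = \<rho> x * s (x / 2) + I x" if x: "0 < x" for x
  proof -
    have p: "H x \<noteq> 0" "H (x/2) \<noteq> 0" using H_pos[of x] H_pos[of "x/2"] x by auto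
    have "\<rho> x * s (x / 2) = U (x/2) / (x\<^sup>2 * H x)" unfolding \<rho>_def s_def using p x by (simp add: power2_eq_square field_simps)
    thus ?thesis unfolding I_def s_def by (simp add: diff_divide_distrib)
  qed
  \<comment> \<open>A rate strictly between \<open>r\<close> and 1, since \<open>\<rho> x\<close>
    only tends to \<open>r\<close>.\<close>
  define r' where "r' = (1 + r) / 2"
  have r': "r < r'" "r' < 1" "0 < r'" using r by (auto simp: r'_def)
  have "((\<lambda>x. \<bar>s x - S\<bar>) \<longlongrightarrow> 0) at_top"
  proof (rule tendsto_zero_halving_recursion[of r'])
    fix \<epsilon> :: real assume e: "0 < \<epsilon>"
    have "((\<lambda>x. \<bar>\<rho> x - r\<bar> * S + \<bar>I x - S * (1 - r)\<bar>) \<longlongrightarrow> \<bar>r - r\<bar> * S + \<bar>S * (1 - r) - S * (1 - r)\<bar>) at_top"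
      by (intro tendsto_intros rho_lim I_lim)
    hence "\<forall>\<^sub>F x in at_top. \<bar>\<rho> x - r\<bar> * S + \<bar>I x - S * (1 - r)\<bar> < \<epsilon> * (1 - r')"
      by (rule order_tendstoD(2)) (use e r' in simp)
    moreover have "\<forall>\<^sub>F x in at_top. \<rho> x < r'" by (rule order_tendstoD(2)[OF rho_lim r'(1)])
    ultimately show "\<forall>\<^sub>F x in at_top. \<bar>s x - S\<bar> \<le> r' * \<bar>s (x / 2) - S\<bar> + \<epsilon> * (1 - r')"
      using eventually_gt_at_top[of 0]
    proof eventually_elim
      fix x :: real
      assume x: "\<bar>\<rho> x - r\<bar> * S + \<bar>I x - S * (1 - r)\<bar> < \<epsilon> * (1 - r')" "\<rho> x < r'" "0 < x"
      have rp: "0 \<le> \<rho> x" unfolding \<rho>_def using H_nonneg x by simp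
      have "s x - S = \<rho> x * (s (x / 2) - S) + (\<rho> x - r) * S + (I x - S * (1 - r))"
        unfolding s_rec[OF x(3)] by (simp add: algebra_simps)
      hence "\<bar>s x - S\<bar> \<le> \<bar>\<rho> x * (s (x / 2) - S)\<bar> + \<bar>(\<rho> x - r) * S\<bar> + \<bar>I x - S * (1 - r)\<bar>" by linarith
      also have "\<dots> = \<rho> x * \<bar>s (x / 2) - S\<bar> + (\<bar>\<rho> x - r\<bar> * S + \<bar>I x - S * (1 - r)\<bar>)" using rp S0 by (simp add: abs_mult)
      also have "\<dots> \<le> r' * \<bar>s (x / 2) - S\<bar> + \<epsilon> * (1 - r')" using x by (intro add_mono mult_right_mono) auto
      finally show "\<bar>s x - S\<bar> \<le> r' * \<bar>s (x / 2) - S\<bar> + \<epsilon> * (1 - r')" .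
    qed
  next
    fix a b :: real assume a: "0 < a"
    show "\<exists>B. \<forall>x\<in>{a..b}. \<bar>s x - S\<bar> \<le> B"
    proof (intro exI ballI)
      fix x assume x: "x \<in> {a..b}"
      have x0: "0 < x" "0 < b" using a x by auto
      have "U x \<le> b\<^sup>2" using order_trans[OF U_bounds(2)[OF x0(1)] power_mono[of x b 2]] x x0 by auto
      moreover have "a\<^sup>2 * H b \<le> x\<^sup>2 * H x" using x a x0 H_nonneg[of b] by (intro mult_mono power_mono H_mono) auto
      moreover have "0 < a\<^sup>2 * H b" using a H_pos[OF x0(2)] by simp
      ultimately have "s x \<le> b\<^sup>2 / (a\<^sup>2 * H b)" unfolding s_def by (intro frac_le) auto
      moreover have "0 \<le> s x" unfolding s_def using U_bounds(3)[OF x0(1)] H_nonneg[OF x0(1)] by simp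
      ultimately show "\<bar>s x - S\<bar> \<le> b\<^sup>2 / (a\<^sup>2 * H b) + S" using S0 by (simp add: abs_le_iff)
    qed
  qed (use r' in auto)
  hence "(s \<longlongrightarrow> S) at_top" by (simp add: tendsto_rabs_zero_iff LIM_zero_iff)
  hence "((\<lambda>x. inverse (s x)) \<longlongrightarrow> inverse S) at_top" using S0 by (intro tendsto_inverse) auto
  thus ?thesis unfolding s_def S_def by (simp add: inverse_eq_divide)
qed

text \<open>For \<alpha> = 2 this is what \<open>unb\<close> provides, through
  \<open>x^2 * H x \<le> U x\<close>. For \<alpha> < 2 a bounded \<open>U\<close> would converge, so
  by the Karamata ratio \<open>x^2 * H x\<close> would have a nonzero limit and \<open>H\<close>
  would vary regularly with exponent -2, not - \<alpha>.\<close>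

lemma U_at_top: "filterlim U at_top at_top"
proof -
  have "\<exists>u>0. C < U u" for C
  proof (cases "\<alpha> = 2")
    case True
    then obtain u where "0 < u" "C < u\<^sup>2 * H u" using unb by blast
    thus ?thesis using U_bounds(1)[of u] by (intro exI[of _ u]) auto
  next
    case False
    hence a2: "\<alpha> < 2" using alpha by simp
    show ?thesis
    proof (rule ccontr)
      assume "\<not> ?thesis"
      hence C: "U u \<le> C" if "0 < u" for u using that by (meson not_less)
      define l where "l = (SUP u\<in>{0<..}. U u)"
      have bdd: "bdd_above (U ` {0<..})" using C by (auto simp: bdd_above_def)
      have lim: "(U \<longlongrightarrow> l) at_top"
      proof (rule order_tendstoI)
        fix y assume "y < l"
        then obtain u where u: "0 < u" "y < U u" unfolding l_def using less_cSUP_iff[OF _ bdd] by auto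
        show "\<forall>\<^sub>F x in at_top. y < U x"
          by (rule eventually_at_top_linorderI[of u]) (use u U_mono in \<open>auto intro: less_le_trans\<close>)
      next
        fix y assume "l < y"
        show "\<forall>\<^sub>F x in at_top. U x < y"
        proof (rule eventually_at_top_linorderI[of 1])
          fix x :: real assume "1 \<le> x"
          hence "U x \<le> l" unfolding l_def by (intro cSUP_upper[OF _ bdd]) simp
          thus "U x < y" using \<open>l < y\<close> by simp
        qed
      qed
      have "U 1 \<le> l" unfolding l_def by (rule cSUP_upper[OF _ bdd]) simp
      hence l0: "0 < l" using U_bounds(3)[of 1] by simp
      have V: "((\<lambda>x. x\<^sup>2 * H x / U x * U x) \<longlongrightarrow> (2 - \<alpha>) / 2 * l) at_top"
        by (intro tendsto_mult U_ratio_limit lim)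
      have ev: "\<forall>\<^sub>F x in at_top. x\<^sup>2 * H x / U x * U x = x\<^sup>2 * H x"
        using eventually_gt_at_top[of 0] by eventually_elim (use U_bounds(3) in force)
      define k where "k = (2 - \<alpha>) / 2 * l"
      have k: "k \<noteq> 0" using a2 l0 by (simp add: k_def)
      have V1: "((\<lambda>x. x\<^sup>2 * H x) \<longlongrightarrow> k) at_top" using Lim_transform_eventually[OF V ev] by (simp add: k_def)
      have "filterlim (\<lambda>x::real. 2 * x) at_top at_top" by (simp add: filterlim_tendsto_pos_mult_at_top[OF tendsto_const _ filterlim_ident])
      from filterlim_compose[OF V1 this] have V2: "((\<lambda>x. (2 * x)\<^sup>2 * H (2 * x)) \<longlongrightarrow> k) at_top" .
      have "((\<lambda>x. ((2 * x)\<^sup>2 * H (2 * x)) / (x\<^sup>2 * H x)) \<longlongrightarrow> k / k) at_top" by (intro tendsto_divide V1 V2 k)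
      moreover have "\<forall>\<^sub>F x in at_top. ((2 * x)\<^sup>2 * H (2 * x)) / (x\<^sup>2 * H x) = 4 * (H (2 * x) / H x)"
        using eventually_gt_at_top[of 0] by eventually_elim (simp add: power2_eq_square)
      ultimately have "((\<lambda>x. 4 * (H (2 * x) / H x)) \<longlongrightarrow> 1) at_top" using k Lim_transform_eventually by fastforce
      moreover have "((\<lambda>x. 4 * (H (2 * x) / H x)) \<longlongrightarrow> 4 * 2 powr - \<alpha>) at_top" by (intro tendsto_intros H_rv) simp
      ultimately have "4 * 2 powr - \<alpha> = (1::real)" using tendsto_unique[OF trivial_limit_at_top_linorder] by blast
      moreover have "4 * 2 powr - \<alpha> = (2::real) powr (2 - \<alpha>)"
      proof -
        have "(2::real) powr (2 - \<alpha>) = 2 powr 2 * 2 powr - \<alpha>" unfolding powr_add[symmetric] by simp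
        thus ?thesis by simp
      qed
      ultimately show False using a2 powr_less_mono[of 0 "2 - \<alpha>" 2] by simp
    qed
  qed
  show ?thesis unfolding filterlim_at_top
  proof
    fix C
    obtain u where "0 < u" "C < U u" using \<open>\<And>C. \<exists>u>0. C < U u\<close> by blast
    thus "\<forall>\<^sub>F x in at_top. C \<le> U x"
      by (intro eventually_at_top_linorderI[of u]) (metis U_mono less_imp_le order_trans)
  qed
qed

lemma U_quadratic_ratio: "((\<lambda>x. U x / x\<^sup>2) \<longlongrightarrow> 0) at_top"
proof (rule tendstoI)
  fix \<epsilon> :: real assume e: "0 < \<epsilon>"
  have "\<forall>\<^sub>F A in at_top. H A < \<epsilon> / 2" by (rule order_tendstoD(2)[OF H_lim]) (use e in simp)
  then obtain A where A: "0 < A" "H A < \<epsilon> / 2"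
    using eventually_happens'[OF trivial_limit_at_top_linorder eventually_conj[OF _ eventually_gt_at_top[of 0]]] by blast
  have "((\<lambda>x::real. A\<^sup>2 / x\<^sup>2) \<longlongrightarrow> 0) at_top"
    by (intro real_tendsto_divide_at_top[OF tendsto_const] filterlim_pow_at_top filterlim_ident) auto
  hence "\<forall>\<^sub>F x in at_top. A\<^sup>2 / x\<^sup>2 < \<epsilon> / 2" by (rule order_tendstoD(2)) (use e in simp)
  thus "\<forall>\<^sub>F x in at_top. dist (U x / x\<^sup>2) 0 < \<epsilon>" using eventually_ge_at_top[of A]
  proof eventually_elim
    fix x assume x: "A\<^sup>2 / x\<^sup>2 < \<epsilon> / 2" "A \<le> x"
    have x0: "0 < x" using A x by simp
    have "U x / x\<^sup>2 \<le> (A\<^sup>2 + x\<^sup>2 * H A) / x\<^sup>2" using U_le_split[OF A(1) x(2)] by (intro divide_right_mono) auto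
    also have "\<dots> = A\<^sup>2 / x\<^sup>2 + H A" using x0 by (simp add: add_divide_distrib)
    also have "\<dots> < \<epsilon>" using x A by linarith
    finally show "dist (U x / x\<^sup>2) 0 < \<epsilon>" using U_bounds(3)[OF x0] by simp
  qed
qed

lemma U_continuous: "continuous_on {1..b} U"
proof (rule lipschitz_on_continuous_on)
  show "(2 * \<bar>b\<bar>)-lipschitz_on {1..b} U"
  proof (rule lipschitz_on_leI)
    fix x y assume xy: "x \<in> {1..b}" "y \<in> {1..b}" "x \<le> y"
    have i: "set_integrable lborel {x<..y} (\<lambda>u. 2 * b)" unfolding set_integrable_def using xy
      by (intro integrable_real_indicator[THEN integrable_scaleR_left]) auto
    have "U y - U x = (LINT u:{x<..y}|lborel. 2 * u * H u)" by (rule trunc_moment_diff(1)[OF dominated_tail_H]) (use xy in auto)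
    also have "\<dots> \<le> (LINT u:{x<..y}|lborel. 2 * b)"
    proof (rule set_integral_mono[OF trunc_moment_diff(2)[OF dominated_tail_H] i])
      fix u assume u: "u \<in> {x<..y}"
      have "2 * u * H u \<le> 2 * b * 1" using u xy H_le[of u] H_nonneg[of u] by (intro mult_mono) auto
      thus "2 * u * H u \<le> 2 * b" by simp
    qed (use xy in auto)
    also have "\<dots> = 2 * b * (y - x)" using xy by (simp add: set_lebesgue_integral_def)
    finally have "U y - U x \<le> 2 * b * (y - x)" .
    moreover have "U x \<le> U y" using xy by (intro U_mono) auto
    ultimately show "dist (U x) (U y) \<le> 2 * \<bar>b\<bar> * dist x y" using xy by (simp add: dist_real_def abs_if)
  qed simp
qed

text \<open>The function \<open>f x = U x / x^2\<close> is continuous and tends to 0, so the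
  intermediate value theorem solves \<open>f x = 1 / n\<close> as soon as
  \<open>1 / n < f 1\<close>.\<close>

lemma norming_sequence:
  "\<exists>a. (\<forall>n. 1 \<le> a n) \<and> filterlim a at_top sequentially \<and> (\<forall>\<^sub>F n in sequentially. real n * U (a n) = (a n)\<^sup>2)"
proof -
  define f where "f x = U x / x\<^sup>2" for x
  \<comment> \<open>The value 1 is a placeholder for the finitely many n without a solution; the
    equation is only claimed eventually.\<close>
  define a where "a n = (if \<exists>x\<ge>1. f x = 1 / real n then SOME x. 1 \<le> x \<and> f x = 1 / real n else 1)" for n
  have a1: "1 \<le> a n" for n unfolding a_def by (auto intro: someI2_ex)
  have f1: "0 < f 1" unfolding f_def using U_bounds(3)[of 1] by simp
  have ex: "\<exists>x\<ge>1. f x = 1 / real n" if n: "1 / real n < f 1" "0 < n" for n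
  proof -
    have "\<forall>\<^sub>F x in at_top. f x < 1 / real n" using U_quadratic_ratio n unfolding f_def by (intro order_tendstoD(2)) auto
    then obtain b where b: "1 \<le> b" "f b < 1 / real n"
      using eventually_happens'[OF trivial_limit_at_top_linorder eventually_conj[OF _ eventually_ge_at_top[of 1]]] by blast
    have "continuous_on {1..b} f" unfolding f_def by (intro continuous_intros U_continuous) auto
    from IVT2'[of f b "1 / real n" 1] this b n show ?thesis by (auto intro: less_imp_le)
  qed
  have "\<forall>\<^sub>F n in sequentially. 1 / real n < f 1 \<and> 0 < n"
    using order_tendstoD(2)[OF lim_1_over_n f1] eventually_gt_at_top[of 0] by eventually_elim simp
  hence fa: "\<forall>\<^sub>F n in sequentially. f (a n) = 1 / real n \<and> 0 < n"
  proof eventually_elim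
    case (elim n)
    from someI_ex[of "\<lambda>x. 1 \<le> x \<and> f x = 1 / real n"] ex[of n] elim show ?case unfolding a_def by auto
  qed
  have "filterlim a at_top sequentially" unfolding filterlim_at_top
  proof
    fix K :: real
    define K' where "K' = max K 1"
    have K': "1 \<le> K'" "K \<le> K'" by (auto simp: K'_def)
    \<comment> \<open>On the interval from 1 to \<open>K'\<close> the function \<open>f\<close>
      stays above this constant, so \<open>f (a n) = 1 / n\<close> drives \<open>a n\<close> out of
      it.\<close>
    have c: "0 < U 1 / K'\<^sup>2" using U_bounds(3)[of 1] K' by (intro divide_pos_pos) auto
    show "\<forall>\<^sub>F n in sequentially. K \<le> a n" using fa order_tendstoD(2)[OF lim_1_over_n c]
    proof eventually_elim
      case (elim n)
      show ?case
      proof (rule ccontr)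
        assume "\<not> K \<le> a n"
        hence "a n \<le> K'" using K' by simp
        hence "U 1 / K'\<^sup>2 \<le> U (a n) / (a n)\<^sup>2" using a1[of n] U_bounds(3)[of "a n"]
          by (intro frac_le U_mono power_mono) auto
        thus False using elim by (simp add: f_def)
      qed
    qed
  qed
  moreover have "\<forall>\<^sub>F n in sequentially. real n * U (a n) = (a n)\<^sup>2" using fa
  proof eventually_elim
    case (elim n)
    have "(a n)\<^sup>2 \<noteq> 0" using a1[of n] by simp
    thus ?case using elim by (simp add: f_def field_simps)
  qed
  ultimately show ?thesis using a1 by blast
qed

end

section \<open>Nonnegative matrices\<close>

definition min_entry :: "real^'q^'q \<Rightarrow> real" where
  "min_entry A = Min (range (\<lambda>(i,j). A$i$j))"

definition min_col_sum :: "real^'q^'q \<Rightarrow> real" where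
  "min_col_sum A = Min (range (\<lambda>j. \<Sum>i\<in>UNIV. A$i$j))"

lemma min_entry_le: "min_entry A \<le> A$i$j"
  unfolding min_entry_def by (rule Min_le) auto

lemma min_col_sum_le: "min_col_sum A \<le> (\<Sum>i\<in>UNIV. A$i$j)"
  unfolding min_col_sum_def by (rule Min_le) auto

lemma min_row_sum_le: "min_row_sum A \<le> (\<Sum>j\<in>UNIV. A$i$j)"
proof -
  have "{(\<Sum>j\<in>UNIV. A$i$j) | i. True} = range (\<lambda>i. \<Sum>j\<in>UNIV. A$i$j)" by auto
  thus ?thesis unfolding min_row_sum_def by (intro Min_le) auto
qed

lemma min_entry_pos: "A \<in> matS_pos \<Longrightarrow> 0 < min_entry A"
  unfolding min_entry_def matS_pos_def by (subst Min_gr_iff) auto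

lemma matS_nonneg: "A \<in> matS \<Longrightarrow> 0 \<le> A$i$j"
  by (simp add: matS_def)

lemma matS_row_ex: "A \<in> matS \<Longrightarrow> \<exists>j. 0 < A$i$j" and matS_col_ex: "A \<in> matS \<Longrightarrow> \<exists>i. 0 < A$i$j"
  by (simp_all add: matS_def)

lemma min_entry_nonneg: "A \<in> matS \<Longrightarrow> 0 \<le> min_entry A"
  unfolding min_entry_def by (subst Min_ge_iff) (auto simp: matS_def)

lemma matS_row_pos:
  assumes A: "A \<in> matS" shows "0 < (\<Sum>j\<in>UNIV. A$i$j)"
proof -
  obtain j where "0 < A$i$j" using matS_row_ex[OF A] by blast
  thus ?thesis by (intro sum_pos2[of _ j]) (simp_all add: matS_nonneg[OF A])
qed

lemma matS_col_pos:
  assumes A: "A \<in> matS" shows "0 < (\<Sum>i\<in>UNIV. A$i$j)"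
proof -
  obtain i where "0 < A$i$j" using matS_col_ex[OF A] by blast
  thus ?thesis by (intro sum_pos2[of _ i]) (simp_all add: matS_nonneg[OF A])
qed

lemma min_row_sum_pos: "A \<in> matS \<Longrightarrow> 0 < min_row_sum A"
proof -
  assume "A \<in> matS"
  have "{(\<Sum>j\<in>UNIV. A$i$j) | i. True} = range (\<lambda>i. \<Sum>j\<in>UNIV. A$i$j)" by auto
  thus ?thesis unfolding min_row_sum_def using matS_row_pos[OF \<open>A \<in> matS\<close>]
    by (simp only:) (subst Min_gr_iff, simp_all)
qed

lemma min_col_sum_pos: "A \<in> matS \<Longrightarrow> 0 < min_col_sum A"
  unfolding min_col_sum_def by (subst Min_gr_iff) (simp_all add: matS_col_pos)

lemma entry_sum_pos: "A \<in> matS \<Longrightarrow> 0 < entry_sum A"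
  unfolding entry_sum_def by (rule sum_pos) (simp_all add: matS_row_pos)

lemma entry_sum_swap: "entry_sum A = (\<Sum>j\<in>UNIV. \<Sum>i\<in>UNIV. A$i$j)"
  unfolding entry_sum_def by (rule sum.swap)

lemma min_row_sum_le_entry_sum: "A \<in> matS \<Longrightarrow> min_row_sum A \<le> entry_sum A"
proof -
  assume A: "A \<in> matS"
  fix i
  have "min_row_sum A \<le> (\<Sum>j\<in>UNIV. A$undefined$j)" by (rule min_row_sum_le)
  also have "\<dots> \<le> entry_sum A" unfolding entry_sum_def
    by (rule member_le_sum) (auto intro!: sum_nonneg matS_nonneg[OF A])
  finally show ?thesis .
qed

lemma entry_le_entry_sum: "A \<in> matS \<Longrightarrow> A$i$j \<le> entry_sum A"
proof -
  assume A: "A \<in> matS"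
  have "A$i$j \<le> (\<Sum>j\<in>UNIV. A$i$j)" by (rule member_le_sum) (auto intro!: matS_nonneg[OF A])
  also have "\<dots> \<le> entry_sum A" unfolding entry_sum_def
    by (rule member_le_sum) (auto intro!: sum_nonneg matS_nonneg[OF A])
  finally show ?thesis .
qed

lemma matrix_mult_nth: "(A ** B)$i$j = (\<Sum>k\<in>UNIV. A$i$k * B$k$j)"
  by (simp add: matrix_matrix_mult_def)

lemma sum_UNIV_pos_iff:
  fixes f :: "'q::finite \<Rightarrow> real"
  assumes "\<And>k. 0 \<le> f k"
  shows "0 < (\<Sum>k\<in>UNIV. f k) \<longleftrightarrow> (\<exists>k. 0 < f k)"
proof
  assume "0 < (\<Sum>k\<in>UNIV. f k)"
  thus "\<exists>k. 0 < f k" using sum_nonpos[of UNIV f] by (meson not_less)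
next
  assume "\<exists>k. 0 < f k"
  then obtain k where "0 < f k" ..
  thus "0 < (\<Sum>k\<in>UNIV. f k)" using assms by (intro sum_pos2[of _ k]) auto
qed

lemma matS_mult: "A \<in> matS \<Longrightarrow> B \<in> matS \<Longrightarrow> A ** B \<in> matS"
proof -
  assume A: "A \<in> matS" and B: "B \<in> matS"
  have nn: "0 \<le> A$i$k * B$k$j" for i j k using A B by (simp add: matS_def)
  have p: "0 < (A ** B)$i$j" if "0 < A$i$k" "0 < B$k$j" for i j k
    unfolding matrix_mult_nth using that by (subst sum_UNIV_pos_iff[OF nn]) (auto intro!: exI[of _ k] mult_pos_pos)
  have "\<exists>j. 0 < (A ** B)$i$j" for i using matS_row_ex[OF A] matS_row_ex[OF B] p by meson
  moreover have "\<exists>i. 0 < (A ** B)$i$j" for j using matS_col_ex[OF A] matS_col_ex[OF B] p by meson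
  ultimately show ?thesis unfolding matS_def by (auto simp: matrix_mult_nth intro!: sum_nonneg nn)
qed

lemma matS_mat_1: "mat 1 \<in> matS"
  unfolding matS_def mat_def by auto

lemma matS_pos_subset: "matS_pos \<subseteq> matS"
  unfolding matS_def matS_pos_def by (auto intro: less_imp_le)

lemma matS_pos_mult_left: "A \<in> matS \<Longrightarrow> B \<in> matS_pos \<Longrightarrow> A ** B \<in> matS_pos"
proof -
  assume A: "A \<in> matS" and B: "B \<in> matS_pos"
  have nn: "0 \<le> A$i$k * B$k$j" for i j k using A B by (simp add: matS_def matS_pos_def less_imp_le)
  show ?thesis unfolding matS_pos_def matrix_mult_nth mem_Collect_eq
  proof (subst sum_UNIV_pos_iff[OF nn], intro allI)
    fix i j
    obtain k where "0 < A$i$k" using matS_row_ex[OF A] by blast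
    thus "\<exists>k. 0 < A$i$k * B$k$j" using B by (intro exI[of _ k] mult_pos_pos) (auto simp: matS_pos_def)
  qed
qed

lemma matS_pos_mult_right: "A \<in> matS_pos \<Longrightarrow> B \<in> matS \<Longrightarrow> A ** B \<in> matS_pos"
proof -
  assume A: "A \<in> matS_pos" and B: "B \<in> matS"
  have nn: "0 \<le> A$i$k * B$k$j" for i j k using A B by (simp add: matS_def matS_pos_def less_imp_le)
  show ?thesis unfolding matS_pos_def matrix_mult_nth mem_Collect_eq
  proof (subst sum_UNIV_pos_iff[OF nn], intro allI)
    fix i j
    obtain k where "0 < B$k$j" using matS_col_ex[OF B] by blast
    thus "\<exists>k. 0 < A$i$k * B$k$j" using A by (intro exI[of _ k] mult_pos_pos) (auto simp: matS_pos_def)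
  qed
qed

text \<open>Only the column sums of the left factor and the row sums of the right one enter. Hence
  the comparison of windows by column sums below, and the lower bounds through
  \<open>min_row_sum\<close> and \<open>min_col_sum\<close>.\<close>

lemma entry_sum_mult:
  "entry_sum (A ** B) = (\<Sum>k\<in>UNIV. (\<Sum>i\<in>UNIV. A$i$k) * (\<Sum>j\<in>UNIV. B$k$j))"
proof -
  have "entry_sum (A ** B) = (\<Sum>i\<in>UNIV. \<Sum>j\<in>UNIV. \<Sum>k\<in>UNIV. A$i$k * B$k$j)"
    by (simp add: entry_sum_def matrix_mult_nth)
  also have "\<dots> = (\<Sum>i\<in>UNIV. \<Sum>k\<in>UNIV. \<Sum>j\<in>UNIV. A$i$k * B$k$j)"
    by (intro sum.cong refl sum.swap)
  also have "\<dots> = (\<Sum>k\<in>UNIV. \<Sum>i\<in>UNIV. \<Sum>j\<in>UNIV. A$i$k * B$k$j)"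
    by (rule sum.swap)
  finally show ?thesis by (simp add: sum_product)
qed

lemma entry_sum_mult_le:
  assumes A: "A \<in> matS" and B: "B \<in> matS"
  shows "entry_sum (A ** B) \<le> entry_sum A * entry_sum B"
proof -
  have "entry_sum (A ** B) \<le> (\<Sum>k\<in>UNIV. (\<Sum>i\<in>UNIV. A$i$k) * entry_sum B)"
    unfolding entry_sum_mult
  proof (intro sum_mono mult_left_mono)
    fix k show "(\<Sum>j\<in>UNIV. B$k$j) \<le> entry_sum B" unfolding entry_sum_def
      by (rule member_le_sum) (auto intro!: sum_nonneg matS_nonneg[OF B])
  qed (auto intro!: sum_nonneg matS_nonneg[OF A])
  also have "\<dots> = entry_sum A * entry_sum B"
    by (simp add: entry_sum_swap[of A] sum_distrib_right)
  finally show ?thesis .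
qed

lemma entry_sum_mult_ge_row:
  assumes A: "A \<in> matS"
  shows "entry_sum A * min_row_sum B \<le> entry_sum (A ** B)"
  unfolding entry_sum_mult entry_sum_swap[of A] sum_distrib_right
  by (intro sum_mono mult_left_mono min_row_sum_le sum_nonneg matS_nonneg[OF A])

lemma entry_sum_mult_ge_col:
  assumes B: "B \<in> matS"
  shows "min_col_sum A * entry_sum B \<le> entry_sum (A ** B)"
  unfolding entry_sum_mult entry_sum_def[of B] sum_distrib_left
  by (intro sum_mono mult_right_mono min_col_sum_le sum_nonneg matS_nonneg[OF B])

text \<open>A positive right factor alone controls how uneven the column sums of a product are,
  whatever stands to its left.\<close>

lemma min_col_sum_mult_ge:
  assumes A: "A \<in> matS"
  shows "entry_sum A * min_entry B \<le> min_col_sum (A ** B)"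
  unfolding min_col_sum_def
proof (subst Min_ge_iff; (simp)?; safe)
  fix j
  have "(\<Sum>i\<in>UNIV. (A ** B)$i$j) = (\<Sum>k\<in>UNIV. (\<Sum>i\<in>UNIV. A$i$k) * B$k$j)"
    unfolding matrix_mult_nth sum_distrib_right by (rule sum.swap)
  also have "\<dots> \<ge> (\<Sum>k\<in>UNIV. (\<Sum>i\<in>UNIV. A$i$k) * min_entry B)"
    by (intro sum_mono mult_left_mono min_entry_le sum_nonneg matS_nonneg[OF A])
  finally show "entry_sum A * min_entry B \<le> (\<Sum>i\<in>UNIV. (A ** B)$i$j)"
    by (simp add: entry_sum_swap[of A] sum_distrib_right)
qed

text \<open>Each entry of the product sums all entries of the middle factor, with weights taken from
  a row of \<open>P\<close> and a column of \<open>R\<close>.\<close>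

lemma min_entry_triple_mult_ge:
  assumes P: "P \<in> matS" and Q: "Q \<in> matS" and R: "R \<in> matS"
  shows "min_entry P * entry_sum Q * min_entry R \<le> min_entry (P ** (Q ** R))"
  unfolding min_entry_def[of "P ** (Q ** R)"]
proof (subst Min_ge_iff; (simp)?; safe)
  fix i j
  have "min_entry P * entry_sum Q * min_entry R = (\<Sum>k\<in>UNIV. min_entry P * (\<Sum>l\<in>UNIV. Q$k$l * min_entry R))"
    by (simp add: entry_sum_def sum_distrib_left sum_distrib_right mult.assoc)
  also have "\<dots> \<le> (\<Sum>k\<in>UNIV. P$i$k * (\<Sum>l\<in>UNIV. Q$k$l * R$l$j))"
    by (intro sum_mono mult_mono min_entry_le mult_left_mono sum_nonneg mult_nonneg_nonneg
         matS_nonneg[OF P] matS_nonneg[OF Q] min_entry_nonneg[OF R])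
  finally show "min_entry P * entry_sum Q * min_entry R \<le> (P ** (Q ** R))$i$j"
    by (simp add: matrix_mult_nth)
qed

text \<open>Bounds the error made when replacing an entry, a scalar product or the spectral radius by the sum of the entries.\<close>
definition distortion :: "real^'q^'q \<Rightarrow> real" where
  "distortion A = ln (entry_sum A / min_entry A)"

lemma abs_ln_diff_le_distortion:
  assumes A: "A \<in> matS_pos" and "min_entry A \<le> r" "r \<le> entry_sum A"
  shows "\<bar>ln r - ln (entry_sum A)\<bar> \<le> distortion A"
proof -
  have m: "0 < min_entry A" by (rule min_entry_pos[OF A])
  hence "0 < r" "0 < entry_sum A" using assms by auto
  moreover have "ln (min_entry A) \<le> ln r" "ln r \<le> ln (entry_sum A)"
    using m assms \<open>0 < r\<close> by auto
  ultimately show ?thesis using m by (simp add: distortion_def ln_div)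
qed

text \<open>The entry sum of \<open>Q\<close> cancels between the upper bound on the entry sum and
  the lower bound on the least entry, so an arbitrarily long middle part costs nothing.\<close>

lemma distortion_triple_mult_le:
  assumes P: "P \<in> matS_pos" and Q: "Q \<in> matS" and R: "R \<in> matS_pos"
  shows "distortion (P ** (Q ** R)) \<le> distortion P + distortion R"
proof -
  note S = P[THEN subsetD[OF matS_pos_subset]] R[THEN subsetD[OF matS_pos_subset]]
  note [simp] = min_entry_pos[OF P] min_entry_pos[OF R] entry_sum_pos[OF Q] entry_sum_pos[OF S(1)] entry_sum_pos[OF S(2)]
  have pos: "P ** (Q ** R) \<in> matS_pos" by (intro matS_pos_mult_right P matS_mult Q S)
  have "entry_sum (P ** (Q ** R)) \<le> entry_sum P * entry_sum (Q ** R)"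
    by (intro entry_sum_mult_le S matS_mult Q)
  also have "\<dots> \<le> entry_sum P * (entry_sum Q * entry_sum R)"
    by (intro mult_left_mono entry_sum_mult_le S Q) (simp add: less_imp_le)
  finally have "entry_sum (P ** (Q ** R)) / min_entry (P ** (Q ** R))
      \<le> (entry_sum P * (entry_sum Q * entry_sum R)) / (min_entry P * entry_sum Q * min_entry R)"
    using min_entry_triple_mult_ge[OF S(1) Q S(2)]
    by (intro frac_le mult_pos_pos mult_nonneg_nonneg) (auto simp: less_imp_le)
  also have "\<dots> = (entry_sum P / min_entry P) * (entry_sum R / min_entry R)"
    using less_imp_neq[OF entry_sum_pos[OF Q]] by simp
  finally have "distortion (P ** (Q ** R)) \<le> ln ((entry_sum P / min_entry P) * (entry_sum R / min_entry R))"
    unfolding distortion_def using min_entry_pos[OF pos] entry_sum_pos[of "P ** (Q ** R)"] pos matS_pos_subset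
    by (subst ln_le_cancel_iff) auto
  also have "\<dots> = distortion P + distortion R" unfolding distortion_def by (rule ln_mult_pos) simp_all
  finally show ?thesis .
qed

text \<open>The products \<open>y$i * x$j\<close> are nonnegative weights of total mass 1, so the
  scalar product is an average of the entries.\<close>

lemma min_entry_le_inner:
  assumes A: "A \<in> matS" and x: "x \<in> Bbar" and y: "y \<in> Bbar"
  shows "min_entry A \<le> y \<bullet> (A *v x)" "y \<bullet> (A *v x) \<le> entry_sum A"
proof -
  have x0: "0 \<le> x$i" "0 \<le> y$i" for i using x y by (auto simp: Bbar_def)
  have x1: "(\<Sum>i\<in>UNIV. x$i) = 1" "(\<Sum>i\<in>UNIV. y$i) = 1" using x y by (auto simp: Bbar_def)
  have le1: "x$i \<le> 1" "y$i \<le> 1" for i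
    using member_le_sum[of i UNIV "\<lambda>i. x$i"] member_le_sum[of i UNIV "\<lambda>i. y$i"] x0 x1 by auto
  have eq: "y \<bullet> (A *v x) = (\<Sum>i\<in>UNIV. \<Sum>j\<in>UNIV. y$i * (A$i$j * x$j))"
    by (simp add: inner_vec_def matrix_vector_mult_def sum_distrib_left)
  have "min_entry A = (\<Sum>i\<in>UNIV. \<Sum>j\<in>UNIV. y$i * (min_entry A * x$j))"
    using x1 by (simp add: sum_distrib_left[symmetric] sum_distrib_right[symmetric])
  also have "\<dots> \<le> y \<bullet> (A *v x)" unfolding eq
    by (intro sum_mono mult_left_mono mult_right_mono min_entry_le x0)
  finally show "min_entry A \<le> y \<bullet> (A *v x)" .
  have "y \<bullet> (A *v x) \<le> (\<Sum>i\<in>UNIV. \<Sum>j\<in>UNIV. 1 * (A$i$j * 1))" unfolding eq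
    by (intro sum_mono mult_mono le1 x0 mult_nonneg_nonneg matS_nonneg[OF A]) auto
  thus "y \<bullet> (A *v x) \<le> entry_sum A" by (simp add: entry_sum_def)
qed

subsection \<open>The spectral radius\<close>

definition eigenvalue :: "real^'q^'q \<Rightarrow> complex \<Rightarrow> bool" where
  "eigenvalue A z \<longleftrightarrow> (\<exists>v :: complex^'q. v \<noteq> 0 \<and> (\<chi> i j. complex_of_real (A$i$j)) *v v = z *s v)"

lemma cmod_eigenvalue_le:
  fixes A :: "real^'q^'q"
  assumes "eigenvalue A z"
  shows "cmod z \<le> (\<Sum>i\<in>UNIV. \<Sum>j\<in>UNIV. \<bar>A$i$j\<bar>)"
proof -
  obtain v :: "complex^'q" where v: "v \<noteq> 0" and ev: "(\<chi> i j. complex_of_real (A$i$j)) *v v = z *s v"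
    using assms by (auto simp: eigenvalue_def)
  have s: "(\<Sum>j\<in>UNIV. cmod (v$j)) > 0"
    using v by (subst sum_UNIV_pos_iff) (auto simp: vec_eq_iff)
  have "cmod z * (\<Sum>i\<in>UNIV. cmod (v$i)) = (\<Sum>i\<in>UNIV. cmod ((z *s v)$i))"
    by (simp add: sum_distrib_left norm_mult)
  also have "\<dots> = (\<Sum>i\<in>UNIV. cmod (\<Sum>j\<in>UNIV. complex_of_real (A$i$j) * v$j))"
    unfolding ev[symmetric] by (simp add: matrix_vector_mult_def)
  also have "\<dots> \<le> (\<Sum>i\<in>UNIV. \<Sum>j\<in>UNIV. \<bar>A$i$j\<bar> * cmod (v$j))"
    by (intro sum_mono order_trans[OF norm_sum]) (simp add: norm_mult)
  also have "\<dots> \<le> (\<Sum>i\<in>UNIV. \<Sum>j\<in>UNIV. \<bar>A$i$j\<bar> * (\<Sum>k\<in>UNIV. cmod (v$k)))"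
    by (intro sum_mono mult_left_mono member_le_sum) auto
  also have "\<dots> = (\<Sum>i\<in>UNIV. \<Sum>j\<in>UNIV. \<bar>A$i$j\<bar>) * (\<Sum>k\<in>UNIV. cmod (v$k))"
    by (simp add: sum_distrib_right)
  finally show ?thesis using s by simp
qed

text \<open>Makes the \<open>Max\<close> in the spectral radius meaningful. Eigenvalues are the
  roots of a characteristic polynomial, which is nonzero because otherwise every complex number
  would be an eigenvalue, against the bound by the sum of absolute entries.\<close>

lemma finite_eigenvalues:
  fixes A :: "real^'q^'q"
  shows "finite {z. eigenvalue A z}"
proof -
  define C where "C = (\<chi> i j. complex_of_real (A$i$j))"
  define P :: "complex poly^'q^'q" where "P = (\<chi> i j. (if i = j then [:0, 1:] else 0) - [:C$i$j:])"
  have poly_det: "poly (det P) z = det (mat z - C)" for z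
    by (auto simp: det_def poly_sum poly_prod P_def mat_def sign_def intro!: sum.cong prod.cong)
  have root: "poly (det P) z = 0 \<longleftrightarrow> eigenvalue A z" for z
  proof -
    have "det (mat z - C) = 0 \<longleftrightarrow> (\<exists>v. v \<noteq> 0 \<and> (mat z - C) *v v = 0)"
      using matrix_left_invertible_ker[of "mat z - C"] invertible_det_nz[of "mat z - C"]
      unfolding invertible_left_inverse by auto
    moreover have "(mat z - C) *v v = 0 \<longleftrightarrow> C *v v = z *s v" for v
    proof -
      have "mat z *v v = z *s v"
        by (simp add: vec_eq_iff matrix_vector_mult_def mat_def if_distrib if_distribR cong: if_cong)
      hence "(mat z - C) *v v = z *s v - C *v v" by (simp only: matrix_vector_mult_diff_rdistrib)
      thus ?thesis by (metis right_minus_eq)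
    qed
    ultimately show ?thesis unfolding poly_det eigenvalue_def C_def[symmetric] by (simp only:)
  qed
  have "det P \<noteq> 0"
  proof
    assume "det P = 0"
    hence "eigenvalue A z" for z using root by simp
    from cmod_eigenvalue_le[OF this[of "of_real ((\<Sum>i\<in>UNIV. \<Sum>j\<in>UNIV. \<bar>A$i$j\<bar>) + 1)"]]
    show False by (simp add: sum_nonneg abs_of_nonneg add_nonneg_nonneg del: of_real_add)
  qed
  from poly_roots_finite[OF this] show ?thesis by (simp add: root)
qed

text \<open>Brouwer's theorem on the simplex \<open>Bbar\<close>, applied to \<open>A *v x\<close>
  divided by its coordinate sum \<open>s x\<close>. That sum is positive because every column of
  \<open>A\<close> has a positive entry.\<close>

lemma matS_eigenvector:
  assumes A: "(A :: real^'q^'q) \<in> matS"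
  shows "\<exists>x\<in>Bbar. \<exists>l. 0 \<le> l \<and> A *v x = l *\<^sub>R x"
proof -
  define s where "s x = (\<Sum>i\<in>UNIV. (A *v x)$i)" for x
  have nn: "0 \<le> (A *v x)$i" if "x \<in> Bbar" for x i
    using that by (auto simp: matrix_vector_mult_def Bbar_def intro!: sum_nonneg mult_nonneg_nonneg matS_nonneg[OF A])
  have s_pos: "0 < s x" if x: "x \<in> Bbar" for x
  proof -
    have eq: "s x = (\<Sum>j\<in>UNIV. (\<Sum>i\<in>UNIV. A$i$j) * x$j)"
      unfolding s_def matrix_vector_mult_def sum_distrib_right by (simp, rule sum.swap)
    have "(\<Sum>j\<in>UNIV. \<bar>x$j\<bar>) = 1" using x unfolding Bbar_def by blast
    hence "0 < (\<Sum>j\<in>UNIV. \<bar>x$j\<bar>)" by linarith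
    hence "\<exists>j. 0 < \<bar>x$j\<bar>" by (subst (asm) sum_UNIV_pos_iff) simp_all
    then obtain j where "0 < x$j" using x by (force simp: Bbar_def)
    hence "\<exists>j. 0 < (\<Sum>i\<in>UNIV. A$i$j) * x$j" using matS_col_pos[OF A] by (intro exI[of _ j] mult_pos_pos)
    moreover have "0 \<le> (\<Sum>i\<in>UNIV. A$i$j) * x$j" for j
      using x matS_col_pos[OF A, of j] by (simp add: Bbar_def)
    ultimately show ?thesis unfolding eq by (subst sum_UNIV_pos_iff)
  qed
  have Beq: "Bbar = {x::real^'q. (\<forall>i. 0 \<le> x$i) \<and> (\<Sum>i\<in>UNIV. x$i) = 1}"
    unfolding Bbar_def by (intro Collect_cong conj_cong refl arg_cong[of _ _ "\<lambda>s. s = 1"] sum.cong) (simp add: abs_of_nonneg)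
  have "convex (Bbar :: (real^'q) set)"
  proof (rule convexI)
    fix x y :: "real^'q" and u v :: real
    assume x: "x \<in> Bbar" and y: "y \<in> Bbar" and uv: "0 \<le> u" "0 \<le> v" "u + v = 1"
    have "(\<Sum>i\<in>UNIV. (u *\<^sub>R x + v *\<^sub>R y)$i) = u * (\<Sum>i\<in>UNIV. x$i) + v * (\<Sum>i\<in>UNIV. y$i)"
      by (simp add: sum.distrib sum_distrib_left)
    thus "u *\<^sub>R x + v *\<^sub>R y \<in> Bbar" using x y uv unfolding Beq by simp
  qed
  moreover have "compact (Bbar :: (real^'q) set)"
  proof (rule compact_eq_bounded_closed[THEN iffD2], safe)
    show "bounded (Bbar :: (real^'q) set)"
      unfolding bounded_iff
    proof (intro exI[of _ 1] ballI)
      fix x :: "real^'q" assume "x \<in> Bbar"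
      hence "(\<Sum>i\<in>UNIV. \<bar>x$i\<bar>) = 1" unfolding Bbar_def by blast
      thus "norm x \<le> 1" using norm_le_l1_cart[of x] by linarith
    qed
    show "closed (Bbar :: (real^'q) set)" unfolding Beq Collect_conj_eq Collect_all_eq
      by (intro closed_Int closed_INT ballI closed_Collect_le closed_Collect_eq continuous_intros)
  qed
  moreover have "Bbar \<noteq> ({} :: (real^'q) set)"
  proof -
    have "axis undefined 1 \<in> (Bbar :: (real^'q) set)" unfolding Beq by (auto simp: axis_def)
    thus ?thesis by auto
  qed
  moreover have "continuous_on Bbar (\<lambda>x. (1 / s x) *\<^sub>R (A *v x))"
    using s_pos unfolding s_def by (intro continuous_intros ballI) force
  moreover have "(\<lambda>x. (1 / s x) *\<^sub>R (A *v x)) \<in> Bbar \<rightarrow> Bbar"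
  proof
    fix x :: "real^'q" assume x: "x \<in> Bbar"
    have "(\<Sum>i\<in>UNIV. ((1 / s x) *\<^sub>R (A *v x))$i) = 1"
      using s_pos[OF x] by (simp add: s_def sum_divide_distrib[symmetric])
    thus "(1 / s x) *\<^sub>R (A *v x) \<in> Bbar" unfolding Beq using s_pos[OF x] nn[OF x] by auto
  qed
  ultimately obtain x where x: "x \<in> Bbar" "(1 / s x) *\<^sub>R (A *v x) = x"
    using brouwer[of Bbar "\<lambda>x. (1 / s x) *\<^sub>R (A *v x)"] by blast
  have "s x *\<^sub>R ((1 / s x) *\<^sub>R (A *v x)) = s x *\<^sub>R x" by (subst x(2)) (rule refl)
  hence "A *v x = s x *\<^sub>R x" using s_pos[OF x(1)] by simp
  thus ?thesis using x s_pos[OF x(1)] by (intro bexI[of _ x] exI[of _ "s x"]) auto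
qed

lemma eigenvalue_of_real:
  assumes "A *v x = l *\<^sub>R x" "x \<noteq> 0"
  shows "eigenvalue A (of_real l)"
  unfolding eigenvalue_def
proof (intro exI conjI)
  show "(\<chi> i. complex_of_real (x$i)) \<noteq> 0" using assms(2) by (auto simp: vec_eq_iff)
  have "(\<Sum>j\<in>UNIV. A$i$j * x$j) = l * x$i" for i using arg_cong[OF assms(1), of "\<lambda>v. v$i"]
    by (simp add: matrix_vector_mult_def)
  hence "complex_of_real (\<Sum>j\<in>UNIV. A$i$j * x$j) = of_real (l * x$i)" for i by simp
  thus "(\<chi> i j. complex_of_real (A$i$j)) *v (\<chi> i. complex_of_real (x$i)) = of_real l *s (\<chi> i. complex_of_real (x$i))"
    by (simp add: vec_eq_iff matrix_vector_mult_def)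
qed

lemma spectral_radius_eq: "spectral_radius A = Max (cmod ` {z. eigenvalue A z})"
  unfolding spectral_radius_def eigenvalue_def setcompr_eq_image by (rule refl)

text \<open>Evaluate the quadratic form at the eigenvector \<open>x\<close> in the simplex: it is at
  least the least entry, and equals \<open>l\<close> times the sum of the squares of
  \<open>x\<close>, which is at most 1.\<close>

lemma matS_eigenvalue_ge:
  assumes A: "A \<in> matS"
  shows "\<exists>z. eigenvalue A z \<and> min_entry A \<le> cmod z"
proof -
  obtain x l where x: "x \<in> Bbar" "0 \<le> l" "A *v x = l *\<^sub>R x" using matS_eigenvector[OF A] by blast
  have x0: "0 \<le> x$i" for i using x by (auto simp: Bbar_def)
  have x1: "(\<Sum>i\<in>UNIV. x$i) = 1" using x by (auto simp: Bbar_def)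
  have "x \<noteq> 0" using x1 by auto
  have "min_entry A \<le> x \<bullet> (A *v x)" using min_entry_le_inner[OF A x(1) x(1)] by simp
  also have "\<dots> = l * (\<Sum>i\<in>UNIV. x$i * x$i)" by (simp add: x(3) inner_vec_def sum_distrib_left mult.left_commute)
  also have "\<dots> \<le> l * (\<Sum>i\<in>UNIV. x$i * 1)"
  proof (intro mult_left_mono sum_mono x0 x)
    fix i show "x$i \<le> 1" using member_le_sum[of i UNIV "\<lambda>i. x$i"] x0 x1 by auto
  qed
  finally show ?thesis using eigenvalue_of_real[OF x(3) \<open>x \<noteq> 0\<close>] x x1 by (intro exI[of _ "of_real l"]) auto
qed

lemma spectral_radius_bounds:
  assumes A: "A \<in> matS"
  shows "min_entry A \<le> spectral_radius A" "spectral_radius A \<le> entry_sum A"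
proof -
  obtain z where z: "eigenvalue A z" "min_entry A \<le> cmod z" using matS_eigenvalue_ge[OF A] by blast
  have "cmod z \<le> spectral_radius A" unfolding spectral_radius_eq
    by (rule Max_ge) (use z finite_eigenvalues in auto)
  with z show "min_entry A \<le> spectral_radius A" by simp
  show "spectral_radius A \<le> entry_sum A" unfolding spectral_radius_eq
  proof (subst Max_le_iff)
    show "\<forall>a\<in>cmod ` {z. eigenvalue A z}. a \<le> entry_sum A"
      using cmod_eigenvalue_le[of A] matS_nonneg[OF A] by (auto simp: entry_sum_def)
  qed (use finite_eigenvalues z in auto)
qed

text \<open>Compactness: along a convergent sequence of matrices the eigenvalues stay bounded and
  the eigenvectors can be normalised, so a subsequence of the eigenpairs converges to an eigenpair.
  The set is a superlevel set of the spectral radius, which is how measurability is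
  obtained.\<close>

lemma closed_eigenvalue_ge: "closed {A :: real^'q^'q. \<exists>z. eigenvalue A z \<and> c \<le> cmod z}"
  unfolding closed_sequential_limits
proof (intro allI impI, elim conjE)
  fix f :: "nat \<Rightarrow> real^'q^'q" and A
  assume f: "\<forall>n. f n \<in> {A. \<exists>z. eigenvalue A z \<and> c \<le> cmod z}" and lim: "f \<longlonglongrightarrow> A"
  define z where "z n = (SOME z. eigenvalue (f n) z \<and> c \<le> cmod z)" for n
  have z: "eigenvalue (f n) (z n)" "c \<le> cmod (z n)" for n
  proof -
    have "\<exists>z. eigenvalue (f n) z \<and> c \<le> cmod z" using f by blast
    from someI_ex[OF this] show "eigenvalue (f n) (z n)" "c \<le> cmod (z n)" unfolding z_def by blast+
  qed
  have "\<exists>v. norm v = 1 \<and> (\<chi> i j. complex_of_real (f n$i$j)) *v v = z n *s v" for n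
  proof -
    obtain w :: "complex^'q" where w: "w \<noteq> 0" "(\<chi> i j. complex_of_real (f n$i$j)) *v w = z n *s w"
      using z(1)[of n] unfolding eigenvalue_def by blast
    define c where "c = complex_of_real (1 / norm w)"
    have "(\<chi> i j. complex_of_real (f n$i$j)) *v (c *s w) = z n *s (c *s w)"
      by (simp only: vector_scalar_commute w(2) vector_smult_assoc mult.commute)
    moreover have "norm (c *s w) = 1"
    proof -
      have "c *s w = (1 / norm w) *\<^sub>R w" unfolding c_def vec_eq_iff
        by (simp add: scaleR_conv_of_real[where 'a=complex])
      thus ?thesis using w(1) by simp
    qed
    ultimately show ?thesis by blast
  qed
  hence "\<forall>n. \<exists>v. norm v = 1 \<and> (\<chi> i j. complex_of_real (f n$i$j)) *v v = z n *s v" by blast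
  from choice[OF this] obtain v where v: "\<And>n. norm (v n) = 1"
      "\<And>n. (\<chi> i j. complex_of_real (f n$i$j)) *v v n = z n *s v n" by blast
  have "bounded (range (\<lambda>n. \<Sum>i\<in>UNIV. \<Sum>j\<in>UNIV. \<bar>f n$i$j\<bar>))"
    by (intro convergent_imp_bounded[of _ "\<Sum>i\<in>UNIV. \<Sum>j\<in>UNIV. \<bar>A$i$j\<bar>"] tendsto_intros lim)
  then obtain B where B: "\<And>n. norm (\<Sum>i\<in>UNIV. \<Sum>j\<in>UNIV. \<bar>f n$i$j\<bar>) \<le> B"
    unfolding bounded_iff by blast
  have zB: "z n \<in> cball 0 B" for n
  proof -
    have "cmod (z n) \<le> norm (\<Sum>i\<in>UNIV. \<Sum>j\<in>UNIV. \<bar>f n$i$j\<bar>)"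
      unfolding real_norm_def by (rule order_trans[OF cmod_eigenvalue_le[OF z(1)[of n]] abs_ge_self])
    thus ?thesis using B[of n] by (simp only: mem_cball_0)
  qed
  have comp: "compact (cball (0::complex) B \<times> sphere (0::complex^'q) 1)" by (intro compact_Times) auto
  have mem: "\<forall>n. (z n, v n) \<in> cball 0 B \<times> sphere 0 1" using zB v by auto
  obtain l r where l: "l \<in> cball 0 B \<times> sphere 0 1" and r: "strict_mono r"
      and lr: "((\<lambda>n. (z n, v n)) \<circ> r) \<longlonglongrightarrow> l"
    by (rule seq_compactE[OF compact_imp_seq_compact[OF comp] mem])
  obtain z' v' where [simp]: "l = (z', v')" by (cases l)
  from lr have lim2: "(\<lambda>n. (z (r n), v (r n))) \<longlonglongrightarrow> (z', v')" by (simp add: o_def)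
  have zl: "(\<lambda>n. z (r n)) \<longlonglongrightarrow> z'" and vl: "(\<lambda>n. v (r n)) \<longlonglongrightarrow> v'"
    using tendsto_fst[OF lim2] tendsto_snd[OF lim2] by auto
  have fl: "(\<lambda>n. f (r n)) \<longlonglongrightarrow> A" using LIMSEQ_subseq_LIMSEQ[OF lim r] by (simp add: o_def)
  have "(\<Sum>j\<in>UNIV. complex_of_real (A$i$j) * v'$j) = z' * v'$i" for i
  proof (rule LIMSEQ_unique)
    show "(\<lambda>n. (\<Sum>j\<in>UNIV. complex_of_real (f (r n)$i$j) * v (r n)$j)) \<longlonglongrightarrow> (\<Sum>j\<in>UNIV. complex_of_real (A$i$j) * v'$j)"
      by (intro tendsto_intros fl vl)
    have "(\<Sum>j\<in>UNIV. complex_of_real (f (r n)$i$j) * v (r n)$j) = z (r n) * v (r n)$i" for n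
      using arg_cong[OF v(2)[of "r n"], of "\<lambda>w. w$i"] by (simp add: matrix_vector_mult_def)
    moreover have "(\<lambda>n. z (r n) * v (r n)$i) \<longlonglongrightarrow> z' * v'$i"
      by (intro tendsto_intros zl vl)
    ultimately show "(\<lambda>n. (\<Sum>j\<in>UNIV. complex_of_real (f (r n)$i$j) * v (r n)$j)) \<longlonglongrightarrow> z' * v'$i" by simp
  qed
  hence "(\<chi> i j. complex_of_real (A$i$j)) *v v' = z' *s v'" by (simp add: vec_eq_iff matrix_vector_mult_def)
  moreover have "v' \<noteq> 0" using l by auto
  moreover have "c \<le> cmod z'" by (rule LIMSEQ_le_const[OF tendsto_norm[OF zl]]) (use z(2) in auto)
  ultimately show "A \<in> {A. \<exists>z. eigenvalue A z \<and> c \<le> cmod z}" unfolding eigenvalue_def by blast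
qed

lemma spectral_radius_measurable:
  assumes [measurable]: "f \<in> borel_measurable M" and f: "\<And>\<omega>. \<omega> \<in> space M \<Longrightarrow> f \<omega> \<in> matS"
  shows "(\<lambda>\<omega>. spectral_radius (f \<omega>)) \<in> borel_measurable M"
proof (rule borel_measurable_iff_ge[THEN iffD2], rule allI)
  fix c
  have *: "c \<le> spectral_radius A \<longleftrightarrow> (\<exists>z. eigenvalue A z \<and> c \<le> cmod z)" if "A \<in> matS" for A :: "real^'q^'q"
    unfolding spectral_radius_eq using finite_eigenvalues matS_eigenvalue_ge[OF that]
    by (subst Max_ge_iff) auto
  have "{\<omega> \<in> space M. c \<le> spectral_radius (f \<omega>)} = f -` {A. \<exists>z. eigenvalue A z \<and> c \<le> cmod z} \<inter> space M"
    using * f by auto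
  also have "\<dots> \<in> sets M" by (intro measurable_sets[OF assms(1)] borel_closed closed_eigenvalue_ge)
  finally show "{\<omega> \<in> space M. c \<le> spectral_radius (f \<omega>)} \<in> sets M" .
qed

section \<open>The defect of multiplicativity of the entry sum\<close>

text \<open>Scale-invariant closeness of the vectors of column sums: their coordinatewise ratios lie
  between \<open>lo\<close> and \<open>hi\<close> with \<open>hi / lo \<le> 1 + e\<close>, a form of
  the Hilbert projective distance.\<close>

definition col_close :: "real \<Rightarrow> real^'q^'q \<Rightarrow> real^'q^'q \<Rightarrow> bool" where
  "col_close e A B \<longleftrightarrow> (\<exists>lo hi. 0 < lo \<and> hi - lo \<le> e * lo \<and>
     (\<forall>j. lo * (\<Sum>i\<in>UNIV. B$i$j) \<le> (\<Sum>i\<in>UNIV. A$i$j) \<and> (\<Sum>i\<in>UNIV. A$i$j) \<le> hi * (\<Sum>i\<in>UNIV. B$i$j)))"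

text \<open>Quantitative positivity: with \<open>d > 0\<close> all entries are comparable to the
  entry sum, and \<open>1 - d\<close> is the contraction factor such a block provides.\<close>

definition balanced :: "real \<Rightarrow> real^'q^'q \<Rightarrow> bool" where
  "balanced d P \<longleftrightarrow> P \<in> matS \<and> d * entry_sum P \<le> min_entry P"

text \<open>The defect of the overview, for a current matrix \<open>A\<close> and a product
  \<open>P\<close> of later ones.\<close>

definition sum_defect :: "real^'q^'q \<Rightarrow> real^'q^'q \<Rightarrow> real" where
  "sum_defect P A = ln (entry_sum P * entry_sum A / entry_sum (P ** A))"

lemma mult_sum_le:
  fixes f g :: "'q::finite \<Rightarrow> real"
  assumes "\<And>j. c * f j \<le> g j" shows "c * (\<Sum>j\<in>UNIV. f j) \<le> (\<Sum>j\<in>UNIV. g j)"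
  using sum_mono[of UNIV "\<lambda>j. c * f j" g] assms by (simp add: sum_distrib_left)

lemma sum_le_mult:
  fixes f g :: "'q::finite \<Rightarrow> real"
  assumes "\<And>j. g j \<le> c * f j" shows "(\<Sum>j\<in>UNIV. g j) \<le> c * (\<Sum>j\<in>UNIV. f j)"
  using sum_mono[of UNIV g "\<lambda>j. c * f j"] assms by (simp add: sum_distrib_left)

lemma col_sum_mult: "(\<Sum>i\<in>UNIV. (A ** P)$i$j) = (\<Sum>k\<in>UNIV. (\<Sum>i\<in>UNIV. A$i$k) * P$k$j)"
  unfolding matrix_mult_nth sum_distrib_right by (rule sum.swap)

lemma col_close_mult:
  assumes "col_close e A B" and P: "P \<in> matS"
  shows "col_close e (A ** P) (B ** P)"
proof -
  obtain lo hi where *: "0 < lo" "hi - lo \<le> e * lo"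
    "\<And>j. lo * (\<Sum>i\<in>UNIV. B$i$j) \<le> (\<Sum>i\<in>UNIV. A$i$j)" "\<And>j. (\<Sum>i\<in>UNIV. A$i$j) \<le> hi * (\<Sum>i\<in>UNIV. B$i$j)"
    using assms(1) by (auto simp: col_close_def)
  have "lo * (\<Sum>i\<in>UNIV. (B ** P)$i$j) \<le> (\<Sum>i\<in>UNIV. (A ** P)$i$j)" for j
    unfolding col_sum_mult
    by (rule mult_sum_le, subst mult.assoc[symmetric], intro mult_right_mono *(3) matS_nonneg[OF P])
  moreover have "(\<Sum>i\<in>UNIV. (A ** P)$i$j) \<le> hi * (\<Sum>i\<in>UNIV. (B ** P)$i$j)" for j
    unfolding col_sum_mult
    by (rule sum_le_mult, subst mult.assoc[symmetric], intro mult_right_mono *(4) matS_nonneg[OF P])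
  ultimately show ?thesis unfolding col_close_def using * by blast
qed

lemma balanced_entry_bounds:
  assumes "balanced d P"
  shows "d * entry_sum P \<le> P$i$j" "P$i$j \<le> entry_sum P"
  using assms min_entry_le[of P i j] entry_le_entry_sum[of P i j] by (auto simp: balanced_def)

lemma balanced_col_bounds:
  assumes P: "balanced d P" and A: "A \<in> matS"
  shows "d * entry_sum P * entry_sum A \<le> (\<Sum>i\<in>UNIV. (A ** P)$i$j)"
    "(\<Sum>i\<in>UNIV. (A ** P)$i$j) \<le> entry_sum P * entry_sum A"
proof -
  have "(\<Sum>k\<in>UNIV. (\<Sum>i\<in>UNIV. A$i$k) * (d * entry_sum P)) \<le> (\<Sum>i\<in>UNIV. (A ** P)$i$j)"
    unfolding col_sum_mult
    by (intro sum_mono mult_left_mono balanced_entry_bounds[OF P] sum_nonneg matS_nonneg[OF A])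
  thus "d * entry_sum P * entry_sum A \<le> (\<Sum>i\<in>UNIV. (A ** P)$i$j)"
    by (simp add: entry_sum_swap[of A] sum_distrib_right sum_distrib_left mult.commute)
  have "(\<Sum>i\<in>UNIV. (A ** P)$i$j) \<le> (\<Sum>k\<in>UNIV. (\<Sum>i\<in>UNIV. A$i$k) * entry_sum P)"
    unfolding col_sum_mult
    by (intro sum_mono mult_left_mono balanced_entry_bounds[OF P] sum_nonneg matS_nonneg[OF A])
  thus "(\<Sum>i\<in>UNIV. (A ** P)$i$j) \<le> entry_sum P * entry_sum A"
    by (simp add: entry_sum_swap[of A] sum_distrib_right sum_distrib_left mult.commute)
qed

text \<open>The first balanced factor creates closeness out of nothing: every column sum of
  \<open>A ** P\<close> lies between \<open>d\<close> and 1 times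
  \<open>entry_sum P * entry_sum A\<close>, and likewise for \<open>B\<close>, which gives
  \<open>hi / lo = 1 / d^2\<close>.\<close>

lemma col_close_balanced_initial:
  assumes P: "balanced d P" and A: "A \<in> matS" and B: "B \<in> matS" and d: "0 < d"
  shows "col_close (1 / d\<^sup>2) (A ** P) (B ** P)"
  unfolding col_close_def
proof (intro exI conjI allI)
  note [simp] = entry_sum_pos[OF A] entry_sum_pos[OF B] entry_sum_pos[OF A, THEN less_imp_le] entry_sum_pos[OF B, THEN less_imp_le]
  have Ppos: "0 < entry_sum P" using P entry_sum_pos by (auto simp: balanced_def)
  show "0 < d * entry_sum A / entry_sum B" using d by simp
  show "entry_sum A / (d * entry_sum B) - d * entry_sum A / entry_sum B \<le> 1 / d\<^sup>2 * (d * entry_sum A / entry_sum B)"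
    using d entry_sum_pos[OF A] entry_sum_pos[OF B] by (simp add: field_simps power2_eq_square)
  fix j
  have "d * entry_sum A / entry_sum B * (\<Sum>i\<in>UNIV. (B ** P)$i$j) \<le> d * entry_sum A / entry_sum B * (entry_sum P * entry_sum B)"
    using d by (intro mult_left_mono balanced_col_bounds[OF P B]) (simp add: less_imp_le)
  also have "\<dots> = d * entry_sum P * entry_sum A" using less_imp_neq[OF entry_sum_pos[OF B]] by simp
  also have "\<dots> \<le> (\<Sum>i\<in>UNIV. (A ** P)$i$j)" by (rule balanced_col_bounds[OF P A])
  finally show "d * entry_sum A / entry_sum B * (\<Sum>i\<in>UNIV. (B ** P)$i$j) \<le> (\<Sum>i\<in>UNIV. (A ** P)$i$j)" .
  have "(\<Sum>i\<in>UNIV. (A ** P)$i$j) \<le> entry_sum P * entry_sum A" by (rule balanced_col_bounds[OF P A])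
  also have "\<dots> = entry_sum A / (d * entry_sum B) * (d * entry_sum P * entry_sum B)"
    using less_imp_neq[OF entry_sum_pos[OF B]] d by simp
  also have "\<dots> \<le> entry_sum A / (d * entry_sum B) * (\<Sum>i\<in>UNIV. (B ** P)$i$j)"
    using d by (intro mult_left_mono balanced_col_bounds[OF P B]) (simp add: less_imp_le)
  finally show "(\<Sum>i\<in>UNIV. (A ** P)$i$j) \<le> entry_sum A / (d * entry_sum B) * (\<Sum>i\<in>UNIV. (B ** P)$i$j)" .
qed

text \<open>The ratios of the column sums of \<open>A ** P\<close> and \<open>B ** P\<close> are averages of those of \<open>A\<close> and \<open>B\<close>,
  and each average gives weight at least \<open>d\<close> to the global ratio \<open>c\<close>.\<close>
lemma col_close_balanced:
  assumes AB: "col_close e A B" and P: "balanced d P" and A: "A \<in> matS" and B: "B \<in> matS"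
    and d: "0 < d" "d \<le> 1"
  shows "col_close ((1 - d) * e) (A ** P) (B ** P)"
proof -
  obtain lo hi where *: "0 < lo" "hi - lo \<le> e * lo"
    "\<And>j. lo * (\<Sum>i\<in>UNIV. B$i$j) \<le> (\<Sum>i\<in>UNIV. A$i$j)" "\<And>j. (\<Sum>i\<in>UNIV. A$i$j) \<le> hi * (\<Sum>i\<in>UNIV. B$i$j)"
    using AB by (auto simp: col_close_def)
  define c where "c = entry_sum A / entry_sum B"
  note Bp = entry_sum_pos[OF B]
  have PS: "P \<in> matS" and Pp: "0 < entry_sum P" using P entry_sum_pos by (auto simp: balanced_def)
  have cB: "c * entry_sum B = entry_sum A" using Bp by (simp add: c_def)
  have "lo * entry_sum B \<le> entry_sum A" unfolding entry_sum_swap by (intro mult_sum_le *)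
  hence lo_c: "lo \<le> c" using Bp by (simp add: c_def field_simps)
  have "entry_sum A \<le> hi * entry_sum B" unfolding entry_sum_swap by (intro sum_le_mult *)
  hence c_hi: "c \<le> hi" using Bp by (simp add: c_def field_simps)
  define a where "a k = (\<Sum>i\<in>UNIV. A$i$k)" for k
  define b where "b k = (\<Sum>i\<in>UNIV. B$i$k)" for k
  have sa: "(\<Sum>k\<in>UNIV. a k) = c * entry_sum B" "(\<Sum>k\<in>UNIV. b k) = entry_sum B"
    unfolding a_def b_def cB by (simp_all add: entry_sum_swap)
  have bP: "(\<Sum>k\<in>UNIV. b k * P$k$j) \<le> entry_sum P * entry_sum B" for j
    using balanced_col_bounds(2)[OF P B] by (simp add: col_sum_mult b_def)
  have low: "(d * c + (1 - d) * lo) * (\<Sum>k\<in>UNIV. b k * P$k$j) \<le> (\<Sum>k\<in>UNIV. a k * P$k$j)" for j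
  proof -
    \<comment> \<open>The vector \<open>a - lo * b\<close> is nonnegative, so replacing each entry
      of \<open>P\<close> by its lower bound \<open>d * entry_sum P\<close> is legitimate; this
      produces the weight \<open>d\<close> on \<open>c\<close>.\<close>
    have "d * (c - lo) * (\<Sum>k\<in>UNIV. b k * P$k$j) \<le> d * (c - lo) * (entry_sum P * entry_sum B)"
      using lo_c d by (intro mult_left_mono bP) auto
    also have "\<dots> = (\<Sum>k\<in>UNIV. (a k - lo * b k) * (d * entry_sum P))"
      by (simp add: sum_distrib_right[symmetric] sum_subtractf sum_distrib_left[symmetric] sa) (simp add: algebra_simps)
    also have "\<dots> \<le> (\<Sum>k\<in>UNIV. (a k - lo * b k) * P$k$j)"
      using *(3) by (intro sum_mono mult_left_mono balanced_entry_bounds[OF P]) (simp add: a_def b_def)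
    also have "\<dots> = (\<Sum>k\<in>UNIV. a k * P$k$j) - lo * (\<Sum>k\<in>UNIV. b k * P$k$j)"
      by (simp add: left_diff_distrib sum_subtractf sum_distrib_left mult.assoc)
    finally show ?thesis by (simp add: algebra_simps)
  qed
  have up: "(\<Sum>k\<in>UNIV. a k * P$k$j) \<le> (d * c + (1 - d) * hi) * (\<Sum>k\<in>UNIV. b k * P$k$j)" for j
  proof -
    have "d * (hi - c) * (\<Sum>k\<in>UNIV. b k * P$k$j) \<le> d * (hi - c) * (entry_sum P * entry_sum B)"
      using c_hi d by (intro mult_left_mono bP) auto
    also have "\<dots> = (\<Sum>k\<in>UNIV. (hi * b k - a k) * (d * entry_sum P))"
      by (simp add: sum_distrib_right[symmetric] sum_subtractf sum_distrib_left[symmetric] sa) (simp add: algebra_simps)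
    also have "\<dots> \<le> (\<Sum>k\<in>UNIV. (hi * b k - a k) * P$k$j)"
      using *(4) by (intro sum_mono mult_left_mono balanced_entry_bounds[OF P]) (simp add: a_def b_def)
    also have "\<dots> = hi * (\<Sum>k\<in>UNIV. b k * P$k$j) - (\<Sum>k\<in>UNIV. a k * P$k$j)"
      by (simp add: left_diff_distrib sum_subtractf sum_distrib_left mult.assoc)
    finally show ?thesis by (simp add: algebra_simps)
  qed
  show ?thesis unfolding col_close_def
  proof (intro exI conjI allI)
    have "d * lo \<le> d * c" using lo_c d by simp
    hence ge: "lo \<le> d * c + (1 - d) * lo" by (simp add: algebra_simps)
    thus "0 < d * c + (1 - d) * lo" using * by linarith
    have e0: "0 \<le> e" using * lo_c c_hi by (smt (verit) mult_nonneg_nonneg zero_le_mult_iff)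
    have "(d * c + (1 - d) * hi) - (d * c + (1 - d) * lo) = (1 - d) * (hi - lo)" by (simp add: algebra_simps)
    also have "\<dots> \<le> (1 - d) * (e * lo)" using * d by (intro mult_left_mono) auto
    also have "\<dots> \<le> (1 - d) * e * (d * c + (1 - d) * lo)"
      unfolding mult.assoc using d e0 ge by (intro mult_left_mono) auto
    finally show "(d * c + (1 - d) * hi) - (d * c + (1 - d) * lo) \<le> (1 - d) * e * (d * c + (1 - d) * lo)" .
  qed (use low up in \<open>auto simp: col_sum_mult a_def b_def\<close>)
qed

text \<open>The second bound depends on the current matrix \<open>A\<close> only, the third on the
  later product \<open>P\<close> only. In the random setting these are independent
  quantities.\<close>

lemma sum_defect_bounds:
  assumes P: "P \<in> matS" and A: "A \<in> matS"
  shows "0 \<le> sum_defect P A"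
    "sum_defect P A \<le> ln (entry_sum A / min_row_sum A)"
    "sum_defect P A \<le> ln (entry_sum P / min_col_sum P)"
proof -
  have PA: "P ** A \<in> matS" by (intro matS_mult P A)
  note [simp] = entry_sum_pos[OF P] entry_sum_pos[OF A] entry_sum_pos[OF PA] min_row_sum_pos[OF A] min_col_sum_pos[OF P]
  have "1 \<le> entry_sum P * entry_sum A / entry_sum (P ** A)"
    using entry_sum_mult_le[OF P A] by simp
  thus "0 \<le> sum_defect P A" unfolding sum_defect_def by (rule ln_ge_zero)
  have "entry_sum P * entry_sum A / entry_sum (P ** A) \<le> entry_sum P * entry_sum A / (entry_sum P * min_row_sum A)"
    using entry_sum_mult_ge_row[OF P, of A] by (intro divide_left_mono mult_pos_pos) (auto simp: less_imp_le)
  also have "\<dots> = entry_sum A / min_row_sum A" using less_imp_neq[OF entry_sum_pos[OF P]] by simp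
  finally show "sum_defect P A \<le> ln (entry_sum A / min_row_sum A)" unfolding sum_defect_def
    by (subst ln_le_cancel_iff) auto
  have "entry_sum P * entry_sum A / entry_sum (P ** A) \<le> entry_sum P * entry_sum A / (min_col_sum P * entry_sum A)"
    using entry_sum_mult_ge_col[OF A, of P] by (intro divide_left_mono mult_pos_pos) (auto simp: less_imp_le)
  also have "\<dots> = entry_sum P / min_col_sum P" using less_imp_neq[OF entry_sum_pos[OF A]] by simp
  finally show "sum_defect P A \<le> ln (entry_sum P / min_col_sum P)" unfolding sum_defect_def
    by (subst ln_le_cancel_iff) auto
qed

text \<open>The difference of the defects is \<open>ln (entry_sum A / entry_sum B)\<close> minus the
  same for \<open>A ** C\<close> and \<open>B ** C\<close>. Both logarithms lie between
  \<open>ln lo\<close> and \<open>ln hi\<close>, and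
  \<open>ln (hi / lo) \<le> hi / lo - 1 \<le> e\<close>.\<close>

lemma col_close_sum_defect:
  assumes AB: "col_close e A B" and A: "A \<in> matS" and B: "B \<in> matS" and C: "C \<in> matS"
  shows "\<bar>sum_defect A C - sum_defect B C\<bar> \<le> e"
proof -
  obtain lo hi where *: "0 < lo" "hi - lo \<le> e * lo"
    "\<And>j. lo * (\<Sum>i\<in>UNIV. B$i$j) \<le> (\<Sum>i\<in>UNIV. A$i$j)" "\<And>j. (\<Sum>i\<in>UNIV. A$i$j) \<le> hi * (\<Sum>i\<in>UNIV. B$i$j)"
    using AB by (auto simp: col_close_def)
  note p = entry_sum_pos[OF A] entry_sum_pos[OF B] entry_sum_pos[OF C]
    entry_sum_pos[OF matS_mult[OF A C]] entry_sum_pos[OF matS_mult[OF B C]]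
  have 1: "lo * entry_sum B \<le> entry_sum A" unfolding entry_sum_swap by (intro mult_sum_le *)
  have 2: "entry_sum A \<le> hi * entry_sum B" unfolding entry_sum_swap by (intro sum_le_mult *)
  have 3: "lo * entry_sum (B ** C) \<le> entry_sum (A ** C)"
    unfolding entry_sum_mult
    by (rule mult_sum_le, subst mult.assoc[symmetric], intro mult_right_mono * sum_nonneg matS_nonneg[OF C])
  have 4: "entry_sum (A ** C) \<le> hi * entry_sum (B ** C)"
    unfolding entry_sum_mult
    by (rule sum_le_mult, subst mult.assoc[symmetric], intro mult_right_mono * sum_nonneg matS_nonneg[OF C])
  have "lo * entry_sum B \<le> hi * entry_sum B" using 1 2 by linarith
  hence lohi: "lo \<le> hi" using p by simp
  have l: "ln lo \<le> ln (entry_sum A) - ln (entry_sum B)" "ln (entry_sum A) - ln (entry_sum B) \<le> ln hi"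
    "ln lo \<le> ln (entry_sum (A ** C)) - ln (entry_sum (B ** C))" "ln (entry_sum (A ** C)) - ln (entry_sum (B ** C)) \<le> ln hi"
    unfolding ln_divide_pos[OF p(1,2), symmetric] ln_divide_pos[OF p(4,5), symmetric]
    using 1 2 3 4 p * lohi by (simp_all add: field_simps)
  have "ln hi - ln lo = ln (hi / lo)" using * lohi by (simp add: ln_div)
  also have "\<dots> \<le> hi / lo - 1" using * lohi by (intro ln_le_minus_one) auto
  also have "\<dots> \<le> e" using * by (simp add: field_simps)
  finally have "ln hi - ln lo \<le> e" .
  moreover have "sum_defect A C - sum_defect B C = (ln (entry_sum A) - ln (entry_sum B)) - (ln (entry_sum (A ** C)) - ln (entry_sum (B ** C)))"
    unfolding sum_defect_def using p by (simp add: ln_div ln_mult_pos)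
  ultimately show ?thesis using l by linarith
qed

subsection \<open>Windows of the product\<close>

text \<open>\<open>Xprod\<close> starts at index 1, so this is the product of the factors
  \<open>k + r\<close> down to \<open>k + 1\<close>; the factor \<open>k\<close> is left
  out.\<close>

abbreviation window :: "(nat \<Rightarrow> 'a \<Rightarrow> real^'q^'q) \<Rightarrow> nat \<Rightarrow> nat \<Rightarrow> 'a \<Rightarrow> real^'q^'q" where
  "window X k r \<equiv> Xprod (\<lambda>i. X (k + i)) r"

lemma Xprod_add: "Xprod X (r + s) \<omega> = window X s r \<omega> ** Xprod X s \<omega>"
  by (induction r) (simp_all add: matrix_mul_assoc add.commute)

lemma window_add: "window X k (r + s) \<omega> = window X (k + s) r \<omega> ** window X k s \<omega>"
  using Xprod_add[of "\<lambda>i. X (k + i)" r s \<omega>] by (simp add: add.assoc)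

lemma Xprod_cong:
  assumes "\<And>i. 1 \<le> i \<Longrightarrow> i \<le> r \<Longrightarrow> X i \<omega> = Y i \<omega>'"
  shows "Xprod X r \<omega> = Xprod Y r \<omega>'"
  using assms by (induction r) auto

lemma Xprod_in_matS:
  assumes "\<And>i. 1 \<le> i \<Longrightarrow> i \<le> r \<Longrightarrow> X i \<omega> \<in> matS"
  shows "Xprod X r \<omega> \<in> matS"
  using assms by (induction r) (auto intro: matS_mult matS_mat_1)

text \<open>Appending \<open>X k\<close> on the right of the window after \<open>k\<close> gives the
  window after \<open>k - 1\<close>. The window after \<open>n\<close> is empty, hence the entry sum
  of the identity as a constant remainder.\<close>

lemma sum_sum_defect:
  assumes X: "\<And>i. 1 \<le> i \<Longrightarrow> X i \<omega> \<in> matS"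
  shows "(\<Sum>k=1..n. sum_defect (window X k (n - k) \<omega>) (X k \<omega>))
     = (\<Sum>k=1..n. ln (entry_sum (X k \<omega>))) + ln (entry_sum (mat 1 :: real^'q^'q)) - ln (entry_sum (Xprod X n \<omega> :: real^'q^'q))"
proof -
  have W: "window X k r \<omega> \<in> matS" for k r by (rule Xprod_in_matS) (simp add: X)
  define F where "F k = ln (entry_sum (window X k (n - k) \<omega>))" for k
  have "(\<Sum>k=1..n. sum_defect (window X k (n - k) \<omega>) (X k \<omega>)) = (\<Sum>k=1..n. ln (entry_sum (X k \<omega>)) + (F k - F (k - 1)))"
  proof (rule sum.cong[OF refl])
    fix k assume k: "k \<in> {1..n}"
    then obtain l where l: "k = Suc l" by (cases k) auto
    have "window X l (n - l) \<omega> = window X k (n - k) \<omega> ** X k \<omega>"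
    proof -
      have "n - l = (n - k) + 1" using k l by auto
      thus ?thesis using window_add[of X l "n - k" 1 \<omega>] l by (simp add: matrix_mul_rid)
    qed
    thus "sum_defect (window X k (n - k) \<omega>) (X k \<omega>) = ln (entry_sum (X k \<omega>)) + (F k - F (k - 1))"
      using k l entry_sum_pos[OF W[of k "n - k"]] entry_sum_pos[OF X[of k]] entry_sum_pos[OF W[of l "n - l"]]
      by (simp add: sum_defect_def F_def ln_div ln_mult_pos)
  qed
  also have "\<dots> = (\<Sum>k=1..n. ln (entry_sum (X k \<omega>))) + (F n - F 0)"
  proof -
    have "(\<Sum>k=1..n. F k - F (k - 1)) = F n - F 0" by (induction n) auto
    thus ?thesis by (simp add: sum.distrib)
  qed
  also have "F 0 = ln (entry_sum (Xprod X n \<omega>))" by (simp add: F_def)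
  also have "F n = ln (entry_sum (mat 1 :: real^'q^'q))" by (simp add: F_def)
  finally show ?thesis by simp
qed

text \<open>Column sums are transformed by the latest block first. The latest balanced block only
  sets the level \<open>1 / d^2\<close>, each earlier balanced one contributes \<open>1 - d\<close>.
  The product counts a factor \<open>1 - d\<close> for the latest one too, and the denominator gives
  it back.\<close>

lemma col_close_window:
  assumes X: "\<And>i. 1 \<le> i \<Longrightarrow> X i \<omega> \<in> matS" and A: "A \<in> matS" and B: "B \<in> matS" and d: "0 < d" "d < 1"
    and ex: "\<exists>i<b. balanced d (window X (k + i * l) l \<omega>)"
  shows "col_close ((\<Prod>i<b. if balanced d (window X (k + i * l) l \<omega>) then 1 - d else 1) / ((1 - d) * d\<^sup>2))
    (A ** window X k (b * l) \<omega>) (B ** window X k (b * l) \<omega>)"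
  using ex
proof (induction b arbitrary: k)
  case (Suc b)
  have W: "window X k r \<omega> \<in> matS" for k r by (rule Xprod_in_matS) (simp add: X)
  let ?w = "\<lambda>k b. \<Prod>i<b. if balanced d (window X (k + i * l) l \<omega>) then 1 - d else 1"
  have w: "?w k (Suc b) = (if balanced d (window X k l \<omega>) then 1 - d else 1) * ?w (k + l) b"
    unfolding prod.lessThan_Suc_shift by (simp add: add.assoc)
  have win: "window X k (Suc b * l) \<omega> = window X (k + l) (b * l) \<omega> ** window X k l \<omega>"
    using window_add[of X k "b * l" l \<omega>] by (simp add: add.commute)
  show ?case
  proof (cases "\<exists>i<b. balanced d (window X (k + l + i * l) l \<omega>)")
    case True
    note IH = Suc.IH[OF True]
    show ?thesis
    proof (cases "balanced d (window X k l \<omega>)")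
      case bal: True
      show ?thesis using col_close_balanced[OF IH bal matS_mult[OF A W] matS_mult[OF B W]] d bal
        by (simp only: w win matrix_mul_assoc if_True times_divide_eq_right)
    next
      case False
      show ?thesis using col_close_mult[OF IH W[of k l]] False
        by (simp only: w win matrix_mul_assoc if_False mult_1)
    qed
  next
    case False
    obtain i where i: "i < Suc b" "balanced d (window X (k + i * l) l \<omega>)" using Suc.prems by blast
    have bal: "balanced d (window X k l \<omega>)"
    proof (cases i)
      case (Suc i')
      hence "balanced d (window X (k + l + i' * l) l \<omega>)" using i(2) by (simp add: add.assoc)
      thus ?thesis using False i(1) Suc by blast
    qed (use i in simp)
    have "?w (k + l) b = 1" using False by (intro prod.neutral) auto
    hence "?w k (Suc b) / ((1 - d) * d\<^sup>2) = 1 / d\<^sup>2" unfolding w using bal d by simp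
    thus ?thesis using col_close_balanced_initial[OF bal matS_mult[OF A W] matS_mult[OF B W] d(1)]
      by (simp only: win matrix_mul_assoc)
  qed
qed simp

text \<open>Extending the window beyond position \<open>k + m\<close> changes the truncated defect by an amount that decays with
  the number of balanced blocks of length \<open>l\<close> inside the window.\<close>
lemma sum_defect_window_diff:
  assumes X: "\<And>i. 1 \<le> i \<Longrightarrow> X i \<omega> \<in> matS" and k: "1 \<le> k" and d: "0 < d" "d < 1"
    and bl: "b * l \<le> m" and mm: "m \<le> m'" and t: "0 \<le> t"
  shows "\<bar>min (sum_defect (window X k m' \<omega>) (X k \<omega>)) t - min (sum_defect (window X k m \<omega>) (X k \<omega>)) t\<bar>
    \<le> (\<Prod>i<b. if balanced d (window X (k + i * l) l \<omega>) then 1 - d else 1) / ((1 - d) * d\<^sup>2)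
       * (1 + min (ln (entry_sum (X k \<omega>) / min_row_sum (X k \<omega>))) t)"
    (is "_ \<le> ?w / _ * (1 + min ?R t)")
proof -
  have W: "window X k r \<omega> \<in> matS" for k r by (rule Xprod_in_matS) (simp add: X)
  note Xk = X[OF k]
  note bounds = sum_defect_bounds[OF W[of k m] Xk] sum_defect_bounds[OF W[of k m'] Xk]
  have R0: "0 \<le> ?R" using order_trans[OF bounds(1,2)] .
  \<comment> \<open>Covers the case without a balanced block: there the product is empty of
    contractions, and the trivial bound by the truncated log ratio suffices because the prefactor is
    at least 1.\<close>
  have K: "1 \<le> 1 / ((1 - d) * d\<^sup>2)"
  proof -
    have "(1 - d) * d\<^sup>2 \<le> 1 * 1" using d by (intro mult_mono power_le_one) auto
    thus ?thesis using d by (simp add: field_simps)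
  qed
  show ?thesis
  proof (cases "\<exists>i<b. balanced d (window X (k + i * l) l \<omega>)")
    case True
    have eq: "window X k r \<omega> = window X (k + b * l) (r - b * l) \<omega> ** window X k (b * l) \<omega>" if "m \<le> r" for r
      using window_add[of X k "r - b * l" "b * l" \<omega>] bl that by simp
    have w0: "0 \<le> ?w / ((1 - d) * d\<^sup>2)" using d by (intro divide_nonneg_nonneg prod_nonneg) auto
    have "\<bar>min a t - min b t\<bar> \<le> \<bar>a - b\<bar>" for a b by (auto simp: min_def)
    hence "\<bar>min (sum_defect (window X k m' \<omega>) (X k \<omega>)) t - min (sum_defect (window X k m \<omega>) (X k \<omega>)) t\<bar> \<le>
      \<bar>sum_defect (window X k m' \<omega>) (X k \<omega>) - sum_defect (window X k m \<omega>) (X k \<omega>)\<bar>" .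
    also have "\<dots> \<le> ?w / ((1 - d) * d\<^sup>2)"
      unfolding eq[OF mm] eq[OF order_refl]
      by (rule col_close_sum_defect[OF col_close_window[OF X W W d True] matS_mult[OF W W] matS_mult[OF W W] Xk])
    also have "\<dots> \<le> ?w / ((1 - d) * d\<^sup>2) * (1 + min ?R t)" using mult_left_mono[OF _ w0, of 1 "1 + min ?R t"] R0 t by simp
    finally show ?thesis .
  next
    case False
    hence "?w = 1" by (intro prod.neutral) auto
    have "\<bar>min (sum_defect (window X k m' \<omega>) (X k \<omega>)) t - min (sum_defect (window X k m \<omega>) (X k \<omega>)) t\<bar> \<le> 1 * (1 + min ?R t)"
    proof -
      have "\<bar>min y t - min x t\<bar> \<le> 1 * (1 + min r t)" if "0 \<le> x" "x \<le> r" "0 \<le> y" "y \<le> r" for x y r :: real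
        using that t by (auto simp: min_def)
      from this[OF bounds(1,2,4,5)] show ?thesis .
    qed
    also have "\<dots> \<le> 1 / ((1 - d) * d\<^sup>2) * (1 + min ?R t)" using K R0 t by (intro mult_right_mono) auto
    finally show ?thesis using \<open>?w = 1\<close> by simp
  qed
qed

section \<open>Products of independent matrices\<close>

lemma borel_measurable_matrix_mult [measurable (raw)]:
  fixes f g :: "'a \<Rightarrow> real^'q^'q"
  assumes "f \<in> borel_measurable M" "g \<in> borel_measurable M"
  shows "(\<lambda>x. f x ** g x) \<in> borel_measurable M"
  using assms
proof (rule borel_measurable_continuous_Pair)
  show "continuous_on UNIV (\<lambda>x :: (real^'q^'q) \<times> (real^'q^'q). fst x ** snd x)"
    unfolding matrix_matrix_mult_def by (intro continuous_intros)
qed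

lemma borel_measurable_entry [measurable (raw)]:
  fixes f :: "'a \<Rightarrow> real^'q^'q"
  assumes "f \<in> borel_measurable M"
  shows "(\<lambda>x. f x $ i $ j) \<in> borel_measurable M"
  by (rule measurable_compose[OF assms], intro borel_measurable_continuous_onI continuous_intros)

lemma borel_measurable_entry_sum [measurable (raw)]:
  assumes [measurable]: "f \<in> borel_measurable M" shows "(\<lambda>x. entry_sum (f x)) \<in> borel_measurable M"
  unfolding entry_sum_def by measurable

lemma borel_measurable_min_row_sum [measurable (raw)]:
  fixes f :: "'a \<Rightarrow> real^'q^'q"
  assumes [measurable]: "f \<in> borel_measurable M" shows "(\<lambda>x. min_row_sum (f x)) \<in> borel_measurable M"
proof -
  have "{(\<Sum>j\<in>UNIV. A$i$j) | i. True} = range (\<lambda>i. \<Sum>j\<in>UNIV. A$i$j)" for A :: "real^'q^'q" by auto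
  hence "min_row_sum A = Min (range (\<lambda>i. \<Sum>j\<in>UNIV. A$i$j))" for A :: "real^'q^'q"
    by (simp only: min_row_sum_def)
  thus ?thesis by simp
qed

lemma borel_measurable_min_col_sum [measurable (raw)]:
  fixes f :: "'a \<Rightarrow> real^'q^'q"
  assumes [measurable]: "f \<in> borel_measurable M" shows "(\<lambda>x. min_col_sum (f x)) \<in> borel_measurable M"
  unfolding min_col_sum_def by measurable

lemma borel_measurable_min_entry [measurable (raw)]:
  fixes f :: "'a \<Rightarrow> real^'q^'q"
  assumes [measurable]: "f \<in> borel_measurable M" shows "(\<lambda>x. min_entry (f x)) \<in> borel_measurable M"
  unfolding min_entry_def by (rule borel_measurable_Min) (auto simp: split_beta)

lemma borel_measurable_distortion [measurable (raw)]:
  assumes [measurable]: "f \<in> borel_measurable M" shows "(\<lambda>x. distortion (f x)) \<in> borel_measurable M"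
  unfolding distortion_def by measurable

lemma matS_pos_iff_min_entry: "A \<in> matS_pos \<longleftrightarrow> 0 < min_entry A"
  using min_entry_pos[of A] min_entry_le[of A] unfolding matS_pos_def by (fastforce intro: less_le_trans)

lemma measurable_Xprod:
  assumes "\<And>i. 1 \<le> i \<Longrightarrow> i \<le> r \<Longrightarrow> X i \<in> borel_measurable N"
  shows "Xprod X r \<in> borel_measurable N"
  using assms
proof (induction r)
  case 0
  have "Xprod X 0 = (\<lambda>_. mat 1)" by (rule ext) simp
  thus ?case by simp
next
  case (Suc r)
  have "X (Suc r) \<in> borel_measurable N" "Xprod X r \<in> borel_measurable N" using Suc by auto
  hence "(\<lambda>\<omega>. X (Suc r) \<omega> ** Xprod X r \<omega>) \<in> borel_measurable N" by (rule borel_measurable_matrix_mult)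
  thus ?case by (simp cong: measurable_cong)
qed

lemma (in prob_space) indep_vars_reindex_inj:
  assumes ind: "indep_vars N Y (f ` I)" and inj: "inj_on f I"
  shows "indep_vars (\<lambda>i. N (f i)) (\<lambda>i. Y (f i)) I"
  unfolding indep_vars_def2
proof (intro conjI ballI indep_setsI)
  show "random_variable (N (f i)) (Y (f i))" if "i \<in> I" for i
    using ind that unfolding indep_vars_def2 by blast
  show "{Y (f i) -` A \<inter> space M | A. A \<in> sets (N (f i))} \<subseteq> events" if "i \<in> I" for i
    using ind that unfolding indep_vars_def2 indep_sets_def by blast
  fix A J assume J: "J \<noteq> {}" "J \<subseteq> I" "finite J"
    and A: "\<forall>j\<in>J. A j \<in> {Y (f j) -` B \<inter> space M | B. B \<in> sets (N (f j))}"
  define g where "g = the_inv_into J f"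
  have injJ: "inj_on f J" using inj J by (meson inj_on_subset)
  have gf: "g (f j) = j" if "j \<in> J" for j unfolding g_def using that by (rule the_inv_into_f_f[OF injJ])
  have "indep_sets (\<lambda>i. {Y i -` A \<inter> space M | A. A \<in> sets (N i)}) (f ` I)"
    using ind unfolding indep_vars_def2 by blast
  from indep_setsD[OF this, of "f ` J" "\<lambda>i. A (g i)"]
  have "prob (\<Inter>i\<in>f ` J. A (g i)) = (\<Prod>i\<in>f ` J. prob (A (g i)))" using J A gf by (simp add: image_mono)
  thus "prob (\<Inter>j\<in>J. A j) = (\<Prod>j\<in>J. prob (A j))"
    using gf injJ by (simp add: prod.reindex)
qed

locale iid_matrices = prob_space M for M :: "'a measure" +
  fixes X :: "nat \<Rightarrow> 'a \<Rightarrow> real^'q^'q"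
  assumes meas: "\<And>n. 1 \<le> n \<Longrightarrow> X n \<in> borel_measurable M"
    and indep: "indep_vars (\<lambda>_. borel) X {1..}"
    and ident: "\<And>n. 1 \<le> n \<Longrightarrow> distr M borel (X n) = distr M borel (X 1)"
    and valS: "\<And>n \<omega>. 1 \<le> n \<Longrightarrow> \<omega> \<in> space M \<Longrightarrow> X n \<omega> \<in> matS"
begin

text \<open>The sigma-algebra generated by the factors with index in \<open>I\<close>. Which factors
  a quantity depends on is recorded as measurability for \<open>gen I\<close>, and disjoint index
  sets then give independence.\<close>

definition gen :: "nat set \<Rightarrow> 'a measure" where
  "gen I = vimage_algebra (space M) (\<lambda>\<omega>. \<lambda>i\<in>I. X i \<omega>) (PiM I (\<lambda>_. borel))"

lemma space_gen [simp]: "space (gen I) = space M"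
  by (simp add: gen_def)

lemma sets_gen: "sets (gen I) = {(\<lambda>\<omega>. \<lambda>i\<in>I. X i \<omega>) -` A \<inter> space M | A. A \<in> sets (PiM I (\<lambda>_. borel))}"
  unfolding gen_def by (rule sets_vimage_algebra2) (auto simp: space_PiM)

lemma measurable_gen_PiM: "J \<subseteq> I \<Longrightarrow> (\<lambda>\<omega>. \<lambda>i\<in>J. X i \<omega>) \<in> measurable (gen I) (PiM J (\<lambda>_. borel))"
proof (rule measurable_restrict)
  fix i assume "J \<subseteq> I" "i \<in> J"
  have "(\<lambda>\<omega>. \<lambda>i\<in>I. X i \<omega>) \<in> measurable (gen I) (PiM I (\<lambda>_. borel))"
    unfolding gen_def by (rule measurable_vimage_algebra1) (auto simp: space_PiM)
  from measurable_compose[OF this measurable_component_singleton[of i]]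
  show "X i \<in> borel_measurable (gen I)" using \<open>J \<subseteq> I\<close> \<open>i \<in> J\<close> by (auto simp: subset_iff)
qed

lemma measurable_gen_X: "i \<in> I \<Longrightarrow> X i \<in> borel_measurable (gen I)"
  using measurable_compose[OF measurable_gen_PiM[of "{i}" I] measurable_component_singleton[of i]] by auto

lemma measurable_gen_mono:
  assumes "f \<in> measurable (gen J) N" "J \<subseteq> I" shows "f \<in> measurable (gen I) N"
proof -
  have "(\<lambda>\<omega>. \<omega>) \<in> measurable (gen I) (gen J)"
    unfolding gen_def[of J]
    by (rule measurable_vimage_algebra2) (auto intro!: measurable_gen_PiM assms)
  from measurable_compose[OF this assms(1)] show ?thesis .
qed

lemma measurable_gen_M:
  assumes "f \<in> measurable (gen I) N" "I \<subseteq> {1..}" shows "f \<in> measurable M N"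
proof -
  have "(\<lambda>\<omega>. \<omega>) \<in> measurable M (gen I)"
    unfolding gen_def using assms(2) meas
    by (intro measurable_vimage_algebra2) (auto intro!: measurable_restrict)
  from measurable_compose[OF this assms(1)] show ?thesis .
qed

lemma indep_var_gen:
  assumes Y: "Y \<in> measurable (gen I) S" and Z: "Z \<in> measurable (gen J) T"
    and IJ: "I \<subseteq> {1..}" "J \<subseteq> {1..}" "I \<inter> J = {}"
  shows "indep_var S Y T Z"
proof -
  have ind: "indep_var (PiM I (\<lambda>_. borel)) (\<lambda>\<omega>. \<lambda>i\<in>I. X i \<omega>) (PiM J (\<lambda>_. borel)) (\<lambda>\<omega>. \<lambda>i\<in>J. X i \<omega>)"
    by (rule indep_var_restrict[OF indep]) (use IJ in auto)
  have "indep_set (sets (gen I)) (sets (gen J))"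
    using ind unfolding indep_var_eq sets_gen[symmetric]
    using sets.sigma_sets_eq[of "gen I"] sets.sigma_sets_eq[of "gen J"] by simp
  moreover have "sigma_sets (space M) {Y -` A \<inter> space M | A. A \<in> sets S} \<subseteq> sets (gen I)"
    using measurable_sets[OF Y] by (intro sets.sigma_sets_subset[of _ "gen I", simplified]) auto
  moreover have "sigma_sets (space M) {Z -` A \<inter> space M | A. A \<in> sets T} \<subseteq> sets (gen J)"
    using measurable_sets[OF Z] by (intro sets.sigma_sets_subset[of _ "gen J", simplified]) auto
  ultimately show ?thesis unfolding indep_var_eq indep_sets2_eq
    using measurable_gen_M[OF Y IJ(1)] measurable_gen_M[OF Z IJ(2)] by (meson subset_iff order_trans)
qed

lemma measurable_window: "window X k r \<in> borel_measurable (gen {k<..k + r})"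
  by (rule measurable_Xprod, rule measurable_gen_X) auto

lemma measurable_window_M [measurable]: "window X k r \<in> borel_measurable M"
  by (rule measurable_gen_M[OF measurable_window]) auto

lemma measurable_X_M [measurable]: "X (Suc k) \<in> borel_measurable M"
  by (rule meas) simp

lemma distr_X: "1 \<le> k \<Longrightarrow> 1 \<le> j \<Longrightarrow> distr M borel (X k) = distr M borel (X j)"
  using ident by metis

lemma prob_X_eq:
  assumes "1 \<le> k" "1 \<le> j" and P: "{A. P A} \<in> sets borel"
  shows "prob {\<omega> \<in> space M. P (X k \<omega>)} = prob {\<omega> \<in> space M. P (X j \<omega>)}"
proof -
  have "prob {\<omega> \<in> space M. P (X i \<omega>)} = measure (distr M borel (X i)) {A. P A}" if "1 \<le> i" for i
    using meas[OF that] P by (subst measure_distr) (auto intro!: arg_cong[of _ _ prob])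
  thus ?thesis using assms distr_X by metis
qed

lemma expectation_X_eq:
  fixes f :: "real^'q^'q \<Rightarrow> real"
  assumes "1 \<le> k" "1 \<le> j" and f: "f \<in> borel_measurable borel"
  shows "expectation (\<lambda>\<omega>. f (X k \<omega>)) = expectation (\<lambda>\<omega>. f (X j \<omega>))"
  using integral_distr[OF meas[OF assms(1)] f] integral_distr[OF meas[OF assms(2)] f] distr_X[OF assms(1,2)] by simp

text \<open>Stationarity: a window is one and the same function \<open>h\<close> of r consecutive
  factors, whose joint law is a power of the law of \<open>X 1\<close>. The empty window is treated
  apart because the product characterisation of independence is applied to a nonempty index
  set.\<close>

lemma distr_window: "distr M borel (window X k r) = distr M borel (Xprod X r)"
proof (cases "r = 0")
  case True
  have "Xprod Y 0 = (\<lambda>_. mat 1)" for Y :: "nat \<Rightarrow> 'a \<Rightarrow> real^'q^'q" by (rule ext) simp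
  thus ?thesis using True by simp
next
  case False
  define P where "P = PiM {..<r} (\<lambda>_. borel :: (real^'q^'q) measure)"
  define h :: "(nat \<Rightarrow> real^'q^'q) \<Rightarrow> real^'q^'q" where "h = Xprod (\<lambda>i f. f (i - 1)) r"
  define V where "V k = (\<lambda>\<omega>. \<lambda>i\<in>{..<r}. X (k + 1 + i) \<omega>)" for k
  have h: "h \<in> borel_measurable P" unfolding h_def P_def
    by (rule measurable_Xprod, rule measurable_component_singleton) auto
  have V: "V k \<in> measurable M P" for k unfolding V_def P_def
    by (intro measurable_restrict meas) auto
  have hV: "window X k r \<omega> = h (V k \<omega>)" for k \<omega>
    unfolding h_def by (rule Xprod_cong) (auto simp: V_def)
  have "distr M P (V k) = PiM {..<r} (\<lambda>_. distr M borel (X 1))" for k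
  proof -
    have "indep_vars (\<lambda>_. borel) (\<lambda>i. X (k + 1 + i)) {..<r}"
      by (rule indep_vars_reindex_inj[OF indep_vars_subset[OF indep]]) (auto simp: inj_on_def)
    hence "distr M P (V k) = PiM {..<r} (\<lambda>i. distr M borel (X (k + 1 + i)))"
      unfolding V_def P_def using False by (subst (asm) indep_vars_iff_distr_eq_PiM') (auto intro: meas)
    also have "\<dots> = PiM {..<r} (\<lambda>_. distr M borel (X 1))" by (intro PiM_cong refl ident) auto
    finally show ?thesis .
  qed
  hence eq: "distr (distr M P (V k)) borel h = distr (distr M P (V 0)) borel h" by simp
  have "window X 0 r = Xprod X r" by simp
  thus ?thesis using eq distr_distr[OF h V[of k]] distr_distr[OF h V[of 0]] hV[of k, symmetric] hV[of 0, symmetric]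
    by (simp add: o_def)
qed

lemma prob_window_eq:
  assumes P: "{A. P A} \<in> sets borel"
  shows "prob {\<omega> \<in> space M. P (window X k r \<omega>)} = prob {\<omega> \<in> space M. P (Xprod X r \<omega>)}"
proof -
  have "prob {\<omega> \<in> space M. P (window X i r \<omega>)} = measure (distr M borel (window X i r)) {A. P A}" for i
    using P by (subst measure_distr) (auto intro!: arg_cong[of _ _ prob])
  from this[of k] this[of 0] show ?thesis using distr_window[of k r] by simp
qed

lemma window_matS: "\<omega> \<in> space M \<Longrightarrow> window X k r \<omega> \<in> matS"
  by (rule Xprod_in_matS) (simp add: valS)

end

section \<open>Bounds for the defects and contraction by independent blocks\<close>

context iid_matrices
begin

text \<open>\<open>spread k\<close> and the \<open>imbalance k m\<close> below bound the same
  defect. The former involves only \<open>X k\<close> and has its tail controlled through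
  \<open>N\<close> and \<open>V\<close>; the latter involves only the factors after \<open>k\<close>
  and turns out to be tight uniformly in \<open>k\<close> and \<open>m\<close>.\<close>

definition spread :: "nat \<Rightarrow> 'a \<Rightarrow> real" where
  "spread k \<omega> = ln (entry_sum (X k \<omega>) / min_row_sum (X k \<omega>))"

definition imbalance :: "nat \<Rightarrow> nat \<Rightarrow> 'a \<Rightarrow> real" where
  "imbalance k m \<omega> = ln (entry_sum (window X k m \<omega>) / min_col_sum (window X k m \<omega>))"

definition defect :: "nat \<Rightarrow> nat \<Rightarrow> 'a \<Rightarrow> real" where
  "defect k m \<omega> = sum_defect (window X k m \<omega>) (X k \<omega>)"

lemma measurable_gen_spread: "spread k \<in> borel_measurable (gen {k})"
proof -
  have [measurable]: "X k \<in> borel_measurable (gen {k})" by (rule measurable_gen_X) simp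
  show ?thesis unfolding spread_def[abs_def] by measurable
qed

lemma measurable_gen_imbalance: "imbalance k m \<in> borel_measurable (gen {k<..k+m})"
proof -
  have [measurable]: "window X k m \<in> borel_measurable (gen {k<..k+m})" by (rule measurable_window)
  show ?thesis unfolding imbalance_def[abs_def] by measurable
qed

lemma measurable_gen_defect: "defect k m \<in> borel_measurable (gen {k..k+m})"
proof -
  have [measurable]: "window X k m \<in> borel_measurable (gen {k..k+m})"
    by (rule measurable_gen_mono[OF measurable_window]) auto
  have [measurable]: "X k \<in> borel_measurable (gen {k..k+m})" by (rule measurable_gen_X) simp
  show ?thesis unfolding defect_def[abs_def] sum_defect_def by measurable
qed

lemma measurable_spread [measurable]: "1 \<le> k \<Longrightarrow> spread k \<in> borel_measurable M"
  by (rule measurable_gen_M[OF measurable_gen_spread]) simp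

lemma measurable_imbalance [measurable]: "imbalance k m \<in> borel_measurable M"
  by (rule measurable_gen_M[OF measurable_gen_imbalance]) auto

lemma measurable_defect [measurable]: "1 \<le> k \<Longrightarrow> defect k m \<in> borel_measurable M"
  by (rule measurable_gen_M[OF measurable_gen_defect]) auto

lemma defect_bounds:
  assumes "1 \<le> k" "\<omega> \<in> space M"
  shows "0 \<le> defect k m \<omega>" "defect k m \<omega> \<le> spread k \<omega>" "defect k m \<omega> \<le> imbalance k m \<omega>"
  unfolding defect_def spread_def imbalance_def
  using sum_defect_bounds[OF window_matS[OF assms(2)] valS[OF assms]] by auto

lemma spread_nonneg: "1 \<le> k \<Longrightarrow> \<omega> \<in> space M \<Longrightarrow> 0 \<le> spread k \<omega>"
  using defect_bounds(1,2) order_trans by blast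

lemma prob_spread_eq: "1 \<le> k \<Longrightarrow> prob {\<omega> \<in> space M. t < spread k \<omega>} = prob {\<omega> \<in> space M. t < spread 1 \<omega>}"
  unfolding spread_def by (rule prob_X_eq) auto

lemma expectation_spread_eq:
  assumes "1 \<le> k" "f \<in> borel_measurable borel"
  shows "expectation (\<lambda>\<omega>. f (spread k \<omega>) :: real) = expectation (\<lambda>\<omega>. f (spread 1 \<omega>))"
  unfolding spread_def using assms(2)
  by (intro expectation_X_eq[where f="\<lambda>A. f (ln (entry_sum A / min_row_sum A))"] assms) auto

lemma tail_prob_tendsto_0:
  fixes f :: "'a \<Rightarrow> real"
  assumes [measurable]: "f \<in> borel_measurable M" and "e > 0"
  shows "\<exists>A\<ge>0. prob {\<omega> \<in> space M. A < f \<omega>} < e"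
proof -
  have "(\<lambda>n::nat. prob {\<omega> \<in> space M. real n < f \<omega>}) \<longlonglongrightarrow> prob (\<Inter>n::nat. {\<omega> \<in> space M. real n < f \<omega>})"
    by (rule finite_Lim_measure_decseq) (auto simp: decseq_def)
  also have "(\<Inter>n::nat. {\<omega> \<in> space M. real n < f \<omega>}) = {}"
    using real_arch_simple by (auto simp: not_less[symmetric])
  finally have "(\<lambda>n::nat. prob {\<omega> \<in> space M. real n < f \<omega>}) \<longlonglongrightarrow> 0" by simp
  from order_tendstoD(2)[OF this \<open>e > 0\<close>] obtain n :: nat where "prob {\<omega> \<in> space M. real n < f \<omega>} < e"
    by (auto simp: eventually_sequentially)
  thus ?thesis by (intro exI[of _ "real n"]) auto
qed

text \<open>Bounds the contraction factor accumulated over \<open>b\<close> consecutive blocks of length \<open>l\<close> after time \<open>k\<close>.\<close>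
definition block_weight :: "real \<Rightarrow> real \<Rightarrow> nat \<Rightarrow> nat \<Rightarrow> nat \<Rightarrow> 'a \<Rightarrow> real" where
  "block_weight r d l k b \<omega> = (\<Prod>i<b. if balanced d (window X (k + i * l) l \<omega>) then r else 1)"

lemma measurable_gen_block_weight: "block_weight r d l k b \<in> borel_measurable (gen {k<..k + b * l})"
proof -
  have "(\<lambda>\<omega>. if balanced d (window X (k + i * l) l \<omega>) then r else 1) \<in> borel_measurable (gen {k<..k + b * l})"
    if "i < b" for i
  proof -
    have "k + i * l + l \<le> k + b * l" using that by (metis add_le_cancel_left group_cancel.add1 mult_Suc mult_le_mono1 Suc_leI add.commute)
    hence [measurable]: "window X (k + i * l) l \<in> borel_measurable (gen {k<..k + b * l})"
      by (intro measurable_gen_mono[OF measurable_window]) auto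
    have "(\<lambda>\<omega>. if d * entry_sum (window X (k + i * l) l \<omega>) \<le> min_entry (window X (k + i * l) l \<omega>) then r else 1)
        \<in> borel_measurable (gen {k<..k + b * l})" by measurable
    thus ?thesis by (subst measurable_cong) (auto simp: balanced_def window_matS)
  qed
  thus ?thesis unfolding block_weight_def[abs_def] by (intro borel_measurable_prod) auto
qed

lemma measurable_block_weight [measurable]: "block_weight r d l k b \<in> borel_measurable M"
  by (rule measurable_gen_M[OF measurable_gen_block_weight]) auto

lemma block_weight_bounds: "0 \<le> r \<Longrightarrow> r \<le> 1 \<Longrightarrow> 0 \<le> block_weight r d l k b \<omega> \<and> block_weight r d l k b \<omega> \<le> 1"
  unfolding block_weight_def by (auto intro!: prod_nonneg prod_le_1)

lemma prob_balanced_eq: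
  "prob {\<omega> \<in> space M. balanced d (window X k l \<omega>)} = prob {\<omega> \<in> space M. balanced d (Xprod X l \<omega>)}"
proof -
  have "{\<omega> \<in> space M. balanced d (window X k l \<omega>)} = {\<omega> \<in> space M. d * entry_sum (window X k l \<omega>) \<le> min_entry (window X k l \<omega>)}" for k
    by (auto simp: balanced_def window_matS)
  from this[of k] this[of 0] show ?thesis
    using prob_window_eq[of "\<lambda>A. d * entry_sum A \<le> min_entry A" k l] by auto
qed

text \<open>Blocks use disjoint sets of factors and are identically distributed, so the expectation
  factorises; each block contributes \<open>r\<close> if balanced and 1 otherwise.\<close>

lemma expectation_block_weight:
  assumes r: "0 \<le> r" "r \<le> 1"
  shows "expectation (block_weight r d l k b) = (1 - (1 - r) * prob {\<omega> \<in> space M. balanced d (Xprod X l \<omega>)}) ^ b"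
proof (induction b arbitrary: k)
  case 0
  thus ?case by (simp add: block_weight_def[abs_def] prob_space)
next
  case (Suc b)
  have int: "integrable M (block_weight r d l k b)" for k b
    using block_weight_bounds[OF r] by (intro integrable_const_bound[where B=1]) auto
  have eq: "block_weight r d l k (Suc b) = (\<lambda>\<omega>. block_weight r d l k 1 \<omega> * block_weight r d l (k + l) b \<omega>)"
    unfolding block_weight_def[abs_def] prod.lessThan_Suc_shift by (simp add: add.assoc)
  have "indep_var borel (block_weight r d l k 1) borel (block_weight r d l (k + l) b)"
    by (rule indep_var_gen[OF measurable_gen_block_weight measurable_gen_block_weight]) auto
  hence "expectation (block_weight r d l k (Suc b)) = expectation (block_weight r d l k 1) * expectation (block_weight r d l (k + l) b)"
    unfolding eq by (rule indep_var_lebesgue_integral) (rule int)+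
  also have "expectation (block_weight r d l k 1) = 1 - (1 - r) * prob {\<omega> \<in> space M. balanced d (Xprod X l \<omega>)}"
  proof -
    let ?B = "{\<omega> \<in> space M. balanced d (window X k l \<omega>)}"
    have B: "?B \<in> events"
    proof -
      have "?B = {\<omega> \<in> space M. d * entry_sum (window X k l \<omega>) \<le> min_entry (window X k l \<omega>)}"
        by (auto simp: balanced_def window_matS)
      thus ?thesis by simp
    qed
    have "expectation (block_weight r d l k 1) = expectation (\<lambda>\<omega>. 1 - (1 - r) * indicator ?B \<omega>)"
      by (rule Bochner_Integration.integral_cong) (auto simp: block_weight_def)
    also have "\<dots> = 1 - (1 - r) * prob ?B"
      using B by (subst Bochner_Integration.integral_diff) (auto simp: prob_space intro!: integrable_mult_right integrable_const_bound[where B=1])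
    finally show ?thesis by (simp only: prob_balanced_eq)
  qed
  finally show ?case using Suc.IH by simp
qed

end

locale contracting_iid_matrices = iid_matrices +
  assumes contr: "0 < prob (\<Union>n\<in>{1..}. {\<omega> \<in> space M. Xprod X n \<omega> \<in> matS_pos})"
begin

lemma measurable_pos [measurable]: "{\<omega> \<in> space M. window X k n \<omega> \<in> matS_pos} \<in> events"
  unfolding matS_pos_iff_min_entry by measurable

lemma measurable_Xprod_M [measurable]: "Xprod X n \<in> borel_measurable M"
  using measurable_window_M[of 0 n] by simp

text \<open>The contraction condition gives a length \<open>l\<close> at which the product is
  positive with positive probability, and a positive matrix is balanced for some \<open>d\<close>
  from a countable family.\<close>

lemma ex_balanced_block:
  "\<exists>l d. 0 < d \<and> d < 1 \<and> 1 \<le> l \<and> 0 < prob {\<omega> \<in> space M. balanced d (Xprod X l \<omega>)}"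
proof (rule ccontr)
  assume no: "\<not> ?thesis"
  have "prob {\<omega> \<in> space M. Xprod X l \<omega> \<in> matS_pos} = 0" if l: "1 \<le> l" for l
  proof -
    \<comment> \<open>The shift by 2 keeps \<open>d = 1 / (j + 2)\<close> strictly below 1.\<close>
    define D where "D j = {\<omega> \<in> space M. balanced (1 / real (j + 2)) (Xprod X l \<omega>)}" for j
    have D_eq: "D j = {\<omega> \<in> space M. 1 / real (j + 2) * entry_sum (Xprod X l \<omega>) \<le> min_entry (Xprod X l \<omega>)}" for j
      using window_matS[of _ 0 l] by (auto simp: D_def balanced_def)
    have "\<not> 0 < prob (D j)" for j using no l unfolding D_def by fastforce
    hence 0: "prob (D j) = 0" for j using measure_nonneg[of M "D j"] by (meson not_less order_antisym)
    have D: "D j \<in> events" for j unfolding D_eq by measurable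
    have ae: "AE \<omega> in M. \<forall>j. \<omega> \<notin> D j"
      unfolding AE_all_countable using 0 D by (metis AE_iff_null_sets emeasure_eq_measure ennreal_0 null_setsI)
    have ex: "\<exists>j. \<omega> \<in> D j" if w: "\<omega> \<in> space M" "Xprod X l \<omega> \<in> matS_pos" for \<omega>
    proof -
      have p: "0 < min_entry (Xprod X l \<omega>)" by (rule min_entry_pos[OF w(2)])
      obtain j :: nat where "entry_sum (Xprod X l \<omega>) / min_entry (Xprod X l \<omega>) \<le> real j" using real_arch_simple by blast
      hence "entry_sum (Xprod X l \<omega>) \<le> real j * min_entry (Xprod X l \<omega>)" using p by (simp add: field_simps)
      also have "\<dots> \<le> real (j + 2) * min_entry (Xprod X l \<omega>)" using p by simp
      finally show ?thesis using w by (intro exI[of _ j]) (simp add: D_eq field_simps)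
    qed
    have "AE \<omega> in M. Xprod X l \<omega> \<notin> matS_pos" using ae AE_space by eventually_elim (use ex in blast)
    moreover have "{\<omega> \<in> space M. Xprod X l \<omega> \<in> matS_pos} \<in> events" using measurable_pos[of 0 l] by simp
    ultimately show ?thesis by (simp add: prob_eq_0)
  qed
  hence "prob (\<Union>n\<in>{1..}. {\<omega> \<in> space M. Xprod X n \<omega> \<in> matS_pos}) = 0"
    using measurable_pos[of 0] by (intro measure_eq_0_null_sets null_sets_UN') (auto intro!: null_setsI simp: emeasure_eq_measure)
  thus False using contr by simp
qed

text \<open>Among many independent blocks one is balanced with high probability, and one positive
  block makes the whole product positive. For a fixed length \<open>l\<close> the bound
  \<open>A\<close> exists because \<open>distortion\<close> is a finite random variable, and it does
  not depend on \<open>k\<close> by stationarity.\<close>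

lemma tight_distortion:
  assumes "0 < e"
  shows "\<exists>l A. \<forall>k. prob {\<omega> \<in> space M. \<not> (window X k l \<omega> \<in> matS_pos \<and> distortion (window X k l \<omega>) \<le> A)} < e"
proof -
  obtain l0 d where l0: "0 < d" "d < 1" "1 \<le> l0" and p: "0 < prob {\<omega> \<in> space M. balanced d (Xprod X l0 \<omega>)}"
    using ex_balanced_block by blast
  define p where "p = prob {\<omega> \<in> space M. balanced d (Xprod X l0 \<omega>)}"
  have p01: "0 < p" "p \<le> 1" using p by (auto simp: p_def)
  have "(\<lambda>b. (1 - p) ^ b) \<longlonglongrightarrow> 0" using p01 by (intro LIMSEQ_realpow_zero) auto
  from order_tendstoD(2)[OF this, of "e / 2"] assms obtain b where b: "(1 - p) ^ b < e / 2"
    by (auto simp: eventually_sequentially)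
  define l where "l = b * l0"
  let ?P = "{\<omega> \<in> space M. Xprod X l \<omega> \<notin> matS_pos}"
  have [measurable]: "?P \<in> events" unfolding matS_pos_iff_min_entry by measurable
  have sub: "Xprod X l \<omega> \<in> matS_pos" if w: "\<omega> \<in> space M" and z: "block_weight 0 d l0 0 b \<omega> = 0" for \<omega>
  proof -
    obtain i where i: "i < b" "balanced d (window X (i * l0) l0 \<omega>)"
      using z by (auto simp: block_weight_def split: if_splits)
    have "window X (i * l0) l0 \<omega> \<in> matS_pos"
      using i(2) l0 entry_sum_pos[OF window_matS[OF w, of "i * l0" l0]]
      unfolding balanced_def matS_pos_iff_min_entry by (auto intro: less_le_trans[rotated])
    moreover have "Xprod X l \<omega> = window X (i * l0 + l0) (l - (i * l0 + l0)) \<omega> ** (window X (i * l0) l0 \<omega> ** window X 0 (i * l0) \<omega>)"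
    proof -
      have "i * l0 + l0 \<le> l" using i(1) unfolding l_def by (metis Suc_leI add.commute mult_Suc mult_le_mono1)
      thus ?thesis using Xprod_add[of X "l - (i * l0 + l0)" "i * l0 + l0" \<omega>] window_add[of X 0 l0 "i * l0" \<omega>]
        by (simp add: add.commute)
    qed
    ultimately show ?thesis by (simp only: matS_pos_mult_left matS_pos_mult_right window_matS[OF w])
  qed
  have "prob ?P = expectation (indicator ?P)" by simp
  \<comment> \<open>With rate 0 the block weight is the indicator that no block is balanced.\<close>
  also have "\<dots> \<le> expectation (block_weight 0 d l0 0 b)"
  proof (rule integral_mono)
    fix \<omega> assume w: "\<omega> \<in> space M"
    have "block_weight 0 d l0 0 b \<omega> = 0 \<or> block_weight 0 d l0 0 b \<omega> = 1"
      unfolding block_weight_def by (induction b) auto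
    thus "indicator ?P \<omega> \<le> block_weight 0 d l0 0 b \<omega>" using sub[OF w] by (auto simp: indicator_def)
  qed (use block_weight_bounds[of 0] in \<open>auto intro!: integrable_const_bound[where B=1]\<close>)
  also have "\<dots> = (1 - p) ^ b" by (simp add: expectation_block_weight p_def)
  finally have P: "prob ?P < e / 2" using b by simp
  obtain A where A: "prob {\<omega> \<in> space M. A < distortion (Xprod X l \<omega>)} < e / 2"
    using tail_prob_tendsto_0[of "\<lambda>\<omega>. distortion (Xprod X l \<omega>)" "e/2"] assms by auto
  have "prob {\<omega> \<in> space M. \<not> (window X k l \<omega> \<in> matS_pos \<and> distortion (window X k l \<omega>) \<le> A)} < e" for k
  proof -
    have "prob {\<omega> \<in> space M. \<not> (window X k l \<omega> \<in> matS_pos \<and> distortion (window X k l \<omega>) \<le> A)}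
      = prob {\<omega> \<in> space M. \<not> (Xprod X l \<omega> \<in> matS_pos \<and> distortion (Xprod X l \<omega>) \<le> A)}"
      by (rule prob_window_eq) (simp add: matS_pos_iff_min_entry)
    also have "{\<omega> \<in> space M. \<not> (Xprod X l \<omega> \<in> matS_pos \<and> distortion (Xprod X l \<omega>) \<le> A)}
      = ?P \<union> {\<omega> \<in> space M. A < distortion (Xprod X l \<omega>)}" by auto
    also have "prob \<dots> \<le> prob ?P + prob {\<omega> \<in> space M. A < distortion (Xprod X l \<omega>)}"
      by (rule measure_Un_le) auto
    finally show ?thesis using P A by linarith
  qed
  thus ?thesis by blast
qed

text \<open>Uniformity in the length \<open>m\<close>: once \<open>m \<ge> l\<close>, the imbalance
  is at most the distortion of the first \<open>l\<close> factors of the window, since these stand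
  rightmost and their positivity evens out the column sums. For \<open>m < l\<close> only finitely
  many laws occur.\<close>

lemma tight_imbalance:
  assumes "0 < e"
  shows "\<exists>A\<ge>0. \<forall>k m. prob {\<omega> \<in> space M. A < imbalance k m \<omega>} < e"
proof -
  obtain l A0 where l: "\<And>k. prob {\<omega> \<in> space M. \<not> (window X k l \<omega> \<in> matS_pos \<and> distortion (window X k l \<omega>) \<le> A0)} < e"
    using tight_distortion[OF assms] by blast
  have "\<exists>A\<ge>0. prob {\<omega> \<in> space M. A < imbalance 0 m \<omega>} < e" for m
    by (rule tail_prob_tendsto_0) (use assms in auto)
  then obtain A1 where A1: "\<And>m. 0 \<le> A1 m" "\<And>m. prob {\<omega> \<in> space M. A1 m < imbalance 0 m \<omega>} < e" by metis
  define A where "A = max 0 (max A0 (\<Sum>m<l. A1 m))"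
  have "prob {\<omega> \<in> space M. A < imbalance k m \<omega>} < e" for k m
  proof (cases "m < l")
    case True
    have "A1 m \<le> (\<Sum>m<l. A1 m)" using True A1 by (intro member_le_sum) auto
    hence "A1 m \<le> A" unfolding A_def by linarith
    have "prob {\<omega> \<in> space M. A < imbalance k m \<omega>} \<le> prob {\<omega> \<in> space M. A1 m < imbalance k m \<omega>}"
      by (intro finite_measure_mono) (use \<open>A1 m \<le> A\<close> in auto)
    also have "\<dots> = prob {\<omega> \<in> space M. A1 m < imbalance 0 m \<omega>}"
      unfolding imbalance_def using prob_window_eq[of "\<lambda>B. A1 m < ln (entry_sum B / min_col_sum B)" k m]
      by simp
    finally show ?thesis using A1(2)[of m] by simp
  next
    case False
    have "prob {\<omega> \<in> space M. A < imbalance k m \<omega>}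
        \<le> prob {\<omega> \<in> space M. \<not> (window X k l \<omega> \<in> matS_pos \<and> distortion (window X k l \<omega>) \<le> A0)}"
    proof (intro finite_measure_mono subsetI, clarify)
      fix \<omega> assume w: "\<omega> \<in> space M" and gt: "A < imbalance k m \<omega>" and pos: "window X k l \<omega> \<in> matS_pos"
        and dist: "distortion (window X k l \<omega>) \<le> A0"
      let ?W = "window X k l \<omega>" and ?Q = "window X (k + l) (m - l) \<omega>"
      have eq: "window X k m \<omega> = ?Q ** ?W" using window_add[of X k "m - l" l \<omega>] False by simp
      note QW = window_matS[OF w, of "k + l" "m - l"] window_matS[OF w, of k l]
      have "entry_sum (?Q ** ?W) / min_col_sum (?Q ** ?W) \<le> (entry_sum ?Q * entry_sum ?W) / (entry_sum ?Q * min_entry ?W)"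
        using entry_sum_mult_le[OF QW] min_col_sum_mult_ge[OF QW(1), of ?W] min_entry_pos[OF pos]
          entry_sum_pos[OF QW(1)] entry_sum_pos[OF QW(2)]
        by (intro frac_le) auto
      also have "\<dots> = entry_sum ?W / min_entry ?W" using less_imp_neq[OF entry_sum_pos[OF QW(1)]] by simp
      finally have "imbalance k m \<omega> \<le> distortion ?W"
        unfolding imbalance_def eq distortion_def
        using min_entry_pos[OF pos] entry_sum_pos[OF QW(2)] min_col_sum_pos[OF matS_mult[OF QW]] entry_sum_pos[OF matS_mult[OF QW]]
        by (subst ln_le_cancel_iff) auto
      thus False using gt dist by (simp add: A_def)
    qed (auto simp: matS_pos_iff_min_entry)
    also have "\<dots> < e" by (rule l)
    finally show ?thesis .
  qed
  moreover have "0 \<le> A" by (simp add: A_def)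
  ultimately show ?thesis by blast
qed

end

section \<open>Concentration of the defects\<close>

text \<open>Comparison with a geometric series of ratio \<open>z powr (1 / l)\<close>, where one
  extra factor \<open>1 / z\<close> pays for the rounding in \<open>m div l\<close>.\<close>

lemma summable_power_div:
  fixes x :: real
  assumes x: "0 \<le> x" "x < 1" and l: "1 \<le> l"
  shows "summable (\<lambda>m. x ^ (m div l))"
proof -
  \<comment> \<open>Keeps the base positive when x = 0, so that the real power is
    meaningful.\<close>
  define z where "z = max x (1/2)"
  have z: "0 < z" "z < 1" "x \<le> z" using x by (auto simp: z_def)
  define y where "y = z powr (1 / real l)"
  have y: "0 < y" "y < 1" using z l powr_less_mono2[of "1 / real l" z 1] by (auto simp: y_def)
  have le: "x ^ (m div l) \<le> y ^ m / z" for m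
  proof -
    have "real m / real l \<le> real (m div l) + 1"
      by (metis add.commute floor_divide_of_nat_eq le_less of_int_of_nat_eq real_of_int_floor_add_one_gt)
    hence "z powr (real (m div l) + 1) \<le> z powr (real m / real l)" using z by (intro powr_mono') auto
    also have "\<dots> = y ^ m" using z by (simp add: y_def powr_powr flip: powr_realpow)
    finally have "z ^ (m div l) * z \<le> y ^ m" using z by (simp add: powr_add powr_realpow)
    moreover have "x ^ (m div l) * z \<le> z ^ (m div l) * z" using x z by (intro mult_right_mono power_mono) auto
    ultimately have "x ^ (m div l) * z \<le> y ^ m" by (rule order_trans[rotated])
    thus ?thesis using z by (simp add: pos_le_divide_eq)
  qed
  have "summable (\<lambda>m. y ^ m / z)" using y by (intro summable_divide summable_geometric) auto
  thus ?thesis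
  proof (rule summable_comparison_test')
    show "norm (x ^ (m div l)) \<le> y ^ m / z" for m using le[of m] x by simp
  qed
qed

text \<open>Cauchy-Schwarz, from the nonnegativity of the quadratic form \<open>(s, t)\<close> to
  the expectation of \<open>(s * f + t * g)^2\<close>.\<close>

lemma (in prob_space) expectation_mult_le_sqrt:
  fixes f g :: "'a \<Rightarrow> real"
  assumes f2: "integrable M (\<lambda>x. (f x)\<^sup>2)" and g2: "integrable M (\<lambda>x. (g x)\<^sup>2)" and fg: "integrable M (\<lambda>x. f x * g x)"
  shows "\<bar>expectation (\<lambda>x. f x * g x)\<bar> \<le> sqrt (expectation (\<lambda>x. (f x)\<^sup>2)) * sqrt (expectation (\<lambda>x. (g x)\<^sup>2))"
proof -
  define A where "A = expectation (\<lambda>x. (f x)\<^sup>2)"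
  define B where "B = expectation (\<lambda>x. (g x)\<^sup>2)"
  define C where "C = expectation (\<lambda>x. f x * g x)"
  have quad: "0 \<le> s\<^sup>2 * A + 2 * s * t * C + t\<^sup>2 * B" for s t
  proof -
    have "0 \<le> expectation (\<lambda>x. (s * f x + t * g x)\<^sup>2)" by simp
    also have "(\<lambda>x. (s * f x + t * g x)\<^sup>2) = (\<lambda>x. s\<^sup>2 * (f x)\<^sup>2 + 2 * s * t * (f x * g x) + t\<^sup>2 * (g x)\<^sup>2)"
      by (rule ext) (simp add: power2_eq_square algebra_simps)
    also have "expectation \<dots> = s\<^sup>2 * A + 2 * s * t * C + t\<^sup>2 * B"
      unfolding A_def B_def C_def using f2 g2 fg
      by (subst Bochner_Integration.integral_add) (auto intro!: Bochner_Integration.integrable_add integrable_mult_right)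
    finally show ?thesis .
  qed
  have A0: "0 \<le> A" and B0: "0 \<le> B" by (simp_all add: A_def B_def)
  have "C\<^sup>2 \<le> A * B"
  proof (cases "B = 0")
    case False
    have "0 \<le> B * (A * B - C\<^sup>2)" using quad[of B "- C"] by (simp add: power2_eq_square algebra_simps)
    thus ?thesis using False B0 by (simp add: zero_le_mult_iff)
  next
    case True
    \<comment> \<open>For B = 0 the form at \<open>s = C\<close>, \<open>t = - (1 + A)\<close>
      equals \<open>- (2 + A) * C^2\<close>, which forces C = 0.\<close>
    have "0 \<le> - (1 + A) * C\<^sup>2 - C\<^sup>2" using quad[of C "- (1 + A)"] True by (simp add: power2_eq_square algebra_simps)
    hence "(2 + A) * C\<^sup>2 \<le> 0" by (simp add: algebra_simps)
    moreover have "C\<^sup>2 \<le> (2 + A) * C\<^sup>2" using A0 by (simp add: algebra_simps)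
    ultimately have "C\<^sup>2 \<le> 0" by (rule order_trans[rotated])
    thus ?thesis using True by simp
  qed
  hence "sqrt (C\<^sup>2) \<le> sqrt (A * B)" by (rule real_sqrt_le_mono)
  thus ?thesis by (simp add: real_sqrt_mult A_def B_def C_def)
qed

context contracting_iid_matrices
begin

lemma integrable_sq_min:
  fixes f :: "'a \<Rightarrow> real"
  assumes "f \<in> borel_measurable M" "0 \<le> t" "\<And>\<omega>. \<omega> \<in> space M \<Longrightarrow> 0 \<le> f \<omega>"
  shows "integrable M (\<lambda>\<omega>. (min (f \<omega>) t)\<^sup>2)"
proof (rule integrable_const_bound[where B="t\<^sup>2"])
  show "AE \<omega> in M. norm ((min (f \<omega>) t)\<^sup>2) \<le> t\<^sup>2"
    using assms by (intro AE_I2) (auto intro!: power_mono)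
qed (use assms in measurable)

text \<open>The source of the small factor. Where \<open>imbalance k m \<le> A\<close> the defect is
  at most \<open>A\<close>; elsewhere it is at most \<open>spread k\<close>, which is independent of
  that event of probability below \<open>e\<close>. The constant \<open>A\<close> depends on
  \<open>e\<close>, but not on \<open>t\<close>, \<open>k\<close> or \<open>m\<close>.\<close>

lemma expectation_sq_min_defect_le:
  assumes "0 < e"
  shows "\<exists>A. \<forall>t\<ge>0. \<forall>k\<ge>1. \<forall>m. expectation (\<lambda>\<omega>. (min (defect k m \<omega>) t)\<^sup>2) \<le> A + e * expectation (\<lambda>\<omega>. (min (spread 1 \<omega>) t)\<^sup>2)"
proof -
  obtain A where A: "0 \<le> A" "\<And>k m. prob {\<omega> \<in> space M. A < imbalance k m \<omega>} < e"
    using tight_imbalance[OF assms] by blast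
  show ?thesis
  proof (intro exI[of _ "A\<^sup>2"] allI impI)
    fix t :: real and k m :: nat
    assume t: "0 \<le> t" and k: "1 \<le> k"
    let ?S = "{\<omega> \<in> space M. A < imbalance k m \<omega>}"
    note [measurable] = measurable_spread[OF k] measurable_defect[OF k]
    have int: "integrable M (\<lambda>\<omega>. (min (spread k \<omega>) t)\<^sup>2)" using t spread_nonneg[OF k] by (intro integrable_sq_min) auto
    have intS: "integrable M (indicator ?S :: _ \<Rightarrow> real)" by (intro integrable_const_bound[where B=1]) auto
    have ind: "indep_var borel (\<lambda>\<omega>. (min (spread k \<omega>) t)\<^sup>2) borel (indicator ?S :: _ \<Rightarrow> real)"
    proof (rule indep_var_gen)
      note [measurable] = measurable_gen_spread[of k] measurable_gen_imbalance[of k m]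
      show "(\<lambda>\<omega>. (min (spread k \<omega>) t)\<^sup>2) \<in> borel_measurable (gen {k})" by measurable
      have "{\<omega> \<in> space (gen {k<..k+m}). A < imbalance k m \<omega>} \<in> sets (gen {k<..k+m})" by measurable
      hence "?S \<in> sets (gen {k<..k+m})" by simp
      thus "indicator ?S \<in> borel_measurable (gen {k<..k+m})" by measurable
    qed (use k in auto)
    have intp: "integrable M (\<lambda>\<omega>. (min (spread k \<omega>) t)\<^sup>2 * indicator ?S \<omega>)"
      by (rule indep_var_integrable[OF ind int intS])
    have "expectation (\<lambda>\<omega>. (min (defect k m \<omega>) t)\<^sup>2) \<le> expectation (\<lambda>\<omega>. A\<^sup>2 + (min (spread k \<omega>) t)\<^sup>2 * indicator ?S \<omega>)"
    proof (rule integral_mono)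
      show "integrable M (\<lambda>\<omega>. (min (defect k m \<omega>) t)\<^sup>2)" using t defect_bounds(1)[OF k] by (intro integrable_sq_min) auto
      show "integrable M (\<lambda>\<omega>. A\<^sup>2 + (min (spread k \<omega>) t)\<^sup>2 * indicator ?S \<omega>)" by (intro Bochner_Integration.integrable_add intp) auto
      fix \<omega> assume w: "\<omega> \<in> space M"
      note b = defect_bounds[OF k w, of m]
      show "(min (defect k m \<omega>) t)\<^sup>2 \<le> A\<^sup>2 + (min (spread k \<omega>) t)\<^sup>2 * indicator ?S \<omega>"
      proof (cases "\<omega> \<in> ?S")
        case True
        have "(min (defect k m \<omega>) t)\<^sup>2 \<le> (min (spread k \<omega>) t)\<^sup>2" using b t by (intro power_mono) auto
        thus ?thesis using True by (simp add: add_increasing)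
      next
        case False
        hence "min (defect k m \<omega>) t \<le> A" using b w by auto
        hence "(min (defect k m \<omega>) t)\<^sup>2 \<le> A\<^sup>2" using b t by (intro power_mono) auto
        thus ?thesis using False by simp
      qed
    qed
    also have "\<dots> = A\<^sup>2 + expectation (\<lambda>\<omega>. (min (spread k \<omega>) t)\<^sup>2) * prob ?S"
      using intp indep_var_lebesgue_integral[OF ind int intS] by (simp add: prob_space)
    also have "\<dots> \<le> A\<^sup>2 + e * expectation (\<lambda>\<omega>. (min (spread k \<omega>) t)\<^sup>2)"
      using A(2)[of k m] by (simp add: mult.commute[of _ "prob ?S"] mult_right_mono)
    also have "expectation (\<lambda>\<omega>. (min (spread k \<omega>) t)\<^sup>2) = expectation (\<lambda>\<omega>. (min (spread 1 \<omega>) t)\<^sup>2)"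
      by (rule expectation_spread_eq[OF k, where f="\<lambda>s. (min s t)\<^sup>2"]) simp
    finally show "expectation (\<lambda>\<omega>. (min (defect k m \<omega>) t)\<^sup>2) \<le> A\<^sup>2 + e * expectation (\<lambda>\<omega>. (min (spread 1 \<omega>) t)\<^sup>2)" .
  qed
qed

text \<open>The pointwise bound on the effect of lengthening the window is a block weight times a
  function of \<open>X k\<close>. These are independent, so the mean square factorises and decays
  geometrically in the number of blocks. The sequence \<open>c\<close> is the same for all
  truncation levels \<open>t\<close>.\<close>

lemma defect_memory_decay:
  "\<exists>c. summable c \<and> (\<forall>m. 0 \<le> c m) \<and> (\<forall>t\<ge>0. \<forall>k\<ge>1. \<forall>m m'. m \<le> m' \<longrightarrow>
     expectation (\<lambda>\<omega>. (min (defect k m' \<omega>) t - min (defect k m \<omega>) t)\<^sup>2)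
       \<le> (c m)\<^sup>2 * expectation (\<lambda>\<omega>. (1 + min (spread 1 \<omega>) t)\<^sup>2))"
proof -
  obtain l d where d: "0 < d" "d < 1" and l: "1 \<le> l" and p: "0 < prob {\<omega> \<in> space M. balanced d (Xprod X l \<omega>)}"
    using ex_balanced_block by blast
  define p where "p = prob {\<omega> \<in> space M. balanced d (Xprod X l \<omega>)}"
  \<comment> \<open>The contraction factor squared, because the mean square is taken;
    \<open>c\<close> then involves \<open>sqrt th\<close>.\<close>
  define r where "r = (1 - d)\<^sup>2"
  define th where "th = 1 - (1 - r) * p"
  define K where "K = 1 / ((1 - d) * d\<^sup>2)"
  have r: "0 \<le> r" "r < 1" using d by (auto simp: r_def power_less_one_iff abs_square_less_1)
  have pp: "0 < p" "p \<le> 1" using p by (auto simp: p_def)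
  have "0 < (1 - r) * p" "(1 - r) * p \<le> 1 * 1" using r pp by (auto intro!: mult_le_one)
  hence th: "0 \<le> th" "th < 1" by (auto simp: th_def)
  define c where "c m = K * sqrt th ^ (m div l)" for m
  have "summable c" unfolding c_def using th l by (intro summable_mult summable_power_div) auto
  moreover have "0 \<le> c m" for m unfolding c_def K_def using d th by auto
  moreover have "expectation (\<lambda>\<omega>. (min (defect k m' \<omega>) t - min (defect k m \<omega>) t)\<^sup>2)
       \<le> (c m)\<^sup>2 * expectation (\<lambda>\<omega>. (1 + min (spread 1 \<omega>) t)\<^sup>2)"
    if t: "0 \<le> t" and k: "1 \<le> k" and m: "m \<le> m'" for t k m m'
  proof -
    note [measurable] = measurable_spread[OF k] measurable_defect[OF k]
    let ?w = "block_weight r d l k (m div l)"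
    let ?s = "\<lambda>\<omega>. (1 + min (spread k \<omega>) t)\<^sup>2"
    have int_s: "integrable M ?s"
      using spread_nonneg[OF k] t by (intro integrable_const_bound[where B="(1 + t)\<^sup>2"]) (auto intro!: AE_I2 power_mono)
    have int_w: "integrable M ?w" using block_weight_bounds[of r] r
      by (intro integrable_const_bound[where B=1]) auto
    have ind: "indep_var borel ?s borel ?w"
    proof (rule indep_var_gen)
      note [measurable] = measurable_gen_spread[of k]
      show "?s \<in> borel_measurable (gen {k})" by measurable
      show "?w \<in> borel_measurable (gen {k<..k + m div l * l})" by (rule measurable_gen_block_weight)
    qed (use k in auto)
    have "expectation (\<lambda>\<omega>. (min (defect k m' \<omega>) t - min (defect k m \<omega>) t)\<^sup>2) \<le> expectation (\<lambda>\<omega>. K\<^sup>2 * (?s \<omega> * ?w \<omega>))"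
    proof (rule integral_mono)
      show "integrable M (\<lambda>\<omega>. K\<^sup>2 * (?s \<omega> * ?w \<omega>))" by (intro integrable_mult_right indep_var_integrable[OF ind int_s int_w])
      show "integrable M (\<lambda>\<omega>. (min (defect k m' \<omega>) t - min (defect k m \<omega>) t)\<^sup>2)"
      proof (rule integrable_const_bound[where B="t\<^sup>2"])
        show "AE \<omega> in M. norm ((min (defect k m' \<omega>) t - min (defect k m \<omega>) t)\<^sup>2) \<le> t\<^sup>2"
        proof (rule AE_I2)
          fix \<omega> assume "\<omega> \<in> space M"
          hence "\<bar>min (defect k m' \<omega>) t - min (defect k m \<omega>) t\<bar> \<le> \<bar>t\<bar>"
            using defect_bounds(1)[OF k, of \<omega> m] defect_bounds(1)[OF k, of \<omega> m'] t by (auto simp: min_def abs_if)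
          thus "norm ((min (defect k m' \<omega>) t - min (defect k m \<omega>) t)\<^sup>2) \<le> t\<^sup>2" by (simp add: abs_le_square_iff)
        qed
      qed measurable
      fix \<omega> assume w: "\<omega> \<in> space M"
      have s0: "0 \<le> 1 + min (spread k \<omega>) t" using spread_nonneg[OF k w] t by simp
      have w1: "0 \<le> block_weight (1 - d) d l k (m div l) \<omega>" using block_weight_bounds[of "1 - d"] d by simp
      have sq: "(block_weight (1 - d) d l k (m div l) \<omega>)\<^sup>2 = ?w \<omega>"
        unfolding block_weight_def r_def prod_power_distrib by (intro prod.cong) auto
      have "\<bar>min (defect k m' \<omega>) t - min (defect k m \<omega>) t\<bar> \<le> block_weight (1 - d) d l k (m div l) \<omega> / ((1 - d) * d\<^sup>2) * (1 + min (spread k \<omega>) t)"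
        unfolding defect_def block_weight_def spread_def
        by (rule sum_defect_window_diff) (use valS w k d m t in auto)
      also have "\<dots> = \<bar>K * block_weight (1 - d) d l k (m div l) \<omega> * (1 + min (spread k \<omega>) t)\<bar>"
        using s0 w1 d by (simp add: K_def abs_mult)
      finally have "(min (defect k m' \<omega>) t - min (defect k m \<omega>) t)\<^sup>2 \<le> (K * block_weight (1 - d) d l k (m div l) \<omega> * (1 + min (spread k \<omega>) t))\<^sup>2"
        by (simp only: abs_le_square_iff)
      thus "(min (defect k m' \<omega>) t - min (defect k m \<omega>) t)\<^sup>2 \<le> K\<^sup>2 * (?s \<omega> * ?w \<omega>)"
        by (simp add: power_mult_distrib sq mult.commute mult.left_commute)
    qed
    also have "\<dots> = K\<^sup>2 * (expectation ?s * expectation ?w)"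
      using indep_var_lebesgue_integral[OF ind int_s int_w] by simp
    also have "expectation ?w = th ^ (m div l)" using r by (simp add: expectation_block_weight th_def p_def)
    also have "expectation ?s = expectation (\<lambda>\<omega>. (1 + min (spread 1 \<omega>) t)\<^sup>2)"
      by (rule expectation_spread_eq[OF k, where f="\<lambda>s. (1 + min s t)\<^sup>2"]) simp
    also have "K\<^sup>2 * (expectation (\<lambda>\<omega>. (1 + min (spread 1 \<omega>) t)\<^sup>2) * th ^ (m div l)) = (c m)\<^sup>2 * expectation (\<lambda>\<omega>. (1 + min (spread 1 \<omega>) t)\<^sup>2)"
      using th by (simp add: c_def power_mult_distrib power_mult[symmetric] mult.commute[of _ 2] power_mult)
    finally show ?thesis .
  qed
  ultimately show ?thesis by blast
qed

text \<open>Each gap occurs at most once on either side of \<open>j\<close>, hence twice the full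
  series.\<close>

lemma sum_gap_le_suminf:
  fixes c :: "nat \<Rightarrow> real"
  assumes c: "summable c" "\<And>m. 0 \<le> c m"
  shows "(\<Sum>k\<in>{1..n} - {j}. c ((if j < k then k - j else j - k) - 1)) \<le> 2 * suminf c"
proof -
  have 1: "(\<Sum>k\<in>{k\<in>{1..n}. j < k}. c (k - j - 1)) \<le> suminf c"
  proof -
    have "(\<Sum>k\<in>{k\<in>{1..n}. j < k}. c (k - j - 1)) = sum c ((\<lambda>k. k - j - 1) ` {k\<in>{1..n}. j < k})"
      by (subst sum.reindex) (auto simp: inj_on_def)
    also have "\<dots> \<le> suminf c" by (rule sum_le_suminf) (use c in auto)
    finally show ?thesis .
  qed
  have 2: "(\<Sum>k\<in>{k\<in>{1..n}. k < j}. c (j - k - 1)) \<le> suminf c"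
  proof -
    have "(\<Sum>k\<in>{k\<in>{1..n}. k < j}. c (j - k - 1)) = sum c ((\<lambda>k. j - k - 1) ` {k\<in>{1..n}. k < j})"
      by (subst sum.reindex) (auto simp: inj_on_def)
    also have "\<dots> \<le> suminf c" by (rule sum_le_suminf) (use c in auto)
    finally show ?thesis .
  qed
  have sp: "{1..n} - {j} = {k\<in>{1..n}. j < k} \<union> {k\<in>{1..n}. k < j}" by auto
  have "(\<Sum>k\<in>{1..n} - {j}. c ((if j < k then k - j else j - k) - 1))
     = (\<Sum>k\<in>{k\<in>{1..n}. j < k}. c ((if j < k then k - j else j - k) - 1)) + (\<Sum>k\<in>{k\<in>{1..n}. k < j}. c ((if j < k then k - j else j - k) - 1))"
    unfolding sp by (rule sum.union_disjoint) auto
  also have "\<dots> = (\<Sum>k\<in>{k\<in>{1..n}. j < k}. c (k - j - 1)) + (\<Sum>k\<in>{k\<in>{1..n}. k < j}. c (j - k - 1))"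
    by (intro arg_cong2[of _ _ _ _ "(+)"] sum.cong) auto
  finally show ?thesis using 1 2 by linarith
qed

text \<open>For \<open>j < k\<close> the defect at \<open>j\<close> is replaced by the one that only looks up to time \<open>k - 1\<close>,
  which is independent of the defect at \<open>k\<close>.\<close>
lemma variance_sum_min_defect:
  "\<exists>T\<ge>0. \<forall>t\<ge>0. \<forall>h n. (\<forall>k\<ge>1. \<forall>m. expectation (\<lambda>\<omega>. (min (defect k m \<omega>) t)\<^sup>2) \<le> h) \<longrightarrow>
     variance (\<lambda>\<omega>. \<Sum>k=1..n. min (defect k (n - k) \<omega>) t)
       \<le> real n * (h + T * sqrt (h * expectation (\<lambda>\<omega>. (1 + min (spread 1 \<omega>) t)\<^sup>2)))"
proof -
  obtain c where c0: "summable c \<and> (\<forall>m. 0 \<le> c m) \<and> (\<forall>t\<ge>0. \<forall>k\<ge>1. \<forall>m m'. m \<le> m' \<longrightarrow>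
     expectation (\<lambda>\<omega>. (min (defect k m' \<omega>) t - min (defect k m \<omega>) t)\<^sup>2)
       \<le> (c m)\<^sup>2 * expectation (\<lambda>\<omega>. (1 + min (spread 1 \<omega>) t)\<^sup>2))"
    using defect_memory_decay ..
  have c: "summable c" "0 \<le> c m" for m using c0 by simp_all
  have dec: "expectation (\<lambda>\<omega>. (min (defect k m' \<omega>) t - min (defect k m \<omega>) t)\<^sup>2)
       \<le> (c m)\<^sup>2 * expectation (\<lambda>\<omega>. (1 + min (spread 1 \<omega>) t)\<^sup>2)"
    if "0 \<le> t" "1 \<le> k" "m \<le> m'" for t k m m' using c0 that by simp
  have T0: "0 \<le> suminf c" using c by (intro suminf_nonneg)
  show ?thesis
  \<comment> \<open>One factor 2 comes from the two terms of each covariance bound, another from the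
    two sides of \<open>j\<close>.\<close>
  proof (intro exI[of _ "4 * suminf c"] conjI allI impI)
    fix t h :: real and n :: nat
    assume t: "0 \<le> t" and h: "\<forall>k\<ge>1. \<forall>m. expectation (\<lambda>\<omega>. (min (defect k m \<omega>) t)\<^sup>2) \<le> h"
    define Q where "Q = expectation (\<lambda>\<omega>. (1 + min (spread 1 \<omega>) t)\<^sup>2)"
    define V where "V k m \<omega> = min (defect k m \<omega>) t" for k m \<omega>
    have V_meas [measurable]: "V k m \<in> borel_measurable M" if "1 \<le> k" for k m
    proof -
      note [measurable] = measurable_defect[OF that]
      show ?thesis unfolding V_def by measurable
    qed
    have V_b: "0 \<le> V k m \<omega>" "V k m \<omega> \<le> t" if "1 \<le> k" "\<omega> \<in> space M" for k m \<omega>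
      using defect_bounds(1)[OF that] t by (auto simp: V_def)
    have bnd: "integrable M f" if "f \<in> borel_measurable M" "\<And>\<omega>. \<omega> \<in> space M \<Longrightarrow> \<bar>f \<omega>\<bar> \<le> B" for f :: "'a \<Rightarrow> real" and B
      using that by (intro integrable_const_bound[where B=B]) auto
    have V_int: "integrable M (V k m)" if "1 \<le> k" for k m
      using V_b[OF that] t by (intro bnd[of _ t] V_meas that) auto
    have VV_int: "integrable M (\<lambda>\<omega>. V j m \<omega> * V k m' \<omega>)" if "1 \<le> j" "1 \<le> k" for j k m m'
    proof (rule bnd[of _ "t * t"])
      fix \<omega> assume w: "\<omega> \<in> space M"
      show "\<bar>V j m \<omega> * V k m' \<omega>\<bar> \<le> t * t"
        using V_b[OF that(1) w, of m] V_b[OF that(2) w, of m'] by (auto simp: abs_mult intro!: mult_mono)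
    qed (use that in measurable)
    have h': "expectation (\<lambda>\<omega>. (V k m \<omega>)\<^sup>2) \<le> h" if "1 \<le> k" for k m using h that by (simp add: V_def)
    have h0: "0 \<le> h" by (rule order_trans[OF _ h'[of 1 0]]) auto
    have Q0: "0 \<le> Q" by (simp add: Q_def)
    have cov1: "\<bar>expectation (\<lambda>\<omega>. V j m' \<omega> * V k m'' \<omega>) - expectation (V j m') * expectation (V k m'')\<bar>
       \<le> 2 * c (k - j - 1) * sqrt (h * Q)" if j: "1 \<le> j" and jk: "j < k" and m': "k - j - 1 \<le> m'" for j k m' m''
    proof -
      have k: "1 \<le> k" using j jk by simp
      \<comment> \<open>The window of this length after \<open>j\<close> ends at
        \<open>k - 1\<close>, so the shortened defect at \<open>j\<close> involves factors up to
        \<open>k - 1\<close> and is independent of the defect at \<open>k\<close>.\<close>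
      let ?m = "k - j - 1"
      define D where "D \<omega> = V j m' \<omega> - V j ?m \<omega>" for \<omega>
      have [measurable]: "D \<in> borel_measurable M" unfolding D_def using j by measurable
      have Db: "\<bar>D \<omega>\<bar> \<le> t" if "\<omega> \<in> space M" for \<omega>
        using V_b[OF j that, of m'] V_b[OF j that, of ?m] by (auto simp: D_def)
      have D2: "expectation (\<lambda>\<omega>. (D \<omega>)\<^sup>2) \<le> (c ?m)\<^sup>2 * Q"
        using dec[OF t j m'] by (simp add: D_def V_def Q_def)
      have ind: "indep_var borel (V j ?m) borel (V k m'')"
      proof (rule indep_var_gen)
        note [measurable] = measurable_gen_defect
        show "V j ?m \<in> borel_measurable (gen {j..j + ?m})" "V k m'' \<in> borel_measurable (gen {k..k + m''})"
          unfolding V_def[abs_def] by measurable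
      qed (use j jk in auto)
      have D_int: "integrable M D" "integrable M (\<lambda>\<omega>. (D \<omega>)\<^sup>2)" "integrable M (\<lambda>\<omega>. D \<omega> * V k m'' \<omega>)"
      proof -
        show "integrable M D" by (rule bnd[of _ t]) (use Db in auto)
        show "integrable M (\<lambda>\<omega>. (D \<omega>)\<^sup>2)"
        proof (rule bnd[of _ "t\<^sup>2"])
          fix \<omega> assume "\<omega> \<in> space M"
          thus "\<bar>(D \<omega>)\<^sup>2\<bar> \<le> t\<^sup>2" using Db[of \<omega>] t by (simp add: abs_le_square_iff[symmetric])
        qed measurable
        have [measurable]: "V k m'' \<in> borel_measurable M" using k by measurable
        show "integrable M (\<lambda>\<omega>. D \<omega> * V k m'' \<omega>)"
        proof (rule bnd[of _ "t * t"])
          fix \<omega> assume "\<omega> \<in> space M"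
          thus "\<bar>D \<omega> * V k m'' \<omega>\<bar> \<le> t * t" using Db[of \<omega>] V_b[OF k, of \<omega> m''] t by (auto simp: abs_mult intro!: mult_mono)
        qed measurable
      qed
      have V2_int: "integrable M (\<lambda>\<omega>. (V k m'' \<omega>)\<^sup>2)" using VV_int[OF k k, of m'' m''] by (simp add: power2_eq_square)
      \<comment> \<open>By independence the shortened defect drops out of the covariance, and only
        the correction \<open>D\<close> remains.\<close>
      have eq: "expectation (\<lambda>\<omega>. V j m' \<omega> * V k m'' \<omega>) - expectation (V j m') * expectation (V k m'')
        = expectation (\<lambda>\<omega>. D \<omega> * V k m'' \<omega>) - expectation D * expectation (V k m'')"
      proof -
        have "expectation (\<lambda>\<omega>. D \<omega> * V k m'' \<omega>) = expectation (\<lambda>\<omega>. V j m' \<omega> * V k m'' \<omega>) - expectation (\<lambda>\<omega>. V j ?m \<omega> * V k m'' \<omega>)"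
          unfolding D_def left_diff_distrib by (rule Bochner_Integration.integral_diff) (auto intro!: VV_int j k)
        moreover have "expectation D = expectation (V j m') - expectation (V j ?m)"
          unfolding D_def by (rule Bochner_Integration.integral_diff) (auto intro!: V_int j)
        moreover have "expectation (\<lambda>\<omega>. V j ?m \<omega> * V k m'' \<omega>) = expectation (V j ?m) * expectation (V k m'')"
          by (rule indep_var_lebesgue_integral[OF ind V_int[OF j] V_int[OF k]])
        ultimately show ?thesis by (simp only: left_diff_distrib)
      qed
      have sD: "sqrt (expectation (\<lambda>\<omega>. (D \<omega>)\<^sup>2)) \<le> c ?m * sqrt Q"
        using real_sqrt_le_mono[OF D2] c(2) by (simp add: real_sqrt_mult)
      have sV: "sqrt (expectation (\<lambda>\<omega>. (V k m'' \<omega>)\<^sup>2)) \<le> sqrt h" by (rule real_sqrt_le_mono[OF h'[OF k]])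
      have "\<bar>expectation (\<lambda>\<omega>. D \<omega> * V k m'' \<omega>)\<bar> \<le> sqrt (expectation (\<lambda>\<omega>. (D \<omega>)\<^sup>2)) * sqrt (expectation (\<lambda>\<omega>. (V k m'' \<omega>)\<^sup>2))"
        by (rule expectation_mult_le_sqrt[OF D_int(2) V2_int D_int(3)])
      also have "\<dots> \<le> (c ?m * sqrt Q) * sqrt h" using sD sV c(2) Q0 by (intro mult_mono) auto
      finally have b1: "\<bar>expectation (\<lambda>\<omega>. D \<omega> * V k m'' \<omega>)\<bar> \<le> (c ?m * sqrt Q) * sqrt h" .
      \<comment> \<open>Cauchy-Schwarz against the constant 1 bounds a mean by the root of the
        second moment.\<close>
      have "\<bar>expectation (\<lambda>\<omega>. D \<omega> * 1)\<bar> \<le> sqrt (expectation (\<lambda>\<omega>. (D \<omega>)\<^sup>2)) * sqrt (expectation (\<lambda>\<omega>. 1\<^sup>2))"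
        by (rule expectation_mult_le_sqrt) (use D_int in auto)
      hence eD: "\<bar>expectation D\<bar> \<le> c ?m * sqrt Q" using sD by (simp add: prob_space)
      have "\<bar>expectation (\<lambda>\<omega>. V k m'' \<omega> * 1)\<bar> \<le> sqrt (expectation (\<lambda>\<omega>. (V k m'' \<omega>)\<^sup>2)) * sqrt (expectation (\<lambda>\<omega>. 1\<^sup>2))"
        by (rule expectation_mult_le_sqrt) (use V2_int V_int[OF k] in auto)
      hence "\<bar>expectation (V k m'')\<bar> \<le> sqrt (expectation (\<lambda>\<omega>. (V k m'' \<omega>)\<^sup>2))" by (simp add: prob_space)
      hence eV: "\<bar>expectation (V k m'')\<bar> \<le> sqrt h" using sV by (rule order_trans)
      have "\<bar>expectation D * expectation (V k m'')\<bar> \<le> (c ?m * sqrt Q) * sqrt h"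
        unfolding abs_mult using eD eV c(2) Q0 by (intro mult_mono) auto
      thus ?thesis unfolding eq using b1 by (simp add: real_sqrt_mult algebra_simps abs_le_iff)
    qed
    define U where "U k = V k (n - k)" for k
    define e where "e k = expectation (U k)" for k
    have UU: "integrable M (\<lambda>\<omega>. (U j \<omega> - e j) * (U k \<omega> - e k))"
      and covU: "expectation (\<lambda>\<omega>. (U j \<omega> - e j) * (U k \<omega> - e k)) = expectation (\<lambda>\<omega>. U j \<omega> * U k \<omega>) - e j * e k"
      if j: "1 \<le> j" and k: "1 \<le> k" for j k
    proof -
      have Ui: "integrable M (U j)" "integrable M (U k)" "integrable M (\<lambda>\<omega>. U j \<omega> * U k \<omega>)"
        unfolding U_def using j k by (auto intro: V_int VV_int)
      have eq: "(\<lambda>\<omega>. (U j \<omega> - e j) * (U k \<omega> - e k)) = (\<lambda>\<omega>. U j \<omega> * U k \<omega> - e k * U j \<omega> - e j * U k \<omega> + e j * e k)"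
        by (rule ext) (simp add: algebra_simps)
      show "integrable M (\<lambda>\<omega>. (U j \<omega> - e j) * (U k \<omega> - e k))" unfolding eq using Ui by auto
      show "expectation (\<lambda>\<omega>. (U j \<omega> - e j) * (U k \<omega> - e k)) = expectation (\<lambda>\<omega>. U j \<omega> * U k \<omega>) - e j * e k"
        unfolding eq using Ui by (simp add: prob_space e_def)
    qed
    have "variance (\<lambda>\<omega>. \<Sum>k=1..n. U k \<omega>) = expectation (\<lambda>\<omega>. (\<Sum>k=1..n. U k \<omega> - e k)\<^sup>2)"
      by (subst Bochner_Integration.integral_sum) (auto simp: U_def e_def sum_subtractf intro: V_int)
    also have "\<dots> = expectation (\<lambda>\<omega>. \<Sum>j=1..n. \<Sum>k=1..n. (U j \<omega> - e j) * (U k \<omega> - e k))"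
      by (simp add: power2_eq_square sum_product)
    also have "\<dots> = (\<Sum>j=1..n. \<Sum>k=1..n. expectation (\<lambda>\<omega>. (U j \<omega> - e j) * (U k \<omega> - e k)))"
      using UU by (subst Bochner_Integration.integral_sum) (auto intro!: sum.cong Bochner_Integration.integral_sum)
    also have "\<dots> \<le> (\<Sum>j=1..n. h + 4 * suminf c * sqrt (h * Q))"
    proof (rule sum_mono)
      fix j assume j: "j \<in> {1..n}"
      have "(\<Sum>k=1..n. expectation (\<lambda>\<omega>. (U j \<omega> - e j) * (U k \<omega> - e k)))
        = expectation (\<lambda>\<omega>. (U j \<omega> - e j) * (U j \<omega> - e j)) + (\<Sum>k\<in>{1..n} - {j}. expectation (\<lambda>\<omega>. (U j \<omega> - e j) * (U k \<omega> - e k)))"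
        using j by (subst sum.remove[of _ j]) auto
      also have "expectation (\<lambda>\<omega>. (U j \<omega> - e j) * (U j \<omega> - e j)) \<le> h"
        using covU[of j j] j h'[of j "n - j"] by (simp add: U_def power2_eq_square) (smt (verit) zero_le_square)
      also have "(\<Sum>k\<in>{1..n} - {j}. expectation (\<lambda>\<omega>. (U j \<omega> - e j) * (U k \<omega> - e k)))
        \<le> (\<Sum>k\<in>{1..n} - {j}. 2 * sqrt (h * Q) * c ((if j < k then k - j else j - k) - 1))"
      proof (rule sum_mono)
        fix k assume k: "k \<in> {1..n} - {j}"
        show "expectation (\<lambda>\<omega>. (U j \<omega> - e j) * (U k \<omega> - e k)) \<le> 2 * sqrt (h * Q) * c ((if j < k then k - j else j - k) - 1)"
        proof (cases "j < k")
          case True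
          have "\<bar>expectation (\<lambda>\<omega>. U j \<omega> * U k \<omega>) - e j * e k\<bar> \<le> 2 * c (k - j - 1) * sqrt (h * Q)"
            unfolding U_def e_def using cov1[of j k "n - j" "n - k"] j k True by auto
          thus ?thesis using covU[of j k] j k True by (auto simp: algebra_simps abs_le_iff)
        next
          case False
          have "\<bar>expectation (\<lambda>\<omega>. U k \<omega> * U j \<omega>) - e k * e j\<bar> \<le> 2 * c (j - k - 1) * sqrt (h * Q)"
            unfolding U_def e_def using cov1[of k j "n - k" "n - j"] j k False by auto
          thus ?thesis using covU[of j k] j k False by (auto simp: algebra_simps abs_le_iff)
        qed
      qed
      also have "\<dots> \<le> 2 * sqrt (h * Q) * (2 * suminf c)"
        unfolding sum_distrib_left[symmetric] using h0 Q0 by (intro mult_left_mono sum_gap_le_suminf c) auto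
      finally show "(\<Sum>k=1..n. expectation (\<lambda>\<omega>. (U j \<omega> - e j) * (U k \<omega> - e k))) \<le> h + 4 * suminf c * sqrt (h * Q)"
        by (simp add: mult.assoc mult.commute[of "suminf c"])
    qed
    finally show "variance (\<lambda>\<omega>. \<Sum>k=1..n. min (defect k (n - k) \<omega>) t)
       \<le> real n * (h + 4 * suminf c * sqrt (h * expectation (\<lambda>\<omega>. (1 + min (spread 1 \<omega>) t)\<^sup>2)))"
      by (simp add: U_def V_def Q_def)
  qed (use T0 in simp)
qed

end

context contracting_iid_matrices
begin

text \<open>The centering \<open>e n\<close> is the mean of the truncated sum. Truncation is
  harmless since \<open>t n < defect k m\<close> requires both \<open>t n < spread k\<close> and a
  large independent imbalance, so the union bound gives at most \<open>C\<close> times an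
  arbitrarily small number. Chebyshev handles the truncated sum once its variance is
  \<open>o((a n)^2)\<close>.\<close>

lemma sum_defect_concentration:
  fixes a t :: "nat \<Rightarrow> real"
  assumes a: "\<And>n. 1 \<le> n \<Longrightarrow> 0 < a n" and an: "filterlim (\<lambda>n. (a n)\<^sup>2 / real n) at_top sequentially"
    and t: "\<And>n. 0 \<le> t n" and t_top: "filterlim t at_top sequentially"
    and tail: "\<And>n. 1 \<le> n \<Longrightarrow> real n * prob {\<omega> \<in> space M. t n < spread 1 \<omega>} \<le> C"
    and sq: "\<And>n. 1 \<le> n \<Longrightarrow> real n * expectation (\<lambda>\<omega>. (min (spread 1 \<omega>) (t n))\<^sup>2) \<le> C * (a n)\<^sup>2"
  shows "\<exists>e. \<forall>\<epsilon>>0. (\<lambda>n. prob {\<omega> \<in> space M. \<epsilon> * a n < \<bar>(\<Sum>k=1..n. defect k (n - k) \<omega>) - e n\<bar>}) \<longlonglongrightarrow> 0"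
proof -
  obtain T where T0: "0 \<le> T \<and> (\<forall>t\<ge>0. \<forall>h n. (\<forall>k\<ge>1. \<forall>m. expectation (\<lambda>\<omega>. (min (defect k m \<omega>) t)\<^sup>2) \<le> h) \<longrightarrow>
     variance (\<lambda>\<omega>. \<Sum>k=1..n. min (defect k (n - k) \<omega>) t)
       \<le> real n * (h + T * sqrt (h * expectation (\<lambda>\<omega>. (1 + min (spread 1 \<omega>) t)\<^sup>2))))"
    using variance_sum_min_defect unfolding Bex_def ..
  have T: "0 \<le> T" using T0 ..
  have var: "variance (\<lambda>\<omega>. \<Sum>k=1..n. min (defect k (n - k) \<omega>) t)
       \<le> real n * (h + T * sqrt (h * expectation (\<lambda>\<omega>. (1 + min (spread 1 \<omega>) t)\<^sup>2)))"
    if "0 \<le> t" "\<forall>k\<ge>1. \<forall>m. expectation (\<lambda>\<omega>. (min (defect k m \<omega>) t)\<^sup>2) \<le> h" for t h n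
    using T0 that by simp
  define C' where "C' = max C 0"
  have C': "0 \<le> C'" "C \<le> C'" by (auto simp: C'_def)
  define S where "S n \<omega> = (\<Sum>k=1..n. min (defect k (n - k) \<omega>) (t n))" for n \<omega>
  have Vm [measurable]: "(\<lambda>\<omega>. min (defect k m \<omega>) s) \<in> borel_measurable M" if "1 \<le> k" for k m s
    using measurable_defect[OF that] by simp
  have S_meas [measurable]: "S n \<in> borel_measurable M" for n
    unfolding S_def by (intro borel_measurable_sum Vm) auto
  have S_b: "\<bar>S n \<omega>\<bar> \<le> real n * t n" if "\<omega> \<in> space M" for n \<omega>
  proof -
    have "\<bar>S n \<omega>\<bar> \<le> (\<Sum>k=1..n. \<bar>min (defect k (n - k) \<omega>) (t n)\<bar>)" unfolding S_def by (rule sum_abs)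
    also have "\<dots> \<le> (\<Sum>k=1..n. t n)"
      using defect_bounds(1)[OF _ that] t[of n] by (intro sum_mono) (auto simp: abs_le_iff min_def)
    finally show ?thesis by simp
  qed
  define v where "v n = variance (S n) / (a n)\<^sup>2" for n
  have v0: "v \<longlonglongrightarrow> 0"
  proof (rule tendstoI)
    fix \<delta> :: real assume "0 < \<delta>"
    \<comment> \<open>The bound obtained below for the variance divided by \<open>(a n)^2\<close>,
      as a function of the small factor \<eta>; it vanishes with \<eta>.\<close>
    let ?g = "\<lambda>\<eta>. \<eta> * (1 + C') + T * sqrt ((\<eta> * (1 + C')) * (2 + 2 * C'))"
    have "(?g \<longlongrightarrow> 0) (at_right 0)" by (auto intro!: tendsto_eq_intros)
    from order_tendstoD(2)[OF this \<open>0 < \<delta>\<close>]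
    have "\<forall>\<^sub>F \<eta> in at_right 0. ?g \<eta> < \<delta> \<and> 0 < \<eta>" by (intro eventually_conj eventually_at_right_less)
    then obtain \<eta> where \<eta>: "?g \<eta> < \<delta>" "0 < \<eta>" using eventually_happens'[OF trivial_limit_at_right_real] by blast
    obtain A where A: "\<forall>t\<ge>0. \<forall>k\<ge>1. \<forall>m. expectation (\<lambda>\<omega>. (min (defect k m \<omega>) t)\<^sup>2) \<le> A + \<eta> * expectation (\<lambda>\<omega>. (min (spread 1 \<omega>) t)\<^sup>2)"
      using expectation_sq_min_defect_le[OF \<eta>(2)] ..
    define A' where "A' = max A 0"
    have "\<forall>\<^sub>F n in sequentially. max 1 (A' / \<eta>) \<le> (a n)\<^sup>2 / real n" using an by (simp only: filterlim_at_top)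
    thus "\<forall>\<^sub>F n in sequentially. dist (v n) 0 < \<delta>" using eventually_ge_at_top[of 1]
    proof eventually_elim
      fix n :: nat assume n: "max 1 (A' / \<eta>) \<le> (a n)\<^sup>2 / real n" and n1: "1 \<le> n"
      have an0: "0 < a n" using a n1 by simp
      hence a2: "0 < (a n)\<^sup>2" by simp
      have r0: "0 < real n" using n1 by simp
      have "1 \<le> (a n)\<^sup>2 / real n" "A' / \<eta> \<le> (a n)\<^sup>2 / real n" using n by auto
      \<comment> \<open>Since \<open>(a n)^2 / n\<close> diverges, the constant \<open>A'\<close>,
        although it depends on \<eta>, contributes at most \<open>\<eta> * (a n)^2\<close> to the
        sum over n terms.\<close>
      hence na: "real n \<le> (a n)\<^sup>2" "real n * A' \<le> \<eta> * (a n)\<^sup>2" using r0 \<eta>(2) by (simp_all add: field_simps)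
      let ?E = "expectation (\<lambda>\<omega>. (min (spread 1 \<omega>) (t n))\<^sup>2)"
      let ?Q = "expectation (\<lambda>\<omega>. (1 + min (spread 1 \<omega>) (t n))\<^sup>2)"
      define h where "h = A' + \<eta> * ?E"
      have E0: "0 \<le> ?E" by simp
      have h0: "0 \<le> h" using \<eta>(2) E0 by (simp add: h_def A'_def)
      have hb: "\<forall>k\<ge>1. \<forall>m. expectation (\<lambda>\<omega>. (min (defect k m \<omega>) (t n))\<^sup>2) \<le> h"
      proof (intro allI impI)
        fix k m :: nat assume "1 \<le> k"
        hence "expectation (\<lambda>\<omega>. (min (defect k m \<omega>) (t n))\<^sup>2) \<le> A + \<eta> * ?E" using A t by blast
        also have "\<dots> \<le> h" by (simp add: h_def A'_def)
        finally show "expectation (\<lambda>\<omega>. (min (defect k m \<omega>) (t n))\<^sup>2) \<le> h" .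
      qed
      have nE: "real n * ?E \<le> C' * (a n)\<^sup>2" by (rule order_trans[OF sq[OF n1]]) (use C' in \<open>auto intro: mult_right_mono\<close>)
      have nh: "real n * h \<le> \<eta> * (1 + C') * (a n)\<^sup>2"
      proof -
        have "real n * h = real n * A' + \<eta> * (real n * ?E)" by (simp add: h_def algebra_simps)
        also have "\<dots> \<le> \<eta> * (a n)\<^sup>2 + \<eta> * (C' * (a n)\<^sup>2)" using na nE \<eta>(2) by (intro add_mono mult_left_mono) auto
        finally show ?thesis by (simp add: algebra_simps)
      qed
      have Qle: "?Q \<le> 2 + 2 * ?E"
      proof -
        have sp: "0 \<le> spread 1 \<omega>" if "\<omega> \<in> space M" for \<omega> using spread_nonneg[OF _ that] by simp
        note [measurable] = measurable_spread[of 1, simplified]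
        have i: "integrable M (\<lambda>\<omega>. (min (spread 1 \<omega>) (t n))\<^sup>2)" using t sp by (intro integrable_sq_min) auto
        have "?Q \<le> expectation (\<lambda>\<omega>. 2 + 2 * (min (spread 1 \<omega>) (t n))\<^sup>2)"
        proof (rule integral_mono)
          show "integrable M (\<lambda>\<omega>. (1 + min (spread 1 \<omega>) (t n))\<^sup>2)"
            using sp t[of n] by (intro integrable_const_bound[where B="(1 + t n)\<^sup>2"]) (auto intro!: AE_I2 power_mono)
          show "integrable M (\<lambda>\<omega>. 2 + 2 * (min (spread 1 \<omega>) (t n))\<^sup>2)" using i by auto
          fix \<omega>
          have "0 \<le> (1 - min (spread 1 \<omega>) (t n))\<^sup>2" by simp
          thus "(1 + min (spread 1 \<omega>) (t n))\<^sup>2 \<le> 2 + 2 * (min (spread 1 \<omega>) (t n))\<^sup>2" by (simp add: power2_eq_square algebra_simps)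
        qed
        also have "\<dots> = 2 + 2 * ?E" using i by (simp add: prob_space)
        finally show ?thesis .
      qed
      have "real n * ?Q \<le> real n * 2 + 2 * (real n * ?E)" using mult_left_mono[OF Qle, of "real n"] by (simp add: algebra_simps)
      also have "\<dots> \<le> (a n)\<^sup>2 * 2 + 2 * (C' * (a n)\<^sup>2)" using na(1) nE by linarith
      finally have nQ: "real n * ?Q \<le> (2 + 2 * C') * (a n)\<^sup>2" by (simp add: algebra_simps)
      have "real n * sqrt (h * ?Q) = sqrt ((real n * h) * (real n * ?Q))"
        by (simp add: real_sqrt_mult)
      also have "\<dots> \<le> sqrt ((\<eta> * (1 + C') * (a n)\<^sup>2) * ((2 + 2 * C') * (a n)\<^sup>2))"
        using h0 C' \<eta>(2) by (intro real_sqrt_le_mono mult_mono[OF nh nQ]) auto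
      also have "\<dots> = sqrt ((\<eta> * (1 + C')) * (2 + 2 * C') * ((a n)\<^sup>2)\<^sup>2)"
        by (rule arg_cong[of _ _ sqrt]) (simp add: power2_eq_square)
      also have "\<dots> = sqrt ((\<eta> * (1 + C')) * (2 + 2 * C')) * (a n)\<^sup>2" by (simp only: real_sqrt_mult real_sqrt_abs abs_power2)
      finally have sq_le: "real n * sqrt (h * ?Q) \<le> sqrt ((\<eta> * (1 + C')) * (2 + 2 * C')) * (a n)\<^sup>2" .
      have "variance (S n) \<le> real n * (h + T * sqrt (h * ?Q))" unfolding S_def by (rule var[OF t hb])
      also have "\<dots> = real n * h + T * (real n * sqrt (h * ?Q))" by (simp add: algebra_simps)
      also have "\<dots> \<le> \<eta> * (1 + C') * (a n)\<^sup>2 + T * (sqrt ((\<eta> * (1 + C')) * (2 + 2 * C')) * (a n)\<^sup>2)"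
        using nh sq_le T by (intro add_mono mult_left_mono) auto
      also have "\<dots> = ?g \<eta> * (a n)\<^sup>2" by (simp only: distrib_right mult.assoc)
      finally have "v n \<le> ?g \<eta>" unfolding v_def using a2 by (simp add: pos_divide_le_eq)
      moreover have "0 \<le> v n" unfolding v_def by simp
      ultimately show "dist (v n) 0 < \<delta>" using \<eta>(1) by simp
    qed
  qed
  define u where "u n = prob {\<omega> \<in> space M. \<exists>k\<in>{1..n}. t n < defect k (n - k) \<omega>}" for n
  have u0: "u \<longlonglongrightarrow> 0"
  proof (rule tendstoI)
    fix \<delta> :: real assume d: "0 < \<delta>"
    define \<eta> where "\<eta> = \<delta> / (2 * (1 + C'))"
    have \<eta>: "0 < \<eta>" "C' * \<eta> < \<delta>" using d C' by (auto simp: \<eta>_def field_simps add_nonneg_pos)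
    obtain A where A: "0 \<le> A" "\<And>k m. prob {\<omega> \<in> space M. A < imbalance k m \<omega>} < \<eta>"
      using tight_imbalance[OF \<eta>(1)] by blast
    have "\<forall>\<^sub>F n in sequentially. A \<le> t n" using t_top by (simp only: filterlim_at_top)
    thus "\<forall>\<^sub>F n in sequentially. dist (u n) 0 < \<delta>" using eventually_ge_at_top[of 1]
    proof eventually_elim
      fix n :: nat assume tA: "A \<le> t n" and n1: "1 \<le> n"
      \<comment> \<open>For \<open>A \<le> t n\<close> a defect above \<open>t n\<close> forces
        \<open>spread k\<close> above \<open>t n\<close> and the imbalance above \<open>A\<close>;
        the probabilities of these two independent events multiply.\<close>
      have one: "prob {\<omega> \<in> space M. t n < defect k m \<omega>} \<le> prob {\<omega> \<in> space M. t n < spread 1 \<omega>} * \<eta>" if k: "1 \<le> k" for k m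
      proof -
        note [measurable] = measurable_spread[OF k] measurable_defect[OF k]
        have "prob {\<omega> \<in> space M. t n < defect k m \<omega>} \<le> prob ((\<lambda>\<omega>. (spread k \<omega>, imbalance k m \<omega>)) -` ({t n<..} \<times> {A<..}) \<inter> space M)"
          using order_less_le_trans[OF _ defect_bounds(2)[OF k]]
            order_le_less_trans[OF tA order_less_le_trans[OF _ defect_bounds(3)[OF k]]]
          by (intro finite_measure_mono) auto
        also have "\<dots> = prob (spread k -` {t n<..} \<inter> space M) * prob (imbalance k m -` {A<..} \<inter> space M)"
          by (rule indep_varD[of borel _ borel])
             (auto intro!: indep_var_gen[OF measurable_gen_spread measurable_gen_imbalance] intro: order_trans[OF k])
        also have "spread k -` {t n<..} \<inter> space M = {\<omega> \<in> space M. t n < spread k \<omega>}" by auto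
        also have "imbalance k m -` {A<..} \<inter> space M = {\<omega> \<in> space M. A < imbalance k m \<omega>}" by auto
        also have "prob {\<omega> \<in> space M. t n < spread k \<omega>} = prob {\<omega> \<in> space M. t n < spread 1 \<omega>}" by (rule prob_spread_eq[OF k])
        also have "\<dots> * prob {\<omega> \<in> space M. A < imbalance k m \<omega>} \<le> prob {\<omega> \<in> space M. t n < spread 1 \<omega>} * \<eta>"
          using A(2)[of k m] by (intro mult_left_mono) auto
        finally show ?thesis .
      qed
      have "{\<omega> \<in> space M. \<exists>k\<in>{1..n}. t n < defect k (n - k) \<omega>} = (\<Union>k\<in>{1..n}. {\<omega> \<in> space M. t n < defect k (n - k) \<omega>})" by auto
      hence "u n \<le> (\<Sum>k=1..n. prob {\<omega> \<in> space M. t n < defect k (n - k) \<omega>})"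
        unfolding u_def using measurable_defect by (simp only:) (intro finite_measure_subadditive_finite, auto)
      also have "\<dots> \<le> (\<Sum>k=1..n. prob {\<omega> \<in> space M. t n < spread 1 \<omega>} * \<eta>)" by (intro sum_mono one) auto
      also have "\<dots> = (real n * prob {\<omega> \<in> space M. t n < spread 1 \<omega>}) * \<eta>" by simp
      also have "\<dots> \<le> C' * \<eta>" using tail[OF n1] C' \<eta>(1) by (intro mult_right_mono) auto
      finally show "dist (u n) 0 < \<delta>" using \<eta>(2) by (simp add: u_def)
    qed
  qed
  have "(\<lambda>n. prob {\<omega> \<in> space M. \<epsilon> * a n < \<bar>(\<Sum>k=1..n. defect k (n - k) \<omega>) - expectation (S n)\<bar>}) \<longlonglongrightarrow> 0"
    if eps: "0 < \<epsilon>" for \<epsilon>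
  proof (rule tendsto_sandwich[OF _ _ tendsto_const])
    show "\<forall>\<^sub>F n in sequentially. 0 \<le> prob {\<omega> \<in> space M. \<epsilon> * a n < \<bar>(\<Sum>k=1..n. defect k (n - k) \<omega>) - expectation (S n)\<bar>}" by simp
    show "(\<lambda>n. u n + v n / \<epsilon>\<^sup>2) \<longlonglongrightarrow> 0" using tendsto_add[OF u0 tendsto_divide[OF v0 tendsto_const, of "\<epsilon>\<^sup>2"]] eps by simp
    show "\<forall>\<^sub>F n in sequentially. prob {\<omega> \<in> space M. \<epsilon> * a n < \<bar>(\<Sum>k=1..n. defect k (n - k) \<omega>) - expectation (S n)\<bar>} \<le> u n + v n / \<epsilon>\<^sup>2"
      using eventually_ge_at_top[of 1]
    proof eventually_elim
      fix n :: nat assume n1: "1 \<le> n"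
      have an0: "0 < \<epsilon> * a n" using a[OF n1] eps by simp
      let ?U = "{\<omega> \<in> space M. \<exists>k\<in>{1..n}. t n < defect k (n - k) \<omega>}"
      let ?W = "{\<omega> \<in> space M. \<epsilon> * a n \<le> \<bar>S n \<omega> - expectation (S n)\<bar>}"
      have U: "?U \<in> events"
      proof -
        have "?U = (\<Union>k\<in>{1..n}. {\<omega> \<in> space M. t n < defect k (n - k) \<omega>})" by auto
        also have "\<dots> \<in> events" using measurable_defect by (intro sets.finite_UN) auto
        finally show ?thesis .
      qed
      have W: "?W \<in> events" by measurable
      \<comment> \<open>Off \<open>?U\<close> no defect exceeds \<open>t n\<close>, so the sum
        coincides with its truncation and only the Chebyshev event \<open>?W\<close> is
        left.\<close>
      have "prob {\<omega> \<in> space M. \<epsilon> * a n < \<bar>(\<Sum>k=1..n. defect k (n - k) \<omega>) - expectation (S n)\<bar>} \<le> prob (?U \<union> ?W)"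
      proof (rule finite_measure_mono[OF subsetI])
        fix \<omega> assume w: "\<omega> \<in> {\<omega> \<in> space M. \<epsilon> * a n < \<bar>(\<Sum>k=1..n. defect k (n - k) \<omega>) - expectation (S n)\<bar>}"
        show "\<omega> \<in> ?U \<union> ?W"
        proof (cases "\<omega> \<in> ?U")
          case False
          hence "\<And>k. k \<in> {1..n} \<Longrightarrow> defect k (n - k) \<omega> \<le> t n" using w by (auto simp: not_less)
          hence "S n \<omega> = (\<Sum>k=1..n. defect k (n - k) \<omega>)" unfolding S_def by (intro sum.cong refl min_absorb1)
          thus ?thesis using w by auto
        qed simp
      qed (use U W in auto)
      also have "\<dots> \<le> prob ?U + prob ?W" by (rule measure_Un_le[OF U W])
      also have "prob ?W \<le> variance (S n) / (\<epsilon> * a n)\<^sup>2"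
      proof (rule Chebyshev_inequality[OF S_meas _ an0])
        show "integrable M (\<lambda>x. (S n x)\<^sup>2)"
        proof (rule integrable_const_bound[where B="(real n * t n)\<^sup>2"])
          show "AE x in M. norm ((S n x)\<^sup>2) \<le> (real n * t n)\<^sup>2"
          proof (rule AE_I2)
            fix \<omega> assume "\<omega> \<in> space M"
            from S_b[OF this, of n] have "\<bar>S n \<omega>\<bar> \<le> \<bar>real n * t n\<bar>" by linarith
            from abs_le_square_iff[THEN iffD1, OF this] show "norm ((S n \<omega>)\<^sup>2) \<le> (real n * t n)\<^sup>2"
              by (simp only: real_norm_def abs_power2)
          qed
        qed measurable
      qed
      also have "variance (S n) / (\<epsilon> * a n)\<^sup>2 = v n / \<epsilon>\<^sup>2" by (simp add: v_def power_mult_distrib)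
      finally show "prob {\<omega> \<in> space M. \<epsilon> * a n < \<bar>(\<Sum>k=1..n. defect k (n - k) \<omega>) - expectation (S n)\<bar>} \<le> u n + v n / \<epsilon>\<^sup>2"
        by (simp add: u_def)
    qed
  qed
  thus ?thesis by (intro exI[of _ "\<lambda>n. expectation (S n)"] allI impI)
qed

end

section \<open>Normalised sums in the domain of attraction of a stable law\<close>

text \<open>Write the square as the integral of \<open>2 * u\<close> over the \<open>u\<close> in
  \<open>{0<..x}\<close> below \<open>Z\<close>, then apply Fubini. This ties
  \<open>trunc_moment\<close> to expectations.\<close>

lemma (in prob_space) expectation_sq_min_layer_cake:
  fixes Z :: "'a \<Rightarrow> real"
  assumes Z [measurable]: "Z \<in> borel_measurable M" and x: "0 \<le> x"
  shows "expectation (\<lambda>\<omega>. (min (max (Z \<omega>) 0) x)\<^sup>2) = (LINT u:{0<..x}|lborel. 2 * u * prob {\<omega> \<in> space M. u < Z \<omega>})"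
proof -
  let ?f = "\<lambda>\<omega> u. indicator {0<..x} u *\<^sub>R (2 * u * indicator {v. v < Z \<omega>} u)"
  interpret P: pair_sigma_finite M lborel ..
  have pointwise: "(LINT u|lborel. ?f \<omega> u) = (min (max (Z \<omega>) 0) x)\<^sup>2" for \<omega>
  proof -
    define c where "c = min (max (Z \<omega>) 0) x"
    have c: "0 \<le> c" using x by (simp add: c_def)
    have "(LINT u|lborel. ?f \<omega> u) = (LINT u|lborel. (2 * u) * indicator {0..c} u)"
    proof (rule integral_cong_AE)
      have "AE u in lborel. u \<noteq> Z \<omega> \<and> u \<noteq> 0" by (intro AE_conjI AE_lborel_singleton)
      thus "AE u in lborel. ?f \<omega> u = (2 * u) * indicator {0..c} u"
        by eventually_elim (auto simp: indicator_def c_def)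
    qed measurable
    also have "\<dots> = c\<^sup>2 - 0\<^sup>2"
      by (rule integral_FTC_Icc_real) (use c in \<open>auto intro!: derivative_eq_intros continuous_intros\<close>)
    finally show ?thesis by (simp add: c_def)
  qed
  have [measurable]: "(\<lambda>(\<omega>, u). ?f \<omega> u) \<in> borel_measurable (M \<Otimes>\<^sub>M lborel)"
  proof -
    have "(\<lambda>(\<omega>, u). indicator {0<..x} u *\<^sub>R (2 * u * (if u < Z \<omega> then 1 else 0))) \<in> borel_measurable (M \<Otimes>\<^sub>M lborel)"
      by measurable
    thus ?thesis by (simp add: indicator_def split_beta' if_distrib cong: if_cong)
  qed
  have int: "integrable (M \<Otimes>\<^sub>M lborel) (\<lambda>(\<omega>, u). ?f \<omega> u)"
  proof (rule Bochner_Integration.integrable_bound)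
    show "AE z in M \<Otimes>\<^sub>M lborel. norm (case z of (\<omega>, u) \<Rightarrow> ?f \<omega> u) \<le> norm (indicator (space M \<times> {0<..x}) z * (2 * x))"
      by (rule AE_I2) (auto simp: indicator_def space_pair_measure)
    have "emeasure (M \<Otimes>\<^sub>M lborel) (space M \<times> {0<..x}) = ennreal x"
      using x by (subst lborel.emeasure_pair_measure_Times) (auto simp: emeasure_space_1)
    thus "integrable (M \<Otimes>\<^sub>M lborel) (\<lambda>z. indicator (space M \<times> {0<..x}) z * (2 * x))"
      by (intro integrable_mult_left integrable_real_indicator) auto
  qed measurable
  have "expectation (\<lambda>\<omega>. (min (max (Z \<omega>) 0) x)\<^sup>2) = expectation (\<lambda>\<omega>. LINT u|lborel. ?f \<omega> u)"
    by (simp only: pointwise)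
  also have "\<dots> = (LINT u|lborel. expectation (\<lambda>\<omega>. ?f \<omega> u))"
    by (rule P.Fubini_integral[OF int, symmetric])
  also have "\<dots> = (LINT u:{0<..x}|lborel. 2 * u * prob {\<omega> \<in> space M. u < Z \<omega>})"
    unfolding set_lebesgue_integral_def
  proof (rule Bochner_Integration.integral_cong[OF refl])
    fix u
    have "expectation (\<lambda>\<omega>. ?f \<omega> u) = expectation (\<lambda>\<omega>. indicator {0<..x} u * 2 * u * indicator {\<omega> \<in> space M. u < Z \<omega>} \<omega>)"
      by (rule Bochner_Integration.integral_cong) (auto simp: indicator_def)
    thus "expectation (\<lambda>\<omega>. ?f \<omega> u) = indicator {0<..x} u *\<^sub>R (2 * u * prob {\<omega> \<in> space M. u < Z \<omega>})" by simp
  qed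
  finally show ?thesis .
qed

text \<open>Integrals of the weight \<open>min (y^2) 1\<close> over \<open>y > x\<close> are thereby
  expressed through tails and truncated moments, whose limits regular variation provides.\<close>

lemma (in prob_space) expectation_sq_min_tail:
  fixes Z :: "'a \<Rightarrow> real"
  assumes Z [measurable]: "Z \<in> borel_measurable M" and x: "0 < x" and a: "0 < a"
  shows "expectation (\<lambda>\<omega>. min ((Z \<omega> / a)\<^sup>2) 1 * indicator {x<..} (Z \<omega> / a)) =
     (min x 1)\<^sup>2 * prob {\<omega> \<in> space M. x * a < Z \<omega>}
     + ((LINT u:{0<..a}|lborel. 2 * u * prob {\<omega> \<in> space M. u < Z \<omega>})
        - (LINT u:{0<..min x 1 * a}|lborel. 2 * u * prob {\<omega> \<in> space M. u < Z \<omega>})) / a\<^sup>2"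
proof -
  let ?m = "\<lambda>c \<omega>. (min (max (Z \<omega>) 0) c)\<^sup>2"
  let ?S = "{\<omega> \<in> space M. x * a < Z \<omega>}"
  have int: "integrable M (?m c)" if "0 \<le> c" for c
  proof (rule integrable_const_bound[where B="c\<^sup>2"])
    show "AE \<omega> in M. norm (?m c \<omega>) \<le> c\<^sup>2" using that by (intro AE_I2) (auto intro!: power_mono)
  qed measurable
  have x1: "0 < min x 1" using x by simp
  have pt: "min ((Z \<omega> / a)\<^sup>2) 1 * indicator {x<..} (Z \<omega> / a) =
     (min x 1)\<^sup>2 * indicator ?S \<omega> + (?m a \<omega> - ?m (min x 1 * a) \<omega>) / a\<^sup>2" if "\<omega> \<in> space M" for \<omega>
  proof -
    define y where "y = Z \<omega> / a"
    have Zy: "Z \<omega> = y * a" using a by (simp add: y_def)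
    have m: "min (max (y * a) 0) (c * a) = min (max y 0) c * a" for c
      using a by (simp add: min_mult_distrib_right max_mult_distrib_right)
    have 1: "?m a \<omega> = (min (max y 0) 1)\<^sup>2 * a\<^sup>2" using m[of 1] by (simp add: Zy power_mult_distrib)
    have 2: "?m (min x 1 * a) \<omega> = (min (max y 0) (min x 1))\<^sup>2 * a\<^sup>2" by (simp only: Zy m power_mult_distrib)
    have 3: "indicator ?S \<omega> = (indicator {x<..} y :: real)" using that a by (auto simp: indicator_def Zy)
    \<comment> \<open>Beyond \<open>x\<close> the truncated square \<open>(min y 1)^2\<close> splits
      into its value at the threshold \<open>min x 1\<close> and its growth after that; up to
      \<open>x\<close> both sides vanish.\<close>
    have "min (y\<^sup>2) 1 * indicator {x<..} y = (min x 1)\<^sup>2 * indicator {x<..} y + ((min (max y 0) 1)\<^sup>2 - (min (max y 0) (min x 1))\<^sup>2)"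
    proof (cases "x < y")
      case True
      hence y0: "0 < y" using x by simp
      have "min (y\<^sup>2) 1 = (min y 1)\<^sup>2" using y0 by (auto simp: min_def abs_square_le_1 power_le_one_iff)
      thus ?thesis using True y0 by (auto simp: min_def)
    next
      case False
      thus ?thesis using x by (auto simp: min_def max_def)
    qed
    thus ?thesis unfolding 1 2 3 y_def[symmetric] using a by (simp add: left_diff_distrib[symmetric])
  qed
  have "expectation (\<lambda>\<omega>. min ((Z \<omega> / a)\<^sup>2) 1 * indicator {x<..} (Z \<omega> / a))
     = expectation (\<lambda>\<omega>. (min x 1)\<^sup>2 * indicator ?S \<omega> + (?m a \<omega> - ?m (min x 1 * a) \<omega>) / a\<^sup>2)"
    by (rule Bochner_Integration.integral_cong[OF refl pt])
  also have "\<dots> = (min x 1)\<^sup>2 * prob ?S + (expectation (?m a) - expectation (?m (min x 1 * a))) / a\<^sup>2"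
    using int[of a] int[of "min x 1 * a"] a x1
    by (subst Bochner_Integration.integral_add)
       (auto intro!: integrable_mult_right integrable_const_bound[where B=1] Bochner_Integration.integral_diff)
  finally show ?thesis using a x1 by (simp add: expectation_sq_min_layer_cake)
qed

section \<open>Norming constants and weighted rescaled laws\<close>

locale stable_domain = real_distribution D for D +
  fixes \<alpha> p :: real
  assumes rt: "regular_tail (\<lambda>u. measure D {u<..} + measure D {..<-u}) \<alpha>"
    and p_lim: "((\<lambda>u. measure D {u<..} / (measure D {u<..} + measure D {..<-u})) \<longlongrightarrow> p) at_top"
begin

definition H :: "real \<Rightarrow> real" where "H u = measure D {u<..} + measure D {..<-u}"

sublocale tail: regular_tail H \<alpha> unfolding H_def[abs_def] by (rule rt)

abbreviation "Tp u \<equiv> measure D {u<..}"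
abbreviation "Tm u \<equiv> measure D {..<-u}"

lemma measurable_tails [measurable]: "Tp \<in> borel_measurable borel" "Tm \<in> borel_measurable borel"
proof -
  have "mono (\<lambda>u. - Tp u)" "mono (\<lambda>u. - Tm u)"
    by (auto intro!: monoI finite_measure_mono)
  from this[THEN borel_measurable_mono] show "Tp \<in> borel_measurable borel" "Tm \<in> borel_measurable borel" by simp_all
qed

lemma dominated_Tp: "tail.dominated_tail Tp p"
  unfolding tail.dominated_tail_def using p_lim by (simp add: H_def)

lemma dominated_Tm: "tail.dominated_tail Tm (1 - p)"
proof -
  have "((\<lambda>u. 1 - Tp u / H u) \<longlongrightarrow> 1 - p) at_top" using p_lim unfolding H_def by (intro tendsto_intros)
  moreover have "\<forall>\<^sub>F u in at_top. 1 - Tp u / H u = Tm u / H u"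
    using eventually_gt_at_top[of 0]
  proof eventually_elim
    fix u :: real assume "0 < u"
    from tail.H_pos[OF this] show "1 - Tp u / H u = Tm u / H u" by (simp add: H_def field_simps)
  qed
  ultimately have "((\<lambda>u. Tm u / H u) \<longlongrightarrow> 1 - p) at_top" by (rule Lim_transform_eventually)
  thus ?thesis unfolding tail.dominated_tail_def by (simp add: H_def)
qed

lemma p_bounds: "0 \<le> p" "p \<le> 1"
proof -
  have nn: "0 \<le> q" if "tail.dominated_tail T q" for T q
  proof (rule tendsto_lowerbound)
    show "((\<lambda>u. T u / H u) \<longlongrightarrow> q) at_top" using that by (simp add: tail.dominated_tail_def)
    show "\<forall>\<^sub>F u in at_top. 0 \<le> T u / H u" using eventually_gt_at_top[of 0]
      by eventually_elim (use that tail.H_nonneg in \<open>auto simp: tail.dominated_tail_def\<close>)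
  qed simp
  show "0 \<le> p" "p \<le> 1" using nn[OF dominated_Tp] nn[OF dominated_Tm] by auto
qed

lemma U_eq: assumes "0 \<le> x" shows "tail.U x = expectation (\<lambda>z. (min \<bar>z\<bar> x)\<^sup>2)"
proof -
  have "expectation (\<lambda>z. (min \<bar>z\<bar> x)\<^sup>2) = expectation (\<lambda>z. (min (max \<bar>z\<bar> 0) x)\<^sup>2)" by (simp add: max_absorb1)
  also have "\<dots> = (LINT u:{0<..x}|lborel. 2 * u * prob {z \<in> space D. u < \<bar>z\<bar>})"
    using assms by (rule expectation_sq_min_layer_cake[rotated]) measurable
  also have "\<dots> = tail.U x" unfolding tail.trunc_moment_def
  proof (rule set_lebesgue_integral_cong)
    show "\<forall>u. u \<in> {0<..x} \<longrightarrow> 2 * u * prob {z \<in> space D. u < \<bar>z\<bar>} = 2 * u * H u"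
    proof safe
      fix u assume "u \<in> {0<..x}"
      hence "{z \<in> space D. u < \<bar>z\<bar>} = {u<..} \<union> {..<-u}" by auto
      hence "prob {z \<in> space D. u < \<bar>z\<bar>} = prob ({u<..} \<union> {..<-u})" by (simp only:)
      also have "\<dots> = H u" unfolding H_def
        using \<open>u \<in> {0<..x}\<close> by (intro finite_measure_Union) auto
      finally show "2 * u * prob {z \<in> space D. u < \<bar>z\<bar>} = 2 * u * H u" by simp
    qed
  qed simp
  finally show ?thesis by simp
qed

definition norming :: "nat \<Rightarrow> real" where
  "norming = (SOME a. (\<forall>n. 1 \<le> a n) \<and> filterlim a at_top sequentially \<and> (\<forall>\<^sub>F n in sequentially. real n * tail.U (a n) = (a n)\<^sup>2))"

abbreviation "a \<equiv> norming"

lemma norming: "1 \<le> a n" "filterlim a at_top sequentially" "\<forall>\<^sub>F n in sequentially. real n * tail.U (a n) = (a n)\<^sup>2"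
  using someI_ex[OF tail.norming_sequence] unfolding norming_def by blast+

lemma norming_pos: "0 < a n" using norming(1)[of n] by simp

text \<open>The Karamata limit, hence also that of \<open>n * H (a n)\<close>. It vanishes exactly
  for \<alpha> = 2, where no large jumps survive the rescaling.\<close>

definition kap :: real where "kap = (2 - \<alpha>) / 2"

lemma n_H_norming: "(\<lambda>n. real n * H (a n)) \<longlonglongrightarrow> kap"
proof -
  have lim: "(\<lambda>n. (a n)\<^sup>2 * H (a n) / tail.U (a n)) \<longlonglongrightarrow> kap"
    unfolding kap_def by (rule filterlim_compose[OF tail.U_ratio_limit norming(2)])
  have "\<forall>\<^sub>F n in sequentially. (a n)\<^sup>2 * H (a n) / tail.U (a n) = real n * H (a n)"
    using norming(3)
  proof eventually_elim
    fix n assume "real n * tail.U (a n) = (a n)\<^sup>2"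
    thus "(a n)\<^sup>2 * H (a n) / tail.U (a n) = real n * H (a n)"
      using tail.U_bounds(3)[OF norming_pos, of n] by (simp add: field_simps)
  qed
  from Lim_transform_eventually[OF lim this] show ?thesis .
qed

text \<open>By the norming equation the quotient is \<open>U (a n)\<close>. Its divergence is what
  renders bounded contributions per term negligible.\<close>

lemma norming_sq_over_n: "filterlim (\<lambda>n. (a n)\<^sup>2 / real n) at_top sequentially"
proof (rule filterlim_at_top_mono)
  show "filterlim (\<lambda>n. tail.U (a n)) at_top sequentially" by (rule filterlim_compose[OF tail.U_at_top norming(2)])
  show "\<forall>\<^sub>F n in sequentially. tail.U (a n) \<le> (a n)\<^sup>2 / real n"
    using norming(3) eventually_gt_at_top[of 0] by eventually_elim (simp add: field_simps)
qed

text \<open>The limiting tail of the measures \<open>n min(x\<^sup>2, 1) P(Z / a\<^sub>n \<in> dx)\<close>.\<close>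
definition lim_tail :: "real \<Rightarrow> real" where
  "lim_tail x = kap * ((min x 1)\<^sup>2 * x powr - \<alpha> + (LINT y:{min x 1<..1}|lborel. 2 * y powr (1 - \<alpha>)))"

text \<open>Kept general in \<open>Z\<close> to serve the right tail with \<open>z\<close> and the
  left one with \<open>- z\<close>.\<close>

lemma weighted_tail_limit:
  fixes Z :: "real \<Rightarrow> real"
  assumes Z [measurable]: "Z \<in> borel_measurable borel" and T: "tail.dominated_tail (\<lambda>u. prob {z \<in> space D. u < Z z}) q" and x: "0 < x"
  shows "(\<lambda>n. real n * expectation (\<lambda>z. min ((Z z / a n)\<^sup>2) 1 * indicator {x<..} (Z z / a n))) \<longlonglongrightarrow> q * lim_tail x"
proof -
  let ?T = "\<lambda>u. prob {z \<in> space D. u < Z z}"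
  let ?V = "tail.trunc_moment ?T"
  let ?x = "min x 1"
  have x1: "0 < ?x" "?x \<le> 1" using x by auto
  have 1: "(\<lambda>n. ?T (x * a n) / H (a n)) \<longlonglongrightarrow> q * x powr - \<alpha>"
    by (rule filterlim_compose[OF tail.T_rv[OF T x] norming(2)])
  have 2: "(\<lambda>n. (?V (a n) - ?V (?x * a n)) / ((a n)\<^sup>2 * H (a n))) \<longlonglongrightarrow> q * (LINT y:{?x<..1}|lborel. 2 * y powr (1 - \<alpha>))"
    by (rule filterlim_compose[OF tail.trunc_moment_diff_limit[OF T x1] norming(2)])
  have "(\<lambda>n. (real n * H (a n)) * (?x\<^sup>2 * (?T (x * a n) / H (a n)) + (?V (a n) - ?V (?x * a n)) / ((a n)\<^sup>2 * H (a n))))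
     \<longlonglongrightarrow> kap * (?x\<^sup>2 * (q * x powr - \<alpha>) + q * (LINT y:{?x<..1}|lborel. 2 * y powr (1 - \<alpha>)))"
    by (intro tendsto_intros n_H_norming 1 2)
  moreover have "(real n * H (a n)) * (?x\<^sup>2 * (?T (x * a n) / H (a n)) + (?V (a n) - ?V (?x * a n)) / ((a n)\<^sup>2 * H (a n)))
     = real n * expectation (\<lambda>z. min ((Z z / a n)\<^sup>2) 1 * indicator {x<..} (Z z / a n))" for n
  proof -
    have "(real n * H (a n)) * (?x\<^sup>2 * (?T (x * a n) / H (a n)) + (?V (a n) - ?V (?x * a n)) / ((a n)\<^sup>2 * H (a n)))
      = real n * (?x\<^sup>2 * ?T (x * a n) + (?V (a n) - ?V (?x * a n)) / (a n)\<^sup>2)"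
      using less_imp_neq[OF tail.H_pos[OF norming_pos, of n]] less_imp_neq[OF norming_pos, of n] by (simp add: field_simps)
    thus ?thesis using expectation_sq_min_tail[of Z x "a n"] x norming_pos[of n] by (simp add: tail.trunc_moment_def)
  qed
  moreover have "kap * (?x\<^sup>2 * (q * x powr - \<alpha>) + q * (LINT y:{?x<..1}|lborel. 2 * y powr (1 - \<alpha>))) = q * lim_tail x"
    unfolding lim_tail_def by (simp add: algebra_simps)
  ultimately show ?thesis by (simp only:)
qed

text \<open>The total mass of the density is \<open>n * U (a n) / (a n)^2\<close>, so this is a
  probability measure precisely because of the norming equation. The point mass is a placeholder for
  the finitely many n where that equation may fail.\<close>

definition G :: "nat \<Rightarrow> real measure" where
  "G n = (if real n * tail.U (a n) = (a n)\<^sup>2 then density (distr D borel (\<lambda>z. z / a n)) (\<lambda>x. ennreal (real n * min (x\<^sup>2) 1)) else return borel 0)"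

lemma integral_G:
  fixes f :: "real \<Rightarrow> 'b::{banach, second_countable_topology}"
  assumes "real n * tail.U (a n) = (a n)\<^sup>2" and [measurable]: "f \<in> borel_measurable borel"
  shows "(LINT x|G n. f x) = expectation (\<lambda>z. (real n * min ((z / a n)\<^sup>2) 1) *\<^sub>R f (z / a n))"
  using assms(1) unfolding G_def by (simp add: integral_density integral_distr)

lemma real_distribution_G: "real_distribution (G n)"
proof (cases "real n * tail.U (a n) = (a n)\<^sup>2")
  case True
  have "emeasure (G n) (space (G n)) = (\<integral>\<^sup>+ x. ennreal (real n * min (x\<^sup>2) 1) \<partial>distr D borel (\<lambda>z. z / a n))"
    using True unfolding G_def by (simp add: emeasure_density)
  also have "\<dots> = (\<integral>\<^sup>+ z. ennreal (real n * min ((z / a n)\<^sup>2) 1) \<partial>D)" by (subst nn_integral_distr) auto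
  also have "\<dots> = ennreal (expectation (\<lambda>z. real n * min ((z / a n)\<^sup>2) 1))"
    by (rule nn_integral_eq_integral) (auto intro!: integrable_const_bound[where B="real n"] mult_left_le)
  also have "expectation (\<lambda>z. real n * min ((z / a n)\<^sup>2) 1) = real n * (tail.U (a n) / (a n)\<^sup>2)"
  proof -
    have "min ((z / a n)\<^sup>2) 1 = (min \<bar>z\<bar> (a n))\<^sup>2 / (a n)\<^sup>2" for z
    proof (cases "\<bar>z\<bar> \<le> a n")
      case True
      hence "\<bar>z / a n\<bar> \<le> 1" using norming_pos[of n] by simp
      hence "(z / a n)\<^sup>2 \<le> 1" by (simp add: abs_square_le_1)
      thus ?thesis using True by (simp add: min_def power_divide)
    next
      case False
      hence "1 \<le> \<bar>z / a n\<bar>" using norming_pos[of n] by simp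
      hence "1 \<le> (z / a n)\<^sup>2" by (metis abs_le_square_iff abs_one one_power2)
      thus ?thesis using False norming_pos[of n] by (simp add: min_def power_divide)
    qed
    thus ?thesis using U_eq[of "a n"] norming_pos[of n] by (simp add: less_imp_le)
  qed
  also have "\<dots> = 1" using True norming_pos[of n] by simp
  finally have "prob_space (G n)" by (intro prob_spaceI) simp
  moreover have "sets (G n) = sets borel" using True by (simp add: G_def)
  ultimately show ?thesis by (simp add: real_distribution_def real_distribution_axioms_def)
next
  case False
  thus ?thesis by (simp add: G_def real_distribution_def real_distribution_axioms_def prob_space_return)
qed

lemma G_tails:
  assumes x: "0 < x"
  shows "(\<lambda>n. measure (G n) {x<..}) \<longlonglongrightarrow> p * lim_tail x" "(\<lambda>n. measure (G n) {..<-x}) \<longlonglongrightarrow> (1 - p) * lim_tail x"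
proof -
  have m: "measure (G n) A = (LINT y|G n. indicator A y)" if "A \<in> sets borel" for n and A :: "real set"
  proof -
    interpret G: real_distribution "G n" by (rule real_distribution_G)
    show ?thesis using that by simp
  qed
  have "tail.dominated_tail (\<lambda>u. prob {z \<in> space D. u < z}) p" using dominated_Tp by (simp add: greaterThan_def)
  from weighted_tail_limit[OF _ this x]
  have 1: "(\<lambda>n. real n * expectation (\<lambda>z. min ((z / a n)\<^sup>2) 1 * indicator {x<..} (z / a n))) \<longlonglongrightarrow> p * lim_tail x" by simp
  have "\<forall>\<^sub>F n in sequentially. real n * expectation (\<lambda>z. min ((z / a n)\<^sup>2) 1 * indicator {x<..} (z / a n)) = measure (G n) {x<..}"
    using norming(3)
  proof eventually_elim
    fix n assume n: "real n * tail.U (a n) = (a n)\<^sup>2"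
    have "measure (G n) {x<..} = expectation (\<lambda>z. (real n * min ((z / a n)\<^sup>2) 1) *\<^sub>R indicator {x<..} (z / a n))"
      by (subst m, simp, rule integral_G[OF n]) simp
    thus "real n * expectation (\<lambda>z. min ((z / a n)\<^sup>2) 1 * indicator {x<..} (z / a n)) = measure (G n) {x<..}"
      by (simp add: mult.assoc)
  qed
  from Lim_transform_eventually[OF 1 this] show "(\<lambda>n. measure (G n) {x<..}) \<longlonglongrightarrow> p * lim_tail x" .
  have "{z \<in> space D. u < - z} = {..<-u}" for u by auto
  hence "tail.dominated_tail (\<lambda>u. prob {z \<in> space D. u < - z}) (1 - p)" using dominated_Tm by simp
  from weighted_tail_limit[OF _ this x]
  have 2: "(\<lambda>n. real n * expectation (\<lambda>z. min ((- z / a n)\<^sup>2) 1 * indicator {x<..} (- z / a n))) \<longlonglongrightarrow> (1 - p) * lim_tail x" by simp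
  have ind: "indicator {x<..} (- (z / a n)) = (indicator {..<-x} (z / a n) :: real)" for z n by (auto simp: indicator_def)
  have "\<forall>\<^sub>F n in sequentially. real n * expectation (\<lambda>z. min ((- z / a n)\<^sup>2) 1 * indicator {x<..} (- z / a n)) = measure (G n) {..<-x}"
    using norming(3)
  proof eventually_elim
    fix n assume n: "real n * tail.U (a n) = (a n)\<^sup>2"
    have "measure (G n) {..<-x} = expectation (\<lambda>z. (real n * min ((z / a n)\<^sup>2) 1) *\<^sub>R indicator {..<-x} (z / a n))"
      by (subst m, simp, rule integral_G[OF n]) simp
    thus "real n * expectation (\<lambda>z. min ((- z / a n)\<^sup>2) 1 * indicator {x<..} (- z / a n)) = measure (G n) {..<-x}"
      by (simp add: mult.assoc ind)
  qed
  from Lim_transform_eventually[OF 2 this] show "(\<lambda>n. measure (G n) {..<-x}) \<longlonglongrightarrow> (1 - p) * lim_tail x" .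
qed

end

text \<open>The integrand of the Levy-Khinchin formula, centered by the sine and divided by \<open>min(x\<^sup>2, 1)\<close>
  to make it bounded and continuous.\<close>
definition kern :: "real \<Rightarrow> real \<Rightarrow> complex" where
  "kern t x = (if x = 0 then - of_real (t\<^sup>2 / 2) else (iexp (t * x) - 1 - \<i> * of_real (t * sin x)) / of_real (min (x\<^sup>2) 1))"

lemma abs_sin_diff_le: "\<bar>x - sin x\<bar> \<le> \<bar>x\<bar> ^ 3 / 6" for x :: real
proof -
  have "\<bar>Im (iexp x - (\<Sum>k\<le>2. (\<i> * x) ^ k / fact k))\<bar> \<le> \<bar>x\<bar> ^ Suc 2 / fact (Suc 2)"
    by (rule order_trans[OF abs_Im_le_cmod iexp_approx1])
  moreover have "Im (iexp x - (\<Sum>k\<le>2. (\<i> * x) ^ k / fact k)) = sin x - x"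
    by (simp add: numeral_2_eq_2 Im_exp power2_eq_square)
  ultimately show ?thesis by (simp add: abs_minus_commute fact_numeral eval_nat_numeral)
qed

lemma kern_times: "of_real (min (x\<^sup>2) 1) * kern t x = iexp (t * x) - 1 - \<i> * of_real (t * sin x)"
  by (auto simp: kern_def min_def)

text \<open>After multiplication by \<open>x^2\<close> only the third-order Taylor remainders of the
  exponential and the sine are left. This yields boundedness of \<open>kern t\<close> near 0 and
  identifies its continuous value there.\<close>

lemma kern_taylor:
  assumes "x \<noteq> 0" "\<bar>x\<bar> \<le> 1"
  shows "cmod (kern t x + of_real (t\<^sup>2 / 2)) \<le> (\<bar>t\<bar> ^ 3 / 6 + \<bar>t\<bar> / 6) * \<bar>x\<bar>"
proof -
  have x2: "x\<^sup>2 \<le> 1" using assms by (simp add: abs_square_le_1)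
  have "of_real (x\<^sup>2) * (kern t x + of_real (t\<^sup>2 / 2)) = (iexp (t * x) - (\<Sum>k\<le>2. (\<i> * (t * x)) ^ k / fact k)) + \<i> * of_real (t * (x - sin x))"
    using kern_times[of x t] x2 by (simp add: min_absorb1 distrib_left numeral_2_eq_2 power2_eq_square algebra_simps)
  hence "cmod (of_real (x\<^sup>2) * (kern t x + of_real (t\<^sup>2 / 2))) \<le> cmod (iexp (t * x) - (\<Sum>k\<le>2. (\<i> * (t * x)) ^ k / fact k)) + cmod (\<i> * of_real (t * (x - sin x)))"
    by (simp only: norm_triangle_ineq)
  also have "cmod (iexp (t * x) - (\<Sum>k\<le>2. (\<i> * (t * x)) ^ k / fact k)) \<le> \<bar>t * x\<bar> ^ 3 / 6"
    using iexp_approx1[of "t * x" 2] by (simp add: fact_numeral eval_nat_numeral)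
  also have "cmod (\<i> * of_real (t * (x - sin x))) = \<bar>t\<bar> * \<bar>x - sin x\<bar>"
    by (simp add: norm_mult abs_mult del: of_real_mult of_real_diff)
  also have "\<dots> \<le> \<bar>t\<bar> * (\<bar>x\<bar> ^ 3 / 6)" by (intro mult_left_mono abs_sin_diff_le) simp
  finally have "cmod (of_real (x\<^sup>2) * (kern t x + of_real (t\<^sup>2 / 2))) \<le> \<bar>t * x\<bar> ^ 3 / 6 + \<bar>t\<bar> * (\<bar>x\<bar> ^ 3 / 6)" by simp
  moreover have "cmod (of_real (x\<^sup>2) * (kern t x + of_real (t\<^sup>2 / 2))) = x\<^sup>2 * cmod (kern t x + of_real (t\<^sup>2 / 2))"
    by (simp only: norm_mult norm_of_real abs_power2)
  moreover have "\<bar>t * x\<bar> ^ 3 / 6 + \<bar>t\<bar> * (\<bar>x\<bar> ^ 3 / 6) = \<bar>x\<bar>\<^sup>2 * ((\<bar>t\<bar> ^ 3 / 6 + \<bar>t\<bar> / 6) * \<bar>x\<bar>)"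
  proof -
    have "(v * w) ^ 3 / 6 + v * (w ^ 3 / 6) = w\<^sup>2 * ((v ^ 3 / 6 + v / 6) * w)" for v w :: real
      by (simp add: field_simps power3_eq_cube power2_eq_square)
    thus ?thesis by (simp only: abs_mult)
  qed
  ultimately have "x\<^sup>2 * cmod (kern t x + of_real (t\<^sup>2 / 2)) \<le> x\<^sup>2 * ((\<bar>t\<bar> ^ 3 / 6 + \<bar>t\<bar> / 6) * \<bar>x\<bar>)"
    by (simp only: power2_abs)
  thus ?thesis using assms by (simp add: mult_le_cancel_left)
qed

lemma kern_bound: "cmod (kern t x) \<le> \<bar>t\<bar> ^ 3 + t\<^sup>2 + \<bar>t\<bar> + 2"
proof -
  have nn: "0 \<le> \<bar>t\<bar> ^ 3" "0 \<le> t\<^sup>2" "0 \<le> \<bar>t\<bar>" by auto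
  consider "x = 0" | "x \<noteq> 0" "\<bar>x\<bar> \<le> 1" | "1 < \<bar>x\<bar>" by linarith
  thus ?thesis
  proof cases
    case 1
    have "cmod (kern t x) = t\<^sup>2 / 2" using 1 by (simp add: kern_def norm_divide norm_power)
    thus ?thesis using nn by linarith
  next
    case 2
    have 1: "cmod (kern t x) \<le> cmod (kern t x + of_real (t\<^sup>2 / 2)) + cmod (of_real (t\<^sup>2 / 2) :: complex)"
      using norm_triangle_ineq4[of "kern t x + of_real (t\<^sup>2 / 2)" "of_real (t\<^sup>2 / 2)"] by simp
    have 3: "cmod (of_real (t\<^sup>2 / 2) :: complex) = t\<^sup>2 / 2" by (simp only: norm_of_real) simp
    have 4: "cmod (kern t x + of_real (t\<^sup>2 / 2)) \<le> (\<bar>t\<bar> ^ 3 / 6 + \<bar>t\<bar> / 6) * 1"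
      by (rule order_trans[OF kern_taylor[OF 2]]) (use 2 nn in \<open>intro mult_left_mono, auto\<close>)
    have "k \<le> c + b + a + 2" if "k \<le> w + b / 2" "w \<le> (c / 6 + a / 6) * 1" "0 \<le> c" "0 \<le> b" "0 \<le> a" for k w a b c :: real
      using that by simp
    from this[OF 1[unfolded 3] 4 nn] show ?thesis .
  next
    case 3
    hence "1 \<le> x\<^sup>2" by (metis abs_le_square_iff abs_one less_imp_le one_power2)
    hence "kern t x = iexp (t * x) - 1 - \<i> * of_real (t * sin x)" using kern_times[of x t] by (simp add: min_absorb2)
    hence "cmod (kern t x) \<le> cmod (iexp (t * x)) + cmod 1 + cmod (\<i> * of_real (t * sin x))"
      by (metis norm_triangle_ineq4 add_right_mono order_trans)
    also have "\<dots> \<le> 1 + 1 + \<bar>t\<bar>" by (simp add: norm_mult abs_mult mult_left_le)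
    finally show ?thesis using nn by linarith
  qed
qed

lemma kern_isCont: "isCont (kern t) x"
proof (cases "x = 0")
  case True
  have "((\<lambda>y. kern t y + of_real (t\<^sup>2 / 2)) \<longlongrightarrow> 0) (at 0)"
  proof (rule Lim_null_comparison)
    show "\<forall>\<^sub>F y in at 0. norm (kern t y + of_real (t\<^sup>2 / 2)) \<le> (\<bar>t\<bar> ^ 3 / 6 + \<bar>t\<bar> / 6) * \<bar>y\<bar>"
      unfolding eventually_at using kern_taylor by (intro exI[of _ 1]) (auto simp: dist_real_def)
    show "((\<lambda>y. (\<bar>t\<bar> ^ 3 / 6 + \<bar>t\<bar> / 6) * \<bar>y\<bar>) \<longlongrightarrow> 0) (at 0)" by (auto intro!: tendsto_eq_intros)
  qed
  from tendsto_diff[OF this tendsto_const[of "of_real (t\<^sup>2 / 2)"]]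
  have "(kern t \<longlongrightarrow> - of_real (t\<^sup>2 / 2)) (at 0)" by simp
  thus ?thesis using True by (simp add: isCont_def kern_def)
next
  case False
  have "isCont (\<lambda>x. (iexp (t * x) - 1 - \<i> * of_real (t * sin x)) / of_real (min (x\<^sup>2) 1)) x"
    using False by (intro continuous_intros) (auto simp: min_def)
  moreover have "\<forall>\<^sub>F y in nhds x. kern t y = (iexp (t * y) - 1 - \<i> * of_real (t * sin y)) / of_real (min (y\<^sup>2) 1)"
    using t1_space_nhds[OF False] by eventually_elim (simp add: kern_def)
  ultimately show ?thesis by (simp add: isCont_cong)
qed

lemma kern_measurable [measurable]: "kern t \<in> borel_measurable borel"
  by (intro borel_measurable_continuous_onI continuous_at_imp_continuous_on ballI kern_isCont)

section \<open>The limit measure and the characteristic exponent\<close>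

context stable_domain
begin

text \<open>The symmetric stable Levy density
  \<open>kap * \<alpha> * \<bar>y\<bar> powr (- 1 - \<alpha>)\<close>, weighted as the measures
  \<open>G n\<close> are. For \<alpha> < 2 each half-line gets mass 1, so that skewness can be added
  by the weights p and 1 - p.\<close>

definition \<Lambda> :: "real measure" where
  "\<Lambda> = density lborel (\<lambda>y. ennreal (kap * \<alpha> * (min (y\<^sup>2) 1 * \<bar>y\<bar> powr (- 1 - \<alpha>))))"

lemma sets_Lambda [simp, measurable_cong]: "sets \<Lambda> = sets borel" and space_Lambda [simp]: "space \<Lambda> = UNIV"
  by (auto simp: \<Lambda>_def)

lemma kap_nonneg: "0 \<le> kap" using tail.alpha by (simp add: kap_def)

lemma lim_tail_ge_1: "1 \<le> x \<Longrightarrow> lim_tail x = kap * x powr - \<alpha>"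
  by (simp add: lim_tail_def set_lebesgue_integral_def)

lemma lim_tail_le_1:
  assumes "0 < x" "x \<le> 1" "\<alpha> < 2"
  shows "lim_tail x = 1 - \<alpha> / 2 * x powr (2 - \<alpha>)"
proof -
  have "x\<^sup>2 * x powr - \<alpha> = x powr (2 - \<alpha>)"
    using assms powr_add[of x 2 "- \<alpha>"] by simp
  hence "lim_tail x = kap * (x powr (2 - \<alpha>) + 2 * (1 - x powr (2 - \<alpha>)) / (2 - \<alpha>))"
    using assms tail.integral_powr_Ioc[of x] by (simp add: lim_tail_def min_absorb1)
  also have "\<dots> = 1 - \<alpha> / 2 * x powr (2 - \<alpha>)"
    using assms unfolding kap_def by (simp add: field_simps)
  finally show ?thesis .
qed

lemma emeasure_Lambda_right_ge_1:
  assumes x: "1 \<le> x" shows "emeasure \<Lambda> {x<..} = ennreal (lim_tail x)"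
proof -
  have "emeasure \<Lambda> {x<..} = (\<integral>\<^sup>+y. ennreal (kap * \<alpha> * (min (y\<^sup>2) 1 * \<bar>y\<bar> powr (- 1 - \<alpha>))) * indicator {x<..} y \<partial>lborel)"
    unfolding \<Lambda>_def by (subst emeasure_density) auto
  also have "\<dots> = (\<integral>\<^sup>+y. ennreal (kap * \<alpha> * y powr (- 1 - \<alpha>)) * indicator {x..} y \<partial>lborel)"
  proof (rule nn_integral_cong_AE)
    have "AE y in lborel. y \<noteq> x" by (rule AE_lborel_singleton)
    thus "AE y in lborel. ennreal (kap * \<alpha> * (min (y\<^sup>2) 1 * \<bar>y\<bar> powr (- 1 - \<alpha>))) * indicator {x<..} y = ennreal (kap * \<alpha> * y powr (- 1 - \<alpha>)) * indicator {x..} y"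
    proof eventually_elim
      fix y assume "y \<noteq> x"
      show "ennreal (kap * \<alpha> * (min (y\<^sup>2) 1 * \<bar>y\<bar> powr (- 1 - \<alpha>))) * indicator {x<..} y = ennreal (kap * \<alpha> * y powr (- 1 - \<alpha>)) * indicator {x..} y"
      proof (cases "x < y")
        case True
        hence "1 \<le> y" using x by simp
        hence "1 \<le> y\<^sup>2" by (simp add: one_le_power)
        thus ?thesis using True \<open>1 \<le> y\<close> by (simp add: min_absorb2)
      qed (use \<open>y \<noteq> x\<close> in auto)
    qed
  qed
  also have "\<dots> = ennreal (0 - (- (kap * x powr - \<alpha>)))"
  proof (rule nn_integral_FTC_atLeast)
    fix y assume y: "x \<le> y"
    hence y0: "0 < y" using x by simp
    have "((\<lambda>y. - kap * y powr - \<alpha>) has_real_derivative - kap * (- \<alpha> * y powr (- \<alpha> - 1))) (at y)"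
      by (intro DERIV_cmult has_real_derivative_powr y0)
    moreover have "- \<alpha> - 1 = - 1 - \<alpha>" by simp
    ultimately show "((\<lambda>y. - (kap * y powr - \<alpha>)) has_real_derivative kap * \<alpha> * y powr (- 1 - \<alpha>)) (at y)"
      by (simp only: mult_minus_left mult_minus_right minus_minus mult.assoc)
    show "0 \<le> kap * \<alpha> * y powr (- 1 - \<alpha>)" using kap_nonneg tail.alpha by simp
  next
    have "((\<lambda>y. y powr - \<alpha>) \<longlongrightarrow> 0) at_top" using tail.alpha by (intro tendsto_neg_powr filterlim_ident) auto
    from tendsto_minus[OF tendsto_mult_left[OF this, of kap]]
    show "((\<lambda>y. - (kap * y powr - \<alpha>)) \<longlongrightarrow> 0) at_top" by simp
  qed measurable
  finally show ?thesis using x by (simp add: lim_tail_ge_1)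
qed

lemma emeasure_Lambda_right:
  assumes x: "0 < x" and a2: "\<alpha> < 2" shows "emeasure \<Lambda> {x<..} = ennreal (lim_tail x)"
proof (cases "1 \<le> x")
  case False
  have "{x<..} = {x<..1} \<union> {1<..}" using False by auto
  hence "emeasure \<Lambda> {x<..} = emeasure \<Lambda> ({x<..1} \<union> {1<..})" by (simp only:)
  also have "\<dots> = emeasure \<Lambda> {x<..1} + emeasure \<Lambda> {1<..}" by (rule plus_emeasure[symmetric]) auto
  also have "emeasure \<Lambda> {1<..} = ennreal kap" by (simp add: emeasure_Lambda_right_ge_1 lim_tail_ge_1)
  also have "emeasure \<Lambda> {x<..1} = ennreal (\<alpha> / 2 * 1 powr (2 - \<alpha>) - \<alpha> / 2 * x powr (2 - \<alpha>))"
  proof -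
    have "emeasure \<Lambda> {x<..1} = (\<integral>\<^sup>+y. ennreal (kap * \<alpha> * (min (y\<^sup>2) 1 * \<bar>y\<bar> powr (- 1 - \<alpha>))) * indicator {x<..1} y \<partial>lborel)"
      unfolding \<Lambda>_def by (subst emeasure_density) auto
    also have "\<dots> = (\<integral>\<^sup>+y. ennreal (kap * \<alpha> * y powr (1 - \<alpha>)) * indicator {x..1} y \<partial>lborel)"
    proof (rule nn_integral_cong_AE)
      have "AE y in lborel. y \<noteq> x" by (rule AE_lborel_singleton)
      thus "AE y in lborel. ennreal (kap * \<alpha> * (min (y\<^sup>2) 1 * \<bar>y\<bar> powr (- 1 - \<alpha>))) * indicator {x<..1} y = ennreal (kap * \<alpha> * y powr (1 - \<alpha>)) * indicator {x..1} y"
      proof eventually_elim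
        fix y assume "y \<noteq> x"
        show "ennreal (kap * \<alpha> * (min (y\<^sup>2) 1 * \<bar>y\<bar> powr (- 1 - \<alpha>))) * indicator {x<..1} y = ennreal (kap * \<alpha> * y powr (1 - \<alpha>)) * indicator {x..1} y"
        proof (cases "x < y \<and> y \<le> 1")
          case True
          hence y: "0 < y" "y \<le> 1" using x by auto
          hence "min (y\<^sup>2) 1 = y\<^sup>2" by (simp add: power_le_one min_absorb1)
          moreover have "y\<^sup>2 * y powr (- 1 - \<alpha>) = y powr (1 - \<alpha>)" using y powr_add[of y 2 "- 1 - \<alpha>"] by simp
          ultimately show ?thesis using True y by simp
        qed (use \<open>y \<noteq> x\<close> in \<open>auto simp: indicator_def\<close>)
      qed
    qed
    also have "\<dots> = ennreal (\<alpha> / 2 * 1 powr (2 - \<alpha>) - \<alpha> / 2 * x powr (2 - \<alpha>))"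
    proof (rule nn_integral_FTC_Icc)
      fix y assume "y \<in> {x..1}"
      hence y0: "0 < y" using x by simp
      have "((\<lambda>y. \<alpha> / 2 * y powr (2 - \<alpha>)) has_real_derivative \<alpha> / 2 * ((2 - \<alpha>) * y powr (2 - \<alpha> - 1))) (at y)"
        by (intro DERIV_cmult has_real_derivative_powr y0)
      moreover have "\<alpha> / 2 * ((2 - \<alpha>) * y powr (2 - \<alpha> - 1)) = kap * \<alpha> * y powr (1 - \<alpha>)" by (simp add: kap_def)
      ultimately show "((\<lambda>y. \<alpha> / 2 * y powr (2 - \<alpha>)) has_real_derivative kap * \<alpha> * y powr (1 - \<alpha>)) (at y)" by (simp only:)
      show "0 \<le> kap * \<alpha> * y powr (1 - \<alpha>)" using kap_nonneg tail.alpha by simp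
    qed (use False in auto)
    finally show ?thesis .
  qed
  also have "ennreal (\<alpha> / 2 * 1 powr (2 - \<alpha>) - \<alpha> / 2 * x powr (2 - \<alpha>)) + ennreal kap = ennreal (lim_tail x)"
  proof -
    have "x powr (2 - \<alpha>) \<le> 1 powr (2 - \<alpha>)" using False x a2 by (intro powr_mono2) auto
    hence "0 \<le> \<alpha> / 2 * (1 powr (2 - \<alpha>) - x powr (2 - \<alpha>))" using tail.alpha by simp
    hence "0 \<le> \<alpha> / 2 * 1 powr (2 - \<alpha>) - \<alpha> / 2 * x powr (2 - \<alpha>)" by (simp add: right_diff_distrib)
    moreover have "lim_tail x = (\<alpha> / 2 * 1 powr (2 - \<alpha>) - \<alpha> / 2 * x powr (2 - \<alpha>)) + kap"
      using False x a2 by (simp add: lim_tail_le_1 kap_def field_simps)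
    ultimately show ?thesis using kap_nonneg by (simp add: ennreal_plus[symmetric] del: ennreal_plus)
  qed
  finally show ?thesis .
qed (rule emeasure_Lambda_right_ge_1)

lemma emeasure_Lambda_left: "emeasure \<Lambda> {..<-x} = emeasure \<Lambda> {x<..}"
proof -
  have "emeasure \<Lambda> {..<-x} = (\<integral>\<^sup>+y. ennreal (kap * \<alpha> * (min (y\<^sup>2) 1 * \<bar>y\<bar> powr (- 1 - \<alpha>))) * indicator {..<-x} y \<partial>lborel)"
    unfolding \<Lambda>_def by (subst emeasure_density) auto
  also have "\<dots> = ennreal \<bar>-1\<bar> * (\<integral>\<^sup>+y. ennreal (kap * \<alpha> * (min ((0 + (-1) * y)\<^sup>2) 1 * \<bar>0 + (-1) * y\<bar> powr (- 1 - \<alpha>))) * indicator {..<-x} (0 + (-1) * y) \<partial>lborel)"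
    by (rule nn_integral_real_affine) auto
  also have "\<dots> = (\<integral>\<^sup>+y. ennreal (kap * \<alpha> * (min (y\<^sup>2) 1 * \<bar>y\<bar> powr (- 1 - \<alpha>))) * indicator {x<..} y \<partial>lborel)"
    by (simp add: indicator_def cong: if_cong)
  also have "\<dots> = emeasure \<Lambda> {x<..}" unfolding \<Lambda>_def by (subst emeasure_density) auto
  finally show ?thesis .
qed

text \<open>As x decreases to 0, the tail \<open>1 - \<alpha> / 2 * x powr (2 - \<alpha>)\<close>
  increases to 1.\<close>

lemma emeasure_Lambda_half:
  assumes a2: "\<alpha> < 2" shows "emeasure \<Lambda> {0<..} = 1" "emeasure \<Lambda> {..<0} = 1"
proof -
  have "(\<lambda>n. emeasure \<Lambda> {1 / real (Suc n)<..}) \<longlonglongrightarrow> emeasure \<Lambda> (\<Union>n. {1 / real (Suc n)<..})"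
    by (rule Lim_emeasure_incseq) (auto simp: incseq_def field_simps)
  moreover have "(\<Union>n. {1 / real (Suc n)<..}) = {0<..}"
  proof safe
    fix x :: real assume "0 < x"
    then obtain n where "inverse (real (Suc n)) < x" using reals_Archimedean by blast
    thus "x \<in> (\<Union>n. {1 / real (Suc n)<..})" by (auto simp: inverse_eq_divide)
  next
    fix x :: real and n :: nat assume "1 / real (Suc n) < x"
    moreover have "0 < 1 / real (Suc n)" by simp
    ultimately show "0 < x" by linarith
  qed
  ultimately have 1: "(\<lambda>n. emeasure \<Lambda> {1 / real (Suc n)<..}) \<longlonglongrightarrow> emeasure \<Lambda> {0<..}" by (simp only:)
  have "(\<lambda>n. (1 / real (Suc n)) powr (2 - \<alpha>)) \<longlonglongrightarrow> 0 powr (2 - \<alpha>)"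
    by (rule tendsto_powr') (use a2 LIMSEQ_inverse_real_of_nat in \<open>auto simp: inverse_eq_divide intro: always_eventually\<close>)
  hence "(\<lambda>n. 1 - \<alpha> / 2 * (1 / real (Suc n)) powr (2 - \<alpha>)) \<longlonglongrightarrow> 1 - \<alpha> / 2 * 0" by (intro tendsto_intros) simp
  hence "(\<lambda>n. lim_tail (1 / real (Suc n))) \<longlonglongrightarrow> 1" using a2 by (simp add: lim_tail_le_1)
  from tendsto_ennrealI[OF this] have "(\<lambda>n. emeasure \<Lambda> {1 / real (Suc n)<..}) \<longlonglongrightarrow> ennreal 1"
    using emeasure_Lambda_right[OF _ a2, of "1 / real (Suc _)"] by simp
  from LIMSEQ_unique[OF 1 this] show "emeasure \<Lambda> {0<..} = 1" by simp
  thus "emeasure \<Lambda> {..<0} = 1" using emeasure_Lambda_left[of 0] by simp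
qed

text \<open>For \<alpha> = 2 the tails of \<open>G n\<close> vanish, as \<open>kap = 0\<close>, and
  all mass collects at 0, where \<open>kern t\<close> has the value \<open>- t^2 / 2\<close> of the
  Gaussian exponent.\<close>

definition Glim :: "real measure" where
  "Glim = (if \<alpha> = 2 then return borel 0 else density \<Lambda> (\<lambda>x. ennreal (if 0 < x then p else 1 - p)))"

lemma emeasure_Glim:
  assumes a2: "\<alpha> < 2" and A: "A \<in> sets borel"
  shows "emeasure Glim A = ennreal p * emeasure \<Lambda> (A \<inter> {0<..}) + ennreal (1 - p) * emeasure \<Lambda> (A \<inter> {..<0})"
proof -
  have "emeasure Glim A = (\<integral>\<^sup>+x. ennreal (if 0 < x then p else 1 - p) * indicator A x \<partial>\<Lambda>)"
    using a2 A unfolding Glim_def by (simp add: emeasure_density)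
  also have "\<dots> = (\<integral>\<^sup>+x. ennreal p * indicator (A \<inter> {0<..}) x + ennreal (1 - p) * indicator (A \<inter> {..<0}) x \<partial>\<Lambda>)"
  proof (rule nn_integral_cong_AE)
    have "AE x in lborel. x \<noteq> (0::real)" by (rule AE_lborel_singleton)
    hence "AE x in \<Lambda>. x \<noteq> 0" unfolding \<Lambda>_def by (subst AE_density) auto
    thus "AE x in \<Lambda>. ennreal (if 0 < x then p else 1 - p) * indicator A x = ennreal p * indicator (A \<inter> {0<..}) x + ennreal (1 - p) * indicator (A \<inter> {..<0}) x"
      by eventually_elim (auto simp: indicator_def)
  qed
  also have "\<dots> = ennreal p * emeasure \<Lambda> (A \<inter> {0<..}) + ennreal (1 - p) * emeasure \<Lambda> (A \<inter> {..<0})"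
    using A by (subst nn_integral_add) (auto simp: nn_integral_cmult_indicator)
  finally show ?thesis .
qed

lemma real_distribution_Glim: "real_distribution Glim"
proof (cases "\<alpha> = 2")
  case True
  have "Glim = return borel 0" unfolding Glim_def by (rule if_P[OF True])
  thus ?thesis by (simp add: real_distribution_def real_distribution_axioms_def prob_space_return)
next
  case False
  hence a2: "\<alpha> < 2" using tail.alpha by simp
  have "emeasure Glim (space Glim) = 1"
    using emeasure_Glim[OF a2, of UNIV] False p_bounds
    by (simp add: Glim_def emeasure_Lambda_half[OF a2] ennreal_plus[symmetric] del: ennreal_plus)
  thus ?thesis using False by (auto simp: real_distribution_def real_distribution_axioms_def Glim_def intro: prob_spaceI)
qed

lemma Glim_tails:
  assumes x: "0 < x"
  shows "measure Glim {x<..} = p * lim_tail x" "measure Glim {..<-x} = (1 - p) * lim_tail x"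
proof -
  have "measure Glim {x<..} = p * lim_tail x \<and> measure Glim {..<-x} = (1 - p) * lim_tail x"
  proof (cases "\<alpha> = 2")
    case True
    have G: "Glim = return borel 0" unfolding Glim_def by (rule if_P[OF True])
    have "kap = 0" unfolding kap_def using True by simp
    hence "lim_tail x = 0" unfolding lim_tail_def by simp
    thus ?thesis unfolding G using x by (simp add: measure_return)
  next
    case False
    hence a2: "\<alpha> < 2" using tail.alpha by simp
    have s: "{x<..} \<inter> {0<..} = {x<..}" "{x<..} \<inter> {..<0} = {}" "{..<-x} \<inter> {0<..} = {}" "{..<-x} \<inter> {..<0} = {..<-x}" using x by auto
    have t0: "0 \<le> lim_tail x"
    proof (cases "1 \<le> x")
      case True thus ?thesis using kap_nonneg by (simp add: lim_tail_ge_1)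
    next
      case False
      have "x powr (2 - \<alpha>) \<le> 1 powr (2 - \<alpha>)" using False x a2 by (intro powr_mono2) auto
      hence "\<alpha> / 2 * x powr (2 - \<alpha>) \<le> 1 * 1" using tail.alpha by (intro mult_mono) auto
      thus ?thesis using False x a2 by (simp add: lim_tail_le_1)
    qed
    show ?thesis using emeasure_Glim[OF a2, of "{x<..}"] emeasure_Glim[OF a2, of "{..<-x}"] p_bounds t0
      by (simp add: s emeasure_Lambda_left emeasure_Lambda_right[OF x a2] measure_def ennreal_mult'[symmetric])
  qed
  thus "measure Glim {x<..} = p * lim_tail x" "measure Glim {..<-x} = (1 - p) * lim_tail x" by auto
qed

lemma weak_conv_G: "weak_conv_m G Glim"
  by (rule weak_conv_m_of_tails[OF real_distribution_G real_distribution_Glim])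
     (use G_tails Glim_tails in auto)

text \<open>The Levy-Khinchin integral of the limit law, with the weight \<open>min (x^2) 1\<close>
  moved from the kernel into the measure.\<close>

definition \<psi> :: "real \<Rightarrow> complex" where "\<psi> t = (CLINT x|Glim. kern t x)"

lemma integral_kern_G_limit: "(\<lambda>n. CLINT x|G n. kern t x) \<longlonglongrightarrow> \<psi> t"
  unfolding \<psi>_def
  by (rule weak_conv_imp_integral_bdd_continuous_conv[OF real_distribution_G real_distribution_Glim weak_conv_G kern_isCont kern_bound])

lemma \<psi>_isCont_0: "isCont \<psi> 0"
  unfolding continuous_at_sequentially
proof safe
  fix u assume u: "u \<longlonglongrightarrow> (0::real)"
  interpret Glim: real_distribution Glim by (rule real_distribution_Glim)
  from u have "Bseq u" by (rule convergent_imp_Bseq[OF convergentI])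
  then obtain B where B: "\<And>n. \<bar>u n\<bar> \<le> B" unfolding Bseq_def by auto
  show "(\<psi> \<circ> u) \<longlonglongrightarrow> \<psi> 0"
    unfolding \<psi>_def comp_def
  proof (rule integral_dominated_convergence[where w="\<lambda>_. B ^ 3 + B\<^sup>2 + B + 2"])
    show "AE x in Glim. (\<lambda>n. kern (u n) x) \<longlonglongrightarrow> kern 0 x"
    proof (rule AE_I2)
      fix x
      show "(\<lambda>n. kern (u n) x) \<longlonglongrightarrow> kern 0 x"
      proof (cases "x = 0")
        case True
        have "(\<lambda>n. - of_real ((u n)\<^sup>2 / 2)) \<longlonglongrightarrow> (- of_real (0\<^sup>2 / 2) :: complex)" by (intro tendsto_intros u) auto
        thus ?thesis using True by (simp add: kern_def)
      next
        case False
        have "(\<lambda>n. (iexp (u n * x) - 1 - \<i> * of_real (u n * sin x)) / of_real (min (x\<^sup>2) 1)) \<longlonglongrightarrow>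
           (iexp (0 * x) - 1 - \<i> * of_real (0 * sin x)) / of_real (min (x\<^sup>2) 1)"
          using False by (intro tendsto_intros u) (auto simp: min_def)
        thus ?thesis using False by (simp add: kern_def)
      qed
    qed
    show "AE x in Glim. norm (kern (u n) x) \<le> B ^ 3 + B\<^sup>2 + B + 2" for n
    proof (rule AE_I2)
      fix x
      have "\<bar>u n\<bar> ^ 3 \<le> B ^ 3" "\<bar>u n\<bar>\<^sup>2 \<le> B\<^sup>2" by (intro power_mono B abs_ge_zero)+
      hence "\<bar>u n\<bar> ^ 3 + (u n)\<^sup>2 + \<bar>u n\<bar> + 2 \<le> B ^ 3 + B\<^sup>2 + B + 2" using B[of n]
        by (intro add_mono order_refl) (simp_all only: power2_abs)
      with kern_bound show "norm (kern (u n) x) \<le> B ^ 3 + B\<^sup>2 + B + 2" by (rule order_trans)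
    qed
    show "kern 0 \<in> borel_measurable Glim" "kern (u n) \<in> borel_measurable Glim" for n
      using kern_measurable by (simp_all add: measurable_cong_sets[OF Glim.events_eq_borel refl])
  qed simp
qed

text \<open>The sine replaces the identity so that the mean exists for every \<alpha>; near 0 it
  cancels the linear term of the exponential.\<close>

definition centering :: "nat \<Rightarrow> real" where "centering n = expectation (\<lambda>z. sin (z / a n))"

text \<open>An exact identity: the weight in \<open>G n\<close> cancels the denominator of
  \<open>kern\<close>. Thus weak convergence of \<open>G n\<close> yields the expansion of the
  characteristic function.\<close>

lemma char_expansion:
  assumes n: "real n * tail.U (a n) = (a n)\<^sup>2"
  shows "of_nat n * (char D (t / a n) - 1 - \<i> * of_real (t * centering n)) = (CLINT x|G n. kern t x)"
proof -
  have "(CLINT x|G n. kern t x) = (CLINT z|D. (real n * min ((z / a n)\<^sup>2) 1) *\<^sub>R kern t (z / a n))"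
    by (rule integral_G[OF n]) measurable
  also have "(\<lambda>z. (real n * min ((z / a n)\<^sup>2) 1) *\<^sub>R kern t (z / a n))
     = (\<lambda>z. of_nat n * (iexp (t / a n * z) - 1 - \<i> * of_real (t * sin (z / a n))))"
  proof
    fix z
    have "(real n * min ((z / a n)\<^sup>2) 1) *\<^sub>R kern t (z / a n) = of_nat n * (of_real (min ((z / a n)\<^sup>2) 1) * kern t (z / a n))"
      by (simp add: scaleR_conv_of_real mult.assoc)
    thus "(real n * min ((z / a n)\<^sup>2) 1) *\<^sub>R kern t (z / a n) = of_nat n * (iexp (t / a n * z) - 1 - \<i> * of_real (t * sin (z / a n)))"
      unfolding kern_times by simp
  qed
  also have "(CLINT z|D. of_nat n * (iexp (t / a n * z) - 1 - \<i> * of_real (t * sin (z / a n))))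
     = of_nat n * (CLINT z|D. iexp (t / a n * z) - 1 - \<i> * of_real (t * sin (z / a n)))" by simp
  also have "(CLINT z|D. iexp (t / a n * z) - 1 - \<i> * of_real (t * sin (z / a n))) = char D (t / a n) - 1 - \<i> * of_real (t * centering n)"
  proof -
    have i1: "complex_integrable D (\<lambda>z. iexp (t / a n * z))" by (rule integrable_const_bound[where B=1]) auto
    have i2: "integrable D (\<lambda>z. sin (z / a n))" by (rule integrable_const_bound[where B=1]) auto
    hence i3: "complex_integrable D (\<lambda>z. \<i> * of_real (t * sin (z / a n)))" by (intro integrable_mult_right integrable_of_real) auto
    have "(CLINT z|D. iexp (t / a n * z) - 1 - \<i> * of_real (t * sin (z / a n)))
      = (CLINT z|D. iexp (t / a n * z)) - (CLINT z|D. 1) - (CLINT z|D. \<i> * of_real (t * sin (z / a n)))"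
      using i1 i3 by (simp only: Bochner_Integration.integral_diff Bochner_Integration.integrable_diff integrable_const)
    moreover have "(CLINT z|D. \<i> * of_real (t * sin (z / a n))) = \<i> * of_real (t * centering n)"
      unfolding centering_def by (simp only: integral_mult_right_zero integral_complex_of_real)
    moreover have "(CLINT z|D. 1) = 1" by (simp add: prob_space[simplified])
    ultimately show ?thesis by (simp add: char_def)
  qed
  finally show ?thesis by simp
qed

text \<open>Needed since exchanging \<open>1 + i * t * c\<close> for its exponential costs order
  \<open>n * c^2\<close>. Below \<open>\<bar>z\<bar> = A\<close> the sine is at most
  \<open>A / a n\<close>; above it Cauchy-Schwarz gives \<open>sqrt (U (a n) * H A) / a n\<close>.
  With the norming equation the total is at most \<open>2 * A^2 * n / (a n)^2 + 2 * H A\<close>,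
  where \<open>H A\<close> is small by choice of \<open>A\<close> and the rest tends to 0.\<close>

lemma n_centering_sq: "(\<lambda>n. real n * (centering n)\<^sup>2) \<longlonglongrightarrow> 0"
proof (rule tendstoI)
  fix \<epsilon> :: real assume e: "0 < \<epsilon>"
  have "\<forall>\<^sub>F A in at_top. H A < \<epsilon> / 4" by (rule order_tendstoD(2)[OF tail.H_lim]) (use e in simp)
  then obtain A where A: "0 < A" "H A < \<epsilon> / 4"
    using eventually_happens'[OF trivial_limit_at_top_linorder eventually_conj[OF _ eventually_gt_at_top[of 0]]] by blast
  have "\<forall>\<^sub>F n in sequentially. 4 * A\<^sup>2 / \<epsilon> + 1 \<le> (a n)\<^sup>2 / real n" using norming_sq_over_n by (simp only: filterlim_at_top)
  thus "\<forall>\<^sub>F n in sequentially. dist (real n * (centering n)\<^sup>2) 0 < \<epsilon>" using norming(3) eventually_gt_at_top[of 0]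
  proof eventually_elim
    fix n :: nat assume nA: "4 * A\<^sup>2 / \<epsilon> + 1 \<le> (a n)\<^sup>2 / real n" and nU: "real n * tail.U (a n) = (a n)\<^sup>2" and n0: "0 < n"
    let ?m = "\<lambda>z. min \<bar>z\<bar> (a n)" and ?I = "indicator {z. A < \<bar>z\<bar>} :: real \<Rightarrow> real"
    have an: "0 < a n" by (rule norming_pos)
    have [measurable]: "{z::real. A < \<bar>z\<bar>} \<in> sets borel" by measurable
    have iI: "integrable D ?I" by (rule integrable_const_bound[where B=1]) auto
    have im2: "integrable D (\<lambda>z. (?m z)\<^sup>2)" by (rule integrable_const_bound[where B="(a n)\<^sup>2"]) (use an in \<open>auto intro!: power_mono\<close>)
    have imI: "integrable D (\<lambda>z. ?m z * ?I z)" by (rule integrable_const_bound[where B="a n"]) (use an in \<open>auto simp: indicator_def\<close>)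
    have pH: "expectation ?I = H A"
    proof -
      have "{z. A < \<bar>z\<bar>} = {A<..} \<union> {..<-A}" using A by auto
      hence "expectation ?I = prob ({A<..} \<union> {..<-A})" by simp
      also have "\<dots> = H A" unfolding H_def using A by (intro finite_measure_Union) auto
      finally show ?thesis .
    qed
    have "\<bar>centering n\<bar> \<le> expectation (\<lambda>z. \<bar>sin (z / a n)\<bar>)" unfolding centering_def by (rule integral_abs_bound)
    also have "\<dots> \<le> expectation (\<lambda>z. A / a n + (?m z * ?I z) / a n)"
    proof (rule integral_mono)
      show "integrable D (\<lambda>z. \<bar>sin (z / a n)\<bar>)" by (rule integrable_const_bound[where B=1]) auto
      show "integrable D (\<lambda>z. A / a n + (?m z * ?I z) / a n)" using imI by auto
      fix z
      have 1: "\<bar>sin (z / a n)\<bar> \<le> \<bar>z\<bar> / a n" using abs_sin_x_le_abs_x[of "z / a n"] an by simp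
      have 2: "\<bar>sin (z / a n)\<bar> \<le> 1" by (rule abs_sin_le_one)
      show "\<bar>sin (z / a n)\<bar> \<le> A / a n + (?m z * ?I z) / a n"
      proof (cases "A < \<bar>z\<bar>")
        case True
        have "\<bar>sin (z / a n)\<bar> \<le> min \<bar>z\<bar> (a n) / a n" using 1 2 an by (simp add: min_def)
        moreover have "0 \<le> A / a n" using A an by simp
        ultimately show ?thesis using True by simp
      next
        case False
        hence "\<bar>z\<bar> / a n \<le> A / a n" using an by (intro divide_right_mono) auto
        thus ?thesis using False 1 by simp
      qed
    qed
    also have "\<dots> = A / a n + expectation (\<lambda>z. ?m z * ?I z) / a n" using imI by (simp add: prob_space[simplified])
    also have "expectation (\<lambda>z. ?m z * ?I z) \<le> sqrt (tail.U (a n)) * sqrt (H A)"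
    proof -
      have sqI: "(\<lambda>z. (?I z)\<^sup>2) = ?I" by (rule ext) (simp add: indicator_def)
      have "\<bar>expectation (\<lambda>z. ?m z * ?I z)\<bar> \<le> sqrt (expectation (\<lambda>z. (?m z)\<^sup>2)) * sqrt (expectation (\<lambda>z. (?I z)\<^sup>2))"
        by (rule expectation_mult_le_sqrt[OF im2 _ imI]) (simp only: sqI iI)
      thus ?thesis using an by (simp only: sqI pH U_eq less_imp_le)
    qed
    finally have c: "\<bar>centering n\<bar> \<le> (A + sqrt (tail.U (a n)) * sqrt (H A)) / a n" using an by (simp add: add_divide_distrib divide_right_mono)
    have U0: "0 \<le> tail.U (a n)" using tail.U_bounds(3)[OF an] by simp
    have H0: "0 \<le> H A" using tail.H_nonneg[OF A(1)] .
    have "(centering n)\<^sup>2 \<le> ((A + sqrt (tail.U (a n)) * sqrt (H A)) / a n)\<^sup>2"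
      using power_mono[OF c, of 2] by simp
    also have "\<dots> \<le> (2 * A\<^sup>2 + 2 * (tail.U (a n) * H A)) / (a n)\<^sup>2"
    proof -
      have "(A + sqrt (tail.U (a n)) * sqrt (H A))\<^sup>2 \<le> 2 * A\<^sup>2 + 2 * (sqrt (tail.U (a n)) * sqrt (H A))\<^sup>2"
        using sum_squares_bound[of A "sqrt (tail.U (a n)) * sqrt (H A)"] by (simp add: power2_sum)
      also have "(sqrt (tail.U (a n)) * sqrt (H A))\<^sup>2 = tail.U (a n) * H A" using U0 H0 by (simp add: power_mult_distrib)
      finally show ?thesis by (simp add: power_divide divide_right_mono)
    qed
    finally have "real n * (centering n)\<^sup>2 \<le> real n * ((2 * A\<^sup>2 + 2 * (tail.U (a n) * H A)) / (a n)\<^sup>2)" by (rule mult_left_mono) simp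
    also have "\<dots> = 2 * A\<^sup>2 * (real n / (a n)\<^sup>2) + 2 * H A"
    proof -
      \<comment> \<open>Here \<open>v\<close> is n and \<open>w\<close> is \<open>U (a n)\<close>,
        whose product is \<open>(a n)^2\<close>.\<close>
      have "v * ((2 * A\<^sup>2 + 2 * (w * h)) / (v * w)) = 2 * A\<^sup>2 * (v / (v * w)) + 2 * h" if "v \<noteq> 0" "w \<noteq> 0" for v w h :: real
        using that by (simp add: field_simps)
      from this[of "real n" "tail.U (a n)" "H A"] show ?thesis using n0 tail.U_bounds(3)[OF an] by (simp add: nU)
    qed
    also have "\<dots> < \<epsilon>"
    proof -
      have "(4 * A\<^sup>2 / \<epsilon> + 1) * real n \<le> (a n)\<^sup>2" using nA n0 by (simp add: field_simps)
      hence "4 * A\<^sup>2 / \<epsilon> * real n \<le> (a n)\<^sup>2" using n0 by (simp add: algebra_simps)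
      hence "2 * A\<^sup>2 * (real n / (a n)\<^sup>2) \<le> \<epsilon> / 2" using e an by (simp add: field_simps)
      thus ?thesis using A(2) by simp
    qed
    finally show "dist (real n * (centering n)\<^sup>2) 0 < \<epsilon>" by simp
  qed
qed

theorem char_power_limit: "(\<lambda>n. (char D (t / a n) * iexp (- (t * centering n))) ^ n) \<longlonglongrightarrow> exp (\<psi> t)"
proof (rule power_tendsto_exp)
  show "norm (char D (t / a n) * iexp (- (t * centering n))) \<le> 1" for n
    using cmod_char_le_1[of "t / a n"] by (simp add: norm_mult del: of_real_minus of_real_mult)
  have c0: "centering \<longlonglongrightarrow> 0"
  proof -
    have "(\<lambda>n. sqrt ((real n * (centering n)\<^sup>2) * inverse (real n))) \<longlonglongrightarrow> sqrt (0 * 0)"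
      by (intro tendsto_intros n_centering_sq lim_inverse_n)
    moreover have "\<forall>\<^sub>F n in sequentially. sqrt ((real n * (centering n)\<^sup>2) * inverse (real n)) = \<bar>centering n\<bar>"
      using eventually_gt_at_top[of 0] by eventually_elim (simp add: field_simps)
    ultimately have "(\<lambda>n. \<bar>centering n\<bar>) \<longlonglongrightarrow> 0" using Lim_transform_eventually by fastforce
    thus ?thesis by (simp add: tendsto_rabs_zero_iff)
  qed
  define E where "E n = iexp (- (t * centering n))" for n
  \<comment> \<open>The product of \<open>1 + i * y\<close> and \<open>exp (- i * y)\<close> agrees
    with 1 to first order in \<open>y = t * centering n\<close>, so \<open>n * R n\<close> is of the
    order of \<open>n * (centering n)^2\<close>.\<close>
  define R where "R n = (1 + \<i> * of_real (t * centering n)) * E n - 1" for n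
  have E1: "E \<longlonglongrightarrow> 1"
  proof -
    have "(\<lambda>n. iexp (- (t * centering n))) \<longlonglongrightarrow> iexp (- (t * 0))" by (intro tendsto_intros c0)
    thus ?thesis unfolding E_def[abs_def] by simp
  qed
  have R0: "(\<lambda>n. of_nat n * R n) \<longlonglongrightarrow> 0"
  proof (rule Lim_null_comparison)
    show "\<forall>\<^sub>F n in sequentially. norm (of_nat n * R n) \<le> t\<^sup>2 / 2 * (real n * (centering n)\<^sup>2)"
    proof (rule always_eventually, rule allI)
      fix n
      let ?y = "t * centering n"
      have "R n = - E n * (iexp ?y - (\<Sum>k\<le>1. (\<i> * ?y) ^ k / fact k))"
        unfolding R_def E_def by (simp add: algebra_simps exp_minus)
      hence "norm (R n) = cmod (iexp ?y - (\<Sum>k\<le>1. (\<i> * ?y) ^ k / fact k))"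
        by (simp add: norm_mult E_def del: of_real_minus of_real_mult)
      also have "\<dots> \<le> \<bar>?y\<bar> ^ Suc 1 / fact (Suc 1)" by (rule iexp_approx1)
      also have "\<bar>?y\<bar> ^ Suc 1 / fact (Suc 1) = \<bar>?y\<bar>\<^sup>2 / 2" by (simp only: Suc_1 fact_2)
      also have "\<dots> = t\<^sup>2 / 2 * (centering n)\<^sup>2" by (simp add: power_mult_distrib)
      finally have "norm (R n) \<le> t\<^sup>2 / 2 * (centering n)\<^sup>2" .
      from mult_left_mono[OF this, of "real n"] show "norm (of_nat n * R n) \<le> t\<^sup>2 / 2 * (real n * (centering n)\<^sup>2)"
        by (simp add: norm_mult mult.left_commute)
    qed
    have "(\<lambda>n. t\<^sup>2 / 2 * (real n * (centering n)\<^sup>2)) \<longlonglongrightarrow> t\<^sup>2 / 2 * 0" by (intro tendsto_intros n_centering_sq)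
    thus "(\<lambda>n. t\<^sup>2 / 2 * (real n * (centering n)\<^sup>2)) \<longlonglongrightarrow> 0" by simp
  qed
  have "(\<lambda>n. of_nat n * R n + (CLINT x|G n. kern t x) * E n) \<longlonglongrightarrow> 0 + \<psi> t * 1"
    by (intro tendsto_intros R0 integral_kern_G_limit E1)
  moreover have "\<forall>\<^sub>F n in sequentially. of_nat n * R n + (CLINT x|G n. kern t x) * E n = of_nat n * (char D (t / a n) * iexp (- (t * centering n)) - 1)"
    using norming(3)
  proof eventually_elim
    fix n assume "real n * tail.U (a n) = (a n)\<^sup>2"
    note eq = char_expansion[OF this, of t, symmetric]
    have "v * ((1 + y) * e - 1) + (v * (c - 1 - y)) * e = v * (c * e - 1)" for v y e c :: complex
      by (simp add: algebra_simps)
    thus "of_nat n * R n + (CLINT x|G n. kern t x) * E n = of_nat n * (char D (t / a n) * iexp (- (t * centering n)) - 1)"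
      unfolding R_def E_def eq .
  qed
  ultimately show "(\<lambda>n. of_nat n * (char D (t / a n) * iexp (- (t * centering n)) - 1)) \<longlonglongrightarrow> \<psi> t"
    using Lim_transform_eventually by fastforce
qed

end

section \<open>Evaluation of the characteristic exponent\<close>

lemma halfline_FTC:
  fixes f F :: "real \<Rightarrow> real"
  assumes F: "\<And>x. 0 < x \<Longrightarrow> (F has_real_derivative f x) (at x)" and f: "\<And>x. 0 < x \<Longrightarrow> isCont f x"
    and int: "set_integrable lborel {0<..} f"
    and A: "(F \<longlongrightarrow> A) (at_right 0)" and B: "(F \<longlongrightarrow> B) at_top"
  shows "(LINT x:{0<..}|lborel. f x) = B - A"
proof -
  have e: "einterval 0 \<infinity> = {0<..}" by (auto simp: einterval_def zero_ereal_def)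
  have "(LBINT x=0..\<infinity>. f x) = B - A"
  proof (rule interval_integral_FTC_integrable[where F=F])
    show "((F \<circ> real_of_ereal) \<longlongrightarrow> A) (at_right 0)" using A by (simp add: zero_ereal_def ereal_tendsto_simps)
    show "((F \<circ> real_of_ereal) \<longlongrightarrow> B) (at_left \<infinity>)" using B by (simp add: ereal_tendsto_simps)
    show "set_integrable lborel (einterval 0 \<infinity>) f" using int by (simp add: e)
  qed (use F f in \<open>auto simp: zero_ereal_def has_real_derivative_iff_has_vector_derivative\<close>)
  thus ?thesis by (simp add: interval_lebesgue_integral_0_infty)
qed

lemma set_integrable_bound_halfline:
  fixes f g :: "real \<Rightarrow> real"
  assumes "set_integrable lborel {0<..} g" "f \<in> borel_measurable borel" "\<And>x. 0 < x \<Longrightarrow> \<bar>f x\<bar> \<le> g x"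
  shows "set_integrable lborel {0<..} f"
  using assms(1) unfolding set_integrable_def
proof (rule Bochner_Integration.integrable_bound)
  show "(\<lambda>x. indicator {0<..} x *\<^sub>R f x) \<in> borel_measurable lborel" using assms(2) by measurable
  show "AE x in lborel. norm (indicator {0<..} x *\<^sub>R f x) \<le> norm (indicator {0<..} x *\<^sub>R g x)"
    using assms(3) by (intro AE_I2) (auto simp: indicator_def intro: order_trans[OF _ abs_ge_self])
qed

lemma laplace_cos_sin:
  fixes s t :: real
  assumes s: "0 < s"
  shows "set_integrable lborel {0<..} (\<lambda>y. exp (- (s * y)) * cos (t * y))"
    and "(LINT y:{0<..}|lborel. exp (- (s * y)) * cos (t * y)) = s / (s\<^sup>2 + t\<^sup>2)"
    and "set_integrable lborel {0<..} (\<lambda>y. exp (- (s * y)) * sin (t * y))"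
    and "(LINT y:{0<..}|lborel. exp (- (s * y)) * sin (t * y)) = t / (s\<^sup>2 + t\<^sup>2)"
proof -
  have e: "set_integrable lborel {0<..} (\<lambda>y. exp (- (s * y)))" using integrable_I0i_exp_mscale[OF s] by (simp add: mult.commute)
  have p: "0 < s\<^sup>2 + t\<^sup>2" using s by (simp add: add_pos_nonneg)
  have b: "\<bar>exp (- (s * y)) * c\<bar> \<le> exp (- (s * y))" if "\<bar>c\<bar> \<le> 1" for c y using that by (simp add: abs_mult mult_left_le)
  show ic: "set_integrable lborel {0<..} (\<lambda>y. exp (- (s * y)) * cos (t * y))"
    by (rule set_integrable_bound_halfline[OF e]) (auto intro!: b)
  show isn: "set_integrable lborel {0<..} (\<lambda>y. exp (- (s * y)) * sin (t * y))"
    by (rule set_integrable_bound_halfline[OF e]) (auto intro!: b)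
  have top: "((\<lambda>y. exp (- (s * y)) * g y) \<longlongrightarrow> 0) at_top" if "\<And>y. \<bar>g y\<bar> \<le> B" for g B
  proof (rule Lim_null_comparison)
    have "((\<lambda>y. exp (- (s * y))) \<longlongrightarrow> 0) at_top"
      using s by (intro filterlim_compose[OF exp_at_bot] filterlim_uminus_at_bot_at_top[THEN filterlim_compose]
          filterlim_tendsto_pos_mult_at_top[OF tendsto_const _ filterlim_ident])
    from tendsto_mult_right[OF this, of B] show "((\<lambda>y. exp (- (s * y)) * B) \<longlongrightarrow> 0) at_top" by simp
  qed (use that in \<open>auto simp: abs_mult intro!: always_eventually mult_left_mono\<close>)
  show "(LINT y:{0<..}|lborel. exp (- (s * y)) * cos (t * y)) = s / (s\<^sup>2 + t\<^sup>2)"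
  proof -
    let ?F = "\<lambda>y. exp (- (s * y)) * ((t * sin (t * y) - s * cos (t * y)) / (s\<^sup>2 + t\<^sup>2))"
    have "(LINT y:{0<..}|lborel. exp (- (s * y)) * cos (t * y)) = 0 - (- (s / (s\<^sup>2 + t\<^sup>2)))"
    proof (rule halfline_FTC[where F="?F"])
      fix x :: real
      have "(?F has_real_derivative exp (- (s * x)) * ((t * (cos (t * x) * t) + s * (sin (t * x) * t)) / (s\<^sup>2 + t\<^sup>2))
          + (exp (- (s * x)) * - s) * ((t * sin (t * x) - s * cos (t * x)) / (s\<^sup>2 + t\<^sup>2))) (at x)"
        proof -
        obtain K where K: "K = s\<^sup>2 + t\<^sup>2" "K \<noteq> 0" using p by (metis less_irrefl)
        show ?thesis unfolding K(1)[symmetric] using K(2) by (auto intro!: derivative_eq_intros simp: field_simps)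
      qed
      moreover have "exp (- (s * x)) * ((t * (cos (t * x) * t) + s * (sin (t * x) * t)) / (s\<^sup>2 + t\<^sup>2))
          + (exp (- (s * x)) * - s) * ((t * sin (t * x) - s * cos (t * x)) / (s\<^sup>2 + t\<^sup>2)) = exp (- (s * x)) * cos (t * x)"
        proof -
        have "E * (A / K) + (E * - s) * (B / K) = E * ((A - s * B) / K)" for E A B K :: real by (simp add: algebra_simps diff_divide_distrib)
        moreover have "t * (cos (t * x) * t) + s * (sin (t * x) * t) - s * (t * sin (t * x) - s * cos (t * x)) = cos (t * x) * (s\<^sup>2 + t\<^sup>2)"
          by (simp add: algebra_simps power2_eq_square)
        ultimately show ?thesis using s p by simp
      qed
      ultimately show "(?F has_real_derivative exp (- (s * x)) * cos (t * x)) (at x)" by simp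
      show "isCont (\<lambda>y. exp (- (s * y)) * cos (t * y)) x" by (intro continuous_intros)
    next
      have "(?F \<longlongrightarrow> ?F 0) (at_right 0)" using p by (intro tendsto_intros) auto
      thus "(?F \<longlongrightarrow> - (s / (s\<^sup>2 + t\<^sup>2))) (at_right 0)" by simp
      have "\<bar>(t * sin (t * y) - s * cos (t * y)) / (s\<^sup>2 + t\<^sup>2)\<bar> \<le> (\<bar>t\<bar> + \<bar>s\<bar>) / (s\<^sup>2 + t\<^sup>2)" for y
      proof -
        have "\<bar>t * sin (t * y) - s * cos (t * y)\<bar> \<le> \<bar>t * sin (t * y)\<bar> + \<bar>s * cos (t * y)\<bar>" by linarith
        also have "\<dots> \<le> \<bar>t\<bar> + \<bar>s\<bar>" by (intro add_mono) (simp_all add: abs_mult mult_left_le)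
        finally show ?thesis using p by (simp add: divide_right_mono)
      qed
      thus "(?F \<longlongrightarrow> 0) at_top" by (rule top)
    qed (rule ic)
    thus ?thesis by simp
  qed
  show "(LINT y:{0<..}|lborel. exp (- (s * y)) * sin (t * y)) = t / (s\<^sup>2 + t\<^sup>2)"
  proof -
    let ?F = "\<lambda>y. exp (- (s * y)) * (- (s * sin (t * y) + t * cos (t * y)) / (s\<^sup>2 + t\<^sup>2))"
    have "(LINT y:{0<..}|lborel. exp (- (s * y)) * sin (t * y)) = 0 - (- (t / (s\<^sup>2 + t\<^sup>2)))"
    proof (rule halfline_FTC[where F="?F"])
      fix x :: real
      have "(?F has_real_derivative exp (- (s * x)) * (- (s * (cos (t * x) * t) - t * (sin (t * x) * t)) / (s\<^sup>2 + t\<^sup>2))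
          + (exp (- (s * x)) * - s) * (- (s * sin (t * x) + t * cos (t * x)) / (s\<^sup>2 + t\<^sup>2))) (at x)"
        proof -
        obtain K where K: "K = s\<^sup>2 + t\<^sup>2" "K \<noteq> 0" using p by (metis less_irrefl)
        show ?thesis unfolding K(1)[symmetric] using K(2) by (auto intro!: derivative_eq_intros simp: field_simps)
      qed
      moreover have "exp (- (s * x)) * (- (s * (cos (t * x) * t) - t * (sin (t * x) * t)) / (s\<^sup>2 + t\<^sup>2))
          + (exp (- (s * x)) * - s) * (- (s * sin (t * x) + t * cos (t * x)) / (s\<^sup>2 + t\<^sup>2)) = exp (- (s * x)) * sin (t * x)"
        proof -
        have gen: "E * (- A / K) + (E * - s) * (- B / K) = E * ((s * B - A) / K)" for E A B K :: real by (simp add: algebra_simps diff_divide_distrib)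
        have sq: "s * (s * sin (t * x) + t * cos (t * x)) - (s * (cos (t * x) * t) - t * (sin (t * x) * t)) = sin (t * x) * (s\<^sup>2 + t\<^sup>2)"
          by (simp add: algebra_simps power2_eq_square)
        show ?thesis unfolding gen sq using s p by simp
      qed
      ultimately show "(?F has_real_derivative exp (- (s * x)) * sin (t * x)) (at x)" by simp
      show "isCont (\<lambda>y. exp (- (s * y)) * sin (t * y)) x" by (intro continuous_intros)
    next
      have "(?F \<longlongrightarrow> ?F 0) (at_right 0)" using p by (intro tendsto_intros) auto
      thus "(?F \<longlongrightarrow> - (t / (s\<^sup>2 + t\<^sup>2))) (at_right 0)" by simp
      have "\<bar>- (s * sin (t * y) + t * cos (t * y)) / (s\<^sup>2 + t\<^sup>2)\<bar> \<le> (\<bar>s\<bar> + \<bar>t\<bar>) / (s\<^sup>2 + t\<^sup>2)" for y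
      proof -
        have "\<bar>s * sin (t * y) + t * cos (t * y)\<bar> \<le> \<bar>s * sin (t * y)\<bar> + \<bar>t * cos (t * y)\<bar>" by linarith
        also have "\<dots> \<le> \<bar>s\<bar> + \<bar>t\<bar>" by (intro add_mono) (simp_all add: abs_mult mult_left_le)
        finally show ?thesis using p by (simp add: divide_right_mono abs_minus_commute)
      qed
      thus "(?F \<longlongrightarrow> 0) at_top" by (rule top)
    qed (rule isn)
    thus ?thesis by simp
  qed
qed

lemma nn_integral_Gamma_scaled:
  fixes b y :: real
  assumes b: "0 < b" and y: "0 < y"
  shows "(\<integral>\<^sup>+s. ennreal (s powr (b - 1) * exp (- (s * y))) * indicator {0<..} s \<partial>lborel) = ennreal (Gamma b * y powr - b)"
proof -
  have g: "(\<integral>\<^sup>+s. ennreal (s powr (b - 1) * exp (- s)) * indicator {0<..} s \<partial>lborel) = ennreal (Gamma b)"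
  proof -
    have "(\<integral>\<^sup>+s. ennreal (s powr (b - 1) * exp (- s)) * indicator {0<..} s \<partial>lborel) = (\<integral>\<^sup>+t. ennreal (indicator {0..} t * t powr (b - 1) / exp t) \<partial>lborel)"
      by (rule nn_integral_cong) (auto simp: indicator_def exp_minus divide_inverse)
    thus ?thesis using Gamma_conv_nn_integral_real[OF b] by simp
  qed
  have "(\<integral>\<^sup>+s. ennreal (s powr (b - 1) * exp (- s)) * indicator {0<..} s \<partial>lborel)
     = ennreal \<bar>y\<bar> * (\<integral>\<^sup>+s. ennreal ((0 + y * s) powr (b - 1) * exp (- (0 + y * s))) * indicator {0<..} (0 + y * s) \<partial>lborel)"
    by (rule nn_integral_real_affine) (use y in auto)
  also have "(\<lambda>s. ennreal ((0 + y * s) powr (b - 1) * exp (- (0 + y * s))) * indicator {0<..} (0 + y * s))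
     = (\<lambda>s. ennreal (y powr (b - 1)) * (ennreal (s powr (b - 1) * exp (- (s * y))) * indicator {0<..} s))"
  proof
    fix s
    show "ennreal ((0 + y * s) powr (b - 1) * exp (- (0 + y * s))) * indicator {0<..} (0 + y * s)
      = ennreal (y powr (b - 1)) * (ennreal (s powr (b - 1) * exp (- (s * y))) * indicator {0<..} s)"
      using y by (cases "0 < s") (auto simp: powr_mult ennreal_mult'[symmetric] indicator_def zero_less_mult_iff mult_ac)
  qed
  also have "ennreal \<bar>y\<bar> * (\<integral>\<^sup>+s. ennreal (y powr (b - 1)) * (ennreal (s powr (b - 1) * exp (- (s * y))) * indicator {0<..} s) \<partial>lborel)
    = ennreal (y powr b) * (\<integral>\<^sup>+s. ennreal (s powr (b - 1) * exp (- (s * y))) * indicator {0<..} s \<partial>lborel)"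
  proof -
    have "y * y powr (b - 1) = y powr b" using y powr_add[of y 1 "b - 1"] by simp
    thus ?thesis using y by (subst nn_integral_cmult) (auto simp: mult.assoc[symmetric] ennreal_mult'[symmetric])
  qed
  finally have "ennreal (y powr - b) * ennreal (Gamma b) = ennreal (y powr - b) * (ennreal (y powr b) * (\<integral>\<^sup>+s. ennreal (s powr (b - 1) * exp (- (s * y))) * indicator {0<..} s \<partial>lborel))"
    using g by simp
  also have "\<dots> = (\<integral>\<^sup>+s. ennreal (s powr (b - 1) * exp (- (s * y))) * indicator {0<..} s \<partial>lborel)"
  proof -
    have "y powr - b * y powr b = 1" using y by (simp add: powr_minus)
    thus ?thesis by (simp add: mult.assoc[symmetric] ennreal_mult'[symmetric])
  qed
  finally have "ennreal (y powr - b) * ennreal (Gamma b) = (\<integral>\<^sup>+s. ennreal (s powr (b - 1) * exp (- (s * y))) * indicator {0<..} s \<partial>lborel)" .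
  moreover have "ennreal (y powr - b) * ennreal (Gamma b) = ennreal (Gamma b * y powr - b)"
    by (subst ennreal_mult'[symmetric]) (simp_all add: mult.commute)
  ultimately show ?thesis by simp
qed

text \<open>Substitution \<open>u = s^2\<close> on bounded intervals, extended to the half-line by
  monotone convergence.\<close>

lemma nn_integral_square_subst:
  fixes f :: "real \<Rightarrow> real"
  assumes [measurable]: "f \<in> borel_measurable borel"
  shows "(\<integral>\<^sup>+u. ennreal (f u) * indicator {0..} u \<partial>lborel) = (\<integral>\<^sup>+s. ennreal (f (s\<^sup>2) * (2 * s)) * indicator {0..} s \<partial>lborel)"
proof -
  have "(\<integral>\<^sup>+u. ennreal (f u) * indicator {0..} u \<partial>lborel) = (\<integral>\<^sup>+u. (SUP n. ennreal (f u) * indicator {0..(real n)\<^sup>2} u) \<partial>lborel)"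
  proof (rule nn_integral_cong)
    fix u :: real
    show "ennreal (f u) * indicator {0..} u = (SUP n. ennreal (f u) * indicator {0..(real n)\<^sup>2} u)"
    proof (cases "0 \<le> u")
      case True
      obtain n where "sqrt u \<le> real n" using real_arch_simple by blast
      hence "u \<le> (real n)\<^sup>2" using True by (metis real_sqrt_le_iff real_sqrt_abs abs_of_nat)
      thus ?thesis using True by (intro antisym SUP_upper2[of n] SUP_least) (auto simp: indicator_def)
    qed simp
  qed
  also have "\<dots> = (SUP n. \<integral>\<^sup>+u. ennreal (f u) * indicator {0..(real n)\<^sup>2} u \<partial>lborel)"
    by (rule nn_integral_monotone_convergence_SUP)
       (auto simp: incseq_def le_fun_def indicator_def intro: order_trans[OF _ power_mono] split: if_splits)
  also have "\<dots> = (SUP n. \<integral>\<^sup>+s. ennreal (f (s\<^sup>2) * (2 * s)) * indicator {0..real n} s \<partial>lborel)"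
  proof (rule SUP_cong[OF refl])
    fix n :: nat
    have "(\<integral>\<^sup>+u. ennreal (f u * indicator {0\<^sup>2..(real n)\<^sup>2} u) \<partial>lborel) = (\<integral>\<^sup>+s. ennreal (f (s\<^sup>2) * (2 * s) * indicator {0..real n} s) \<partial>lborel)"
      by (rule nn_integral_substitution) (auto intro!: derivative_eq_intros continuous_intros simp: set_borel_measurable_def)
    thus "(\<integral>\<^sup>+u. ennreal (f u) * indicator {0..(real n)\<^sup>2} u \<partial>lborel) = (\<integral>\<^sup>+s. ennreal (f (s\<^sup>2) * (2 * s)) * indicator {0..real n} s \<partial>lborel)"
      by (simp add: nn_integral_set_ennreal)
  qed
  also have "\<dots> = (\<integral>\<^sup>+s. (SUP n. ennreal (f (s\<^sup>2) * (2 * s)) * indicator {0..real n} s) \<partial>lborel)"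
    by (rule nn_integral_monotone_convergence_SUP[symmetric])
       (auto simp: incseq_def le_fun_def indicator_def split: if_splits)
  also have "\<dots> = (\<integral>\<^sup>+s. ennreal (f (s\<^sup>2) * (2 * s)) * indicator {0..} s \<partial>lborel)"
  proof (rule nn_integral_cong)
    fix s :: real
    show "(SUP n. ennreal (f (s\<^sup>2) * (2 * s)) * indicator {0..real n} s) = ennreal (f (s\<^sup>2) * (2 * s)) * indicator {0..} s"
    proof (cases "0 \<le> s")
      case True
      obtain n where "s \<le> real n" using real_arch_simple by blast
      thus ?thesis using True by (intro antisym SUP_upper2[of n] SUP_least) (auto simp: indicator_def)
    qed simp
  qed
  finally show ?thesis .
qed

text \<open>Write \<open>1 / (s^2 + t^2)\<close> as the integral of
  \<open>exp (- v * (s^2 + t^2))\<close> over \<open>v > 0\<close> and exchange. With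
  \<open>u = s^2\<close> the inner integral is \<open>Gamma (b/2) / 2 * v powr - (b/2)\<close> times
  \<open>exp (- v * t^2)\<close>, the outer one gives \<open>Gamma (1 - b/2)\<close>, and the
  reflection formula turns the product into a sine.\<close>

lemma nn_integral_power_over_quadratic:
  fixes b t :: real
  assumes b: "0 < b" "b < 2" and t: "0 < t"
  shows "(\<integral>\<^sup>+s. ennreal (s powr (b - 1) / (s\<^sup>2 + t\<^sup>2)) * indicator {0<..} s \<partial>lborel) = ennreal (t powr (b - 2) * (pi / (2 * sin (pi * b / 2))))"
proof -
  define h where "h s v = ennreal (s powr (b - 1) * exp (- (v * (s\<^sup>2 + t\<^sup>2)))) * indicator {0<..} s * indicator {0<..} v" for s v
  have [measurable]: "(\<lambda>(s, v). h s v) \<in> borel_measurable (lborel \<Otimes>\<^sub>M lborel)"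
    unfolding h_def by measurable
  have 1: "(\<integral>\<^sup>+v. h s v \<partial>lborel) = ennreal (s powr (b - 1) / (s\<^sup>2 + t\<^sup>2)) * indicator {0<..} s" for s
  proof -
    have p: "0 < s\<^sup>2 + t\<^sup>2" using t by (simp add: add_nonneg_pos)
    have "(\<integral>\<^sup>+v. h s v \<partial>lborel) = (\<integral>\<^sup>+v. (ennreal (s powr (b - 1)) * indicator {0<..} s) * (ennreal (v powr (1 - 1) * exp (- (v * (s\<^sup>2 + t\<^sup>2)))) * indicator {0<..} v) \<partial>lborel)"
      by (rule nn_integral_cong) (auto simp: h_def indicator_def ennreal_mult'[symmetric])
    also have "\<dots> = (ennreal (s powr (b - 1)) * indicator {0<..} s) * ennreal (Gamma 1 * (s\<^sup>2 + t\<^sup>2) powr - 1)"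
      by (subst nn_integral_cmult) (simp_all only: nn_integral_Gamma_scaled[OF zero_less_one p], measurable)
    also have "\<dots> = ennreal (s powr (b - 1) / (s\<^sup>2 + t\<^sup>2)) * indicator {0<..} s"
      using p by (simp add: powr_minus divide_inverse ennreal_mult' indicator_def)
    finally show ?thesis .
  qed
  have 2: "(\<integral>\<^sup>+s. h s v \<partial>lborel) = ennreal (Gamma (b/2) / 2) * (ennreal (v powr ((1 - b/2) - 1) * exp (- (v * t\<^sup>2))) * indicator {0<..} v)" for v
  proof (cases "0 < v")
    case True
    have "(\<integral>\<^sup>+s. h s v \<partial>lborel) = (\<integral>\<^sup>+s. ennreal (exp (- (v * t\<^sup>2)) / 2) * (ennreal (((s\<^sup>2) powr (b/2 - 1) * exp (- (s\<^sup>2 * v))) * (2 * s)) * indicator {0..} s) \<partial>lborel)"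
    proof (rule nn_integral_cong)
      fix s :: real
      show "h s v = ennreal (exp (- (v * t\<^sup>2)) / 2) * (ennreal (((s\<^sup>2) powr (b/2 - 1) * exp (- (s\<^sup>2 * v))) * (2 * s)) * indicator {0..} s)"
      proof (cases "0 < s")
        case s: True
        have "(s\<^sup>2) powr (b/2 - 1) * s = s powr (b - 1)"
          using s powr_powr[of s 2 "b/2 - 1"] powr_add[of s "b - 2" 1] by (simp add: right_diff_distrib)
        moreover have "exp (- (v * (s\<^sup>2 + t\<^sup>2))) = exp (- (v * t\<^sup>2)) * exp (- (s\<^sup>2 * v))" by (simp add: exp_add[symmetric] algebra_simps)
        ultimately show ?thesis using s True by (simp add: h_def ennreal_mult'[symmetric] mult_ac)
      qed (auto simp: h_def indicator_def)
    qed
    also have "\<dots> = ennreal (exp (- (v * t\<^sup>2)) / 2) * (\<integral>\<^sup>+s. ennreal (((s\<^sup>2) powr (b/2 - 1) * exp (- (s\<^sup>2 * v))) * (2 * s)) * indicator {0..} s \<partial>lborel)"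
      by (rule nn_integral_cmult) measurable
    also have "(\<integral>\<^sup>+s. ennreal (((s\<^sup>2) powr (b/2 - 1) * exp (- (s\<^sup>2 * v))) * (2 * s)) * indicator {0..} s \<partial>lborel)
       = (\<integral>\<^sup>+u. ennreal (u powr (b/2 - 1) * exp (- (u * v))) * indicator {0..} u \<partial>lborel)"
      by (rule nn_integral_square_subst[symmetric]) measurable
    also have "\<dots> = (\<integral>\<^sup>+u. ennreal (u powr (b/2 - 1) * exp (- (u * v))) * indicator {0<..} u \<partial>lborel)"
      by (rule nn_integral_cong) (auto simp: indicator_def)
    also have "\<dots> = ennreal (Gamma (b/2) * v powr - (b/2))" using b True by (intro nn_integral_Gamma_scaled) auto
    finally show ?thesis using True Gamma_real_pos[of "b/2"] b by (simp add: ennreal_mult'[symmetric] mult_ac)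
  qed (simp add: h_def)
  have "(\<integral>\<^sup>+s. ennreal (s powr (b - 1) / (s\<^sup>2 + t\<^sup>2)) * indicator {0<..} s \<partial>lborel) = (\<integral>\<^sup>+s. \<integral>\<^sup>+v. h s v \<partial>lborel \<partial>lborel)"
    by (simp only: 1)
  also have "\<dots> = (\<integral>\<^sup>+v. \<integral>\<^sup>+s. h s v \<partial>lborel \<partial>lborel)" by (rule lborel_pair.Fubini'[symmetric]) measurable
  also have "\<dots> = ennreal (Gamma (b/2) / 2) * (\<integral>\<^sup>+v. ennreal (v powr ((1 - b/2) - 1) * exp (- (v * t\<^sup>2))) * indicator {0<..} v \<partial>lborel)"
    unfolding 2 by (rule nn_integral_cmult) measurable
  also have "\<dots> = ennreal (Gamma (b/2) / 2) * ennreal (Gamma (1 - b/2) * (t\<^sup>2) powr - (1 - b/2))"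
    using b t by (subst nn_integral_Gamma_scaled) auto
  also have "\<dots> = ennreal (t powr (b - 2) * (pi / (2 * sin (pi * b / 2))))"
  proof -
    have "(t\<^sup>2) powr - (1 - b/2) = t powr (b - 2)" using t powr_powr[of t 2 "- (1 - b/2)"] by (simp add: algebra_simps)
    moreover have "Gamma (b/2) * Gamma (1 - b/2) = pi / sin (pi * (b/2))"
    proof -
      have "complex_of_real (Gamma (b/2) * Gamma (1 - b/2)) = Gamma (of_real (b/2)) * Gamma (1 - of_real (b/2))"
        by (simp add: Gamma_complex_of_real[symmetric])
      also have "\<dots> = of_real pi / sin (of_real pi * of_real (b/2))" by (rule Gamma_reflection_complex)
      also have "\<dots> = complex_of_real (pi / sin (pi * (b/2)))" by (simp add: sin_of_real[symmetric])
      finally show ?thesis by (simp only: of_real_eq_iff)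
    qed
    ultimately have "Gamma (b/2) / 2 * (Gamma (1 - b/2) * (t\<^sup>2) powr - (1 - b/2)) = t powr (b - 2) * (pi / (2 * sin (pi * b / 2)))"
      by (simp add: field_simps)
    moreover have "ennreal (Gamma (b/2) / 2) * ennreal (Gamma (1 - b/2) * (t\<^sup>2) powr - (1 - b/2)) = ennreal (Gamma (b/2) / 2 * (Gamma (1 - b/2) * (t\<^sup>2) powr - (1 - b/2)))"
      using Gamma_real_pos[of "b/2"] b by (intro ennreal_mult'[symmetric]) auto
    ultimately show ?thesis by (simp only:)
  qed
  finally show ?thesis .
qed

lemma integral_power_over_quadratic:
  fixes b t :: real
  assumes b: "0 < b" "b < 2" and t: "0 < t"
  shows "set_integrable lborel {0<..} (\<lambda>s. s powr (b - 1) / (s\<^sup>2 + t\<^sup>2))"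
    and "(LINT s:{0<..}|lborel. s powr (b - 1) / (s\<^sup>2 + t\<^sup>2)) = t powr (b - 2) * (pi / (2 * sin (pi * b / 2)))"
proof -
  have "0 < sin (pi * b / 2)" using b by (intro sin_gt_zero) (auto simp: field_simps)
  hence "has_bochner_integral lborel (\<lambda>s. indicator {0<..} s *\<^sub>R (s powr (b - 1) / (s\<^sup>2 + t\<^sup>2))) (t powr (b - 2) * (pi / (2 * sin (pi * b / 2))))"
    using nn_integral_power_over_quadratic[OF b t] t
    by (intro has_bochner_integral_nn_integral) (auto simp: nn_integral_set_ennreal mult.commute[of "indicator _ _"] intro!: AE_I2 divide_nonneg_nonneg mult_nonneg_nonneg)
  thus "set_integrable lborel {0<..} (\<lambda>s. s powr (b - 1) / (s\<^sup>2 + t\<^sup>2))"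
    and "(LINT s:{0<..}|lborel. s powr (b - 1) / (s\<^sup>2 + t\<^sup>2)) = t powr (b - 2) * (pi / (2 * sin (pi * b / 2)))"
    unfolding set_integrable_def set_lebesgue_integral_def by (auto simp: has_bochner_integral_iff)
qed

text \<open>Write \<open>y\<^sup>-\<^sup>1\<^sup>-\<^sup>\<alpha>\<close> as a mixture of exponentials and exchange the integrals.\<close>
lemma integral_power_mixture:
  fixes f :: "real \<Rightarrow> real"
  assumes [measurable]: "f \<in> borel_measurable borel" and a: "0 < \<alpha>"
    and int: "set_integrable lborel {0<..} (\<lambda>y. y powr (- 1 - \<alpha>) * f y)"
  shows "(LINT y:{0<..}|lborel. y powr (- 1 - \<alpha>) * f y)
     = (LINT s:{0<..}|lborel. s powr \<alpha> * (LINT y:{0<..}|lborel. exp (- (s * y)) * f y)) / Gamma (1 + \<alpha>)"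
proof -
  define F where "F y s = (indicator {0<..} y * f y) * (indicator {0<..} s * (s powr \<alpha> * exp (- (s * y))))" for y s :: real
  have [measurable]: "(\<lambda>(y, s). F y s) \<in> borel_measurable (lborel \<Otimes>\<^sub>M lborel)" unfolding F_def by measurable
  have G0: "0 < Gamma (1 + \<alpha>)" using a by (intro Gamma_real_pos) auto
  have g: "has_bochner_integral lborel (\<lambda>s. indicator {0<..} s * (s powr \<alpha> * exp (- (s * y)))) (Gamma (1 + \<alpha>) * y powr (- 1 - \<alpha>))" if y: "0 < y" for y
  proof (rule has_bochner_integral_nn_integral)
    have "(\<integral>\<^sup>+s. ennreal (indicator {0<..} s * (s powr \<alpha> * exp (- (s * y)))) \<partial>lborel) = (\<integral>\<^sup>+s. ennreal (s powr ((1 + \<alpha>) - 1) * exp (- (s * y))) * indicator {0<..} s \<partial>lborel)"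
      by (rule nn_integral_cong) (simp add: indicator_def)
    also have "\<dots> = ennreal (Gamma (1 + \<alpha>) * y powr (- (1 + \<alpha>)))" using a y by (intro nn_integral_Gamma_scaled) auto
    finally show "(\<integral>\<^sup>+s. ennreal (indicator {0<..} s * (s powr \<alpha> * exp (- (s * y)))) \<partial>lborel) = ennreal (Gamma (1 + \<alpha>) * y powr (- 1 - \<alpha>))" by (simp add: algebra_simps)
  qed (use G0 in auto)
  have gi: "integrable lborel (\<lambda>s. F y s)" and gv: "(LINT s|lborel. F y s) = Gamma (1 + \<alpha>) * (indicator {0<..} y *\<^sub>R (y powr (- 1 - \<alpha>) * f y))"
    and gn: "(LINT s|lborel. norm (F y s)) = Gamma (1 + \<alpha>) * norm (indicator {0<..} y *\<^sub>R (y powr (- 1 - \<alpha>) * f y))" for y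
  proof -
    have "integrable lborel (\<lambda>s. F y s) \<and> (LINT s|lborel. F y s) = Gamma (1 + \<alpha>) * (indicator {0<..} y *\<^sub>R (y powr (- 1 - \<alpha>) * f y))
      \<and> (LINT s|lborel. norm (F y s)) = Gamma (1 + \<alpha>) * norm (indicator {0<..} y *\<^sub>R (y powr (- 1 - \<alpha>) * f y))"
    proof (cases "0 < y")
      case True
      have i: "integrable lborel (\<lambda>s. indicator {0<..} s * (s powr \<alpha> * exp (- (s * y))))"
        and v: "(LINT s|lborel. indicator {0<..} s * (s powr \<alpha> * exp (- (s * y)))) = Gamma (1 + \<alpha>) * y powr (- 1 - \<alpha>)"
        using g[OF True] by (auto simp: has_bochner_integral_iff)
      have n: "norm (F y s) = \<bar>f y\<bar> * (indicator {0<..} s * (s powr \<alpha> * exp (- (s * y))))" for s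
        using True by (simp add: F_def abs_mult)
      show ?thesis unfolding n unfolding F_def using i v True by (simp add: abs_mult mult_ac)
    qed (simp add: F_def)
    thus "integrable lborel (\<lambda>s. F y s)" "(LINT s|lborel. F y s) = Gamma (1 + \<alpha>) * (indicator {0<..} y *\<^sub>R (y powr (- 1 - \<alpha>) * f y))"
     "(LINT s|lborel. norm (F y s)) = Gamma (1 + \<alpha>) * norm (indicator {0<..} y *\<^sub>R (y powr (- 1 - \<alpha>) * f y))" by auto
  qed
  have FI: "integrable (lborel \<Otimes>\<^sub>M lborel) (\<lambda>(y, s). F y s)"
  proof (rule lborel_pair.Fubini_integrable)
    show "integrable lborel (\<lambda>y. LINT s|lborel. norm (case (y, s) of (y, s) \<Rightarrow> F y s))"
      using int unfolding set_integrable_def by (simp only: prod.case gn) (intro integrable_mult_right integrable_norm)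
  qed (use gi in auto)
  have "Gamma (1 + \<alpha>) * (LINT y:{0<..}|lborel. y powr (- 1 - \<alpha>) * f y) = (LINT y|lborel. LINT s|lborel. F y s)"
    unfolding gv set_lebesgue_integral_def by simp
  also have "\<dots> = (LINT s|lborel. LINT y|lborel. F y s)" by (rule lborel_pair.Fubini_integral[OF FI, symmetric])
  also have "\<dots> = (LINT s:{0<..}|lborel. s powr \<alpha> * (LINT y:{0<..}|lborel. exp (- (s * y)) * f y))"
    unfolding set_lebesgue_integral_def
  proof (rule Bochner_Integration.integral_cong[OF refl])
    fix s
    have "(\<lambda>y. F y s) = (\<lambda>y. (indicator {0<..} s * s powr \<alpha>) * (indicator {0<..} y *\<^sub>R (exp (- (s * y)) * f y)))"
      by (rule ext) (simp add: F_def mult_ac)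
    thus "(LINT y|lborel. F y s) = indicator {0<..} s *\<^sub>R (s powr \<alpha> * (LINT y|lborel. indicator {0<..} y *\<^sub>R (exp (- (s * y)) * f y)))"
      by (simp only: integral_mult_right_zero) simp
  qed
  finally show ?thesis using G0 by (simp add: field_simps)
qed

text \<open>The Laplace transform of \<open>1 - cos (t * y)\<close> is
  \<open>t^2 / (s * (s^2 + t^2))\<close>; mixed with \<open>s powr \<alpha>\<close> it becomes the
  preceding integral with \<open>b = \<alpha>\<close>.\<close>

lemma integral_power_one_minus_cos:
  fixes \<alpha> t :: real
  assumes a: "0 < \<alpha>" "\<alpha> < 2" and t: "0 < t"
    and int: "set_integrable lborel {0<..} (\<lambda>y. y powr (- 1 - \<alpha>) * (1 - cos (t * y)))"
  shows "(LINT y:{0<..}|lborel. y powr (- 1 - \<alpha>) * (1 - cos (t * y))) = t powr \<alpha> * (pi / (2 * sin (pi * \<alpha> / 2)) / Gamma (1 + \<alpha>))"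
proof -
  have inner: "(LINT y:{0<..}|lborel. exp (- (s * y)) * (1 - cos (t * y))) = t\<^sup>2 / (s * (s\<^sup>2 + t\<^sup>2))" if s: "0 < s" for s
  proof -
    have "(LINT y:{0<..}|lborel. exp (- (s * y)) * (1 - cos (t * y))) = (LINT y:{0<..}|lborel. exp (- (s * y)) * cos (0 * y) - exp (- (s * y)) * cos (t * y))"
      by (simp add: algebra_simps)
    also have "\<dots> = s / (s\<^sup>2 + 0\<^sup>2) - s / (s\<^sup>2 + t\<^sup>2)"
      by (subst set_integral_diff(2)) (simp_all only: laplace_cos_sin[OF s])
    also have "\<dots> = t\<^sup>2 / (s * (s\<^sup>2 + t\<^sup>2))"
    proof -
      have "s\<^sup>2 + t\<^sup>2 \<noteq> 0" using s by (simp add: sum_power2_eq_zero_iff)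
      thus ?thesis using s by (simp add: divide_simps) (simp add: algebra_simps power2_eq_square)
    qed
    finally show ?thesis .
  qed
  have "(LINT y:{0<..}|lborel. y powr (- 1 - \<alpha>) * (1 - cos (t * y)))
      = (LINT s:{0<..}|lborel. s powr \<alpha> * (LINT y:{0<..}|lborel. exp (- (s * y)) * (1 - cos (t * y)))) / Gamma (1 + \<alpha>)"
    using a int by (intro integral_power_mixture) auto
  also have "(LINT s:{0<..}|lborel. s powr \<alpha> * (LINT y:{0<..}|lborel. exp (- (s * y)) * (1 - cos (t * y)))) = (LINT s:{0<..}|lborel. t\<^sup>2 * (s powr (\<alpha> - 1) / (s\<^sup>2 + t\<^sup>2)))"
  proof (rule set_lebesgue_integral_cong)
    show "\<forall>s. s \<in> {0<..} \<longrightarrow> s powr \<alpha> * (LINT y:{0<..}|lborel. exp (- (s * y)) * (1 - cos (t * y))) = t\<^sup>2 * (s powr (\<alpha> - 1) / (s\<^sup>2 + t\<^sup>2))"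
    proof (intro allI impI)
      fix s :: real assume s: "s \<in> {0<..}"
      hence "s powr \<alpha> = s * s powr (\<alpha> - 1)" using powr_add[of s 1 "\<alpha> - 1"] by simp
      thus "s powr \<alpha> * (LINT y:{0<..}|lborel. exp (- (s * y)) * (1 - cos (t * y))) = t\<^sup>2 * (s powr (\<alpha> - 1) / (s\<^sup>2 + t\<^sup>2))"
        using s inner[of s] by simp
    qed
  qed simp
  also have "\<dots> = t\<^sup>2 * (t powr (\<alpha> - 2) * (pi / (2 * sin (pi * \<alpha> / 2))))"
    by (simp only: set_integral_mult_right integral_power_over_quadratic(2)[OF a t])
  also have "t\<^sup>2 * (t powr (\<alpha> - 2) * (pi / (2 * sin (pi * \<alpha> / 2)))) = t powr \<alpha> * (pi / (2 * sin (pi * \<alpha> / 2)))"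
    using t powr_add[of t 2 "\<alpha> - 2"] by simp
  finally show ?thesis by simp
qed

lemma integral_power_sin_mixture:
  fixes \<alpha> t :: real
  assumes a: "0 < \<alpha>" and t: "0 < t"
    and int: "set_integrable lborel {0<..} (\<lambda>y. y powr (- 1 - \<alpha>) * (sin (t * y) - t * sin y))"
  shows "(LINT y:{0<..}|lborel. y powr (- 1 - \<alpha>) * (sin (t * y) - t * sin y))
     = t * (LINT s:{0<..}|lborel. s powr \<alpha> * (1 / (s\<^sup>2 + t\<^sup>2) - 1 / (s\<^sup>2 + 1))) / Gamma (1 + \<alpha>)"
proof -
  have inner: "(LINT y:{0<..}|lborel. exp (- (s * y)) * (sin (t * y) - t * sin y)) = t * (1 / (s\<^sup>2 + t\<^sup>2) - 1 / (s\<^sup>2 + 1))" if s: "0 < s" for s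
  proof -
    have "(LINT y:{0<..}|lborel. exp (- (s * y)) * (sin (t * y) - t * sin y)) = (LINT y:{0<..}|lborel. exp (- (s * y)) * sin (t * y) - t * (exp (- (s * y)) * sin (1 * y)))"
      by (simp add: algebra_simps)
    also have "\<dots> = t / (s\<^sup>2 + t\<^sup>2) - t * (1 / (s\<^sup>2 + 1\<^sup>2))"
      by (subst set_integral_diff(2)[OF laplace_cos_sin(3)[OF s] set_integrable_mult_right[OF laplace_cos_sin(3)[OF s]]])
         (simp only: laplace_cos_sin[OF s] set_integral_mult_right)
    also have "\<dots> = t * (1 / (s\<^sup>2 + t\<^sup>2) - 1 / (s\<^sup>2 + 1))" by (simp add: algebra_simps)
    finally show ?thesis .
  qed
  have "(LINT y:{0<..}|lborel. y powr (- 1 - \<alpha>) * (sin (t * y) - t * sin y))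
      = (LINT s:{0<..}|lborel. s powr \<alpha> * (LINT y:{0<..}|lborel. exp (- (s * y)) * (sin (t * y) - t * sin y))) / Gamma (1 + \<alpha>)"
    using a int by (intro integral_power_mixture) auto
  also have "(LINT s:{0<..}|lborel. s powr \<alpha> * (LINT y:{0<..}|lborel. exp (- (s * y)) * (sin (t * y) - t * sin y)))
      = (LINT s:{0<..}|lborel. t * (s powr \<alpha> * (1 / (s\<^sup>2 + t\<^sup>2) - 1 / (s\<^sup>2 + 1))))"
    by (rule set_lebesgue_integral_cong) (auto simp: inner)
  finally show ?thesis by (simp only: set_integral_mult_right)
qed

text \<open>The two fractions of the mixture formula are integrable separately with
  \<open>b = \<alpha> + 1\<close> only for \<alpha> < 1. For \<alpha> > 1 their common leading part
  has to be removed before splitting, which lowers the exponent to \<open>b = \<alpha> - 1\<close>.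
  At \<alpha> = 1 the cosine in the denominator vanishes.\<close>

lemma integral_power_sin:
  fixes \<alpha> t :: real
  assumes a: "0 < \<alpha>" "\<alpha> < 2" "\<alpha> \<noteq> 1" and t: "0 < t"
    and int: "set_integrable lborel {0<..} (\<lambda>y. y powr (- 1 - \<alpha>) * (sin (t * y) - t * sin y))"
  shows "(LINT y:{0<..}|lborel. y powr (- 1 - \<alpha>) * (sin (t * y) - t * sin y))
     = pi / (2 * cos (pi * \<alpha> / 2)) / Gamma (1 + \<alpha>) * (t powr \<alpha> - t)"
proof -
  have p: "s\<^sup>2 + t\<^sup>2 \<noteq> 0" "s\<^sup>2 + 1 \<noteq> 0" for s :: real using t by (simp_all add: sum_power2_eq_zero_iff add_nonneg_eq_0_iff)
  have sin1: "sin (pi * (\<alpha> + 1) / 2) = cos (pi * \<alpha> / 2)" "sin (pi * (\<alpha> - 1) / 2) = - cos (pi * \<alpha> / 2)"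
    using sin_add[of "pi * \<alpha> / 2" "pi / 2"] sin_diff[of "pi * \<alpha> / 2" "pi / 2"] by (simp_all add: algebra_simps add_divide_distrib diff_divide_distrib)
  have "(LINT s:{0<..}|lborel. s powr \<alpha> * (1 / (s\<^sup>2 + t\<^sup>2) - 1 / (s\<^sup>2 + 1))) = pi / (2 * cos (pi * \<alpha> / 2)) * (t powr (\<alpha> - 1) - 1)"
  proof (cases "\<alpha> < 1")
    case True
    have b: "0 < \<alpha> + 1" "\<alpha> + 1 < 2" using a True by auto
    have "(LINT s:{0<..}|lborel. s powr \<alpha> * (1 / (s\<^sup>2 + t\<^sup>2) - 1 / (s\<^sup>2 + 1)))
       = (LINT s:{0<..}|lborel. s powr ((\<alpha> + 1) - 1) / (s\<^sup>2 + t\<^sup>2) - s powr ((\<alpha> + 1) - 1) / (s\<^sup>2 + 1\<^sup>2))"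
      by (simp add: algebra_simps)
    also have "\<dots> = t powr ((\<alpha> + 1) - 2) * (pi / (2 * sin (pi * (\<alpha> + 1) / 2))) - 1 powr ((\<alpha> + 1) - 2) * (pi / (2 * sin (pi * (\<alpha> + 1) / 2)))"
      by (subst set_integral_diff(2)) (simp_all only: integral_power_over_quadratic[OF b t] integral_power_over_quadratic[OF b zero_less_one])
    also have "\<dots> = pi / (2 * cos (pi * \<alpha> / 2)) * (t powr (\<alpha> - 1) - 1)" unfolding sin1 by (simp add: algebra_simps diff_divide_distrib)
    finally show ?thesis .
  next
    case False
    have b: "0 < \<alpha> - 1" "\<alpha> - 1 < 2" using a False by auto
    \<comment> \<open>Uses \<open>s^2 / (s^2 + c) = 1 - c / (s^2 + c)\<close> for both fractions;
      the ones cancel.\<close>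
    have "(LINT s:{0<..}|lborel. s powr \<alpha> * (1 / (s\<^sup>2 + t\<^sup>2) - 1 / (s\<^sup>2 + 1)))
       = (LINT s:{0<..}|lborel. s powr ((\<alpha> - 1) - 1) / (s\<^sup>2 + 1\<^sup>2) - t\<^sup>2 * (s powr ((\<alpha> - 1) - 1) / (s\<^sup>2 + t\<^sup>2)))"
    proof (rule set_lebesgue_integral_cong)
      show "\<forall>s. s \<in> {0<..} \<longrightarrow> s powr \<alpha> * (1 / (s\<^sup>2 + t\<^sup>2) - 1 / (s\<^sup>2 + 1)) = s powr ((\<alpha> - 1) - 1) / (s\<^sup>2 + 1\<^sup>2) - t\<^sup>2 * (s powr ((\<alpha> - 1) - 1) / (s\<^sup>2 + t\<^sup>2))"
      proof (intro allI impI)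
        fix s :: real assume s: "s \<in> {0<..}"
        hence "s powr \<alpha> = s\<^sup>2 * s powr ((\<alpha> - 1) - 1)" using powr_add[of s 2 "\<alpha> - 2"] by simp
        moreover have "s\<^sup>2 * c * (1 / (s\<^sup>2 + t\<^sup>2) - 1 / (s\<^sup>2 + 1)) = c / (s\<^sup>2 + 1\<^sup>2) - t\<^sup>2 * (c / (s\<^sup>2 + t\<^sup>2))" for c
          using p[of s] t by (simp add: divide_simps) (simp add: algebra_simps)
        ultimately show "s powr \<alpha> * (1 / (s\<^sup>2 + t\<^sup>2) - 1 / (s\<^sup>2 + 1)) = s powr ((\<alpha> - 1) - 1) / (s\<^sup>2 + 1\<^sup>2) - t\<^sup>2 * (s powr ((\<alpha> - 1) - 1) / (s\<^sup>2 + t\<^sup>2))"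
          by (simp only:)
      qed
    qed simp
    also have "\<dots> = 1 powr ((\<alpha> - 1) - 2) * (pi / (2 * sin (pi * (\<alpha> - 1) / 2))) - t\<^sup>2 * (t powr ((\<alpha> - 1) - 2) * (pi / (2 * sin (pi * (\<alpha> - 1) / 2))))"
      by (subst set_integral_diff(2)[OF integral_power_over_quadratic(1)[OF b zero_less_one] set_integrable_mult_right[OF integral_power_over_quadratic(1)[OF b t]]])
         (simp only: integral_power_over_quadratic(2)[OF b t] integral_power_over_quadratic(2)[OF b zero_less_one] set_integral_mult_right)
    also have "\<dots> = pi / (2 * sin (pi * (\<alpha> - 1) / 2)) * (1 - t powr (\<alpha> - 1))"
      using t powr_add[of t 2 "(\<alpha> - 1) - 2"] by (simp add: algebra_simps diff_divide_distrib)
    also have "\<dots> = pi / (2 * cos (pi * \<alpha> / 2)) * (t powr (\<alpha> - 1) - 1)"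
      unfolding sin1(2) by (simp add: algebra_simps diff_divide_distrib)
    finally show ?thesis .
  qed
  moreover have "t * (t powr (\<alpha> - 1) - 1) = t powr \<alpha> - t" using t powr_add[of t 1 "\<alpha> - 1"] by (simp add: algebra_simps)
  moreover have "t * (c * x) / g = c / g * (t * x)" for c x g :: real by simp
  ultimately show ?thesis using integral_power_sin_mixture[OF a(1) t int] by (simp only:)
qed

text \<open>At \<alpha> = 1 the mixture integrand has the primitive
  \<open>(ln (s^2 + t^2) - ln (s^2 + 1)) / 2\<close>, running from \<open>ln t\<close> at 0 to 0 at
  infinity. This is the origin of the logarithm in the stable exponent of index 1.\<close>

lemma integral_power_sin_1:
  fixes t :: real
  assumes t: "0 < t"
    and int: "set_integrable lborel {0<..} (\<lambda>y. y powr (- 1 - 1) * (sin (t * y) - t * sin y))"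
  shows "(LINT y:{0<..}|lborel. y powr (- 1 - 1) * (sin (t * y) - t * sin y)) = - (t * ln t)"
proof -
  have p: "0 < s\<^sup>2 + t\<^sup>2" "0 < s\<^sup>2 + 1" for s :: real using t by (simp_all add: add_nonneg_pos)
  have "(LINT s:{0<..}|lborel. s * (1 / (s\<^sup>2 + t\<^sup>2) - 1 / (s\<^sup>2 + 1))) = 0 - ln t"
  proof (rule halfline_FTC[where F="\<lambda>s. (ln (s\<^sup>2 + t\<^sup>2) - ln (s\<^sup>2 + 1)) / 2"])
    fix x :: real
    show "((\<lambda>s. (ln (s\<^sup>2 + t\<^sup>2) - ln (s\<^sup>2 + 1)) / 2) has_real_derivative x * (1 / (x\<^sup>2 + t\<^sup>2) - 1 / (x\<^sup>2 + 1))) (at x)"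
    proof -
      have d: "((\<lambda>s. s\<^sup>2 + c) has_real_derivative 2 * x) (at x)" for c :: real by (auto intro!: derivative_eq_intros)
      have "((\<lambda>s. (ln (s\<^sup>2 + t\<^sup>2) - ln (s\<^sup>2 + 1)) / 2) has_real_derivative (1 / (x\<^sup>2 + t\<^sup>2) * (2 * x) - 1 / (x\<^sup>2 + 1) * (2 * x)) / 2) (at x)"
        by (intro DERIV_cdivide DERIV_diff DERIV_chain2[OF DERIV_ln_divide d] p)
      moreover have "(A * (2 * x) - B * (2 * x)) / 2 = x * (A - B)" for A B by (simp add: field_simps)
      ultimately show ?thesis by (simp only:)
    qed
    show "isCont (\<lambda>s. s * (1 / (s\<^sup>2 + t\<^sup>2) - 1 / (s\<^sup>2 + 1))) x" using p[of x] by (intro continuous_intros) auto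
  next
    \<comment> \<open>The dominating function: the difference of fractions carries the factor
      \<open>1 - t^2\<close>, and \<open>s / (s^2 + t^2) \<le> 1 / (2 * t)\<close> by the
      arithmetic-geometric mean inequality.\<close>
    have q: "set_integrable lborel {0<..} (\<lambda>s. \<bar>1 - t\<^sup>2\<bar> / (2 * t) * (1 / (s\<^sup>2 + 1)))"
    proof -
      have "set_integrable lborel {0<..} (\<lambda>s::real. s powr (1 - 1) / (s\<^sup>2 + 1\<^sup>2))" by (rule integral_power_over_quadratic) auto
      also have "?this \<longleftrightarrow> set_integrable lborel {0<..} (\<lambda>s::real. 1 / (s\<^sup>2 + 1))" by (rule set_integrable_cong) auto
      finally show ?thesis by (rule set_integrable_mult_right)
    qed
    show "set_integrable lborel {0<..} (\<lambda>s. s * (1 / (s\<^sup>2 + t\<^sup>2) - 1 / (s\<^sup>2 + 1)))"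
    proof (rule set_integrable_bound_halfline[OF q])
      fix s :: real assume s: "0 < s"
      have "s * (1 / (s\<^sup>2 + t\<^sup>2) - 1 / (s\<^sup>2 + 1)) = (1 - t\<^sup>2) * (s / (s\<^sup>2 + t\<^sup>2)) * (1 / (s\<^sup>2 + 1))"
        using p[of s] by (simp add: divide_simps)
      moreover have "s / (s\<^sup>2 + t\<^sup>2) \<le> 1 / (2 * t)"
        using p[of s] t sum_squares_bound[of s t] by (simp add: divide_simps)
      moreover have "0 \<le> s / (s\<^sup>2 + t\<^sup>2)" using s p[of s] by simp
      ultimately have "\<bar>s * (1 / (s\<^sup>2 + t\<^sup>2) - 1 / (s\<^sup>2 + 1))\<bar> \<le> \<bar>1 - t\<^sup>2\<bar> * (1 / (2 * t)) * (1 / (s\<^sup>2 + 1))"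
        using p[of s] t by (simp only: abs_mult) (intro mult_mono; simp)
      thus "\<bar>s * (1 / (s\<^sup>2 + t\<^sup>2) - 1 / (s\<^sup>2 + 1))\<bar> \<le> \<bar>1 - t\<^sup>2\<bar> / (2 * t) * (1 / (s\<^sup>2 + 1))" by simp
    qed measurable
    have "((\<lambda>s. (ln (s\<^sup>2 + t\<^sup>2) - ln (s\<^sup>2 + 1)) / 2) \<longlongrightarrow> (ln (0\<^sup>2 + t\<^sup>2) - ln (0\<^sup>2 + 1)) / 2) (at_right 0)"
      using t by (intro tendsto_intros) auto
    thus "((\<lambda>s. (ln (s\<^sup>2 + t\<^sup>2) - ln (s\<^sup>2 + 1)) / 2) \<longlongrightarrow> ln t) (at_right 0)" using t by (simp add: ln_realpow)
    show "((\<lambda>s. (ln (s\<^sup>2 + t\<^sup>2) - ln (s\<^sup>2 + 1)) / 2) \<longlongrightarrow> 0) at_top" using t by real_asymp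
  qed
  moreover have "(LINT s:{0<..}|lborel. s powr 1 * (1 / (s\<^sup>2 + t\<^sup>2) - 1 / (s\<^sup>2 + 1))) = (LINT s:{0<..}|lborel. s * (1 / (s\<^sup>2 + t\<^sup>2) - 1 / (s\<^sup>2 + 1)))"
    by (rule set_lebesgue_integral_cong) auto
  moreover have "Gamma (1 + 1 :: real) = 1" by (simp add: Gamma_numeral)
  ultimately show ?thesis using integral_power_sin_mixture[OF zero_less_one t int] by simp
qed

section \<open>Identification of the stable parameters\<close>

context stable_domain
begin

text \<open>Up to the constant \<open>kap * \<alpha>\<close>, positive for \<alpha> < 2, the
  integrand is the density of \<Lambda>, whose mass on the half-line is finite.\<close>

lemma integrable_weight:
  assumes a2: "\<alpha> < 2"
  shows "set_integrable lborel {0<..} (\<lambda>y. y powr (- 1 - \<alpha>) * min (y\<^sup>2) 1)"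
proof -
  have k0: "0 < kap * \<alpha>" using a2 tail.alpha by (simp add: kap_def)
  have "(\<integral>\<^sup>+y. ennreal (norm (indicator {0<..} y *\<^sub>R (kap * \<alpha> * (min (y\<^sup>2) 1 * \<bar>y\<bar> powr (- 1 - \<alpha>))))) \<partial>lborel) = emeasure \<Lambda> {0<..}"
    unfolding \<Lambda>_def using k0 by (subst emeasure_density) (auto intro!: nn_integral_cong simp: indicator_def abs_mult kap_nonneg tail.alpha(1) less_imp_le)
  hence "integrable lborel (\<lambda>y. indicator {0<..} y *\<^sub>R (kap * \<alpha> * (min (y\<^sup>2) 1 * \<bar>y\<bar> powr (- 1 - \<alpha>))))"
    using emeasure_Lambda_half[OF a2] by (intro integrableI_bounded) auto
  hence "set_integrable lborel {0<..} (\<lambda>y. (kap * \<alpha>) * (min (y\<^sup>2) 1 * \<bar>y\<bar> powr (- 1 - \<alpha>)))" unfolding set_integrable_def by simp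
  hence "set_integrable lborel {0<..} (\<lambda>y. min (y\<^sup>2) 1 * \<bar>y\<bar> powr (- 1 - \<alpha>))" using k0 by (simp only: set_integrable_mult_right_iff)
  also have "?this \<longleftrightarrow> set_integrable lborel {0<..} (\<lambda>y. y powr (- 1 - \<alpha>) * min (y\<^sup>2) 1)"
    by (rule set_integrable_cong) auto
  finally show ?thesis .
qed

lemma kern_Re: "min (x\<^sup>2) 1 * Re (kern t x) = - (1 - cos (t * x))" and kern_Im: "min (x\<^sup>2) 1 * Im (kern t x) = sin (t * x) - t * sin x"
proof -
  have R: "r * Re z = Re (of_real r * z)" "r * Im z = Im (of_real r * z)" for r z by simp_all
  show "min (x\<^sup>2) 1 * Re (kern t x) = - (1 - cos (t * x))" "min (x\<^sup>2) 1 * Im (kern t x) = sin (t * x) - t * sin x"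
    unfolding R kern_times by (simp_all add: Re_exp Im_exp)
qed

lemma set_integrable_weight_bounded:
  assumes a2: "\<alpha> < 2" and [measurable]: "h \<in> borel_measurable borel" and h: "\<And>y. \<bar>h y\<bar> \<le> B"
  shows "set_integrable lborel {0<..} (\<lambda>y. y powr (- 1 - \<alpha>) * (min (y\<^sup>2) 1 * h y))"
proof (rule set_integrable_bound_halfline)
  show "set_integrable lborel {0<..} (\<lambda>y. B * (y powr (- 1 - \<alpha>) * min (y\<^sup>2) 1))" by (rule set_integrable_mult_right[OF integrable_weight[OF a2]])
  show "\<bar>y powr (- 1 - \<alpha>) * (min (y\<^sup>2) 1 * h y)\<bar> \<le> B * (y powr (- 1 - \<alpha>) * min (y\<^sup>2) 1)" for y
  proof -
    have "\<bar>y powr (- 1 - \<alpha>) * (min (y\<^sup>2) 1 * h y)\<bar> = (y powr (- 1 - \<alpha>) * min (y\<^sup>2) 1) * \<bar>h y\<bar>" by (simp add: abs_mult)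
    also have "\<dots> \<le> (y powr (- 1 - \<alpha>) * min (y\<^sup>2) 1) * B" by (intro mult_left_mono h) auto
    finally show ?thesis by (simp add: mult.commute)
  qed
qed measurable

lemma integral_Glim:
  assumes a2: "\<alpha> < 2" and [measurable]: "h \<in> borel_measurable borel" and h: "\<And>y. \<bar>h y\<bar> \<le> B"
  shows "(LINT x|Glim. h x) = kap * \<alpha> * (p * (LINT y:{0<..}|lborel. y powr (- 1 - \<alpha>) * (min (y\<^sup>2) 1 * h y))
    + (1 - p) * (LINT y:{0<..}|lborel. y powr (- 1 - \<alpha>) * (min (y\<^sup>2) 1 * h (- y))))"
proof -
  let ?R = "LINT y:{0<..}|lborel. y powr (- 1 - \<alpha>) * (min (y\<^sup>2) 1 * h y)"
  let ?L = "LINT y:{0<..}|lborel. y powr (- 1 - \<alpha>) * (min (y\<^sup>2) 1 * h (- y))"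
  define g where "g y = indicator {0<..} y *\<^sub>R (y powr (- 1 - \<alpha>) * (min (y\<^sup>2) 1 * h y))" for y
  define g' where "g' y = indicator {0<..} y *\<^sub>R (y powr (- 1 - \<alpha>) * (min (y\<^sup>2) 1 * h (- y)))" for y
  have k0: "0 \<le> kap * \<alpha>" using kap_nonneg tail.alpha by simp
  have 1: "has_bochner_integral lborel g ?R"
    using set_integrable_weight_bounded[OF a2 assms(2) h] by (simp add: has_bochner_integral_iff set_integrable_def set_lebesgue_integral_def g_def[abs_def])
  have "has_bochner_integral lborel g' ?L"
    using set_integrable_weight_bounded[OF a2 _ h, of "\<lambda>y. - y"] by (simp add: has_bochner_integral_iff set_integrable_def set_lebesgue_integral_def g'_def[abs_def])
  hence 2: "has_bochner_integral lborel (\<lambda>y. g' (0 + (- 1) * y)) (?L /\<^sub>R \<bar>- 1\<bar>)"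
    by (subst (asm) lborel_has_bochner_integral_real_affine_iff[of "- 1" _ _ 0]) auto
  have 3: "has_bochner_integral lborel (\<lambda>y. kap * \<alpha> * (p * g y + (1 - p) * g' (0 + (- 1) * y))) (kap * \<alpha> * (p * ?R + (1 - p) * (?L /\<^sub>R \<bar>- 1\<bar>)))"
    by (intro has_bochner_integral_mult_right has_bochner_integral_add 1 2)
  have G: "Glim = density \<Lambda> (\<lambda>x. ennreal (if 0 < x then p else 1 - p))" using a2 by (simp add: Glim_def)
  have "(LINT x|Glim. h x) = (LINT x|\<Lambda>. (if 0 < x then p else 1 - p) *\<^sub>R h x)"
    unfolding G using p_bounds by (intro integral_density) auto
  also have "\<dots> = (LINT x|lborel. (kap * \<alpha> * (min (x\<^sup>2) 1 * \<bar>x\<bar> powr (- 1 - \<alpha>))) *\<^sub>R ((if 0 < x then p else 1 - p) *\<^sub>R h x))"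
    unfolding \<Lambda>_def using k0 by (intro integral_density) auto
  also have "\<dots> = (LINT y|lborel. kap * \<alpha> * (p * g y + (1 - p) * g' (0 + (- 1) * y)))"
  proof (rule integral_cong_AE)
    have "AE x in lborel. x \<noteq> (0::real)" by (rule AE_lborel_singleton)
    thus "AE x in lborel. (kap * \<alpha> * (min (x\<^sup>2) 1 * \<bar>x\<bar> powr (- 1 - \<alpha>))) *\<^sub>R ((if 0 < x then p else 1 - p) *\<^sub>R h x) = kap * \<alpha> * (p * g x + (1 - p) * g' (0 + (- 1) * x))"
      by eventually_elim (auto simp: g_def g'_def indicator_def)
  qed (auto simp: g_def g'_def)
  also have "\<dots> = kap * \<alpha> * (p * ?R + (1 - p) * (?L /\<^sub>R \<bar>- 1\<bar>))" using 3 by (simp add: has_bochner_integral_iff)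
  finally show ?thesis by simp
qed

lemma integrable_cos_sin_weight:
  assumes a2: "\<alpha> < 2"
  shows "set_integrable lborel {0<..} (\<lambda>y. y powr (- 1 - \<alpha>) * (1 - cos (t * y)))"
    and "set_integrable lborel {0<..} (\<lambda>y. y powr (- 1 - \<alpha>) * (sin (t * y) - t * sin y))"
proof -
  have b: "\<bar>Im (kern t y)\<bar> \<le> \<bar>t\<bar> ^ 3 + t\<^sup>2 + \<bar>t\<bar> + 2" "\<bar>- Re (kern t y)\<bar> \<le> \<bar>t\<bar> ^ 3 + t\<^sup>2 + \<bar>t\<bar> + 2" for y
    using abs_Im_le_cmod[of "kern t y"] abs_Re_le_cmod[of "kern t y"] kern_bound[of t y] by auto
  show "set_integrable lborel {0<..} (\<lambda>y. y powr (- 1 - \<alpha>) * (1 - cos (t * y)))"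
    using set_integrable_weight_bounded[where h="\<lambda>y. - Re (kern t y)", OF a2 _ b(2)] by (simp add: kern_Re mult_minus_right)
  show "set_integrable lborel {0<..} (\<lambda>y. y powr (- 1 - \<alpha>) * (sin (t * y) - t * sin y))"
    using set_integrable_weight_bounded[where h="\<lambda>y. Im (kern t y)", OF a2 _ b(1)] by (simp add: kern_Im)
qed

text \<open>The real part of the kernel is even, so the weights p and 1 - p add up to 1; the
  imaginary part is odd, so they subtract to \<open>2 * p - 1\<close>.\<close>

lemma \<psi>_eq:
  assumes a2: "\<alpha> < 2"
  shows "\<psi> t = Complex (- (kap * \<alpha> * (LINT y:{0<..}|lborel. y powr (- 1 - \<alpha>) * (1 - cos (t * y)))))
    (kap * \<alpha> * ((2 * p - 1) * (LINT y:{0<..}|lborel. y powr (- 1 - \<alpha>) * (sin (t * y) - t * sin y))))"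
proof -
  interpret Glim: real_distribution Glim by (rule real_distribution_Glim)
  let ?A = "LINT y:{0<..}|lborel. y powr (- 1 - \<alpha>) * (1 - cos (t * y))"
  let ?J = "LINT y:{0<..}|lborel. y powr (- 1 - \<alpha>) * (sin (t * y) - t * sin y)"
  have b: "\<bar>Im (kern t y)\<bar> \<le> \<bar>t\<bar> ^ 3 + t\<^sup>2 + \<bar>t\<bar> + 2" "\<bar>Re (kern t y)\<bar> \<le> \<bar>t\<bar> ^ 3 + t\<^sup>2 + \<bar>t\<bar> + 2" for y
    using abs_Im_le_cmod[of "kern t y"] abs_Re_le_cmod[of "kern t y"] kern_bound[of t y] by auto
  have int: "integrable Glim (kern t)"
    by (rule Glim.integrable_const_bound[where B="\<bar>t\<bar> ^ 3 + t\<^sup>2 + \<bar>t\<bar> + 2"]) (use kern_bound in auto)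
  have m: "min (y\<^sup>2) 1 * Re (kern t (- y)) = - (1 - cos (t * y))" "min (y\<^sup>2) 1 * Im (kern t (- y)) = - (sin (t * y) - t * sin y)" for y
    using kern_Re[of "- y" t] kern_Im[of "- y" t] by simp_all
  have neg: "y powr (- 1 - \<alpha>) * (- z) = - (y powr (- 1 - \<alpha>) * z)" for y z by simp
  have "Re (\<psi> t) = (LINT x|Glim. Re (kern t x))" unfolding \<psi>_def by (rule integral_Re[OF int, symmetric])
  also have "\<dots> = kap * \<alpha> * (p * - ?A + (1 - p) * - ?A)"
    by (subst integral_Glim[OF a2 _ b(2)]) (simp_all only: kern_Re m neg set_integral_uminus integrable_cos_sin_weight[OF a2], measurable)
  finally have re: "Re (\<psi> t) = - (kap * \<alpha> * ?A)" by (simp add: algebra_simps)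
  have "Im (\<psi> t) = (LINT x|Glim. Im (kern t x))" unfolding \<psi>_def by (rule integral_Im[OF int, symmetric])
  also have "\<dots> = kap * \<alpha> * (p * ?J + (1 - p) * - ?J)"
    by (subst integral_Glim[OF a2 _ b(1)]) (simp_all only: kern_Im m neg set_integral_uminus integrable_cos_sin_weight[OF a2], measurable)
  finally have im: "Im (\<psi> t) = kap * \<alpha> * ((2 * p - 1) * ?J)" by (simp add: algebra_simps)
  show ?thesis by (rule complex_eqI) (simp_all add: re im)
qed

lemma cos_weight_abs: "(LINT y:{0<..}|lborel. y powr (- 1 - \<alpha>) * (1 - cos (\<bar>t\<bar> * y))) = (LINT y:{0<..}|lborel. y powr (- 1 - \<alpha>) * (1 - cos (t * y)))"
  by (cases "0 \<le> t") simp_all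

lemma sin_weight_abs:
  assumes a2: "\<alpha> < 2"
  shows "(LINT y:{0<..}|lborel. y powr (- 1 - \<alpha>) * (sin (t * y) - t * sin y)) = sgn t * (LINT y:{0<..}|lborel. y powr (- 1 - \<alpha>) * (sin (\<bar>t\<bar> * y) - \<bar>t\<bar> * sin y))"
proof -
  have "y powr (- 1 - \<alpha>) * (sin (t * y) - t * sin y) = sgn t * (y powr (- 1 - \<alpha>) * (sin (\<bar>t\<bar> * y) - \<bar>t\<bar> * sin y))" for y
    by (cases t "0::real" rule: linorder_cases) (simp_all add: algebra_simps)
  thus ?thesis by (simp only: set_integral_mult_right)
qed

text \<open>The exponent in \<open>stable_law\<close>, so that the parameters can be matched before
  exponentiating.\<close>

definition is_stable_exponent :: "(real \<Rightarrow> complex) \<Rightarrow> bool" where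
  "is_stable_exponent f \<longleftrightarrow> (\<exists>\<sigma> \<beta> \<gamma>. 0 < \<sigma> \<and> -1 \<le> \<beta> \<and> \<beta> \<le> 1 \<and>
       (\<forall>t. f t =
          (if \<alpha> \<noteq> 1 then
             - complex_of_real ((\<sigma> * \<bar>t\<bar>) powr \<alpha>)
                    * (1 - \<i> * complex_of_real (\<beta> * sgn t * tan (pi * \<alpha> / 2)))
                  + \<i> * complex_of_real (\<gamma> * t)
           else
             - complex_of_real (\<sigma> * \<bar>t\<bar>)
                    * (1 + \<i> * complex_of_real (\<beta> * (2 / pi) * sgn t * ln \<bar>t\<bar>))
                  + \<i> * complex_of_real (\<gamma> * t))))"

lemma stable_exponent_\<psi>: "is_stable_exponent \<psi>"
proof (cases "\<alpha> = 2")
  case True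
  have G: "Glim = return borel 0" unfolding Glim_def by (rule if_P[OF True])
  have "\<psi> t = kern t 0" for t unfolding \<psi>_def G by (rule integral_return) auto
  hence ps: "\<psi> t = - of_real (t\<^sup>2 / 2)" for t by (simp add: kern_def)
  \<comment> \<open>The Gaussian scale \<open>sqrt (1/2)\<close> turns
    \<open>\<sigma>^2 * t^2\<close> into \<open>t^2 / 2\<close>; skewness and drift are taken
    0.\<close>
  have s: "(sqrt (1/2) * \<bar>t\<bar>) powr \<alpha> = t\<^sup>2 / 2" for t
  proof -
    have "(sqrt (1/2) * \<bar>t\<bar>) powr \<alpha> = (sqrt (1/2) * \<bar>t\<bar>)\<^sup>2" unfolding True by (rule powr_numeral) simp
    thus ?thesis by (simp add: power_mult_distrib)
  qed
  have a1: "\<alpha> \<noteq> 1" unfolding True by simp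
  show ?thesis unfolding is_stable_exponent_def
    by (rule exI[of _ "sqrt (1/2)"], rule exI[of _ 0], rule exI[of _ 0]) (simp only: s ps if_P[OF a1], simp)
next
  case False
  hence a2: "\<alpha> < 2" using tail.alpha by simp
  have a0: "0 < \<alpha>" using tail.alpha by simp
  have k0: "0 < kap * \<alpha>" using a2 a0 by (simp add: kap_def)
  define C where "C = pi / (2 * sin (pi * \<alpha> / 2)) / Gamma (1 + \<alpha>)"
  have "0 < sin (pi * \<alpha> / 2)" using a0 a2 by (intro sin_gt_zero) (auto simp: field_simps)
  hence C0: "0 < C" using a0 by (auto simp: C_def intro!: divide_pos_pos Gamma_real_pos)
  have A: "(LINT y:{0<..}|lborel. y powr (- 1 - \<alpha>) * (1 - cos (t * y))) = \<bar>t\<bar> powr \<alpha> * C" for t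
  proof (cases "t = 0")
    case False
    thus ?thesis using integral_power_one_minus_cos[OF a0 a2 _ integrable_cos_sin_weight(1)[OF a2], of "\<bar>t\<bar>"] by (simp add: cos_weight_abs C_def)
  qed simp
  show ?thesis
  proof (cases "\<alpha> = 1")
    case False
    define K where "K = pi / (2 * cos (pi * \<alpha> / 2)) / Gamma (1 + \<alpha>)"
    have KC: "K = C * tan (pi * \<alpha> / 2)" using \<open>0 < sin (pi * \<alpha> / 2)\<close> by (simp add: K_def C_def tan_def)
    have J: "(LINT y:{0<..}|lborel. y powr (- 1 - \<alpha>) * (sin (t * y) - t * sin y)) = K * (sgn t * \<bar>t\<bar> powr \<alpha> - t)" for t
    proof (cases "t = 0")
      case t: False
      have "sgn t * (\<bar>t\<bar> powr \<alpha> - \<bar>t\<bar>) = sgn t * \<bar>t\<bar> powr \<alpha> - t" by (simp add: right_diff_distrib sgn_mult_abs)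
      thus ?thesis using integral_power_sin[OF a0 a2 False _ integrable_cos_sin_weight(2)[OF a2], of "\<bar>t\<bar>"] t sin_weight_abs[OF a2, of t]
        unfolding K_def[symmetric] by (simp add: mult.left_commute)
    qed simp
    \<comment> \<open>The scale comes from the cosine integral and the skewness is
      \<open>2 * p - 1\<close>. As \<open>K = C * tan (pi * \<alpha> / 2)\<close>, the sine integral
      supplies the tangent term, and its part linear in t, due to the sine centering, becomes the
      drift.\<close>
    define \<sigma> where "\<sigma> = (kap * \<alpha> * C) powr (1 / \<alpha>)"
    have s0: "0 < \<sigma>" unfolding \<sigma>_def using k0 C0 by auto
    have s: "(\<sigma> * \<bar>t\<bar>) powr \<alpha> = kap * \<alpha> * C * \<bar>t\<bar> powr \<alpha>" for t
    proof -
      have "\<sigma> powr \<alpha> = kap * \<alpha> * C" unfolding \<sigma>_def powr_powr using mult_pos_pos[OF k0 C0] a0 by simp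
      thus ?thesis using s0 by (simp add: powr_mult)
    qed
    have "\<psi> t = - complex_of_real ((\<sigma> * \<bar>t\<bar>) powr \<alpha>) * (1 - \<i> * complex_of_real ((2 * p - 1) * sgn t * tan (pi * \<alpha> / 2)))
                  + \<i> * complex_of_real (- (kap * \<alpha> * (2 * p - 1) * K) * t)" for t
      unfolding \<psi>_eq[OF a2] A J s by (rule complex_eqI) (simp_all add: KC algebra_simps)
    thus ?thesis unfolding is_stable_exponent_def using s0 p_bounds False
      by (intro exI[of _ \<sigma>] exI[of _ "2 * p - 1"] exI[of _ "- (kap * \<alpha> * (2 * p - 1) * K)"]) auto
  next
    case True
    have C: "C = pi / 2" unfolding C_def True by (simp add: Gamma_numeral)
    have J: "(LINT y:{0<..}|lborel. y powr (- 1 - \<alpha>) * (sin (t * y) - t * sin y)) = - (t * ln \<bar>t\<bar>)" for t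
    proof (cases "t = 0")
      case t: False
      have "sgn t * - (\<bar>t\<bar> * ln \<bar>t\<bar>) = - (t * ln \<bar>t\<bar>)" by (simp add: mult.assoc[symmetric] sgn_mult_abs)
      moreover have "(LINT y:{0<..}|lborel. y powr (- 1 - \<alpha>) * (sin (\<bar>t\<bar> * y) - \<bar>t\<bar> * sin y)) = - (\<bar>t\<bar> * ln \<bar>t\<bar>)"
        using integral_power_sin_1[of "\<bar>t\<bar>"] integrable_cos_sin_weight(2)[OF a2, of "\<bar>t\<bar>"] t unfolding True by simp
      ultimately show ?thesis using sin_weight_abs[OF a2, of t] by (simp only:)
    qed simp
    have st: "\<bar>t\<bar> * sgn t = t" for t :: real by (simp add: abs_mult_sgn)
    have "\<psi> t = - complex_of_real (kap * \<alpha> * C * \<bar>t\<bar>) * (1 + \<i> * complex_of_real ((2 * p - 1) * (2 / pi) * sgn t * ln \<bar>t\<bar>))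
                  + \<i> * complex_of_real (0 * t)" for t
    proof -
      have "kap * \<alpha> * C * \<bar>t\<bar> * ((2 * p - 1) * (2 / pi) * sgn t * ln \<bar>t\<bar>) = kap * \<alpha> * ((2 * p - 1) * ((\<bar>t\<bar> * sgn t) * ln \<bar>t\<bar>))"
        unfolding C by simp
      hence e: "kap * \<alpha> * C * \<bar>t\<bar> * ((2 * p - 1) * (2 / pi) * sgn t * ln \<bar>t\<bar>) = kap * \<alpha> * ((2 * p - 1) * (t * ln \<bar>t\<bar>))" unfolding st .
      have "\<bar>t\<bar> powr \<alpha> = \<bar>t\<bar>" unfolding True by simp
      hence ps: "\<psi> t = Complex (- (kap * \<alpha> * (\<bar>t\<bar> * C))) (kap * \<alpha> * ((2 * p - 1) * - (t * ln \<bar>t\<bar>)))" unfolding \<psi>_eq[OF a2] A J by simp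
      define u v where "u = kap * \<alpha> * C * \<bar>t\<bar>" and "v = (2 * p - 1) * (2 / pi) * sgn t * ln \<bar>t\<bar>"
      have uv: "- complex_of_real u * (1 + \<i> * complex_of_real v) + \<i> * complex_of_real (0 * t) = Complex (- u) (- (u * v))"
        by (rule complex_eqI) simp_all
      show ?thesis unfolding u_def[symmetric] v_def[symmetric] uv unfolding u_def v_def e ps by (simp add: mult_ac)
    qed
    \<comment> \<open>For \<alpha> = 1 the scale \<open>kap * \<alpha> * C\<close> is
      \<open>pi / 4\<close>, and the sine centering leaves no drift.\<close>
    thus ?thesis unfolding is_stable_exponent_def using k0 C0 p_bounds
      by (intro exI[of _ "kap * \<alpha> * C"] exI[of _ "2 * p - 1"] exI[of _ 0]) (auto simp: True simp del: of_real_mult)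
  qed
qed

lemma stable_law_of_char:
  assumes "real_distribution \<mu>" "\<And>t. char \<mu> t = exp (\<psi> t)"
  shows "stable_law \<alpha> \<mu>"
proof -
  obtain \<sigma> \<beta> \<gamma> where s: "0 < \<sigma>" "-1 \<le> \<beta>" "\<beta> \<le> 1" and ps: "\<forall>t. \<psi> t =
          (if \<alpha> \<noteq> 1 then
             - complex_of_real ((\<sigma> * \<bar>t\<bar>) powr \<alpha>)
                    * (1 - \<i> * complex_of_real (\<beta> * sgn t * tan (pi * \<alpha> / 2)))
                  + \<i> * complex_of_real (\<gamma> * t)
           else
             - complex_of_real (\<sigma> * \<bar>t\<bar>)
                    * (1 + \<i> * complex_of_real (\<beta> * (2 / pi) * sgn t * ln \<bar>t\<bar>))
                  + \<i> * complex_of_real (\<gamma> * t))"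
    using stable_exponent_\<psi> unfolding is_stable_exponent_def by (elim exE conjE)
  show ?thesis unfolding stable_law_def
    by (rule conjI[OF assms(1)], rule exI[of _ \<sigma>], rule exI[of _ \<beta>], rule exI[of _ \<gamma>])
       (intro conjI s allI, simp only: assms(2) ps[rule_format] if_distrib[of exp])
qed

end

section \<open>Limit theorems\<close>

context stable_domain
begin

text \<open>By independence the characteristic function of the normalised sum is exactly the n-th
  power treated in \<open>char_power_limit\<close>; its limit is continuous at 0, so it belongs to a
  law, which the parameters found above identify as stable.\<close>

lemma iid_sum_weak_limit:
  fixes M :: "'b measure" and \<zeta> :: "nat \<Rightarrow> 'b \<Rightarrow> real"
  assumes "prob_space M" and indep: "prob_space.indep_vars M (\<lambda>_. borel) \<zeta> {1..}" and D: "\<And>k. 1 \<le> k \<Longrightarrow> distr M borel (\<zeta> k) = D"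
  shows "\<exists>\<mu>. stable_law \<alpha> \<mu> \<and> weak_conv_m (\<lambda>n. distr M borel (\<lambda>\<omega>. ((\<Sum>k=1..n. \<zeta> k \<omega>) - real n * (a n * centering n)) / a n)) \<mu>"
proof -
  interpret M: prob_space M by fact
  let ?N = "\<lambda>n. distr M borel (\<lambda>\<omega>. ((\<Sum>k=1..n. \<zeta> k \<omega>) - real n * (a n * centering n)) / a n)"
  have rv: "\<zeta> k \<in> borel_measurable M" if "1 \<le> k" for k using indep that unfolding M.indep_vars_def by auto
  have S [measurable]: "(\<lambda>\<omega>. \<Sum>k=1..n. \<zeta> k \<omega>) \<in> borel_measurable M" for n by (rule borel_measurable_sum) (use rv in auto)
  have T: "(\<lambda>\<omega>. ((\<Sum>k=1..n. \<zeta> k \<omega>) - real n * (a n * centering n)) / a n) \<in> borel_measurable M" for n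
    by (intro borel_measurable_divide borel_measurable_diff S borel_measurable_const)
  have rd: "real_distribution (?N n)" for n by (rule M.real_distribution_distr[OF T])
  have char: "char (?N n) t = (char D (t / a n) * iexp (- (t * centering n))) ^ n" for n t
  proof -
    have "char (distr M borel (\<lambda>\<omega>. \<Sum>k\<in>{1..n}. \<zeta> k \<omega>)) (t / a n) = (\<Prod>k\<in>{1..n}. char (distr M borel (\<zeta> k)) (t / a n))"
      by (rule M.char_distr_sum) (rule M.indep_vars_subset[OF indep], auto)
    also have "\<dots> = char D (t / a n) ^ n" by (simp add: D)
    finally have 1: "(CLINT \<omega>|M. iexp (t / a n * (\<Sum>k=1..n. \<zeta> k \<omega>))) = char D (t / a n) ^ n"
      unfolding char_def by (subst (asm) integral_distr[OF S]) measurable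
    have "char (?N n) t = (CLINT \<omega>|M. iexp (t * (((\<Sum>k=1..n. \<zeta> k \<omega>) - real n * (a n * centering n)) / a n)))"
      unfolding char_def by (subst integral_distr[OF T]) measurable
    also have "\<dots> = (CLINT \<omega>|M. iexp (- (t * centering n)) ^ n * iexp (t / a n * (\<Sum>k=1..n. \<zeta> k \<omega>)))"
    proof (rule Bochner_Integration.integral_cong[OF refl])
      fix \<omega>
      have "t * (((\<Sum>k=1..n. \<zeta> k \<omega>) - real n * (a n * centering n)) / a n) = real n * (- (t * centering n)) + t / a n * (\<Sum>k=1..n. \<zeta> k \<omega>)"
        using norming_pos[of n] by (simp add: field_simps)
      moreover have "iexp (- (t * centering n)) ^ n = iexp (real n * (- (t * centering n)))"
        by (simp add: exp_of_nat_mult[symmetric] mult_ac)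
      ultimately show "iexp (t * (((\<Sum>k=1..n. \<zeta> k \<omega>) - real n * (a n * centering n)) / a n)) = iexp (- (t * centering n)) ^ n * iexp (t / a n * (\<Sum>k=1..n. \<zeta> k \<omega>))"
        by (simp only: of_real_add distrib_left exp_add)
    qed
    also have "\<dots> = iexp (- (t * centering n)) ^ n * (CLINT \<omega>|M. iexp (t / a n * (\<Sum>k=1..n. \<zeta> k \<omega>)))"
      by (rule integral_mult_right_zero)
    also have "\<dots> = (char D (t / a n) * iexp (- (t * centering n))) ^ n" unfolding 1 by (simp add: power_mult_distrib)
    finally show ?thesis .
  qed
  have lim: "(\<lambda>n. char (?N n) t) \<longlonglongrightarrow> exp (\<psi> t)" for t unfolding char by (rule char_power_limit)
  have "isCont (\<lambda>t. exp (\<psi> t)) 0" by (intro isCont_exp' \<psi>_isCont_0)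
  from levy_existence[of ?N, OF rd lim this] obtain \<mu> where \<mu>: "real_distribution \<mu>" "char \<mu> = (\<lambda>t. exp (\<psi> t))" by auto
  have "weak_conv_m ?N \<mu>" by (rule levy_continuity[OF rd \<mu>(1)]) (use lim in \<open>simp add: \<mu>(2)\<close>)
  moreover have "stable_law \<alpha> \<mu>" by (rule stable_law_of_char[OF \<mu>(1)]) (simp add: \<mu>(2))
  ultimately show ?thesis by auto
qed

text \<open>Supplies the tail and second moment hypotheses of the concentration result for
  \<open>Z = spread 1\<close> and the truncation \<open>2 * a n\<close>, using that
  \<open>n * H (a n)\<close> and \<open>n * U (a n) / (a n)^2\<close> are bounded.\<close>

lemma tail_comparison:
  fixes M :: "'b measure" and Z :: "'b \<Rightarrow> real"
  assumes "prob_space M" and [measurable]: "Z \<in> borel_measurable M" and Z0: "\<And>\<omega>. \<omega> \<in> space M \<Longrightarrow> 0 \<le> Z \<omega>"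
    and tail: "\<forall>\<^sub>F u in at_top. measure M {\<omega> \<in> space M. 2 * u < Z \<omega>} \<le> B * H u"
  shows "\<exists>C. \<forall>n\<ge>1. real n * measure M {\<omega> \<in> space M. 2 * a n < Z \<omega>} \<le> C
     \<and> real n * (LINT \<omega>|M. (min (Z \<omega>) (2 * a n))\<^sup>2) \<le> C * (a n)\<^sup>2"
proof -
  interpret M: prob_space M by fact
  obtain u0 where u0: "\<And>u. u0 \<le> u \<Longrightarrow> measure M {\<omega> \<in> space M. 2 * u < Z \<omega>} \<le> B * H u" using tail unfolding eventually_at_top_linorder by auto
  \<comment> \<open>Extends the eventual bound to all \<open>u > 0\<close>: below \<open>u0\<close>
    the tail \<open>H u\<close> is at least \<open>H (max u0 1)\<close>, so the second term makes
    the bound at least 1.\<close>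
  define c where "c = max B (1 / H (max u0 1))"
  have Hp: "0 < H (max u0 1)" by (rule tail.H_pos) simp
  have c: "M.prob {\<omega> \<in> space M. 2 * u < Z \<omega>} \<le> c * H u" if u: "0 < u" for u
  proof (cases "u0 \<le> u")
    case True
    have "B * H u \<le> c * H u" unfolding c_def by (intro mult_right_mono tail.H_nonneg u) auto
    thus ?thesis using u0[OF True] by linarith
  next
    case False
    have "H (max u0 1) \<le> H u" using False u by (intro tail.H_mono) auto
    hence "1 \<le> (1 / H (max u0 1)) * H u" using Hp by (simp add: field_simps)
    also have "\<dots> \<le> c * H u" unfolding c_def by (intro mult_right_mono tail.H_nonneg u) auto
    finally show ?thesis using M.prob_le_1[of "{\<omega> \<in> space M. 2 * u < Z \<omega>}"] by linarith
  qed
  have c0: "0 \<le> c" unfolding c_def using Hp by (simp add: le_max_iff_disj)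
  have sq: "(LINT \<omega>|M. (min (Z \<omega>) (2 * x))\<^sup>2) \<le> 4 * c * tail.U x" if x: "0 < x" for x
  proof -
    have "(LINT \<omega>|M. (min (Z \<omega>) (2 * x))\<^sup>2) = (LINT \<omega>|M. 4 * (min (max (Z \<omega> / 2) 0) x)\<^sup>2)"
    proof (rule Bochner_Integration.integral_cong[OF refl])
      fix \<omega> assume "\<omega> \<in> space M"
      hence "min (Z \<omega>) (2 * x) = 2 * min (max (Z \<omega> / 2) 0) x" using Z0[of \<omega>] x by (auto simp: min_def max_def)
      thus "(min (Z \<omega>) (2 * x))\<^sup>2 = 4 * (min (max (Z \<omega> / 2) 0) x)\<^sup>2" by (simp add: power_mult_distrib)
    qed
    also have "\<dots> = 4 * (LINT u:{0<..x}|lborel. 2 * u * M.prob {\<omega> \<in> space M. u < Z \<omega> / 2})"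
      using x by (subst integral_mult_right_zero) (subst M.expectation_sq_min_layer_cake, auto)
    also have "(LINT u:{0<..x}|lborel. 2 * u * M.prob {\<omega> \<in> space M. u < Z \<omega> / 2}) \<le> (LINT u:{0<..x}|lborel. c * (2 * u * H u))"
    \<comment> \<open>If the integrand on the left is not integrable, its integral is 0 by
      convention, and nonnegativity of the right-hand side settles the bound.\<close>
    proof (cases "set_integrable lborel {0<..x} (\<lambda>u. 2 * u * M.prob {\<omega> \<in> space M. u < Z \<omega> / 2})")
      case True
      show ?thesis
      proof (rule set_integral_mono[OF True])
        show "set_integrable lborel {0<..x} (\<lambda>u. c * (2 * u * H u))" by (rule set_integrable_mult_right[OF tail.trunc_moment_integrable[OF tail.dominated_tail_H]])
        fix u assume u: "u \<in> {0<..x}"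
        have "2 * u * M.prob {\<omega> \<in> space M. u < Z \<omega> / 2} \<le> 2 * u * (c * H u)" using c[of u] u by (intro mult_left_mono) (auto simp: field_simps)
        thus "2 * u * M.prob {\<omega> \<in> space M. u < Z \<omega> / 2} \<le> c * (2 * u * H u)" by (simp add: mult_ac)
      qed
    next
      case False
      hence "(LINT u:{0<..x}|lborel. 2 * u * M.prob {\<omega> \<in> space M. u < Z \<omega> / 2}) = 0"
        unfolding set_integrable_def set_lebesgue_integral_def by (rule not_integrable_integral_eq)
      moreover have "0 \<le> (LINT u:{0<..x}|lborel. c * (2 * u * H u))" unfolding set_lebesgue_integral_def
        by (rule Bochner_Integration.integral_nonneg) (use c0 tail.H_nonneg in \<open>auto simp: indicator_def\<close>)
      ultimately show ?thesis by simp
    qed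
    also have "(LINT u:{0<..x}|lborel. c * (2 * u * H u)) = c * tail.U x" unfolding tail.trunc_moment_def by (rule set_integral_mult_right)
    finally show ?thesis by simp
  qed
  have "Bseq (\<lambda>n. real n * H (a n))" by (rule convergent_imp_Bseq[OF convergentI[OF n_H_norming]])
  then obtain K1 where K1: "\<And>n. norm (real n * H (a n)) \<le> K1" unfolding Bseq_def by auto
  have "(\<lambda>n. real n * tail.U (a n) / (a n)\<^sup>2) \<longlonglongrightarrow> 1"
    by (rule tendsto_eventually) (use norming(3) in eventually_elim, use norming_pos in \<open>simp add: less_imp_neq[symmetric]\<close>)
  hence "Bseq (\<lambda>n. real n * tail.U (a n) / (a n)\<^sup>2)" by (rule convergent_imp_Bseq[OF convergentI])
  then obtain K2 where K2: "\<And>n. norm (real n * tail.U (a n) / (a n)\<^sup>2) \<le> K2" unfolding Bseq_def by auto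
  show ?thesis
  proof (intro exI[of _ "max (c * K1) (4 * c * K2)"] allI impI conjI)
    fix n :: nat
    have "real n * M.prob {\<omega> \<in> space M. 2 * a n < Z \<omega>} \<le> real n * (c * H (a n))" by (intro mult_left_mono c norming_pos) auto
    also have "\<dots> = c * (real n * H (a n))" by simp
    also have "\<dots> \<le> c * K1" using K1[of n] by (intro mult_left_mono c0) (simp add: abs_le_iff)
    finally show "real n * M.prob {\<omega> \<in> space M. 2 * a n < Z \<omega>} \<le> max (c * K1) (4 * c * K2)" by simp
    have a2: "0 < (a n)\<^sup>2" using norming_pos[of n] by simp
    have "real n * tail.U (a n) / (a n)\<^sup>2 \<le> K2" using K2[of n] by (simp only: real_norm_def abs_le_iff)
    hence k: "real n * tail.U (a n) \<le> K2 * (a n)\<^sup>2" using a2 by (simp add: pos_divide_le_eq)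
    have "real n * (LINT \<omega>|M. (min (Z \<omega>) (2 * a n))\<^sup>2) \<le> real n * (4 * c * tail.U (a n))" by (intro mult_left_mono sq norming_pos) auto
    also have "\<dots> = 4 * c * (real n * tail.U (a n))" by simp
    also have "\<dots> \<le> 4 * c * (K2 * (a n)\<^sup>2)" using c0 by (intro mult_left_mono k) auto
    also have "\<dots> = (4 * c * K2) * (a n)\<^sup>2" by simp
    also have "\<dots> \<le> max (c * K1) (4 * c * K2) * (a n)\<^sup>2" by (intro mult_right_mono) auto
    finally show "real n * (LINT \<omega>|M. (min (Z \<omega>) (2 * a n))\<^sup>2) \<le> max (c * K1) (4 * c * K2) * (a n)\<^sup>2" .
  qed
qed

end

lemma regular_ratio_limit:
  fixes L :: "real \<Rightarrow> real"
  assumes L: "slowly_varying L" and c: "0 < c"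
  shows "((\<lambda>u. (u powr \<alpha> / L u) / ((c * u) powr \<alpha> / L (c * u))) \<longlongrightarrow> c powr - \<alpha>) at_top"
proof -
  have "((\<lambda>u. L (c * u) / L u) \<longlongrightarrow> 1) at_top" using L c unfolding slowly_varying_def by auto
  hence "((\<lambda>u. c powr - \<alpha> * (L (c * u) / L u)) \<longlongrightarrow> c powr - \<alpha> * 1) at_top" by (intro tendsto_intros)
  moreover have "\<forall>\<^sub>F u in at_top. c powr - \<alpha> * (L (c * u) / L u) = (u powr \<alpha> / L u) / ((c * u) powr \<alpha> / L (c * u))"
    using eventually_gt_at_top[of 0] by eventually_elim (use c in \<open>simp add: powr_mult powr_minus field_simps\<close>)
  ultimately show ?thesis by (auto elim: Lim_transform_eventually)
qed

text \<open>For \<open>b > 1\<close> the value \<open>P u\<close> lies between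
  \<open>Q (b * u)\<close> and \<open>Q u\<close>, and regular variation makes the lower bound
  smaller only by the factor \<open>b powr - \<alpha>\<close>, which tends to 1 as b decreases to 1.
  It converts the non-strict left tail of hypothesis (i) into the open half-lines used for
  \<open>H\<close>.\<close>

lemma strict_tail_limit:
  fixes P Q L :: "real \<Rightarrow> real"
  assumes L: "slowly_varying L" and Q: "((\<lambda>u. u powr \<alpha> / L u * Q u) \<longlongrightarrow> c) at_top"
    and le: "\<And>u. P u \<le> Q u" and ge: "\<And>u v. 0 < u \<Longrightarrow> u < v \<Longrightarrow> Q v \<le> P u"
  shows "((\<lambda>u. u powr \<alpha> / L u * P u) \<longlongrightarrow> c) at_top"
proof (rule order_tendstoI)
  have Lpos: "\<forall>\<^sub>F u in at_top. 0 < L u" using L unfolding slowly_varying_def by simp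
  { fix l assume l: "c < l"
    from order_tendstoD(2)[OF Q l] Lpos eventually_gt_at_top[of 0] show "\<forall>\<^sub>F u in at_top. u powr \<alpha> / L u * P u < l"
    proof eventually_elim
      fix u assume u: "u powr \<alpha> / L u * Q u < l" "0 < L u" "0 < u"
      have "u powr \<alpha> / L u * P u \<le> u powr \<alpha> / L u * Q u" using u by (intro mult_left_mono le) auto
      thus "u powr \<alpha> / L u * P u < l" using u by simp
    qed }
  { fix l assume l: "l < c"
    have "((\<lambda>b::real. c * b powr - \<alpha>) \<longlongrightarrow> c * 1 powr - \<alpha>) (at_right 1)" by (intro tendsto_intros) auto
    hence "\<forall>\<^sub>F b in at_right 1. l < c * b powr - \<alpha>" using l by (intro order_tendstoD(1)) auto
    hence "\<forall>\<^sub>F b in at_right 1. l < c * b powr - \<alpha> \<and> 1 < b" by (intro eventually_conj eventually_at_right_less)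
    then obtain b :: real where b: "l < c * b powr - \<alpha>" "1 < b" using eventually_happens'[of "at_right (1::real)"] by auto
    have lim: "((\<lambda>u. ((b * u) powr \<alpha> / L (b * u) * Q (b * u)) * ((u powr \<alpha> / L u) / ((b * u) powr \<alpha> / L (b * u)))) \<longlongrightarrow> c * b powr - \<alpha>) at_top"
    proof (rule tendsto_mult)
      show "((\<lambda>u. (b * u) powr \<alpha> / L (b * u) * Q (b * u)) \<longlongrightarrow> c) at_top"
        by (rule filterlim_compose[OF Q]) (use b in \<open>auto intro!: filterlim_tendsto_pos_mult_at_top[OF tendsto_const] filterlim_ident\<close>)
    qed (rule regular_ratio_limit[OF L], use b in simp)
    have Lb: "\<forall>\<^sub>F u in at_top. 0 < L (b * u)"
      by (rule eventually_compose_filterlim[OF Lpos]) (use b in \<open>auto intro!: filterlim_tendsto_pos_mult_at_top[OF tendsto_const] filterlim_ident\<close>)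
    have "\<forall>\<^sub>F u in at_top. l < ((b * u) powr \<alpha> / L (b * u) * Q (b * u)) * ((u powr \<alpha> / L u) / ((b * u) powr \<alpha> / L (b * u))) \<and> 0 < L (b * u)"
      by (rule eventually_conj[OF order_tendstoD(1)[OF lim b(1)] Lb])
    thus "\<forall>\<^sub>F u in at_top. l < u powr \<alpha> / L u * P u" using Lpos eventually_gt_at_top[of 0]
    proof eventually_elim
      fix u assume u: "l < ((b * u) powr \<alpha> / L (b * u) * Q (b * u)) * ((u powr \<alpha> / L u) / ((b * u) powr \<alpha> / L (b * u))) \<and> 0 < L (b * u)" "0 < L u" "0 < u"
      have n0: "(b * u) powr \<alpha> / L (b * u) \<noteq> 0" using u b by auto
      have "(r * q) * (s / r) = s * q" if "r \<noteq> 0" for r q s :: real using that by simp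
      from this[OF n0] have "((b * u) powr \<alpha> / L (b * u) * Q (b * u)) * ((u powr \<alpha> / L u) / ((b * u) powr \<alpha> / L (b * u))) = u powr \<alpha> / L u * Q (b * u)" .
      hence "l < u powr \<alpha> / L u * Q (b * u)" using u(1) by (simp only:)
      also have "\<dots> \<le> u powr \<alpha> / L u * P u" using u b by (intro mult_left_mono ge) auto
      finally show "l < u powr \<alpha> / L u * P u" .
    qed }
qed

text \<open>Both tails are asymptotic to constants over the normaliser
  \<open>u powr \<alpha> / L u\<close>. Their sum therefore inherits regular variation from it, and
  the share of the right tail tends to the quotient of the constants.\<close>

lemma (in prob_space) stable_domain_of_tails:
  fixes Z :: "'a \<Rightarrow> real" and L :: "real \<Rightarrow> real"
  assumes [measurable]: "Z \<in> borel_measurable M"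
    and alpha: "0 < \<alpha>" "\<alpha> \<le> 2" and L: "slowly_varying L" and L_unb: "\<alpha> = 2 \<Longrightarrow> \<not> (\<exists>C. \<forall>\<^sub>F u in at_top. L u \<le> C)"
    and cpm: "0 \<le> c_plus" "0 \<le> c_minus" "0 < c_plus + c_minus"
    and tail_plus: "((\<lambda>u. u powr \<alpha> / L u * prob {\<omega> \<in> space M. u < Z \<omega>}) \<longlongrightarrow> c_plus) at_top"
    and tail_minus: "((\<lambda>u. u powr \<alpha> / L u * prob {\<omega> \<in> space M. Z \<omega> \<le> - u}) \<longlongrightarrow> c_minus) at_top"
  shows "stable_domain (distr M borel Z) \<alpha> (c_plus / (c_plus + c_minus))"
    and "((\<lambda>u. u powr \<alpha> / L u * (measure (distr M borel Z) {u<..} + measure (distr M borel Z) {..<-u})) \<longlongrightarrow> c_plus + c_minus) at_top"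
proof -
  let ?D = "distr M borel Z"
  interpret D: real_distribution ?D by (rule real_distribution_distr) measurable
  let ?R = "\<lambda>u. u powr \<alpha> / L u"
  define h where "h u = measure ?D {u<..} + measure ?D {..<-u}" for u
  have Lpos: "\<forall>\<^sub>F u in at_top. 0 < L u" using L unfolding slowly_varying_def by simp
  have mp: "measure ?D {u<..} = prob {\<omega> \<in> space M. u < Z \<omega>}" for u
    by (subst measure_distr) (auto intro!: arg_cong[where f=prob])
  have mm: "measure ?D {..<-u} = prob {\<omega> \<in> space M. Z \<omega> < - u}" for u
    by (subst measure_distr) (auto intro!: arg_cong[where f=prob])
  have tp: "((\<lambda>u. ?R u * measure ?D {u<..}) \<longlongrightarrow> c_plus) at_top" unfolding mp by (rule tail_plus)
  have tm: "((\<lambda>u. ?R u * measure ?D {..<-u}) \<longlongrightarrow> c_minus) at_top" unfolding mm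
    by (rule strict_tail_limit[OF L tail_minus]) (auto intro!: finite_measure_mono)
  have th: "((\<lambda>u. ?R u * h u) \<longlongrightarrow> c_plus + c_minus) at_top"
    unfolding h_def distrib_left by (rule tendsto_add[OF tp tm])
  thus "((\<lambda>u. ?R u * (measure ?D {u<..} + measure ?D {..<-u})) \<longlongrightarrow> c_plus + c_minus) at_top" unfolding h_def .
  have R0: "\<forall>\<^sub>F u in at_top. ?R u \<noteq> 0" using Lpos eventually_gt_at_top[of 0] by eventually_elim simp
  have top: "filterlim (\<lambda>u. c * u) at_top at_top" if "0 < c" for c :: real
    using that by (intro filterlim_tendsto_pos_mult_at_top[OF tendsto_const] filterlim_ident)
  have "regular_tail h \<alpha>"
  proof
    show mono: "h v \<le> h u" if "u \<le> v" for u v unfolding h_def using that by (intro add_mono D.finite_measure_mono) auto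
    show "0 \<le> h u" for u unfolding h_def by simp
    show "h u \<le> 1" if "0 < u" for u
    proof -
      have "h u = measure ?D ({u<..} \<union> {..<-u})" unfolding h_def using that by (intro D.finite_measure_Union[symmetric]) auto
      thus ?thesis using D.prob_le_1[of "{u<..} \<union> {..<-u}"] by (simp only:)
    qed
    show "((\<lambda>u. h (c * u) / h u) \<longlongrightarrow> c powr - \<alpha>) at_top" if c: "0 < c" for c
    proof -
      have "((\<lambda>u. (?R (c * u) * h (c * u)) / (?R u * h u) * (?R u / ?R (c * u))) \<longlongrightarrow> (c_plus + c_minus) / (c_plus + c_minus) * c powr - \<alpha>) at_top"
        using cpm by (intro tendsto_mult tendsto_divide filterlim_compose[OF th top[OF c]] th regular_ratio_limit[OF L c]) auto
      moreover have "\<forall>\<^sub>F u in at_top. (?R (c * u) * h (c * u)) / (?R u * h u) * (?R u / ?R (c * u)) = h (c * u) / h u"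
        using R0 eventually_compose_filterlim[OF R0 top[OF c]]
      proof eventually_elim
        fix u assume "?R u \<noteq> 0" "?R (c * u) \<noteq> 0"
        moreover have "(r * x) / (s * y) * (s / r) = x / y" if "s \<noteq> 0" "r \<noteq> 0" for r s x y :: real using that by simp
        ultimately show "(?R (c * u) * h (c * u)) / (?R u * h u) * (?R u / ?R (c * u)) = h (c * u) / h u" by blast
      qed
      ultimately show ?thesis using cpm by (auto elim: Lim_transform_eventually)
    qed
    show "(h \<longlongrightarrow> 0) at_top"
    proof (rule tendsto_sandwich[OF _ _ tendsto_const])
      show "((\<lambda>u. (1 - cdf ?D u) + cdf ?D (- u)) \<longlongrightarrow> 0) at_top"
        using tendsto_add[OF tendsto_diff[OF tendsto_const[of 1] D.cdf_lim_at_top_prob] filterlim_compose[OF D.cdf_lim_at_bot filterlim_uminus_at_bot_at_top]] by simp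
      have "h u \<le> (1 - cdf ?D u) + cdf ?D (- u)" for u
      proof -
        have "measure ?D {u<..} = 1 - cdf ?D u" unfolding cdf_def using D.prob_compl[of "{..u}"] by (simp add: Compl_eq_Diff_UNIV[symmetric] del: Compl_eq_Diff_UNIV)
        moreover have "measure ?D {..<-u} \<le> cdf ?D (- u)" unfolding cdf_def by (intro D.finite_measure_mono) auto
        ultimately show ?thesis unfolding h_def by simp
      qed
      thus "\<forall>\<^sub>F u in at_top. h u \<le> (1 - cdf ?D u) + cdf ?D (- u)" by simp
    qed (simp add: h_def)
    show "0 < \<alpha>" "\<alpha> \<le> 2" by fact+
    show "\<forall>C. \<exists>u>0. C < u\<^sup>2 * h u" if a2: "\<alpha> = 2"
    proof
      fix C
      let ?c = "c_plus + c_minus"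
      have "\<forall>\<^sub>F u in at_top. ?c / 2 < ?R u * h u" using cpm by (intro order_tendstoD(1)[OF th]) simp
      hence ev: "\<forall>\<^sub>F u in at_top. ?c / 2 < ?R u * h u \<and> 0 < L u \<and> 0 < u" using Lpos eventually_gt_at_top[of 0] by eventually_elim simp
      have "\<exists>\<^sub>F u in at_top. \<not> L u \<le> \<bar>C\<bar> / (?c / 2)" using L_unb[OF a2] unfolding not_eventually[symmetric] by blast
      from frequently_eventually_conj[OF this ev] obtain u where u: "?c / 2 < ?R u * h u" "0 < L u" "0 < u" "\<bar>C\<bar> / (?c / 2) < L u"
        by (auto dest!: frequently_ex)
      \<comment> \<open>For \<alpha> = 2 the product \<open>u^2 * h u\<close> is eventually at least
        a constant times \<open>L u\<close>. Unboundedness of \<open>L\<close> only yields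
        frequently large values, which is all that \<open>unb\<close> asks for.\<close>
      have "u powr \<alpha> = u\<^sup>2" unfolding a2 using u by (simp add: powr_numeral)
      hence "?c / 2 * L u < u\<^sup>2 * h u" using u(1,2) by (simp add: field_simps)
      moreover have "\<bar>C\<bar> < ?c / 2 * L u" using u(4) cpm by (simp add: field_simps)
      ultimately show "\<exists>u>0. C < u\<^sup>2 * h u" using u(3) by (intro exI[of _ u]) auto
    qed
    have "mono (\<lambda>u. - h u)" by (auto intro!: monoI mono)
    from borel_measurable_mono[OF this] show "h \<in> borel_measurable borel" by simp
  qed
  moreover have "((\<lambda>u. measure ?D {u<..} / h u) \<longlongrightarrow> c_plus / (c_plus + c_minus)) at_top"
  proof -
    have "((\<lambda>u. (?R u * measure ?D {u<..}) / (?R u * h u)) \<longlongrightarrow> c_plus / (c_plus + c_minus)) at_top"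
      using cpm by (intro tendsto_divide tp th) auto
    moreover have "\<forall>\<^sub>F u in at_top. (?R u * measure ?D {u<..}) / (?R u * h u) = measure ?D {u<..} / h u"
      using R0 by eventually_elim simp
    ultimately show ?thesis by (rule Lim_transform_eventually)
  qed
  ultimately show "stable_domain ?D \<alpha> (c_plus / (c_plus + c_minus))"
    unfolding h_def[abs_def] by (intro stable_domain.intro stable_domain_axioms.intro) (auto intro: D.real_distribution_axioms)
qed

lemma borel_measurable_inner_mult [measurable (raw)]:
  fixes f :: "'a \<Rightarrow> real^'n^'n"
  assumes [measurable]: "f \<in> borel_measurable M"
  shows "(\<lambda>\<omega>. y \<bullet> (f \<omega> *v x)) \<in> borel_measurable M"
  unfolding inner_vec_def matrix_vector_mult_def inner_real_def vec_lambda_beta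
  by (intro borel_measurable_sum borel_measurable_times borel_measurable_const) measurable

section \<open>From the entry sum to scalar products and the spectral radius\<close>

context contracting_iid_matrices
begin

text \<open>For \<open>n \<ge> 2 * l\<close> the first and last \<open>l\<close> factors do not
  overlap. When both end blocks are positive, their distortions bound that of the whole product
  whatever lies between them.\<close>

lemma tight_distortion_Xprod:
  assumes e: "0 < e"
  shows "\<exists>A. \<forall>\<^sub>F n in sequentially. prob {\<omega> \<in> space M. \<not> (Xprod X n \<omega> \<in> matS_pos \<and> distortion (Xprod X n \<omega>) \<le> A)} < e"
proof -
  obtain l A where lA: "\<And>k. prob {\<omega> \<in> space M. \<not> (window X k l \<omega> \<in> matS_pos \<and> distortion (window X k l \<omega>) \<le> A)} < e / 2"
    using tight_distortion[of "e / 2"] e by auto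
  let ?bad = "\<lambda>k. {\<omega> \<in> space M. \<not> (window X k l \<omega> \<in> matS_pos \<and> distortion (window X k l \<omega>) \<le> A)}"
  have ev: "?bad k \<in> events" for k unfolding matS_pos_iff_min_entry by measurable
  have "prob {\<omega> \<in> space M. \<not> (Xprod X n \<omega> \<in> matS_pos \<and> distortion (Xprod X n \<omega>) \<le> 2 * A)} < e" if n: "2 * l \<le> n" for n
  proof -
    have "{\<omega> \<in> space M. \<not> (Xprod X n \<omega> \<in> matS_pos \<and> distortion (Xprod X n \<omega>) \<le> 2 * A)} \<subseteq> ?bad (n - l) \<union> ?bad 0"
    proof (rule subsetI, rule ccontr)
      fix \<omega> assume w: "\<omega> \<in> {\<omega> \<in> space M. \<not> (Xprod X n \<omega> \<in> matS_pos \<and> distortion (Xprod X n \<omega>) \<le> 2 * A)}" and "\<omega> \<notin> ?bad (n - l) \<union> ?bad 0"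
      hence P: "window X (n - l) l \<omega> \<in> matS_pos" "distortion (window X (n - l) l \<omega>) \<le> A"
        and R: "Xprod X l \<omega> \<in> matS_pos" "distortion (Xprod X l \<omega>) \<le> A" by auto
      have sp: "\<omega> \<in> space M" using w by simp
      have Q: "window X l (n - 2 * l) \<omega> \<in> matS" by (rule window_matS[OF sp])
      have "Xprod X n \<omega> = window X l (n - l) \<omega> ** Xprod X l \<omega>" using Xprod_add[of X "n - l" l \<omega>] n by simp
      also have "window X l (n - l) \<omega> = window X (n - l) l \<omega> ** window X l (n - 2 * l) \<omega>"
      proof -
        have "l + (n - 2 * l) = n - l" using n by simp
        thus ?thesis using window_add[of X l l "n - 2 * l" \<omega>] by simp
      qed
      finally have eq: "Xprod X n \<omega> = window X (n - l) l \<omega> ** (window X l (n - 2 * l) \<omega> ** Xprod X l \<omega>)" by (simp only: matrix_mul_assoc)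
      have "Xprod X n \<omega> \<in> matS_pos" unfolding eq by (intro matS_pos_mult_right matS_mult P Q subsetD[OF matS_pos_subset R(1)])
      moreover have "distortion (Xprod X n \<omega>) \<le> 2 * A" unfolding eq using distortion_triple_mult_le[OF P(1) Q R(1)] P R by linarith
      ultimately show False using w by simp
    qed
    hence "prob {\<omega> \<in> space M. \<not> (Xprod X n \<omega> \<in> matS_pos \<and> distortion (Xprod X n \<omega>) \<le> 2 * A)} \<le> prob (?bad (n - l) \<union> ?bad 0)"
      by (rule finite_measure_mono) (intro sets.Un ev)
    also have "\<dots> \<le> prob (?bad (n - l)) + prob (?bad 0)" by (rule measure_Un_le[OF ev ev])
    also have "\<dots> < e" using lA[of "n - l"] lA[of 0] by linarith
    finally show ?thesis .
  qed
  thus ?thesis by (intro exI[of _ "2 * A"] eventually_sequentiallyI[of "2 * l"])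
qed

text \<open>On events of probability close to 1 the two quantities differ by at most a constant,
  which disappears after division by \<open>a n\<close>. What \<open>f n\<close> does where the
  product is not positive is irrelevant in the limit.\<close>

lemma weak_limit_transfer:
  fixes f :: "nat \<Rightarrow> 'a \<Rightarrow> real"
  assumes lim: "weak_conv_m (\<lambda>n. distr M borel (\<lambda>\<omega>. (ln (entry_sum (Xprod X n \<omega>)) - b n) / a n)) \<mu>" and mu: "real_distribution \<mu>"
    and a: "\<And>n. 0 < a n" "filterlim a at_top sequentially"
    and f [measurable]: "\<And>n. f n \<in> borel_measurable M"
    and fd: "\<And>n \<omega>. 1 \<le> n \<Longrightarrow> \<omega> \<in> space M \<Longrightarrow> Xprod X n \<omega> \<in> matS_pos \<Longrightarrow> \<bar>f n \<omega> - ln (entry_sum (Xprod X n \<omega>))\<bar> \<le> distortion (Xprod X n \<omega>)"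
  shows "weak_conv_m (\<lambda>n. distr M borel (\<lambda>\<omega>. (f n \<omega> - b n) / a n)) \<mu>"
proof (rule weak_conv_m_prob_diff[OF lim mu])
  fix \<epsilon> :: real assume eps: "0 < \<epsilon>"
  let ?E = "\<lambda>n. {\<omega> \<in> space M. \<epsilon> < \<bar>(ln (entry_sum (Xprod X n \<omega>)) - b n) / a n - (f n \<omega> - b n) / a n\<bar>}"
  show "(\<lambda>n. prob (?E n)) \<longlonglongrightarrow> 0"
  proof (rule order_tendstoI)
    fix e :: real assume "0 < e"
    from tight_distortion_Xprod[OF this] obtain A
      where A: "\<forall>\<^sub>F n in sequentially. prob {\<omega> \<in> space M. \<not> (Xprod X n \<omega> \<in> matS_pos \<and> distortion (Xprod X n \<omega>) \<le> A)} < e" by auto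
    have "\<forall>\<^sub>F n in sequentially. A / \<epsilon> \<le> a n" using a(2) by (simp add: filterlim_at_top)
    with A show "\<forall>\<^sub>F n in sequentially. prob (?E n) < e" using eventually_ge_at_top[of 1]
    proof eventually_elim
      fix n assume n: "prob {\<omega> \<in> space M. \<not> (Xprod X n \<omega> \<in> matS_pos \<and> distortion (Xprod X n \<omega>) \<le> A)} < e" "A / \<epsilon> \<le> a n" "1 \<le> n"
      have "?E n \<subseteq> {\<omega> \<in> space M. \<not> (Xprod X n \<omega> \<in> matS_pos \<and> distortion (Xprod X n \<omega>) \<le> A)}"
      proof (rule subsetI, rule ccontr)
        fix \<omega> assume w: "\<omega> \<in> ?E n" and "\<omega> \<notin> {\<omega> \<in> space M. \<not> (Xprod X n \<omega> \<in> matS_pos \<and> distortion (Xprod X n \<omega>) \<le> A)}"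
        hence g: "Xprod X n \<omega> \<in> matS_pos" "distortion (Xprod X n \<omega>) \<le> A" "\<omega> \<in> space M" by auto
        have "\<bar>(ln (entry_sum (Xprod X n \<omega>)) - b n) / a n - (f n \<omega> - b n) / a n\<bar> = \<bar>f n \<omega> - ln (entry_sum (Xprod X n \<omega>))\<bar> / a n"
          using a(1)[of n] by (simp add: diff_divide_distrib[symmetric] abs_minus_commute)
        also have "\<dots> \<le> A / a n" using fd[OF n(3) g(3) g(1)] g(2) a(1)[of n] by (intro divide_right_mono) auto
        also have "\<dots> \<le> \<epsilon>" using n(2) eps a(1)[of n] by (simp add: field_simps)
        finally show False using w by simp
      qed
      hence "prob (?E n) \<le> prob {\<omega> \<in> space M. \<not> (Xprod X n \<omega> \<in> matS_pos \<and> distortion (Xprod X n \<omega>) \<le> A)}"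
        by (rule finite_measure_mono) (unfold matS_pos_iff_min_entry, measurable)
      thus "prob (?E n) < e" using n(1) by simp
    qed
  qed (auto intro!: always_eventually less_le_trans[OF _ measure_nonneg])
qed measurable

text \<open>Positivity persists: multiplying a positive matrix on the left by an element of S keeps
  it positive. Hence the event \<open>T \<le> n\<close> concerns \<open>Xprod X n\<close>
  alone.\<close>

lemma hitT_le_iff:
  assumes w: "\<omega> \<in> space M" and n: "1 \<le> n"
  shows "hitT X \<omega> \<le> enat n \<longleftrightarrow> Xprod X n \<omega> \<in> matS_pos"
proof
  assume h: "hitT X \<omega> \<le> enat n"
  have ex: "\<exists>n\<ge>1. Xprod X n \<omega> \<in> matS_pos"
  proof (rule ccontr)
    assume "\<not> ?thesis"
    hence "hitT X \<omega> = \<infinity>" unfolding hitT_def by (rule if_not_P)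
    thus False using h by simp
  qed
  let ?m = "LEAST n. n \<ge> 1 \<and> Xprod X n \<omega> \<in> matS_pos"
  have "hitT X \<omega> = enat ?m" unfolding hitT_def by (rule if_P[OF ex])
  hence m: "?m \<le> n" using h by simp
  from ex obtain j where j: "j \<ge> 1 \<and> Xprod X j \<omega> \<in> matS_pos" ..
  have "?m \<ge> 1 \<and> Xprod X ?m \<omega> \<in> matS_pos" by (rule LeastI[of "\<lambda>n. n \<ge> 1 \<and> Xprod X n \<omega> \<in> matS_pos", OF j])
  hence p: "Xprod X ?m \<omega> \<in> matS_pos" ..
  have "Xprod X n \<omega> = window X ?m (n - ?m) \<omega> ** Xprod X ?m \<omega>" using Xprod_add[of X "n - ?m" ?m \<omega>] m by simp
  also have "\<dots> \<in> matS_pos" by (rule matS_pos_mult_left[OF window_matS[OF w] p])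
  finally show "Xprod X n \<omega> \<in> matS_pos" .
next
  assume p: "Xprod X n \<omega> \<in> matS_pos"
  have "\<exists>n\<ge>1. Xprod X n \<omega> \<in> matS_pos" by (rule exI[of _ n], rule conjI[OF n p])
  hence "hitT X \<omega> = enat (LEAST n. n \<ge> 1 \<and> Xprod X n \<omega> \<in> matS_pos)" unfolding hitT_def by (rule if_P)
  moreover have "(LEAST n. n \<ge> 1 \<and> Xprod X n \<omega> \<in> matS_pos) \<le> n" by (rule Least_le[of "\<lambda>n. n \<ge> 1 \<and> Xprod X n \<omega> \<in> matS_pos", OF conjI[OF n p]])
  ultimately show "hitT X \<omega> \<le> enat n" by simp
qed

text \<open>Joins the limit theorem for the i.i.d. sum of \<open>ln (entry_sum (X k))\<close> with
  the concentration of the defects, both at the scale \<open>SD.norming\<close>.\<close>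

lemma log_entry_sum_limit:
  assumes "stable_domain (distr M borel (\<lambda>\<omega>. ln (entry_sum (X 1 \<omega>)))) \<alpha> p"
    and tail: "\<forall>\<^sub>F u in at_top. prob {\<omega> \<in> space M. 2 * u < spread 1 \<omega>} \<le> B * (measure (distr M borel (\<lambda>\<omega>. ln (entry_sum (X 1 \<omega>)))) {u<..} + measure (distr M borel (\<lambda>\<omega>. ln (entry_sum (X 1 \<omega>)))) {..<-u})"
  shows "\<exists>a b \<mu>. (\<forall>n. 0 < a n) \<and> filterlim a at_top sequentially \<and> stable_law \<alpha> \<mu>
    \<and> weak_conv_m (\<lambda>n. distr M borel (\<lambda>\<omega>. (ln (entry_sum (Xprod X n \<omega>)) - b n) / a n)) \<mu>"
proof -
  let ?D = "distr M borel (\<lambda>\<omega>. ln (entry_sum (X 1 \<omega>)))"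
  interpret SD: stable_domain ?D \<alpha> p by fact
  have [measurable]: "X k \<in> borel_measurable M" if "1 \<le> k" for k using meas[OF that] .
  define \<zeta> where "\<zeta> k \<omega> = ln (entry_sum (X k \<omega>))" for k \<omega>
  have "indep_vars (\<lambda>_. borel) (\<lambda>k \<omega>. ln (entry_sum (X k \<omega>))) {1..}"
    by (rule indep_vars_compose2[OF indep]) measurable
  hence ind: "indep_vars (\<lambda>_. borel) \<zeta> {1..}" unfolding \<zeta>_def[abs_def] .
  have dis: "distr M borel (\<zeta> k) = ?D" if k: "1 \<le> k" for k
  proof -
    have "distr (distr M borel (X k)) borel (\<lambda>A. ln (entry_sum A)) = distr (distr M borel (X 1)) borel (\<lambda>A. ln (entry_sum A))"
      by (simp only: ident[OF k])
    thus ?thesis unfolding \<zeta>_def[abs_def] using k meas[OF k] meas[of 1] by (simp add: distr_distr o_def)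
  qed
  from SD.iid_sum_weak_limit[OF prob_space_axioms ind dis] obtain \<mu> where \<mu>: "stable_law \<alpha> \<mu>"
    and w: "weak_conv_m (\<lambda>n. distr M borel (\<lambda>\<omega>. ((\<Sum>k=1..n. \<zeta> k \<omega>) - real n * (SD.norming n * SD.centering n)) / SD.norming n)) \<mu>" by auto
  have sp0: "0 \<le> spread 1 \<omega>" if "\<omega> \<in> space M" for \<omega>
  proof -
    have S: "X 1 \<omega> \<in> matS" by (rule valS[OF _ that]) simp
    show ?thesis unfolding spread_def using min_row_sum_pos[OF S] min_row_sum_le_entry_sum[OF S] by simp
  qed
  have sm: "spread 1 \<in> borel_measurable M" by (rule measurable_spread) simp
  have tl: "\<forall>\<^sub>F u in at_top. prob {\<omega> \<in> space M. 2 * u < spread 1 \<omega>} \<le> B * SD.H u" using tail unfolding SD.H_def .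
  from SD.tail_comparison[OF prob_space_axioms sm sp0 tl] obtain C where C: "\<forall>n\<ge>1. real n * prob {\<omega> \<in> space M. 2 * SD.norming n < spread 1 \<omega>} \<le> C
     \<and> real n * (LINT \<omega>|M. (min (spread 1 \<omega>) (2 * SD.norming n))\<^sup>2) \<le> C * (SD.norming n)\<^sup>2" ..
  have "\<exists>e. \<forall>\<epsilon>>0. (\<lambda>n. prob {\<omega> \<in> space M. \<epsilon> * SD.norming n < \<bar>(\<Sum>k=1..n. defect k (n - k) \<omega>) - e n\<bar>}) \<longlonglongrightarrow> 0"
  proof (rule sum_defect_concentration[where C=C])
    show "filterlim (\<lambda>n. 2 * SD.norming n) at_top sequentially"
      by (rule filterlim_tendsto_pos_mult_at_top[OF tendsto_const _ SD.norming(2)]) simp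
  qed (use SD.norming_pos SD.norming_sq_over_n C in \<open>simp_all add: less_imp_le\<close>)
  then obtain e where e: "\<And>\<epsilon>. 0 < \<epsilon> \<Longrightarrow> (\<lambda>n. prob {\<omega> \<in> space M. \<epsilon> * SD.norming n < \<bar>(\<Sum>k=1..n. defect k (n - k) \<omega>) - e n\<bar>}) \<longlonglongrightarrow> 0" by auto
  \<comment> \<open>The centering of the i.i.d. sum minus that of the defects, because the
    telescoped identity subtracts the defects.\<close>
  define b where "b n = real n * (SD.norming n * SD.centering n) - e n" for n
  have dm: "(\<lambda>\<omega>. \<Sum>k=1..n. defect k (n - k) \<omega>) \<in> borel_measurable M" for n
    by (rule borel_measurable_sum, rule measurable_defect) simp
  have zm: "(\<lambda>\<omega>. \<Sum>k=1..n. \<zeta> k \<omega>) \<in> borel_measurable M" for n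
  proof (rule borel_measurable_sum)
    fix k assume "k \<in> {1..n}"
    hence [measurable]: "X k \<in> borel_measurable M" by (intro meas) simp
    show "\<zeta> k \<in> borel_measurable M" unfolding \<zeta>_def[abs_def] by measurable
  qed
  have "weak_conv_m (\<lambda>n. distr M borel (\<lambda>\<omega>. (ln (entry_sum (Xprod X n \<omega>)) - b n) / SD.norming n)) \<mu>"
  proof (rule weak_conv_m_prob_diff[OF w])
    show "real_distribution \<mu>" using \<mu> unfolding stable_law_def by (rule conjunct1)
    show "(\<lambda>\<omega>. ((\<Sum>k=1..n. \<zeta> k \<omega>) - real n * (SD.norming n * SD.centering n)) / SD.norming n) \<in> borel_measurable M" for n
      by (intro borel_measurable_divide borel_measurable_diff zm borel_measurable_const)
    fix \<epsilon> :: real assume eps: "0 < \<epsilon>"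
    let ?c = "ln (entry_sum (mat 1 :: real^'b^'b))"
    let ?E = "\<lambda>n. {\<omega> \<in> space M. \<epsilon> < \<bar>((\<Sum>k=1..n. \<zeta> k \<omega>) - real n * (SD.norming n * SD.centering n)) / SD.norming n - (ln (entry_sum (Xprod X n \<omega>)) - b n) / SD.norming n\<bar>}"
    let ?F = "\<lambda>n. {\<omega> \<in> space M. \<epsilon> / 2 * SD.norming n < \<bar>(\<Sum>k=1..n. defect k (n - k) \<omega>) - e n\<bar>}"
    show "(\<lambda>n. prob (?E n)) \<longlonglongrightarrow> 0"
    proof (rule tendsto_sandwich[OF _ _ tendsto_const])
      show "(\<lambda>n. prob (?F n)) \<longlonglongrightarrow> 0" by (rule e) (use eps in simp)
      have "\<forall>\<^sub>F n in sequentially. \<bar>?c\<bar> / (\<epsilon> / 2) \<le> SD.norming n" using SD.norming(2) by (simp add: filterlim_at_top)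
      thus "\<forall>\<^sub>F n in sequentially. prob (?E n) \<le> prob (?F n)"
      proof eventually_elim
        fix n assume "\<bar>?c\<bar> / (\<epsilon> / 2) \<le> SD.norming n"
        \<comment> \<open>The constant left by the empty window uses up half of \<epsilon>, so the
          event \<open>?F n\<close> is set at level \<open>\<epsilon> / 2\<close>.\<close>
        hence c: "\<bar>?c\<bar> \<le> \<epsilon> / 2 * SD.norming n" using eps by (simp add: field_simps)
        have a: "0 < SD.norming n" by (rule SD.norming_pos)
        show "prob (?E n) \<le> prob (?F n)"
        proof (rule finite_measure_mono)
          show "?E n \<subseteq> ?F n"
          proof safe
            fix \<omega> assume w: "\<omega> \<in> space M" and d: "\<epsilon> < \<bar>((\<Sum>k=1..n. \<zeta> k \<omega>) - real n * (SD.norming n * SD.centering n)) / SD.norming n - (ln (entry_sum (Xprod X n \<omega>)) - b n) / SD.norming n\<bar>"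
            have "(\<Sum>k=1..n. defect k (n - k) \<omega>) = (\<Sum>k=1..n. \<zeta> k \<omega>) + ?c - ln (entry_sum (Xprod X n \<omega>))"
              unfolding \<zeta>_def defect_def by (rule sum_sum_defect) (rule valS[OF _ w])
            hence "(\<Sum>k=1..n. \<zeta> k \<omega>) - real n * (SD.norming n * SD.centering n) - (ln (entry_sum (Xprod X n \<omega>)) - b n) = (\<Sum>k=1..n. defect k (n - k) \<omega>) - e n - ?c"
              unfolding b_def by linarith
            hence "\<epsilon> < \<bar>(\<Sum>k=1..n. defect k (n - k) \<omega>) - e n - ?c\<bar> / SD.norming n"
              using d a by (simp add: diff_divide_distrib[symmetric])
            hence "\<epsilon> * SD.norming n < \<bar>(\<Sum>k=1..n. defect k (n - k) \<omega>) - e n - ?c\<bar>" using a by (simp add: pos_less_divide_eq)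
            moreover have "\<bar>x - y\<bar> \<le> \<bar>x\<bar> + \<bar>y\<bar>" for x y :: real by (rule abs_triangle_ineq4)
            ultimately show "\<epsilon> / 2 * SD.norming n < \<bar>(\<Sum>k=1..n. defect k (n - k) \<omega>) - e n\<bar>"
              using c by (smt (verit) field_sum_of_halves distrib_right)
          qed
          have "?F n = (\<lambda>\<omega>. \<bar>(\<Sum>k=1..n. defect k (n - k) \<omega>) - e n\<bar>) -` {\<epsilon> / 2 * SD.norming n<..} \<inter> space M" by auto
          also have "\<dots> \<in> events" by (rule measurable_sets[where A=borel]) (intro borel_measurable_abs borel_measurable_diff dm borel_measurable_const, simp)
          finally show "?F n \<in> events" .
        qed
      qed
    qed simp
  qed measurable
  thus ?thesis using \<mu> SD.norming_pos SD.norming(2) by blast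
qed

end

text \<open>\<open>conv_distr\<close> looks at the indices from 1 on, while the limits above are
  indexed from 0.\<close>

lemma weak_conv_m_Suc: "weak_conv_m N \<mu> \<Longrightarrow> weak_conv_m (\<lambda>n. N (Suc n)) \<mu>"
  unfolding weak_conv_m_def weak_conv_def by (auto intro: LIMSEQ_Suc)

theorem theoremI:
  fixes M :: "'a measure"
    and X :: "nat \<Rightarrow> 'a \<Rightarrow> real^'q^'q"
    and \<alpha> c_plus c_minus :: real
    and L :: "real \<Rightarrow> real"
  assumes "prob_space M"
    and meas: "\<And>n. n \<ge> 1 \<Longrightarrow> X n \<in> borel_measurable M"
    and indep: "prob_space.indep_vars M (\<lambda>_. borel) X {1..}"
    and ident: "\<And>n. n \<ge> 1 \<Longrightarrow> distr M borel (X n) = distr M borel (X 1)"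
    and valS: "\<And>n \<omega>. n \<ge> 1 \<Longrightarrow> \<omega> \<in> space M \<Longrightarrow> X n \<omega> \<in> matS"
    and contr: "measure M (\<Union>n\<in>{1..}. {\<omega> \<in> space M. Xprod X n \<omega> \<in> matS_pos}) > 0"
    and alpha: "0 < \<alpha>" "\<alpha> \<le> 2"
    and L_sv: "slowly_varying L"
    and L_unb: "\<alpha> = 2 \<Longrightarrow> \<not> (\<exists>C. \<forall>\<^sub>F u in at_top. L u \<le> C)"
    and cpm: "0 \<le> c_plus" "0 \<le> c_minus" "0 < c_plus + c_minus"
    and tail_plus: "((\<lambda>u. u powr \<alpha> / L u *
                 measure M {\<omega> \<in> space M. entry_sum (X 1 \<omega>) > exp u}) \<longlongrightarrow> c_plus) at_top"
    and tail_minus: "((\<lambda>u. u powr \<alpha> / L u *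
                 measure M {\<omega> \<in> space M. entry_sum (X 1 \<omega>) \<le> exp (- u)}) \<longlongrightarrow> c_minus) at_top"
    and tail_V: "Limsup at_top (\<lambda>u. ereal (u powr \<alpha> / L u *
                 measure M {\<omega> \<in> space M. min_row_sum (X 1 \<omega>) \<le> exp (- u)})) < \<infinity>"
  shows "\<exists>a b :: nat \<Rightarrow> real. (\<forall>n\<ge>1. 0 < a n) \<and> filterlim a at_top sequentially \<and>
           (\<exists>\<mu>. stable_law \<alpha> \<mu> \<and>
              (\<forall>xs ys :: nat \<Rightarrow> real^'q. (\<forall>n\<ge>1. xs n \<in> Bbar \<and> ys n \<in> Bbar) \<longrightarrow>
                 conv_distr M (\<lambda>n \<omega>. ((if hitT X \<omega> \<le> enat n
                                        then ln (ys n \<bullet> (Xprod X n \<omega> *v xs n)) else 0) - b n) / a n) \<mu>) \<and>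
              conv_distr M (\<lambda>n \<omega>. (ln (spectral_radius (Xprod X n \<omega>)) - b n) / a n) \<mu>)"
proof -
  interpret prob_space M by fact
  interpret contracting_iid_matrices M X by unfold_locales (fact meas indep ident valS contr)+
  have m1 [measurable]: "X 1 \<in> borel_measurable M" by (rule meas) simp
  let ?Z = "\<lambda>\<omega>. ln (entry_sum (X 1 \<omega>))"
  let ?D = "distr M borel ?Z" and ?R = "\<lambda>u. u powr \<alpha> / L u"
  let ?V = "\<lambda>u. {\<omega> \<in> space M. min_row_sum (X 1 \<omega>) \<le> exp (- u)}"
  have pos: "0 < entry_sum (X 1 \<omega>)" "0 < min_row_sum (X 1 \<omega>)" if "\<omega> \<in> space M" for \<omega>
  proof -
    have S: "X 1 \<omega> \<in> matS" by (rule valS[OF _ that]) simp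
    show "0 < entry_sum (X 1 \<omega>)" "0 < min_row_sum (X 1 \<omega>)" by (rule entry_sum_pos[OF S], rule min_row_sum_pos[OF S])
  qed
  have iff: "exp u < r \<longleftrightarrow> u < ln r" "r \<le> exp u \<longleftrightarrow> ln r \<le> u" if "0 < r" for r u :: real
    using that ln_less_cancel_iff[of "exp u" r] ln_le_cancel_iff[of r "exp u"] by simp_all
  have "{\<omega> \<in> space M. entry_sum (X 1 \<omega>) > exp u} = {\<omega> \<in> space M. u < ?Z \<omega>}" for u
    by (rule Collect_cong) (use pos iff in auto)
  hence tp: "((\<lambda>u. ?R u * prob {\<omega> \<in> space M. u < ?Z \<omega>}) \<longlongrightarrow> c_plus) at_top" using tail_plus by (simp only:)
  have "{\<omega> \<in> space M. entry_sum (X 1 \<omega>) \<le> exp (- u)} = {\<omega> \<in> space M. ?Z \<omega> \<le> - u}" for u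
    by (rule Collect_cong) (use pos iff in auto)
  hence tm: "((\<lambda>u. ?R u * prob {\<omega> \<in> space M. ?Z \<omega> \<le> - u}) \<longlongrightarrow> c_minus) at_top" using tail_minus by (simp only:)
  have Zm: "?Z \<in> borel_measurable M" by measurable
  note sd = stable_domain_of_tails[OF Zm alpha L_sv L_unb cpm tp tm]
  define h where "h u = measure ?D {u<..} + measure ?D {..<-u}" for u
  have Lpos: "\<forall>\<^sub>F u in at_top. 0 < L u" using L_sv unfolding slowly_varying_def by simp
  obtain K where K: "Limsup at_top (\<lambda>u. ereal (?R u * prob (?V u))) < ereal K"
    using less_PInf_Ex_of_nat[of "Limsup at_top (\<lambda>u. ereal (?R u * prob (?V u)))"] tail_V by auto
  have KV: "\<forall>\<^sub>F u in at_top. ?R u * prob (?V u) < K" using Limsup_lessD[OF K] by simp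
  have "r / 2 < r" if "0 < r" for r :: real using that by simp
  note c_half = this[OF cpm(3)]
  have half: "\<forall>\<^sub>F u in at_top. (c_plus + c_minus) / 2 < ?R u * h u" unfolding h_def
    by (rule order_tendstoD(1)[OF sd(2) c_half])
  \<comment> \<open>Here hypothesis (ii) enters. As \<open>spread 1\<close> is
    \<open>ln N - ln V\<close>, exceeding \<open>2 * u\<close> forces \<open>ln N > u\<close> or
    \<open>V \<le> exp (- u)\<close>. The first event has probability at most \<open>h u\<close>.
    The second has at most \<open>K\<close> over the normaliser, of which \<open>h u\<close> is
    eventually at least \<open>(c_plus + c_minus) / 2\<close> over the same.\<close>
  have tail: "\<forall>\<^sub>F u in at_top. prob {\<omega> \<in> space M. 2 * u < spread 1 \<omega>} \<le> (1 + \<bar>K\<bar> / ((c_plus + c_minus) / 2)) * h u"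
    using Lpos KV half eventually_gt_at_top[of 0]
  proof eventually_elim
    fix u assume u: "0 < L u" "?R u * prob (?V u) < K" "(c_plus + c_minus) / 2 < ?R u * h u" "0 < u"
    let ?c = "(c_plus + c_minus) / 2"
    have c0: "0 < ?c" using cpm by simp
    have R0: "0 < ?R u" using u by simp
    have "?R u * prob (?V u) \<le> \<bar>K\<bar> / ?c * ?c" using u(2) c0 by simp
    also have "\<dots> \<le> \<bar>K\<bar> / ?c * (?R u * h u)" using u(3) c0 by (intro mult_left_mono) auto
    also have "\<dots> = ?R u * (\<bar>K\<bar> / ?c * h u)" by (simp only: mult_ac)
    finally have V: "prob (?V u) \<le> \<bar>K\<bar> / ?c * h u" using R0 by (simp only: mult_le_cancel_left_pos)
    have mD: "measure ?D {u<..} = prob {\<omega> \<in> space M. u < ?Z \<omega>}" by (subst measure_distr) (auto intro!: arg_cong[where f=prob])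
    have "{\<omega> \<in> space M. 2 * u < spread 1 \<omega>} \<subseteq> {\<omega> \<in> space M. u < ?Z \<omega>} \<union> ?V u"
    proof safe
      fix \<omega> assume w: "\<omega> \<in> space M" "2 * u < spread 1 \<omega>" "\<not> min_row_sum (X 1 \<omega>) \<le> exp (- u)"
      have "exp (- u) < min_row_sum (X 1 \<omega>)" using w(3) by simp
      hence "ln (exp (- u)) < ln (min_row_sum (X 1 \<omega>))" using pos(2)[OF w(1)] by (subst ln_less_cancel_iff) auto
      moreover have "spread 1 \<omega> = ?Z \<omega> - ln (min_row_sum (X 1 \<omega>))" unfolding spread_def using pos[OF w(1)] by (simp add: ln_div)
      ultimately show "u < ?Z \<omega>" using w(2) by simp
    qed
    hence "prob {\<omega> \<in> space M. 2 * u < spread 1 \<omega>} \<le> prob ({\<omega> \<in> space M. u < ?Z \<omega>} \<union> ?V u)" by (rule finite_measure_mono) measurable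
    also have "\<dots> \<le> prob {\<omega> \<in> space M. u < ?Z \<omega>} + prob (?V u)" by (rule measure_Un_le) measurable
    also have "\<dots> \<le> h u + \<bar>K\<bar> / ?c * h u" unfolding mD[symmetric] using V by (intro add_mono) (simp_all add: h_def)
    finally show "prob {\<omega> \<in> space M. 2 * u < spread 1 \<omega>} \<le> (1 + \<bar>K\<bar> / ?c) * h u" by (simp add: distrib_right)
  qed
  have "\<exists>a b \<mu>. (\<forall>n. 0 < a n) \<and> filterlim a at_top sequentially \<and> stable_law \<alpha> \<mu>
    \<and> weak_conv_m (\<lambda>n. distr M borel (\<lambda>\<omega>. (ln (entry_sum (Xprod X n \<omega>)) - b n) / a n)) \<mu>"
    by (rule log_entry_sum_limit[OF sd(1) tail[unfolded h_def]])
  then obtain a b \<mu> where a0: "\<forall>n. 0 < a n" and a1: "filterlim a at_top sequentially" and \<mu>: "stable_law \<alpha> \<mu>"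
    and w: "weak_conv_m (\<lambda>n. distr M borel (\<lambda>\<omega>. (ln (entry_sum (Xprod X n \<omega>)) - b n) / a n)) \<mu>"
    by (elim exE conjE) (rule that)
  have a: "\<And>n. 0 < a n" "filterlim a at_top sequentially" using a0 a1 by simp_all
  have rd: "real_distribution \<mu>" using \<mu> unfolding stable_law_def by (rule conjunct1)
  have inS: "Xprod X n \<omega> \<in> matS" if "\<omega> \<in> space M" for n \<omega> by (rule Xprod_in_matS) (rule valS[OF _ that])
  have "conv_distr M (\<lambda>n \<omega>. (ln (spectral_radius (Xprod X n \<omega>)) - b n) / a n) \<mu>"
    unfolding conv_distr_def
  proof (rule weak_conv_m_Suc, rule weak_limit_transfer[OF w rd a])
    show "(\<lambda>\<omega>. ln (spectral_radius (Xprod X n \<omega>))) \<in> borel_measurable M" for n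
      by (rule borel_measurable_ln[OF spectral_radius_measurable[OF measurable_Xprod_M inS]])
    show "\<bar>ln (spectral_radius (Xprod X n \<omega>)) - ln (entry_sum (Xprod X n \<omega>))\<bar> \<le> distortion (Xprod X n \<omega>)"
      if "\<omega> \<in> space M" "Xprod X n \<omega> \<in> matS_pos" for n \<omega>
      by (rule abs_ln_diff_le_distortion[OF that(2) spectral_radius_bounds[OF inS[OF that(1)]]])
  qed
  moreover have "conv_distr M (\<lambda>n \<omega>. ((if hitT X \<omega> \<le> enat n then ln (ys n \<bullet> (Xprod X n \<omega> *v xs n)) else 0) - b n) / a n) \<mu>"
    if xy: "\<forall>n\<ge>1. xs n \<in> Bbar \<and> ys n \<in> Bbar" for xs ys :: "nat \<Rightarrow> real^'q"
  proof -
    \<comment> \<open>The indicator of \<open>T \<le> n\<close> is replaced by positivity of the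
      product, for which measurability and the distortion bound are available; for
      \<open>n \<ge> 1\<close> the two coincide.\<close>
    define f where "f n \<omega> = (if Xprod X n \<omega> \<in> matS_pos then ln (ys n \<bullet> (Xprod X n \<omega> *v xs n)) else 0)" for n \<omega>
    have "weak_conv_m (\<lambda>n. distr M borel (\<lambda>\<omega>. (f n \<omega> - b n) / a n)) \<mu>"
    proof (rule weak_limit_transfer[OF w rd a])
      show "f n \<in> borel_measurable M" for n unfolding f_def matS_pos_iff_min_entry by measurable
      fix n \<omega> assume n: "1 \<le> n" and om: "\<omega> \<in> space M" and p: "Xprod X n \<omega> \<in> matS_pos"
      have x: "xs n \<in> Bbar" and y: "ys n \<in> Bbar" using xy[rule_format, OF n] by simp_all
      show "\<bar>f n \<omega> - ln (entry_sum (Xprod X n \<omega>))\<bar> \<le> distortion (Xprod X n \<omega>)"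
        unfolding f_def if_P[OF p] by (rule abs_ln_diff_le_distortion[OF p min_entry_le_inner[OF inS[OF om] x y]])
    qed
    from weak_conv_m_Suc[OF this] have c: "weak_conv_m (\<lambda>n. distr M borel (\<lambda>\<omega>. (f (Suc n) \<omega> - b (Suc n)) / a (Suc n))) \<mu>" .
    have "distr M borel (\<lambda>\<omega>. ((if hitT X \<omega> \<le> enat (Suc n) then ln (ys (Suc n) \<bullet> (Xprod X (Suc n) \<omega> *v xs (Suc n))) else 0) - b (Suc n)) / a (Suc n))
      = distr M borel (\<lambda>\<omega>. (f (Suc n) \<omega> - b (Suc n)) / a (Suc n))" for n
    proof (rule distr_cong[OF refl refl])
      fix \<omega> assume om: "\<omega> \<in> space M"
      have "hitT X \<omega> \<le> enat (Suc n) \<longleftrightarrow> Xprod X (Suc n) \<omega> \<in> matS_pos" by (rule hitT_le_iff[OF om]) simp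
      thus "((if hitT X \<omega> \<le> enat (Suc n) then ln (ys (Suc n) \<bullet> (Xprod X (Suc n) \<omega> *v xs (Suc n))) else 0) - b (Suc n)) / a (Suc n) = (f (Suc n) \<omega> - b (Suc n)) / a (Suc n)"
        unfolding f_def by (simp only:)
    qed
    thus ?thesis unfolding conv_distr_def using c by (simp only:)
  qed
  ultimately have "\<forall>xs ys :: nat \<Rightarrow> real^'q. (\<forall>n\<ge>1. xs n \<in> Bbar \<and> ys n \<in> Bbar) \<longrightarrow>
                 conv_distr M (\<lambda>n \<omega>. ((if hitT X \<omega> \<le> enat n then ln (ys n \<bullet> (Xprod X n \<omega> *v xs n)) else 0) - b n) / a n) \<mu>"
    and "conv_distr M (\<lambda>n \<omega>. (ln (spectral_radius (Xprod X n \<omega>)) - b n) / a n) \<mu>"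
    by simp_all
  with a \<mu> show ?thesis by (intro exI[of _ a] exI[of _ b] exI[of _ \<mu>] conjI) simp_all
qed

end
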